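(* Consider a coalescing skip-free process on $S$ with every point initially occupied, run for time $T>0$. Let $k\ge 2$ and let $a_1<b_1\le a_2<b_2\le\cdots\le a_k<b_k$ be points of $S$. For $w=1,\dots,k$ let $\eta_w$ be the indicator of the event that at least one wall (at time $T$) lies in $(a_w,b_w)$. Run $2k$ independent copies of the underlying process up to time $T$, one from $a_w$ and one from $b_w$ for each $w$, both carrying color $w$ (the two flanking particles of wall $w$), and let $I$ be the random sequence of length $2k$ obtained by reading the colors of the $2k$ final positions from left to right, ties (in the discrete case) being broken uniformly at random. Then the joint cumulant of $\eta_1,\dots,\eta_k$ is $$\kappa(\eta_1,\dots,\eta_k)=\mathbb{E}\Big[c(I)\cdot\prod_{w=1}^{k}\mathbf{1}_{\text{wall } w\text{ non-crossing}}\Big],$$ where $c(I)$ is the coloring coefficient of $I$ (an integer depending only on the sequence $I$), "wall $w$ non-crossing" is the event that the two flanking particles of wall $w$ keep their strict order (do not cross or meet) during $[0,T]$, and the expectation is over the random trajectories of the $2k$ independent particles and, in the discrete case, the random tie-breaking.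
   Context: Skip-free process: a (strong) Markov process describing the motion of one particle on a linearly ordered state space $S$, such that particles cannot change order without first meeting. On $S=\mathbb{Z}$ this means nearest-neighbor transitions (discrete or continuous time); on $S=\mathbb{R}$ it means continuous paths. Transition probabilities may be inhomogeneous in space and time. Coalescing system with every point initially occupied: one particle starts from each point of $S$ at time $0$; particles move as independent copies of the underlying process until they meet, then merge and continue as one. The basin of a survivor $y$ at time $T$ is the contiguous set of initial positions whose particle has coalesced with $y$ by time $T$; a wall is a boundary between two adjacent basins (an element of $\mathbb{Z}+\frac12$ if $S=\mathbb{Z}$, a real number if $S=\mathbb{R}$). Coloring: a sequence of length $2k$ over $\{1,\dots,k\}$ in which each letter appears exactly twice. Coloring coefficient. The wall edges are $(1,2),(3,4),\dots,(2k-1,2k)$. A perfect matching $M$ of $\{1,\dots,2k\}$ is connected if the union of the wall edges and the edges of $M$ forms a single Hamiltonian cycle. Writing the edges of $M$ as $(i_1,j_1),\dots,(i_k,j_k)$ with $i_r<j_r$ and $i_1<\cdots<i_k$, $\operatorname{sgn}(M)$ is the sign of the permutation $(i_1,j_1,\dots,i_k,j_k)$ of $\{1,\dots,2k\}$. A lift of a coloring $I$ is a permutation $\sigma\in S_{2k}$ such that $\{\sigma(2w-1),\sigma(2w)\}$ is the set of the two positions of color $w$ in $I$, for every $w$ (equivalently $\sigma\cdot(1,1,2,2,\dots,k,k)=I$). A lift $\sigma$ is compatible with $M$ if $\sigma(i)>\sigma(j)$ for every edge $\{i,j\}\in M$ with $i<j$. The lift sign is $\epsilon(\sigma)=\prod_{w=1}^k(-1)^{[\sigma(2w-1)>\sigma(2w)]}$,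 where $[\cdot]$ is $1$ if the condition holds and $0$ otherwise. Then $$c(I)=(-1)^k\sum_{M\text{ connected}}\operatorname{sgn}(M)\sum_{\substack{\sigma\text{ lift of }I\\ \text{compatible with }M}}\epsilon(\sigma).$$ Joint cumulant: $\kappa(X_1,\dots,X_k)=\sum_{\pi}(-1)^{|\pi|-1}(|\pi|-1)!\prod_{B\in\pi}\mathbb{E}\big[\prod_{i\in B}X_i\big]$, the sum over set partitions $\pi$ of $\{1,\dots,k\}$.
   Formalization: For S=ℝ a wall exactly at a_w or b_w that separates this endpoint from the interior also counts as lying in (a_w,b_w), since otherwise the identity can fail; on ℤ, besides nearest-neighbor steps, it is required that particles cannot change order without meeting. *)

theory Defs
  imports "HOL-Probability.Probability" "HOL-Combinatorics.Combinatorics"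
begin

section \<open>Skip-free processes\<close>

text \<open>
  The state space is a set \<open>S\<close> of reals (\<open>\<int>\<close> or all of \<open>\<real>\<close>) and the set of times is a set
  \<open>Tm\<close> of reals (\<open>\<nat>\<close> for discrete time, \<open>[0, \<infinity>)\<close> for continuous time).
\<close>

definition admissible_setting :: "real set \<Rightarrow> real set \<Rightarrow> bool" where
  "admissible_setting S Tm \<longleftrightarrow>
     (S = \<int> \<and> Tm = \<nat>) \<or> (S = \<int> \<and> Tm = {0..}) \<or> (S = UNIV \<and> Tm = {0..})"

text \<open>
  On \<open>\<int>\<close> in continuous time a nearest-neighbour path is a right-continuous path with left limits,
  all of whose jumps have size at most one.
\<close>

definition skip_free_paths :: "real set \<Rightarrow> real set \<Rightarrow> (real \<Rightarrow> real) set" where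
  "skip_free_paths S Tm = {\<omega> \<in> Tm \<rightarrow>\<^sub>E S.
     (if S = UNIV then continuous_on Tm \<omega>
      else if Tm = \<nat> then \<forall>t\<in>Tm. \<bar>\<omega> (t + 1) - \<omega> t\<bar> \<le> 1
      else (\<forall>t\<in>Tm. (\<omega> \<longlongrightarrow> \<omega> t) (at_right t)) \<and>
           (\<forall>t\<in>Tm. t > 0 \<longrightarrow> (\<exists>l. (\<omega> \<longlongrightarrow> l) (at_left t) \<and> \<bar>\<omega> t - l\<bar> \<le> 1)))}"

definition path_space :: "real set \<Rightarrow> real set \<Rightarrow> (real \<Rightarrow> real) measure" where
  "path_space S Tm = restrict_space (Pi\<^sub>M Tm (\<lambda>_. borel)) (skip_free_paths S Tm)"

definition history :: "real set \<Rightarrow> real set \<Rightarrow> real \<Rightarrow> (real \<Rightarrow> real) measure" where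
  "history S Tm t = vimage_algebra (skip_free_paths S Tm)
     (\<lambda>\<omega>. restrict \<omega> (Tm \<inter> {..t})) (Pi\<^sub>M (Tm \<inter> {..t}) (\<lambda>_. borel))"

definition path_shift :: "real set \<Rightarrow> real \<Rightarrow> (real \<Rightarrow> real) \<Rightarrow> real \<Rightarrow> real" where
  "path_shift Tm r \<omega> = (\<lambda>u\<in>Tm. \<omega> (r + u))"

text \<open>
  A space- and time-inhomogeneous strong Markov family: \<open>K s x\<close> is the law of the path
  \<open>u \<mapsto> X (s + u)\<close> of a particle that sits at \<open>x\<close> at time \<open>s\<close>, so the time argument of a path is
  the time elapsed since \<open>s\<close>. The assumption \<open>no_swap\<close> says that two independent particles cannot
  change order without first meeting; it holds automatically for continuous paths, while in
  discrete time on \<open>\<int>\<close> it also forbids two neighbours to exchange their positions in one step.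
\<close>

locale skip_free_process =
  fixes S Tm :: "real set" and K :: "real \<Rightarrow> real \<Rightarrow> (real \<Rightarrow> real) measure"
  assumes setting: "admissible_setting S Tm"
    and kernel: "(\<lambda>(s, x). K s x) \<in> restrict_space borel Tm \<Otimes>\<^sub>M restrict_space borel S
                   \<rightarrow>\<^sub>M prob_algebra (path_space S Tm)"
    and start: "\<And>s x. s \<in> Tm \<Longrightarrow> x \<in> S \<Longrightarrow> AE \<omega> in K s x. \<omega> 0 = x"
    and strong_markov: "\<And>s x \<tau> A B. s \<in> Tm \<Longrightarrow> x \<in> S \<Longrightarrow>
           stopping_time (history S Tm) \<tau> \<Longrightarrow> \<tau> \<in> skip_free_paths S Tm \<rightarrow> Tm \<Longrightarrow>
           A \<in> sets (filtration.pre_sigma (skip_free_paths S Tm) (history S Tm) \<tau>) \<Longrightarrow>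
           B \<in> sets (path_space S Tm) \<Longrightarrow>
           measure (K s x) {\<omega> \<in> A. path_shift Tm (\<tau> \<omega>) \<omega> \<in> B} =
             (\<integral>\<omega>. indicator A \<omega> * measure (K (s + \<tau> \<omega>) (\<omega> (\<tau> \<omega>))) B \<partial>K s x)"
    and no_swap: "\<And>s x y. s \<in> Tm \<Longrightarrow> x \<in> S \<Longrightarrow> y \<in> S \<Longrightarrow> x < y \<Longrightarrow>
           AE (f, g) in K s x \<Otimes>\<^sub>M K s y.
             \<forall>t\<in>Tm. g t < f t \<longrightarrow> (\<exists>u\<in>Tm. u \<le> t \<and> f u = g u)"

section \<open>Coalescing systems and walls\<close>

text \<open>
  \<open>coalesce Tm X n\<close> turns the independent paths \<open>X 0, \<dots>, X (n - 1)\<close> into coalescing ones: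
  particle \<open>n\<close> follows \<open>X n\<close> until it first meets one of the (already coalesced) particles
  \<open>0, \<dots>, n - 1\<close> and follows that particle from then on. If it meets several of them at that
  time, these have already merged, so the choice made by \<open>LEAST\<close> is immaterial.
\<close>

definition follow :: "real set \<Rightarrow> nat \<Rightarrow> (nat \<Rightarrow> real \<Rightarrow> real) \<Rightarrow> (real \<Rightarrow> real) \<Rightarrow> real \<Rightarrow> real" where
  "follow Tm n Z f =
     (let H = {s \<in> Tm. \<exists>j<n. Z j s = f s};
          j = (LEAST j. j < n \<and> Z j (Inf H) = f (Inf H))
      in (\<lambda>t\<in>Tm. if \<exists>s\<in>H. s \<le> t then Z j t else f t))"

primrec coalesce :: "real set \<Rightarrow> (nat \<Rightarrow> real \<Rightarrow> real) \<Rightarrow> nat \<Rightarrow> nat \<Rightarrow> real \<Rightarrow> real" where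
  "coalesce Tm X 0 = X"
| "coalesce Tm X (Suc n) =
     (let Z = coalesce Tm X n in Z(n := follow Tm n Z (X n)))"

text \<open>
  \<open>Y x \<omega>\<close> is the path of the particle started from \<open>x\<close>. Once two particles have met they move
  together, and any finitely many particles have the law of coalescing independent copies of the
  underlying process.
\<close>

locale coalescing_system = prob_space M
  for S Tm :: "real set" and K :: "real \<Rightarrow> real \<Rightarrow> (real \<Rightarrow> real) measure" and M :: "'w measure" +
  fixes Y :: "real \<Rightarrow> 'w \<Rightarrow> real \<Rightarrow> real"
  assumes path_measurable: "\<And>x. x \<in> S \<Longrightarrow> Y x \<in> M \<rightarrow>\<^sub>M path_space S Tm"
    and initial: "\<And>x \<omega>. x \<in> S \<Longrightarrow> \<omega> \<in> space M \<Longrightarrow> Y x \<omega> 0 = x"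
    and merge: "\<And>x y \<omega> s t. x \<in> S \<Longrightarrow> y \<in> S \<Longrightarrow> \<omega> \<in> space M \<Longrightarrow> s \<in> Tm \<Longrightarrow> t \<in> Tm \<Longrightarrow> s \<le> t \<Longrightarrow>
           Y x \<omega> s = Y y \<omega> s \<Longrightarrow> Y x \<omega> t = Y y \<omega> t"
    and law: "\<And>n x. x \<in> {..<n} \<rightarrow> S \<Longrightarrow> strict_mono_on {..<n} x \<Longrightarrow>
           distr M (Pi\<^sub>M {..<n} (\<lambda>_. path_space S Tm)) (\<lambda>\<omega>. \<lambda>i\<in>{..<n}. Y (x i) \<omega>) =
           distr (Pi\<^sub>M {..<n} (\<lambda>i. K 0 (x i))) (Pi\<^sub>M {..<n} (\<lambda>_. path_space S Tm))
             (\<lambda>X. \<lambda>i\<in>{..<n}. coalesce Tm X n i)"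

text \<open>In the following, \<open>y x t\<close> is the position at time \<open>t\<close> of the particle started from \<open>x\<close>.\<close>

definition basin :: "real set \<Rightarrow> (real \<Rightarrow> real \<Rightarrow> real) \<Rightarrow> real \<Rightarrow> real \<Rightarrow> real set" where
  "basin S y T z = {x \<in> S. y x T = z}"

definition is_wall :: "real set \<Rightarrow> (real \<Rightarrow> real \<Rightarrow> real) \<Rightarrow> real \<Rightarrow> real \<Rightarrow> bool" where
  "is_wall S y T r \<longleftrightarrow>
     (if S = UNIV then \<exists>z. r \<in> frontier (basin S y T z)
      else \<exists>n\<in>S. r = n + 1/2 \<and> (\<exists>z z'. z \<noteq> z' \<and> n \<in> basin S y T z \<and> n + 1 \<in> basin S y T z'))"

text \<open>
  The event that a wall lies in \<open>(a, b)\<close>. The last two disjuncts fix a convention that matters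
  only for \<open>S = \<real>\<close> and only if a wall sits exactly at \<open>a\<close> or at \<open>b\<close>: such a wall counts as lying
  inside if it separates the end point from the interior, as the particle started from \<open>a\<close> is then
  on the left (the one started from \<open>b\<close> on the right) of the wall. See \<open>wall_between_interior\<close>.
\<close>

definition wall_between :: "real set \<Rightarrow> (real \<Rightarrow> real \<Rightarrow> real) \<Rightarrow> real \<Rightarrow> real \<Rightarrow> real \<Rightarrow> bool" where
  "wall_between S y T a b \<longleftrightarrow>
     (\<exists>r. a < r \<and> r < b \<and> is_wall S y T r) \<or>
     (S = UNIV \<and> ((\<exists>\<^sub>F x in at_right a. y x T \<noteq> y a T) \<or> (\<exists>\<^sub>F x in at_left b. y x T \<noteq> y b T)))"

lemma frequently_imp_is_wall:
  assumes "\<exists>\<^sub>F x in at a. y x T \<noteq> y a T"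
  shows "is_wall UNIV y T a"
proof -
  let ?B = "basin UNIV y T (y a T)"
  have "a \<in> ?B" by (simp add: basin_def)
  have "a \<notin> interior ?B"
  proof
    assume "a \<in> interior ?B"
    then have "\<forall>\<^sub>F x in at a. x \<in> interior ?B"
      using eventually_at_topological open_interior by blast
    then have "\<forall>\<^sub>F x in at a. y x T = y a T"
      by (rule eventually_mono) (use interior_subset in \<open>auto simp: basin_def\<close>)
    with assms show False by (simp add: frequently_def)
  qed
  with \<open>a \<in> ?B\<close> show ?thesis
    using closure_subset unfolding is_wall_def frontier_def by auto
qed

lemma wall_between_interior:
  assumes "S \<noteq> UNIV \<or> \<not> is_wall S y T a \<and> \<not> is_wall S y T b"
  shows "wall_between S y T a b \<longleftrightarrow> (\<exists>r. a < r \<and> r < b \<and> is_wall S y T r)"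
  using assms frequently_imp_is_wall[of y T a] frequently_imp_is_wall[of y T b]
  unfolding wall_between_def at_eq_sup_left_right by (auto simp: frequently_def eventually_sup)

section \<open>Coloring coefficient\<close>

definition wall_edges :: "nat \<Rightarrow> nat set set" where
  "wall_edges k = {{2 * w - 1, 2 * w} | w. w \<in> {1..k}}"

definition perfect_matchings :: "nat \<Rightarrow> nat set set set" where
  "perfect_matchings k = {M. partition_on {1..2 * k} M \<and> (\<forall>e\<in>M. card e = 2)}"

definition hamiltonian_cycle :: "nat set \<Rightarrow> nat set set \<Rightarrow> bool" where
  "hamiltonian_cycle V E \<longleftrightarrow>
     (\<exists>vs. distinct vs \<and> set vs = V \<and>
           E = {{vs ! i, vs ! (Suc i mod length vs)} | i. i < length vs})"

definition connected_matching :: "nat \<Rightarrow> nat set set \<Rightarrow> bool" where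
  "connected_matching k M \<longleftrightarrow> hamiltonian_cycle {1..2 * k} (wall_edges k \<union> M)"

text \<open>The word \<open>i\<^sub>1 j\<^sub>1 i\<^sub>2 j\<^sub>2 \<dots> i\<^sub>k j\<^sub>k\<close> with \<open>i\<^sub>r < j\<^sub>r\<close> and \<open>i\<^sub>1 < \<dots> < i\<^sub>k\<close>.\<close>

definition matching_word :: "nat set set \<Rightarrow> nat list" where
  "matching_word M = concat (map (\<lambda>e. [Min e, Max e]) (sorted_key_list_of_set Min M))"

definition matching_sgn :: "nat \<Rightarrow> nat set set \<Rightarrow> int" where
  "matching_sgn k M =
     sign (\<lambda>p. if p \<in> {1..2 * k} then matching_word M ! (p - 1) else p)"

text \<open>A coloring is a list \<open>I\<close>; position \<open>p \<in> {1..2k}\<close> carries the color \<open>I ! (p - 1)\<close>.\<close>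

definition is_lift :: "nat \<Rightarrow> nat list \<Rightarrow> (nat \<Rightarrow> nat) \<Rightarrow> bool" where
  "is_lift k I \<sigma> \<longleftrightarrow> \<sigma> permutes {1..2 * k} \<and>
     (\<forall>w\<in>{1..k}. {\<sigma> (2 * w - 1), \<sigma> (2 * w)} = {p \<in> {1..2 * k}. I ! (p - 1) = w})"

definition compatible :: "(nat \<Rightarrow> nat) \<Rightarrow> nat set set \<Rightarrow> bool" where
  "compatible \<sigma> M \<longleftrightarrow> (\<forall>i j. {i, j} \<in> M \<and> i < j \<longrightarrow> \<sigma> i > \<sigma> j)"

definition lift_sign :: "nat \<Rightarrow> (nat \<Rightarrow> nat) \<Rightarrow> int" where
  "lift_sign k \<sigma> = (\<Prod>w=1..k. (- 1) ^ of_bool (\<sigma> (2 * w - 1) > \<sigma> (2 * w)))"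

definition coloring_coeff :: "nat \<Rightarrow> nat list \<Rightarrow> int" where
  "coloring_coeff k I = (- 1) ^ k *
     (\<Sum>M | M \<in> perfect_matchings k \<and> connected_matching k M.
        matching_sgn k M * (\<Sum>\<sigma> | is_lift k I \<sigma> \<and> compatible \<sigma> M. lift_sign k \<sigma>))"

section \<open>Joint cumulants\<close>

definition joint_cumulant :: "'w measure \<Rightarrow> nat \<Rightarrow> (nat \<Rightarrow> 'w \<Rightarrow> real) \<Rightarrow> real" where
  "joint_cumulant M k X =
     (\<Sum>\<pi> | partition_on {1..k} \<pi>. (- 1) ^ (card \<pi> - 1) * fact (card \<pi> - 1) *
        (\<Prod>B\<in>\<pi>. \<integral>\<omega>. (\<Prod>i\<in>B. X i \<omega>) \<partial>M))"

section \<open>Flanking particles\<close>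

text \<open>
  The flanking particles are numbered \<open>1, \<dots>, 2k\<close>: particles \<open>2w - 1\<close> and \<open>2w\<close> carry color \<open>w\<close> and
  start from \<open>a w\<close> and \<open>b w\<close>.
\<close>

definition particle_color :: "nat \<Rightarrow> nat" where
  "particle_color p = (p + 1) div 2"

definition particle_start :: "(nat \<Rightarrow> real) \<Rightarrow> (nat \<Rightarrow> real) \<Rightarrow> nat \<Rightarrow> real" where
  "particle_start a b p = (if odd p then a (particle_color p) else b (particle_color p))"

text \<open>
  \<open>\<rho>\<close> lists the particles in uniformly random order, independent of the paths. As
  \<^const>\<open>sort_key\<close> is stable, sorting \<open>\<rho>\<close> by final position breaks all ties uniformly at random.
\<close>

definition flanking_space ::
    "(real \<Rightarrow> real \<Rightarrow> (real \<Rightarrow> real) measure) \<Rightarrow> nat \<Rightarrow> (nat \<Rightarrow> real) \<Rightarrow> (nat \<Rightarrow> real) \<Rightarrow>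
     ((nat \<Rightarrow> real \<Rightarrow> real) \<times> nat list) measure" where
  "flanking_space K k a b =
     (Pi\<^sub>M {1..2 * k} (\<lambda>p. K 0 (particle_start a b p)))
       \<Otimes>\<^sub>M measure_pmf (pmf_of_set (permutations_of_set {1..2 * k}))"

definition color_sequence :: "real \<Rightarrow> (nat \<Rightarrow> real \<Rightarrow> real) \<Rightarrow> nat list \<Rightarrow> nat list" where
  "color_sequence T X \<rho> = map particle_color (sort_key (\<lambda>p. X p T) \<rho>)"

definition non_crossing :: "real set \<Rightarrow> real \<Rightarrow> (real \<Rightarrow> real) \<Rightarrow> (real \<Rightarrow> real) \<Rightarrow> bool" where
  "non_crossing Tm T f g \<longleftrightarrow> (\<forall>t\<in>Tm. t \<le> T \<longrightarrow> f t < g t)"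

end

theory Submission
  imports Defs
begin

text \<open>
  Give an ordered pair of positions the weight 2 if it is inverted, 1 if it is a tie and 0 otherwise,
  and let \<open>pfaff\<close> be the Pfaffian of these weights over a list of positions. On a sorted list of
  even length it is the indicator that the entries with numbers 0, 1, then 2, 3, and so on are equal.
  Its values at the two orders of two neighbouring entries add up to its values at the lists in which
  both entries are replaced by one of them, so such a merger changes it by an antisymmetric amount.

  When two independent particles meet, the strong Markov property makes their futures
  exchangeable, so an antisymmetric function of their final positions has mean zero on the event
  that they meet. Turning independent particles into coalescing ones, one meeting at a time, changes
  the Pfaffian by such functions (\<open>expectation_merging\<close>). Hence the probability that the flanking
  particles of every wall in a set \<open>B\<close> have coalesced is the expected Pfaffian of independent
  particles (\<open>prob_pairs_coalesced\<close>). It expands into a signed sum over perfect matchings of the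
  flanking particles, and independence makes each term a product over edges
  (\<open>prob_flanks_coalesced\<close>).

  That a wall lies in an interval means that its flanking particles have not coalesced. Passing to
  complements multiplies a joint cumulant by a sign (\<open>partition_sum_complement\<close>). The sign of a
  matching is multiplicative over unions of walls, so the alternating sum over set partitions keeps
  exactly the matchings that connect all walls (\<open>partition_sum_connected\<close>). The cumulant is
  therefore, up to the sign, the mean of \<open>connected_weight\<close>, a signed sum over connected matchings.

  Conversely, the lifts of a non-crossing coloring arise from the true ranking of the particles
  by exchanging the two ends of some walls. Such an exchange turns a connected matching into another
  one and changes its sign, so all \<open>2\<^sup>k\<close> choices contribute equally
  (\<open>coloring_coeff_noncrossing\<close>). Averaging over the ties turns compatibility into half the weight
  of each edge (\<open>tie_breaking_average\<close>). As \<open>connected_weight\<close> is antisymmetric in the two ends of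
  a wall, the exchange of futures shows that the event that a wall is crossed contributes nothing,
  so that the non-crossing constraints can be dropped (\<open>expectation_noncrossing\<close>).
\<close>

section \<open>The Pfaffian of order weights\<close>

text \<open>
  A tie counts as half an inversion: this is what makes \<open>order_weight x y + order_weight y
  x\<close> constant.
\<close>

definition order_weight :: "real => real => real" where
 "order_weight x y = (if y < x then 2 else if x = y then 1 else 0)"

text \<open>The expansion of a Pfaffian along its first row.\<close>

function pfaff :: "real list => real" where
 "pfaff [] = 1"
| "pfaff (x # xs) = (\<Sum>i<length xs. (-1) ^ i * order_weight x (xs ! i) * pfaff (take i xs @ drop (Suc i) xs))"
 by pat_completeness auto
termination by (relation "inv_image less_than length") auto

lemma order_weight_refl [simp]: "order_weight x x = 1"
 by (simp add: order_weight_def)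
lemma order_weight_swap: "order_weight x y + order_weight y x = 2"
 by (auto simp: order_weight_def)

lemma sum_lessThan_split2:
 fixes f :: "nat => real"
 shows "(\<Sum>i<p + (2 + q). f i) = (\<Sum>i<p. f i) + f p + f (Suc p) + (\<Sum>i<q. f (p + (2 + i)))"
proof -
 have "(\<Sum>i<p + n. f i) = (\<Sum>i<p. f i) + (\<Sum>i<n. f (p + i))" for n
  by (induction n) auto
 from this[of "2+q"] show ?thesis
  by (simp add: eval_nat_numeral sum.lessThan_Suc_shift del: sum.lessThan_Suc)
qed

abbreviation del :: "nat => 'a list => 'a list" where "del i xs \<equiv> take i xs @ drop (Suc i) xs"

lemma pfaff_swap_cons:
 assumes IH: "\<And>xs' ys'. length (xs' @ ys') < length (x # xs @ ys) ==>
   pfaff (xs' @ u # v # ys') + pfaff (xs' @ v # u # ys') = 2 * pfaff (xs' @ ys')"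
 shows "pfaff (x # xs @ u # v # ys) + pfaff (x # xs @ v # u # ys) = 2 * pfaff (x # xs @ ys)"
proof -
 let ?p = "length xs" and ?q = "length ys"
 have E: "pfaff (x # xs @ u # v # ys) =
   (\<Sum>i<?p. (-1)^i * order_weight x (xs!i) * pfaff (del i xs @ u # v # ys))
   + (-1)^?p * order_weight x u * pfaff (xs @ v # ys) + (-1)^(Suc ?p) * order_weight x v * pfaff (xs @ u # ys)
   + (\<Sum>i<?q. (-1)^(?p+i) * order_weight x (ys!i) * pfaff (xs @ u # v # del i ys))" for u v
 proof -
  have len: "length (xs @ u # v # ys) = ?p + (2 + ?q)" by simp
  have 1: "(\<Sum>i<?p. (-1)^i * order_weight x ((xs @ u # v # ys)!i) * pfaff (del i (xs @ u # v # ys)))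
    = (\<Sum>i<?p. (-1)^i * order_weight x (xs!i) * pfaff (del i xs @ u # v # ys))"
   by (rule sum.cong) (auto simp: nth_append)
  have 2: "(\<Sum>i<?q. (-1)^(?p+(2+i)) * order_weight x ((xs @ u # v # ys)!(?p+(2+i))) * pfaff (del (?p+(2+i)) (xs @ u # v # ys)))
    = (\<Sum>i<?q. (-1)^(?p+i) * order_weight x (ys!i) * pfaff (xs @ u # v # del i ys))"
   by (rule sum.cong) (auto simp: nth_append eval_nat_numeral)
  show ?thesis
   unfolding pfaff.simps len sum_lessThan_split2 1 2 by (simp add: nth_append)
 qed
 have F: "pfaff (x # xs @ ys) = (\<Sum>i<?p. (-1)^i * order_weight x (xs!i) * pfaff (del i xs @ ys))
   + (\<Sum>i<?q. (-1)^(?p+i) * order_weight x (ys!i) * pfaff (xs @ del i ys))"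
 proof -
  have "(\<Sum>i<?p + n. f i) = (\<Sum>i<?p. f i) + (\<Sum>i<n. f (?p + i))" for n and f :: "nat => real"
   by (induction n) auto
  hence "pfaff (x # xs @ ys) = (\<Sum>i<?p. (-1)^i * order_weight x ((xs @ ys)!i) * pfaff (del i (xs @ ys)))
   + (\<Sum>i<?q. (-1)^(?p+i) * order_weight x ((xs @ ys)!(?p+i)) * pfaff (del (?p+i) (xs @ ys)))"
   by simp
  also have "(\<Sum>i<?p. (-1)^i * order_weight x ((xs @ ys)!i) * pfaff (del i (xs @ ys))) =
    (\<Sum>i<?p. (-1)^i * order_weight x (xs!i) * pfaff (del i xs @ ys))"
   by (rule sum.cong) (auto simp: nth_append)
  finally show ?thesis by (simp add: nth_append)
 qed
 have 1: "(\<Sum>i<?p. (-1)^i * order_weight x (xs!i) * pfaff (del i xs @ u # v # ys)) +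
    (\<Sum>i<?p. (-1)^i * order_weight x (xs!i) * pfaff (del i xs @ v # u # ys)) =
    2 * (\<Sum>i<?p. (-1)^i * order_weight x (xs!i) * pfaff (del i xs @ ys))"
  unfolding sum.distrib[symmetric] sum_distrib_left
 proof (intro sum.cong refl)
  fix i assume "i \<in> {..<?p}"
  hence "pfaff (del i xs @ u # v # ys) + pfaff (del i xs @ v # u # ys) = 2 * pfaff (del i xs @ ys)"
   by (intro IH) auto
  from arg_cong[OF this, of "%z. (-1)^i * order_weight x (xs!i) * z"]
  show "(-1)^i * order_weight x (xs!i) * pfaff (del i xs @ u # v # ys) + (-1)^i * order_weight x (xs!i) * pfaff (del i xs @ v # u # ys) =
     2 * ((-1)^i * order_weight x (xs!i) * pfaff (del i xs @ ys))" by (simp add: algebra_simps)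
 qed
 have 2: "(\<Sum>i<?q. (-1)^(?p+i) * order_weight x (ys!i) * pfaff (xs @ u # v # del i ys)) +
    (\<Sum>i<?q. (-1)^(?p+i) * order_weight x (ys!i) * pfaff (xs @ v # u # del i ys)) =
    2 * (\<Sum>i<?q. (-1)^(?p+i) * order_weight x (ys!i) * pfaff (xs @ del i ys))"
  unfolding sum.distrib[symmetric] sum_distrib_left
 proof (intro sum.cong refl)
  fix i assume "i \<in> {..<?q}"
  hence "pfaff (xs @ u # v # del i ys) + pfaff (xs @ v # u # del i ys) = 2 * pfaff (xs @ del i ys)"
   by (intro IH) auto
  from arg_cong[OF this, of "%z. (-1)^(?p+i) * order_weight x (ys!i) * z"]
  show "(-1)^(?p+i) * order_weight x (ys!i) * pfaff (xs @ u # v # del i ys) + (-1)^(?p+i) * order_weight x (ys!i) * pfaff (xs @ v # u # del i ys) =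
     2 * ((-1)^(?p+i) * order_weight x (ys!i) * pfaff (xs @ del i ys))" by (simp add: algebra_simps)
 qed
 show ?thesis using 1 2 unfolding E[of u v] E[of v u] F by (simp add: algebra_simps)
qed

lemma pfaff_swap_head:
 "pfaff (u # v # ys) + pfaff (v # u # ys) = 2 * pfaff ys"
proof -
 define D :: "real => real => nat => nat => real" where
  "D u v i j = order_weight u (ys!i) * order_weight v (ys!j) * (if j < i then (-1)^(i+j) * pfaff (del j (del i ys)) else if i < j then - ((-1)^(i+j)) * pfaff (del i (del j ys)) else 0)" for u v i j
 have E: "pfaff (u # v # ys) = order_weight u v * pfaff ys - (\<Sum>i<length ys. \<Sum>j<length ys. D u v i j)" for u v
 proof -
  have "pfaff (u # v # ys) = order_weight u v * pfaff ys + (\<Sum>i<length ys. (-1)^(Suc i) * order_weight u (ys!i) * pfaff (v # del i ys))"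
   by (subst pfaff.simps) (simp add: sum.lessThan_Suc_shift del: sum.lessThan_Suc pfaff.simps)
  also have "(\<Sum>i<length ys. (-1)^(Suc i) * order_weight u (ys!i) * pfaff (v # del i ys)) = - (\<Sum>i<length ys. \<Sum>j<length ys. D u v i j)"
  proof (subst sum_negf[symmetric], intro sum.cong refl)
   fix i assume "i \<in> {..<length ys}"
   hence i: "i < length ys" by simp
   obtain n where n: "length ys = i + Suc n" using i by (metis add_Suc_right less_iff_Suc_add)
   have "pfaff (v # del i ys) = (\<Sum>j<i + n. (-1)^j * order_weight v (del i ys ! j) * pfaff (del j (del i ys)))"
    using n by simp
   also have "... = (\<Sum>j<i. (-1)^j * order_weight v (del i ys ! j) * pfaff (del j (del i ys)))
     + (\<Sum>j<n. (-1)^(i+j) * order_weight v (del i ys ! (i+j)) * pfaff (del (i+j) (del i ys)))"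
    by (induction n) auto
   finally have 1: "pfaff (v # del i ys) = ..." .
   have "(\<Sum>j<length ys. D u v i j) = (\<Sum>j<i. D u v i j) + D u v i i + (\<Sum>j<n. D u v i (i + Suc j))"
   proof -
    have "(\<Sum>j<i + Suc n. f j) = (\<Sum>j<i. f j) + f i + (\<Sum>j<n. f (i + Suc j))" for f :: "nat => real"
     by (induction n) auto
    thus ?thesis by (simp add: n)
   qed
   moreover have "(\<Sum>j<i. D u v i j) = (-1)^i * order_weight u (ys!i) * (\<Sum>j<i. (-1)^j * order_weight v (del i ys ! j) * pfaff (del j (del i ys)))"
    unfolding sum_distrib_left
    by (rule sum.cong) (use i in \<open>auto simp: D_def nth_append power_add\<close>)
   moreover have "(\<Sum>j<n. D u v i (i + Suc j)) = (-1)^i * order_weight u (ys!i) * (\<Sum>j<n. (-1)^(i+j) * order_weight v (del i ys ! (i+j)) * pfaff (del (i+j) (del i ys)))"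
    unfolding sum_distrib_left
   proof (rule sum.cong[OF refl])
    fix j assume "j \<in> {..<n}"
    hence j: "i + Suc j < length ys" using n by simp
    have a: "del i ys ! (i+j) = ys ! (i + Suc j)" using i j by (simp add: nth_append)
    have b: "del (i+j) (del i ys) = del i (del (i + Suc j) ys)"
    proof -
     define A where "A = take i ys"
     define B where "B = take j (drop (Suc i) ys)"
     have "ys = A @ ys ! i # drop (Suc i) ys" unfolding A_def by (rule id_take_nth_drop[OF i])
     moreover have "drop (Suc i) ys = B @ drop (Suc i) ys ! j # drop (Suc j) (drop (Suc i) ys)"
      unfolding B_def by (rule id_take_nth_drop) (use j in simp)
     ultimately obtain y z C where ys: "ys = A @ y # B @ z # C" by metis
     have "length A = i" "length B = j" unfolding A_def B_def using i j by auto
     thus ?thesis unfolding ys by simp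
    qed
    show "D u v i (i + Suc j) = (-1)^i * order_weight u (ys!i) * ((-1)^(i+j) * order_weight v (del i ys ! (i+j)) * pfaff (del (i+j) (del i ys)))"
     unfolding D_def a b by (simp add: power_add)
   qed
   moreover have "D u v i i = 0" by (simp add: D_def)
   ultimately show "(-1)^(Suc i) * order_weight u (ys!i) * pfaff (v # del i ys) = - (\<Sum>j<length ys. D u v i j)"
    unfolding 1 by (simp add: algebra_simps)
  qed
  finally show ?thesis by simp
 qed
 have "(\<Sum>i<length ys. \<Sum>j<length ys. D v u i j) = (\<Sum>i<length ys. \<Sum>j<length ys. D v u j i)"
  by (rule sum.swap)
 also have "... = - (\<Sum>i<length ys. \<Sum>j<length ys. D u v i j)"
  unfolding sum_negf[symmetric] by (intro sum.cong refl) (auto simp: D_def add.commute)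
 finally show ?thesis
  using arg_cong[OF order_weight_swap[of u v], of "%z. z * pfaff ys"] unfolding E by (simp add: algebra_simps)
qed

text \<open>
  Expanding along the first entry reduces to a shorter list, until the two neighbours come first.
  There all terms cancel except those that pair the neighbours with each other, whose weights in
  the two orders add up to 2.
\<close>

lemma pfaff_swap: "pfaff (xs @ u # v # ys) + pfaff (xs @ v # u # ys) = 2 * pfaff (xs @ ys)"
proof (induction "length (xs @ ys)" arbitrary: xs ys rule: less_induct)
 case less
 show ?case
 proof (cases xs)
  case Nil thus ?thesis using pfaff_swap_head[of u v ys] by simp
 next
  case (Cons x xs')
  show ?thesis
   unfolding Cons append_Cons
   by (rule pfaff_swap_cons) (rule less, simp add: Cons)
 qed
qed

lemma pfaff_double: "pfaff (xs @ u # u # ys) = pfaff (xs @ ys)"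
 using pfaff_swap[of xs u u ys] by simp

lemma pfaff_replicate: "pfaff (xs @ replicate m u @ ys) = pfaff (xs @ replicate (m mod 2) u @ ys)"
proof (induction m rule: nat_induct2)
 case (step n)
 have "pfaff (xs @ replicate (n+2) u @ ys) = pfaff (xs @ replicate n u @ ys)"
  using pfaff_double[of xs u "replicate n u @ ys"] by simp
 thus ?case using step by simp
qed auto

text \<open>
  Equal neighbours cancel in pairs, so only the parities of the blocks matter. This is the form
  used for clusters: the exchange of two clusters is compared with their merger.
\<close>

lemma pfaff_block_swap:
 "pfaff (xs @ replicate m u @ replicate n v @ ys) + pfaff (xs @ replicate m v @ replicate n u @ ys) =
  pfaff (xs @ replicate (m + n) u @ ys) + pfaff (xs @ replicate (m + n) v @ ys)"
proof -
 have R: "pfaff (xs @ replicate m u @ replicate n v @ ys) = pfaff (xs @ replicate (m mod 2) u @ replicate (n mod 2) v @ ys)" for u v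
  using pfaff_replicate[of xs m u "replicate n v @ ys"] pfaff_replicate[of "xs @ replicate (m mod 2) u" n v ys] by simp
 have S: "pfaff (xs @ replicate (m + n) u @ ys) = pfaff (xs @ replicate ((m mod 2 + n mod 2) mod 2) u @ ys)" for u
  using pfaff_replicate[of xs "m + n" u ys] by (simp add: mod_add_eq)
 have "m mod 2 = 0 \<or> m mod 2 = 1" "n mod 2 = 0 \<or> n mod 2 = 1" by auto
 thus ?thesis
  unfolding R S using pfaff_swap[of xs u v ys] by auto
qed

lemma pfaff_strictly_sorted: "sorted_wrt (<) xs ==> xs \<noteq> [] ==> pfaff xs = 0"
 by (cases xs) (force simp: order_weight_def dest!: nth_mem intro!: sum.neutral)+

text \<open>
  Neighbouring equal entries cancel, and a nonempty strictly sorted list has Pfaffian 0 because no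
  pair is inverted or tied along the first row.
\<close>

lemma pfaff_sorted:
 assumes "sorted xs" "even (length xs)"
 shows "pfaff xs = of_bool (\<forall>j<length xs div 2. xs ! (2 * j) = xs ! (2 * j + 1))"
 using assms
proof (induction "length xs" arbitrary: xs rule: less_induct)
 case less
 show ?case
 proof (cases "sorted_wrt (<) xs")
  case True
  show ?thesis
  proof (cases "xs = []")
   case False
   with less have "2 \<le> length xs" by (cases xs; cases "tl xs") auto
   hence "xs ! 0 < xs ! 1" using True by (auto intro: sorted_wrt_nth_less)
   hence "\<not> (\<forall>j<length xs div 2. xs ! (2 * j) = xs ! (2 * j + 1))"
    using \<open>2 \<le> length xs\<close> by (auto intro!: exI[of _ 0])
   thus ?thesis using pfaff_strictly_sorted[OF True False] by simp
  qed simp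
 next
  case False
  then obtain i where i: "Suc i < length xs" "\<not> xs ! i < xs ! Suc i"
   by (auto simp: sorted_wrt_iff_nth_Suc_transp)
  with less(2) have eq: "xs ! i = xs ! Suc i" by (metis sorted_nth_mono lessI less_imp_le_nat linorder_not_less order_antisym)
  define zs where "zs = take i xs @ drop (i + 2) xs"
  have xs: "xs = take i xs @ xs ! i # xs ! i # drop (i + 2) xs"
   using i eq by (metis Cons_nth_drop_Suc Suc_lessD add_2_eq_Suc' id_take_nth_drop)
  have len: "length xs = length zs + 2" using i by (simp add: zs_def)
  have srt: "sorted zs" using less(2) by (subst (asm) xs) (auto simp: zs_def sorted_append)
  have pf: "pfaff xs = pfaff zs" using pfaff_double[of "take i xs" "xs ! i" "drop (i + 2) xs"] xs by (simp add: zs_def)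
  have IH: "pfaff zs = of_bool (\<forall>j<length zs div 2. zs ! (2 * j) = zs ! (2 * j + 1))"
   using less len srt by auto
  have low: "zs ! j = xs ! j" if "j < i" for j using that i by (simp add: zs_def nth_append)
  have high: "zs ! j = xs ! (j + 2)" if "i \<le> j" "j < length zs" for j
   using that i by (simp add: zs_def nth_append add.commute)
  have "(\<forall>j<length zs div 2. zs ! (2 * j) = zs ! (2 * j + 1)) \<longleftrightarrow> (\<forall>j<length xs div 2. xs ! (2 * j) = xs ! (2 * j + 1))"
  proof (cases "even i")
   case True
   then obtain h where h: "i = 2 * h" by auto
   show ?thesis
   proof safe
    fix j assume a: "\<forall>j<length zs div 2. zs ! (2 * j) = zs ! (2 * j + 1)" "j < length xs div 2"
    consider "j < h" | "j = h" | "j > h" by linarith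
    thus "xs ! (2 * j) = xs ! (2 * j + 1)"
    proof cases
     case 1 thus ?thesis using a(1)[rule_format, of j] low[of "2*j"] low[of "2*j+1"] i len h by auto
    next
     case 2 thus ?thesis using eq h by simp
    next
     case 3 thus ?thesis using a(1)[rule_format, of "j-1"] a(2) high[of "2*(j-1)"] high[of "2*(j-1)+1"] i len h
      by (cases j) (auto simp: algebra_simps)
    qed
   next
    fix j assume a: "\<forall>j<length xs div 2. xs ! (2 * j) = xs ! (2 * j + 1)" "j < length zs div 2"
    show "zs ! (2 * j) = zs ! (2 * j + 1)"
     using a(1)[rule_format, of j] a(1)[rule_format, of "Suc j"] a(2) low[of "2*j"] low[of "2*j+1"] high[of "2*j"] high[of "2*j+1"] len h
     by (cases "j < h") auto
   qed
  next
   case False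
   then obtain h where h: "i = 2 * h + 1" by (auto elim: oddE)
   have le: "xs ! p \<le> xs ! q" if "p \<le> q" "q < length xs" for p q using less(2) that by (auto simp: sorted_nth_mono)
   have il: "2 * h + 3 < length xs" using i(1) h less(3) by presburger
   hence hz: "h < length zs div 2" "Suc h < length xs div 2" "h < length xs div 2" using len by auto
   show ?thesis
   proof safe
    fix j assume a: "\<forall>j<length zs div 2. zs ! (2 * j) = zs ! (2 * j + 1)" "j < length xs div 2"
    have m: "xs ! (2 * h) = xs ! (2 * h + 3)"
     using a(1)[rule_format, OF hz(1)] low[of "2*h"] high[of "2*h+1"] h il len by (simp add: numeral_eq_Suc)
    consider "j < h" | "j = h" | "j = h+1" | "j > h + 1" by linarith
    thus "xs ! (2 * j) = xs ! (2 * j + 1)"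
    proof cases
     case 1 thus ?thesis using a(1)[rule_format, of j] low[of "2*j"] low[of "2*j+1"] i len h by auto
    next
     case 2 thus ?thesis using m le[of "2*h" "2*h+1"] le[of "2*h+1" "2*h+3"] il by auto
    next
     case 3 thus ?thesis using m le[of "2*h" "2*h+2"] le[of "2*h+2" "2*h+3"] il by (auto simp: numeral_eq_Suc)
    next
     case 4 thus ?thesis using a(1)[rule_format, of "j-1"] a(2) high[of "2*(j-1)"] high[of "2*(j-1)+1"] i len h
      by (cases j) (auto simp: algebra_simps)
    qed
   next
    fix j assume a: "\<forall>j<length xs div 2. xs ! (2 * j) = xs ! (2 * j + 1)" "j < length zs div 2"
    consider "j < h" | "j = h" | "j > h" by linarith
    thus "zs ! (2 * j) = zs ! (2 * j + 1)"
    proof cases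
     case 1 thus ?thesis using a(1)[rule_format, of j] a(2) low[of "2*j"] low[of "2*j+1"] len h by auto
    next
     case 2
     have "xs ! (2*h) = xs ! (2*h+1)" "xs ! (2*h+2) = xs ! (2*h+3)" "xs ! (2*h+1) = xs ! (2*h+2)"
      using a(1)[rule_format, OF hz(3)] a(1)[rule_format, OF hz(2)] eq h il by (auto simp: numeral_eq_Suc)
     thus ?thesis using 2 low[of "2*h"] high[of "2*h+1"] h il len by (auto simp: numeral_eq_Suc)
    next
     case 3 thus ?thesis using a(1)[rule_format, of "Suc j"] a(2) high[of "2*j"] high[of "2*j+1"] len h by auto
    qed
   qed
  qed
  thus ?thesis using pf IH by simp
 qed
qed

section \<open>Regularity and measurability of paths\<close>

text \<open>
  The common properties of all path spaces that the meeting times use: right-continuity along the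
  set of times, and either continuity or integer values. It is stable under differences, unlike
  skip-freeness.
\<close>

definition regular_path :: "real set => (real => real) => bool" where
 "regular_path Tm v \<longleftrightarrow> (\<forall>t\<in>Tm. (v \<longlongrightarrow> v t) (at t within Tm \<inter> {t<..})) \<and>
   (Tm = {0..} \<and> continuous_on Tm v \<or> v ` Tm \<subseteq> \<int>)"

lemma admissible_time:
 assumes "admissible_setting S Tm"
 shows "0 \<in> Tm" "\<And>t. t \<in> Tm ==> 0 \<le> t" "\<And>s t. s \<in> Tm ==> t \<in> Tm ==> s + t \<in> Tm"
  "\<And>s t. s \<in> Tm ==> t \<in> Tm ==> s \<le> t ==> t - s \<in> Tm" "\<And>t. t \<in> Tm ==> t + 1 \<in> Tm"
  "Tm = \<nat> \<or> Tm = {0..}" "Tm \<in> sets borel" "S \<in> sets borel"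
proof -
 have N: "(\<nat>::real set) \<in> sets borel" "(\<int>::real set) \<in> sets borel"
  by (intro borel_closed closed_Nats closed_Ints)+
 have T: "Tm = \<nat> \<or> Tm = {0..}" and S: "S = \<int> \<or> S = UNIV"
  using assms by (auto simp: admissible_setting_def)
 have pos: "0 \<le> t" if "t \<in> \<nat>" for t :: real
  using that by (cases t rule: Nats_cases) auto
 show "Tm = \<nat> \<or> Tm = {0..}" by (rule T)
 show "0 \<in> Tm" "Tm \<in> sets borel" "S \<in> sets borel" using T S N by auto
 show "t \<in> Tm ==> 0 \<le> t" "s \<in> Tm ==> t \<in> Tm ==> s + t \<in> Tm" "t \<in> Tm ==> t + 1 \<in> Tm" for s t
  using T pos Nats_add[of s t] Nats_add[of t 1] by (elim disjE; simp)+
 show "t - s \<in> Tm" if "s \<in> Tm" "t \<in> Tm" "s \<le> t" for s t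
 proof (cases "Tm = \<nat>")
  case True
  obtain m n where "s = of_nat m" "t = of_nat n" using \<open>s \<in> Tm\<close> \<open>t \<in> Tm\<close> True by (auto elim!: Nats_cases)
  hence "t - s = of_nat (n - m)" using that by auto
  thus ?thesis using True by (simp only: of_nat_in_Nats)
 next
  case False
  with assms that show ?thesis by (auto simp: admissible_setting_def)
 qed
qed

lemma Ints_neq_UNIV: "(\<int> :: real set) \<noteq> UNIV"
proof
 assume "(\<int> :: real set) = UNIV"
 hence "(1/2 :: real) \<in> \<int>" by blast
 then obtain n :: int where "1/2 = (of_int n :: real)" by (rule Ints_cases)
 hence "1 = 2 * n" by linarith
 thus False by presburger
qed

lemma Nats_neq_halfline: "(\<nat> :: real set) \<noteq> {0..}"
proof
 assume "(\<nat> :: real set) = {0..}"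
 hence "(1/2 :: real) \<in> \<nat>" by (metis atLeast_iff divide_nonneg_nonneg zero_le_one zero_le_numeral)
 then obtain n where "1/2 = (of_nat n :: real)" by (rule Nats_cases)
 hence "1 = 2 * n" by linarith
 thus False by presburger
qed

lemma tendsto_within_Nats:
 assumes "t \<in> (\<nat> :: real set)"
 shows "(v \<longlongrightarrow> l) (at t within \<nat> \<inter> {t<..})"
proof -
 have "eventually (%_. False) (at t within \<nat> \<inter> {t<..})"
  unfolding eventually_at
 proof (intro exI[of _ 1] conjI ballI impI)
  fix x assume x: "x \<in> \<nat> \<inter> {t<..}" "x \<noteq> t \<and> dist x t < 1"
  obtain m n where "x = of_nat m" "t = of_nat n" using x assms by (auto elim!: Nats_cases)
  with x show False by (auto simp: dist_real_def)
 qed auto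
 thus ?thesis
  unfolding tendsto_def using eventually_mono by fastforce
qed

lemma regular_path_skip_free:
 assumes "admissible_setting S Tm" "\<omega> \<in> skip_free_paths S Tm"
 shows "regular_path Tm \<omega>"
proof -
 consider "S = \<int>" "Tm = \<nat>" | "S = \<int>" "Tm = {0..}" | "S = UNIV" "Tm = {0..}"
  using assms(1) by (auto simp: admissible_setting_def)
 thus ?thesis
 proof cases
  case 1
  thus ?thesis using assms(2)
   by (auto simp: regular_path_def skip_free_paths_def intro!: tendsto_within_Nats)
 next
  case 2
  hence "\<forall>t\<in>Tm. (\<omega> \<longlongrightarrow> \<omega> t) (at_right t)" "\<omega> ` Tm \<subseteq> \<int>"
   using assms(2) Ints_neq_UNIV Nats_neq_halfline by (auto simp: skip_free_paths_def)
  thus ?thesis by (auto simp: regular_path_def intro: tendsto_within_subset)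
 next
  case 3
  hence "continuous_on Tm \<omega>" using assms(2) by (auto simp: skip_free_paths_def)
  thus ?thesis using 3
   by (auto simp: regular_path_def continuous_on_def intro: tendsto_within_subset)
 qed
qed

lemma regular_path_compose2:
 assumes "regular_path Tm f" "regular_path Tm g"
  and h: "continuous_on UNIV (%(x, y). h x y)" "\<And>x y. x \<in> \<int> ==> y \<in> \<int> ==> h x y \<in> \<int>"
  and "Tm = {0..} \<and> continuous_on Tm f \<and> continuous_on Tm g \<or> f ` Tm \<subseteq> \<int> \<and> g ` Tm \<subseteq> \<int>"
 shows "regular_path Tm (%t. h (f t) (g t))"
proof -
 have "((%u. h (f u) (g u)) \<longlongrightarrow> h (f t) (g t)) (at t within Tm \<inter> {t<..})" if "t \<in> Tm" for t
 proof -
  have "((%u. (f u, g u)) \<longlongrightarrow> (f t, g t)) (at t within Tm \<inter> {t<..})"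
   using assms(1,2) that by (auto simp: regular_path_def intro!: tendsto_Pair)
  from continuous_on_tendsto_compose[OF h(1) this] show ?thesis by auto
 qed
 moreover have "continuous_on Tm (%u. h (f u) (g u))" if "continuous_on Tm f" "continuous_on Tm g"
  using continuous_on_compose2[OF h(1) continuous_on_Pair[OF that]] by auto
 moreover have "(%t. h (f t) (g t)) ` Tm \<subseteq> \<int>" if "f ` Tm \<subseteq> \<int> \<and> g ` Tm \<subseteq> \<int>"
  using that h(2) by blast
 ultimately show ?thesis using assms(5) unfolding regular_path_def by blast
qed

lemma path_dichotomy:
 assumes "admissible_setting S Tm" "f \<in> skip_free_paths S Tm" "g \<in> skip_free_paths S Tm"
 shows "Tm = {0..} \<and> continuous_on Tm f \<and> continuous_on Tm g \<or> f ` Tm \<subseteq> \<int> \<and> g ` Tm \<subseteq> \<int>"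
 using assms by (auto simp: admissible_setting_def skip_free_paths_def)

lemma regular_path_diff:
 assumes "admissible_setting S Tm" "f \<in> skip_free_paths S Tm" "g \<in> skip_free_paths S Tm"
 shows "regular_path Tm (%t. f t - g t)" "regular_path Tm (%t. max 0 (f t - g t))"
proof -
 note r = regular_path_skip_free[OF assms(1,2)] regular_path_skip_free[OF assms(1,3)]
 show "regular_path Tm (%t. f t - g t)"
  by (rule regular_path_compose2[OF r _ _ path_dichotomy[OF assms], of "%x y. x - y"])
   (auto simp: case_prod_unfold intro!: continuous_intros)
 show "regular_path Tm (%t. max 0 (f t - g t))"
  by (rule regular_path_compose2[OF r _ _ path_dichotomy[OF assms], of "%x y. max 0 (x - y)"])
   (simp_all add: case_prod_unfold continuous_on_max continuous_on_diff continuous_on_fst continuous_on_snd max_def_raw[symmetric], auto simp: max_def)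
qed

text \<open>
  Countably many times decide whether a zero is hit: a continuous path attains its infimum on a
  compact interval, and an integer-valued right-continuous path keeps the value 0 for a while.
  This yields the measurability of all meeting events.
\<close>

lemma hits_zero_iff:
 assumes adm: "admissible_setting S Tm" and v: "regular_path Tm v"
 shows "(\<exists>u\<in>Tm. u \<le> t \<and> v u = 0) \<longleftrightarrow>
   (\<forall>n::nat. \<exists>q\<in>{q \<in> Tm. q \<le> t \<and> (q \<in> \<rat> \<or> q = t)}. \<bar>v q\<bar> < 1 / real (Suc n))"
proof
 assume "\<exists>u\<in>Tm. u \<le> t \<and> v u = 0"
 then obtain u where u: "u \<in> Tm" "u \<le> t" "v u = 0" by auto
 show "\<forall>n::nat. \<exists>q\<in>{q \<in> Tm. q \<le> t \<and> (q \<in> \<rat> \<or> q = t)}. \<bar>v q\<bar> < 1 / real (Suc n)"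
 proof
  fix n :: nat
  show "\<exists>q\<in>{q \<in> Tm. q \<le> t \<and> (q \<in> \<rat> \<or> q = t)}. \<bar>v q\<bar> < 1 / real (Suc n)"
  proof (cases "u \<in> \<rat> \<or> u = t")
   case True thus ?thesis using u by (intro bexI[of _ u]) auto
  next
   case False
   hence Tm: "Tm = {0..}" using u admissible_time(6)[OF adm] by (auto simp: Nats_def)
   have "(v \<longlongrightarrow> v u) (at u within Tm \<inter> {u<..})" using v u(1) by (auto simp: regular_path_def)
   hence "eventually (%x. dist (v x) 0 < 1 / real (Suc n)) (at u within Tm \<inter> {u<..})"
    unfolding u(3) by (rule tendstoD) simp
   then obtain d where d: "d > 0" "\<And>x. x \<in> Tm ==> u < x ==> dist x u < d ==> dist (v x) 0 < 1 / real (Suc n)"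
    by (auto simp: eventually_at)
   have "u < min (u + d) t" using d(1) False u(2) by auto
   then obtain q where q: "q \<in> \<rat>" "u < q" "q < min (u + d) t" using Rats_dense_in_real by blast
   thus ?thesis using d(2)[of q] u Tm by (intro bexI[of _ q]) (auto simp: dist_real_def)
  qed
 qed
next
 assume H: "\<forall>n::nat. \<exists>q\<in>{q \<in> Tm. q \<le> t \<and> (q \<in> \<rat> \<or> q = t)}. \<bar>v q\<bar> < 1 / real (Suc n)"
 show "\<exists>u\<in>Tm. u \<le> t \<and> v u = 0"
 proof (cases "v ` Tm \<subseteq> \<int>")
  case True
  obtain q where q: "q \<in> Tm" "q \<le> t" "\<bar>v q\<bar> < 1" using H[rule_format, of 0] by auto
  hence "v q \<in> \<int>" using True by auto
  hence "v q = 0" using q(3) by (auto elim!: Ints_cases)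
  thus ?thesis using q by auto
 next
  case False
  hence Tm: "Tm = {0..}" and c: "continuous_on {0..} v" using v by (auto simp: regular_path_def)
  obtain q where "q \<in> Tm" "q \<le> t" using H by auto
  hence "{0..t} \<noteq> {}" using Tm by auto
  moreover have "continuous_on {0..t} (%x. \<bar>v x\<bar>)" using c by (auto intro!: continuous_intros intro: continuous_on_subset)
  ultimately obtain m where m: "m \<in> {0..t}" "\<And>x. x \<in> {0..t} ==> \<bar>v m\<bar> \<le> \<bar>v x\<bar>"
   using continuous_attains_inf[of "{0..t}" "%x. \<bar>v x\<bar>"] by auto
  have "\<bar>v m\<bar> < 1 / real (Suc n)" for n
  proof -
   obtain q where "q \<in> Tm" "q \<le> t" "\<bar>v q\<bar> < 1 / real (Suc n)" using H by blast
   thus ?thesis using m(2)[of q] Tm by auto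
  qed
  hence "\<not> \<bar>v m\<bar> > 0" using reals_Archimedean[of "\<bar>v m\<bar>"] by (auto simp: inverse_eq_divide dest: less_asym)
  hence "v m = 0" by simp
  thus ?thesis using m Tm by auto
 qed
qed

lemma pred_hits_zero:
 assumes adm: "admissible_setting S Tm" and v: "\<And>\<omega>. \<omega> \<in> space N ==> regular_path Tm (v \<omega>)"
  and m: "\<And>u. u \<in> Tm ==> u \<le> t ==> (%\<omega>. v \<omega> u) \<in> borel_measurable N"
 shows "Measurable.pred N (%\<omega>. \<exists>u\<in>Tm. u \<le> t \<and> v \<omega> u = 0)"
proof -
 let ?D = "{q \<in> Tm. q \<le> t \<and> (q \<in> \<rat> \<or> q = t)}"
 have "?D \<subseteq> \<rat> \<union> {t}" by auto
 hence cD: "countable ?D" by (rule countable_subset) (simp add: countable_rat)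
 have "Measurable.pred N (%\<omega>. \<forall>n::nat. \<exists>q\<in>?D. \<bar>v \<omega> q\<bar> < 1 / real (Suc n))"
  unfolding pred_def
 proof (rule sets.sets_Collect_countable_All)
  fix n :: nat
  have "{\<omega> \<in> space N. \<exists>q\<in>?D. \<bar>v \<omega> q\<bar> < 1 / real (Suc n)} = (\<Union>q\<in>?D. {\<omega> \<in> space N. \<bar>v \<omega> q\<bar> < 1 / real (Suc n)})" by auto
  also have "... \<in> sets N"
  proof (rule sets.countable_UN'[OF cD], rule image_subsetI)
   fix q assume "q \<in> ?D"
   hence [measurable]: "(%\<omega>. v \<omega> q) \<in> borel_measurable N" using m by auto
   show "{\<omega> \<in> space N. \<bar>v \<omega> q\<bar> < 1 / real (Suc n)} \<in> sets N" by measurable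
  qed
  finally show "{\<omega> \<in> space N. \<exists>q\<in>?D. \<bar>v \<omega> q\<bar> < 1 / real (Suc n)} \<in> sets N" .
 qed
 thus ?thesis by (subst measurable_cong[OF hits_zero_iff[OF adm v]])
qed

text \<open>Right-continuity makes the first hitting time a time at which the zero is attained.\<close>

lemma Inf_zero_attained:
 assumes adm: "admissible_setting S Tm" and v: "regular_path Tm v" and H: "\<exists>s\<in>Tm. v s = 0"
 shows "Inf {s\<in>Tm. v s = 0} \<in> Tm" "v (Inf {s\<in>Tm. v s = 0}) = 0"
  and "\<And>s. s \<in> Tm ==> v s = 0 ==> Inf {s\<in>Tm. v s = 0} \<le> s"
proof -
 let ?H = "{s\<in>Tm. v s = 0}"
 have bdd: "bdd_below ?H" using admissible_time(2)[OF adm] by (auto intro!: bdd_belowI[of _ 0])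
 thus "\<And>s. s \<in> Tm ==> v s = 0 ==> Inf ?H \<le> s" by (auto intro!: cInf_lower)
 have "Inf ?H \<in> ?H"
 proof (cases "Tm = \<nat>")
  case True
  have "\<exists>n. real n \<in> ?H" using H True by (auto elim: Nats_cases)
  hence L: "real (LEAST n. real n \<in> ?H) \<in> ?H" (is "real ?l \<in> _") by (rule LeastI_ex)
  have "Inf ?H = real ?l"
   by (rule cInf_eq_minimum[OF L]) (auto simp: True elim!: Nats_cases intro!: Least_le)
  thus ?thesis using L by simp
 next
  case False
  hence Tm: "Tm = {0..}" using admissible_time(6)[OF adm] by auto
  let ?i = "Inf ?H"
  have i: "?i \<in> Tm" using H unfolding Tm by (auto intro!: cInf_greatest)
  show ?thesis
  proof (rule ccontr)
   assume "?i \<notin> ?H"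
   hence n: "v ?i \<noteq> 0" using i by auto
   have "(v \<longlongrightarrow> v ?i) (at ?i within Tm \<inter> {?i<..})" using v i by (auto simp: regular_path_def)
   hence "eventually (%x. dist (v x) (v ?i) < \<bar>v ?i\<bar>) (at ?i within Tm \<inter> {?i<..})"
    by (rule tendstoD) (use n in simp)
   then obtain d where d: "d > 0" "\<And>x. x \<in> Tm ==> ?i < x ==> dist x ?i < d ==> dist (v x) (v ?i) < \<bar>v ?i\<bar>"
    by (auto simp: eventually_at)
   obtain s where s: "s \<in> ?H" "s < ?i + d" using cInf_lessD[of ?H "?i + d"] H d(1) by auto
   hence "?i \<le> s" using bdd by (intro cInf_lower) auto
   moreover have "s \<noteq> ?i" using s(1) n by auto
   ultimately have "dist (v s) (v ?i) < \<bar>v ?i\<bar>" using s by (intro d(2)) (auto simp: dist_real_def)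
   thus False using s(1) by (auto simp: dist_real_def)
  qed
 qed
 thus "Inf ?H \<in> Tm" "v (Inf ?H) = 0" by auto
qed

lemma skip_free_paths_PiE: "\<omega> \<in> skip_free_paths S Tm ==> \<omega> \<in> Tm \<rightarrow>\<^sub>E S"
 unfolding skip_free_paths_def by blast

lemma skip_free_paths_subset: "skip_free_paths S Tm \<subseteq> Tm \<rightarrow>\<^sub>E UNIV"
proof
 fix \<omega> assume "\<omega> \<in> skip_free_paths S Tm"
 hence "\<omega> \<in> Tm \<rightarrow>\<^sub>E S" by (rule skip_free_paths_PiE)
 thus "\<omega> \<in> Tm \<rightarrow>\<^sub>E UNIV" by (rule subsetD[OF PiE_mono, rotated]) simp
qed

lemma space_path_space [simp]: "space (path_space S Tm) = skip_free_paths S Tm"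
 by (simp add: path_space_def space_restrict_space space_PiM Int_absorb2 skip_free_paths_subset)

lemma path_eval_measurable [measurable]: "(%\<omega>. \<omega> u) \<in> path_space S Tm \<rightarrow>\<^sub>M borel"
proof (cases "u \<in> Tm")
 case True
 thus ?thesis unfolding path_space_def by (intro measurable_restrict_space1) simp
next
 case False
 have "(%_. undefined) \<in> path_space S Tm \<rightarrow>\<^sub>M borel" by simp
 thus ?thesis
  by (subst measurable_cong[where g="%_. undefined"])
   (use False in \<open>auto simp: skip_free_paths_def PiE_iff extensional_def\<close>)
qed

lemma measurable_path_spaceI:
 assumes "f \<in> space N \<rightarrow> skip_free_paths S Tm" "\<And>u. u \<in> Tm ==> (%x. f x u) \<in> N \<rightarrow>\<^sub>M borel"
 shows "f \<in> N \<rightarrow>\<^sub>M path_space S Tm"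
 unfolding path_space_def
proof (rule measurable_restrict_space2[OF assms(1)], rule measurable_PiM_single')
 show "(%i. f i) \<in> space N \<rightarrow> Tm \<rightarrow>\<^sub>E space borel"
  using assms(1) skip_free_paths_subset[of S Tm] unfolding space_borel by blast
qed (use assms(2) in auto)

lemma space_history [simp]: "space (history S Tm t) = skip_free_paths S Tm"
 by (simp add: history_def)

lemma history_eval_measurable:
 assumes "u \<in> Tm" "u \<le> t" shows "(%\<omega>. \<omega> u) \<in> history S Tm t \<rightarrow>\<^sub>M borel"
proof -
 have "(%\<omega>. restrict \<omega> (Tm \<inter> {..t})) \<in> history S Tm t \<rightarrow>\<^sub>M PiM (Tm \<inter> {..t}) (%_. borel)"
  unfolding history_def by (rule measurable_vimage_algebra1) (auto simp: space_PiM)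
 hence "(%\<omega>. restrict \<omega> (Tm \<inter> {..t}) u) \<in> history S Tm t \<rightarrow>\<^sub>M borel"
  by (rule measurable_compose[OF _ measurable_component_singleton]) (use assms in auto)
 thus ?thesis using assms by simp
qed

lemma sets_history_subset:
 assumes "space N = skip_free_paths S Tm" "\<And>u. u \<in> Tm ==> u \<le> t ==> (%\<omega>. \<omega> u) \<in> N \<rightarrow>\<^sub>M borel"
 shows "sets (history S Tm t) \<subseteq> sets N"
proof -
 have "(%\<omega>. restrict \<omega> (Tm \<inter> {..t})) \<in> N \<rightarrow>\<^sub>M PiM (Tm \<inter> {..t}) (%_. borel)"
  by (rule measurable_restrict) (use assms in auto)
 thus ?thesis unfolding measurable_iff_sets history_def assms(1) by blast
qed

lemma sets_history_path: "sets (history S Tm t) \<subseteq> sets (path_space S Tm)"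
 by (rule sets_history_subset) auto

lemma filtration_history: "filtration (skip_free_paths S Tm) (history S Tm)"
proof
 show "sets (history S Tm s) \<le> sets (history S Tm t)" if "s \<le> t" for s t
  by (rule sets_history_subset) (use that in \<open>auto intro: history_eval_measurable\<close>)
qed simp

abbreviation past :: "real set => real set => ((real => real) => real) => (real => real) measure" where
 "past S Tm \<equiv> filtration.pre_sigma (skip_free_paths S Tm) (history S Tm)"

text \<open>
  Discretising the time from the right reduces evaluation at a variable time to evaluations at
  fixed times.
\<close>

lemma path_joint_eval_measurable:
 assumes adm: "admissible_setting S Tm"
 shows "(%(t, \<omega>). \<omega> t) \<in> restrict_space borel Tm \<Otimes>\<^sub>M path_space S Tm \<rightarrow>\<^sub>M borel" (is "_ \<in> ?N \<rightarrow>\<^sub>M _")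
proof (cases "Tm = \<nat>")
 case True
 have fl: "(%x. \<lfloor>fst x\<rfloor>) \<in> ?N \<rightarrow>\<^sub>M count_space UNIV"
 proof -
  have "(%t::real. \<lfloor>t\<rfloor>) \<in> restrict_space borel Tm \<rightarrow>\<^sub>M count_space UNIV"
   by (intro measurable_restrict_space1) measurable
  thus ?thesis by (rule measurable_compose[OF measurable_fst])
 qed
 have "(%x. snd x (of_int \<lfloor>fst x\<rfloor>)) \<in> ?N \<rightarrow>\<^sub>M borel"
  by (rule measurable_compose_countable'[OF _ fl, of "%i x. snd x (of_int i)"])
   (rule measurable_compose[OF measurable_snd path_eval_measurable], simp)
 moreover have "(case x of (t, \<omega>) => \<omega> t) = snd x (of_int \<lfloor>fst x\<rfloor>)" if "x \<in> space ?N" for x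
 proof -
  have "fst x \<in> \<nat>" using that by (simp add: space_pair_measure space_restrict_space True mem_Times_iff)
  hence "of_int \<lfloor>fst x\<rfloor> = fst x" by (rule Nats_cases) simp
  thus ?thesis by (simp only: case_prod_unfold)
 qed
 ultimately show ?thesis
  using measurable_cong[of ?N "%x. case x of (t, \<omega>) => \<omega> t" "%x. snd x (of_int \<lfloor>fst x\<rfloor>)" borel] by blast
next
 case False
 hence Tm: "Tm = {0..}" using admissible_time(6)[OF adm] by auto
 define c where "c n t = (of_int \<lfloor>t * real (Suc n)\<rfloor> + 1) / real (Suc n)" for n and t :: real
 have c1: "t < c n t" "c n t \<le> t + 1 / real (Suc n)" for n t
 proof -
  have l: "t * real (Suc n) < of_int \<lfloor>t * real (Suc n)\<rfloor> + 1" and u: "of_int \<lfloor>t * real (Suc n)\<rfloor> + 1 \<le> t * real (Suc n) + 1"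
   by linarith+
  show "t < c n t" using l unfolding c_def by (subst pos_less_divide_eq) auto
  have "c n t \<le> (t * real (Suc n) + 1) / real (Suc n)"
   using u unfolding c_def by (rule divide_right_mono) simp
  also have "... = t + 1 / real (Suc n)" by (simp add: add_divide_distrib del: of_nat_Suc)
  finally show "c n t \<le> t + 1 / real (Suc n)" .
 qed
 have m: "(%x. snd x (c n (fst x))) \<in> ?N \<rightarrow>\<^sub>M borel" for n
 proof -
  have fl: "(%x. \<lfloor>fst x * real (Suc n)\<rfloor>) \<in> ?N \<rightarrow>\<^sub>M count_space UNIV"
  proof -
   have "(%t::real. \<lfloor>t * real (Suc n)\<rfloor>) \<in> restrict_space borel Tm \<rightarrow>\<^sub>M count_space UNIV"
    by (intro measurable_restrict_space1) measurable
   thus ?thesis by (rule measurable_compose[OF measurable_fst])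
  qed
  show ?thesis unfolding c_def
   by (rule measurable_compose_countable'[OF _ fl, of "%i x. snd x ((of_int i + 1) / real (Suc n))"])
    (rule measurable_compose[OF measurable_snd path_eval_measurable], simp)
 qed
 have lim: "(%n. snd x (c n (fst x))) \<longlonglongrightarrow> snd x (fst x)" if xN: "x \<in> space ?N" for x
 proof -
  obtain t \<omega> where x: "x = (t, \<omega>)" "t \<in> Tm" "\<omega> \<in> skip_free_paths S Tm"
   using xN by (cases x) (simp add: space_pair_measure space_restrict_space)
  have 1: "(\<omega> \<longlongrightarrow> \<omega> t) (at t within Tm \<inter> {t<..})"
   using regular_path_skip_free[OF adm x(3)] x(2) by (auto simp: regular_path_def)
  have 2: "filterlim (%n. c n t) (at t within Tm \<inter> {t<..}) sequentially"
   unfolding filterlim_at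
  proof (intro conjI)
   have "c n t \<in> Tm \<inter> {t<..} \<and> c n t \<noteq> t" for n
    using c1(1)[of t n] x(2) unfolding Tm atLeast_iff greaterThan_iff Int_iff by linarith
   thus "eventually (%n. c n t \<in> Tm \<inter> {t<..} \<and> c n t \<noteq> t) sequentially"
    by (rule always_eventually[OF allI])
   have "(%n. t + 1 / real (Suc n)) \<longlonglongrightarrow> t + 0"
    by (intro tendsto_intros LIMSEQ_Suc[OF lim_1_over_n])
   hence "(%n. t + 1 / real (Suc n)) \<longlonglongrightarrow> t" by (simp only: add_0_right)
   thus "(%n. c n t) \<longlonglongrightarrow> t"
    by (rule tendsto_sandwich[OF always_eventually[OF allI] always_eventually[OF allI] tendsto_const, rotated 2])
     (rule less_imp_le[OF c1(1)], rule c1(2))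
  qed
  from filterlim_compose[OF 1 2] show ?thesis unfolding x(1) fst_conv snd_conv .
 qed
 have "(%x. snd x (fst x)) \<in> ?N \<rightarrow>\<^sub>M borel"
  by (rule borel_measurable_LIMSEQ_real[OF lim m])
 thus ?thesis by (simp add: case_prod_unfold)
qed

lemma measurable_path_at:
 assumes "admissible_setting S Tm" "f \<in> N \<rightarrow>\<^sub>M borel" "f \<in> space N \<rightarrow> Tm" "g \<in> N \<rightarrow>\<^sub>M path_space S Tm"
 shows "(%x. g x (f x)) \<in> N \<rightarrow>\<^sub>M borel"
proof -
 have "(%x. (f x, g x)) \<in> N \<rightarrow>\<^sub>M restrict_space borel Tm \<Otimes>\<^sub>M path_space S Tm"
  by (intro measurable_Pair measurable_restrict_space2 assms)
 from measurable_compose[OF this path_joint_eval_measurable[OF assms(1)]] show ?thesis by simp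
qed

lemma path_shift_in_paths:
 assumes adm: "admissible_setting S Tm" and r: "r \<in> Tm" and w: "\<omega> \<in> skip_free_paths S Tm"
 shows "path_shift Tm r \<omega> \<in> skip_free_paths S Tm"
proof -
 note T = admissible_time[OF adm]
 have E: "path_shift Tm r \<omega> \<in> Tm \<rightarrow>\<^sub>E S" using w r T(3) by (auto simp: path_shift_def skip_free_paths_def)
 consider "S = \<int>" "Tm = \<nat>" | "S = \<int>" "Tm = {0..}" | "S = UNIV" "Tm = {0..}"
  using adm by (auto simp: admissible_setting_def)
 thus ?thesis
 proof cases
  case 1
  hence "\<forall>t\<in>Tm. \<bar>\<omega> (t + 1) - \<omega> t\<bar> \<le> 1" using w Ints_neq_UNIV by (auto simp: skip_free_paths_def)
  hence "\<forall>t\<in>Tm. \<bar>path_shift Tm r \<omega> (t + 1) - path_shift Tm r \<omega> t\<bar> \<le> 1"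
   using r T(3,5) by (auto simp: path_shift_def simp flip: add.assoc)
  thus ?thesis using E 1 Ints_neq_UNIV by (auto simp: skip_free_paths_def)
 next
  case 2
  have a: "(\<omega> \<longlongrightarrow> \<omega> t) (at_right t)" if "t \<ge> 0" for t
   using w 2 that Ints_neq_UNIV Nats_neq_halfline by (auto simp: skip_free_paths_def)
  have b: "\<exists>l. (\<omega> \<longlongrightarrow> l) (at_left t) \<and> \<bar>\<omega> t - l\<bar> \<le> 1" if "t > 0" for t
   using w 2 that Ints_neq_UNIV Nats_neq_halfline by (auto simp: skip_free_paths_def)
  have r0: "0 \<le> r" using r 2 by auto
  have "(path_shift Tm r \<omega> \<longlongrightarrow> path_shift Tm r \<omega> t) (at_right t)" if t: "t \<ge> 0" for t
  proof -
   have "filterlim (%u. r + u) (at_right (r + t)) (at_right t)"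
    unfolding filterlim_at by (auto intro!: tendsto_eq_intros simp: eventually_at_topological) 
   from filterlim_compose[OF a this] have "((%u. \<omega> (r + u)) \<longlongrightarrow> \<omega> (r + t)) (at_right t)" using r0 t by auto
   moreover have "eventually (%u. path_shift Tm r \<omega> u = \<omega> (r + u)) (at_right t)"
    unfolding path_shift_def 2 eventually_at_right_field using t by (intro exI[of _ "t+1"]) auto
   ultimately show ?thesis using t by (subst filterlim_cong[OF refl refl]) (auto simp: path_shift_def 2)
  qed
  moreover have "\<exists>l. (path_shift Tm r \<omega> \<longlongrightarrow> l) (at_left t) \<and> \<bar>path_shift Tm r \<omega> t - l\<bar> \<le> 1" if t: "t > 0" for t
  proof -
   obtain l where l: "(\<omega> \<longlongrightarrow> l) (at_left (r + t))" "\<bar>\<omega> (r + t) - l\<bar> \<le> 1" using b[of "r + t"] r0 t by auto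
   have "filterlim (%u. r + u) (at_left (r + t)) (at_left t)"
    unfolding filterlim_at by (auto intro!: tendsto_eq_intros simp: eventually_at_topological)
   from filterlim_compose[OF l(1) this] have "((%u. \<omega> (r + u)) \<longlongrightarrow> l) (at_left t)" .
   moreover have "eventually (%u. path_shift Tm r \<omega> u = \<omega> (r + u)) (at_left t)"
    unfolding path_shift_def 2 eventually_at_left_field using t by (intro exI[of _ 0]) auto
   ultimately have "(path_shift Tm r \<omega> \<longlongrightarrow> l) (at_left t)" by (subst filterlim_cong[OF refl refl]) auto
   thus ?thesis using l(2) t by (auto simp: path_shift_def 2)
  qed
  ultimately show ?thesis using E 2 Ints_neq_UNIV Nats_neq_halfline by (auto simp: skip_free_paths_def)
 next
  case 3
  hence "continuous_on {0..} \<omega>" using w by (auto simp: skip_free_paths_def)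
  hence "continuous_on {0..} (%u. \<omega> (r + u))"
   by (rule continuous_on_compose2) (use r 3 in \<open>auto intro!: continuous_intros\<close>)
  hence "continuous_on Tm (path_shift Tm r \<omega>)"
   using 3 by (subst continuous_on_cong[OF refl, of _ _ "%u. \<omega> (r + u)"]) (auto simp: path_shift_def)
  thus ?thesis using E 3 by (auto simp: skip_free_paths_def)
 qed
qed

lemma measurable_path_shift:
 assumes adm: "admissible_setting S Tm" and f: "f \<in> N \<rightarrow>\<^sub>M borel" "f \<in> space N \<rightarrow> Tm" and g: "g \<in> N \<rightarrow>\<^sub>M path_space S Tm"
 shows "(%x. path_shift Tm (f x) (g x)) \<in> N \<rightarrow>\<^sub>M path_space S Tm"
proof (rule measurable_path_spaceI)
 have gs: "g x \<in> skip_free_paths S Tm" if "x \<in> space N" for x using measurable_space[OF g that] by simp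
 show "(%x. path_shift Tm (f x) (g x)) \<in> space N \<rightarrow> skip_free_paths S Tm"
  using gs f(2) path_shift_in_paths[OF adm] by auto
 fix u assume "u \<in> Tm"
 thus "(%x. path_shift Tm (f x) (g x) u) \<in> N \<rightarrow>\<^sub>M borel"
  using f admissible_time(3)[OF adm]
  by (auto simp: path_shift_def intro!: measurable_path_at[OF adm _ _ g])
qed

section \<open>Exchanging the futures of two particles that meet\<close>

context skip_free_process begin

lemma kernel_at:
 assumes "s \<in> Tm" "x \<in> S"
 shows "sets (K s x) = sets (path_space S Tm)" "prob_space (K s x)" "space (K s x) = skip_free_paths S Tm"
proof -
 have "(%(s, x). K s x) (s, x) \<in> space (prob_algebra (path_space S Tm))"
  by (rule measurable_space[OF kernel])
   (use assms admissible_time(7,8)[OF setting] in \<open>auto simp: space_pair_measure space_restrict_space\<close>)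
 thus 1: "sets (K s x) = sets (path_space S Tm)" "prob_space (K s x)"
  by (auto simp: space_prob_algebra)
 thus "space (K s x) = skip_free_paths S Tm" using sets_eq_imp_space_eq[OF 1(1)] by simp
qed

lemma measurable_kernel_cong: "s \<in> Tm ==> x \<in> S ==> (f \<in> K s x \<rightarrow>\<^sub>M N) = (f \<in> path_space S Tm \<rightarrow>\<^sub>M N)"
 by (rule arg_cong[where f="%A. f \<in> A"], rule measurable_cong_sets) (simp_all add: kernel_at)

lemma kernel_measurable:
 assumes "f \<in> N \<rightarrow>\<^sub>M borel" "g \<in> N \<rightarrow>\<^sub>M borel" "f \<in> space N \<rightarrow> Tm" "g \<in> space N \<rightarrow> S"
 shows "(%x. K (f x) (g x)) \<in> N \<rightarrow>\<^sub>M prob_algebra (path_space S Tm)"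
proof -
 have "(%x. (f x, g x)) \<in> N \<rightarrow>\<^sub>M restrict_space borel Tm \<Otimes>\<^sub>M restrict_space borel S"
  by (intro measurable_Pair measurable_restrict_space2 assms)
 from measurable_compose[OF this kernel] show ?thesis by simp
qed

definition remaining :: "real => real => real" where
 "remaining T u = (if u \<le> T then T - u else 0)"

definition trans_prob :: "real => real => real => real set => ennreal" where
 "trans_prob T u y C = emeasure (K u y) {\<omega> \<in> skip_free_paths S Tm. \<omega> (remaining T u) \<in> C}"

lemma remaining_in_time: "T \<in> Tm ==> u \<in> Tm ==> remaining T u \<in> Tm"
 using admissible_time(1,4)[OF setting] by (auto simp: remaining_def)

lemma remaining_measurable [measurable]: "remaining T \<in> borel \<rightarrow>\<^sub>M borel"
 unfolding remaining_def[abs_def] by measurable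

lemma trans_prob_measurable:
 assumes T: "T \<in> Tm" and C: "C \<in> sets borel"
  and f: "f \<in> N \<rightarrow>\<^sub>M borel" "f \<in> space N \<rightarrow> Tm" and g: "g \<in> N \<rightarrow>\<^sub>M borel" "g \<in> space N \<rightarrow> S"
 shows "(%x. trans_prob T (f x) (g x) C) \<in> N \<rightarrow>\<^sub>M borel"
proof -
 have "(%(x, \<omega>). \<omega> (remaining T (f x))) \<in> N \<Otimes>\<^sub>M path_space S Tm \<rightarrow>\<^sub>M borel"
  unfolding case_prod_unfold
 proof (rule measurable_path_at[OF setting, where f="%x. remaining T (f (fst x))" and g=snd])
  show "(%x. remaining T (f (fst x))) \<in> N \<Otimes>\<^sub>M path_space S Tm \<rightarrow>\<^sub>M borel"
   by (rule measurable_compose[OF measurable_fst measurable_compose[OF f(1) remaining_measurable]])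
  show "(%x. remaining T (f (fst x))) \<in> space (N \<Otimes>\<^sub>M path_space S Tm) \<rightarrow> Tm"
   by (intro funcsetI remaining_in_time[OF T] funcset_mem[OF f(2)]) (simp add: space_pair_measure mem_Times_iff)
 qed simp
 hence "(%x. distr (K (f x) (g x)) borel (%\<omega>. \<omega> (remaining T (f x)))) \<in> N \<rightarrow>\<^sub>M subprob_algebra borel"
  by (rule measurable_distr2) (intro measurable_prob_algebraD kernel_measurable f g)
 hence "(%x. emeasure (distr (K (f x) (g x)) borel (%\<omega>. \<omega> (remaining T (f x)))) C) \<in> N \<rightarrow>\<^sub>M borel"
  by (rule measurable_compose[OF _ measurable_emeasure_subprob_algebra[OF C]])
 moreover have "emeasure (distr (K (f x) (g x)) borel (%\<omega>. \<omega> (remaining T (f x)))) C = trans_prob T (f x) (g x) C"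
  if "x \<in> space N" for x
 proof -
  have fg: "f x \<in> Tm" "g x \<in> S" using f(2) g(2) that by auto
  have "(%\<omega>. \<omega> (remaining T (f x))) \<in> K (f x) (g x) \<rightarrow>\<^sub>M borel"
   unfolding measurable_kernel_cong[OF fg] by (rule path_eval_measurable)
  from emeasure_distr[OF this C] show ?thesis
   unfolding trans_prob_def kernel_at(3)[OF fg] by (simp add: vimage_def Int_def conj_commute)
 qed
 ultimately show ?thesis by (subst measurable_cong[symmetric]) auto
qed

lemma stopping_time_path_measurable:
 assumes "stopping_time (history S Tm) \<tau>"
 shows "\<tau> \<in> path_space S Tm \<rightarrow>\<^sub>M borel"
 using measurable_stopping_time[OF assms sets_history_path] by simp

lemma pre_sigma_subset:
 assumes "stopping_time (history S Tm) \<tau>" "\<tau> \<in> skip_free_paths S Tm \<rightarrow> Tm"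
 shows "sets (past S Tm \<tau>) \<subseteq> sets (path_space S Tm)"
proof
 interpret F: filtration "skip_free_paths S Tm" "history S Tm" by (rule filtration_history)
 fix A assume A: "A \<in> sets (F.pre_sigma \<tau>)"
 hence "{\<omega> \<in> A. \<tau> \<omega> \<le> real n} \<in> sets (path_space S Tm)" for n
  using F.sets_pre_sigmaD[OF assms(1) A] sets_history_path by blast
 hence "(\<Union>n. {\<omega> \<in> A. \<tau> \<omega> \<le> real n}) \<in> sets (path_space S Tm)" by blast
 also have "(\<Union>n. {\<omega> \<in> A. \<tau> \<omega> \<le> real n}) = A" using real_arch_simple by fastforce
 finally show "A \<in> sets (path_space S Tm)" .
qed

text \<open>
  The strong Markov property of the locale does not let the event of the future depend on the
  stopping time. It determines the joint law of that time and the future on rectangles, and these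
  generate.
\<close>

lemma strong_markov_joint:
 assumes x: "x \<in> S" and st: "stopping_time (history S Tm) \<tau>" and rng: "\<tau> \<in> skip_free_paths S Tm \<rightarrow> Tm"
  and A: "A \<in> sets (past S Tm \<tau>)"
  and E: "E \<in> sets (borel \<Otimes>\<^sub>M path_space S Tm)"
 shows "emeasure (K 0 x) {\<omega> \<in> A. (\<tau> \<omega>, path_shift Tm (\<tau> \<omega>) \<omega>) \<in> E} =
  (\<integral>\<^sup>+\<omega>. indicator A \<omega> * emeasure (K (\<tau> \<omega>) (\<omega> (\<tau> \<omega>))) {\<omega>' \<in> skip_free_paths S Tm. (\<tau> \<omega>, \<omega>') \<in> E} \<partial>K 0 x)"
proof -
 interpret F: filtration "skip_free_paths S Tm" "history S Tm" by (rule filtration_history)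
 let ?P = "path_space S Tm" and ?N = "borel \<Otimes>\<^sub>M path_space S Tm"
 have z: "0 \<in> Tm" by (rule admissible_time(1)[OF setting])
 note Kx = kernel_at[OF z x]
 interpret Kx: prob_space "K 0 x" by (rule Kx)
 have tm: "\<tau> \<in> ?P \<rightarrow>\<^sub>M borel" by (rule stopping_time_path_measurable[OF st])
 have AP: "A \<in> sets ?P" using A pre_sigma_subset[OF st rng] by auto
 have rng': "\<tau> \<in> space ?P \<rightarrow> Tm" using rng by simp
 have sh: "(%\<omega>. path_shift Tm (\<tau> \<omega>) \<omega>) \<in> ?P \<rightarrow>\<^sub>M ?P"
  by (rule measurable_path_shift[OF setting tm rng']) simp
 have pos: "(%\<omega>. \<omega> (\<tau> \<omega>)) \<in> ?P \<rightarrow>\<^sub>M borel"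
  by (rule measurable_path_at[OF setting tm rng']) simp
 have posS: "(%\<omega>. \<omega> (\<tau> \<omega>)) \<in> space ?P \<rightarrow> S"
  using rng skip_free_paths_PiE[of _ S Tm] by (auto simp: PiE_iff)
 have inT: "\<tau> \<omega> \<in> Tm" "\<omega> (\<tau> \<omega>) \<in> S" if "\<omega> \<in> skip_free_paths S Tm" for \<omega>
  using rng posS that by auto
 have kern: "(%\<omega>. K (\<tau> \<omega>) (\<omega> (\<tau> \<omega>))) \<in> ?P \<rightarrow>\<^sub>M prob_algebra ?P"
  by (rule kernel_measurable[OF tm pos rng' posS])
 \<comment> \<open>the joint law of the stopping time and a path that starts afresh from there\<close>
 define kn where "kn \<omega> = distr (K (\<tau> \<omega>) (\<omega> (\<tau> \<omega>))) ?N (%\<omega>'. (\<tau> \<omega>, \<omega>'))" for \<omega>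
 have kn: "kn \<in> ?P \<rightarrow>\<^sub>M subprob_algebra ?N"
  unfolding kn_def
 proof (rule measurable_distr2)
  have "(%x. (\<tau> (fst x), snd x)) \<in> ?P \<Otimes>\<^sub>M ?P \<rightarrow>\<^sub>M ?N"
   by (intro measurable_Pair measurable_compose[OF measurable_fst tm] measurable_snd)
  thus "(%(\<omega>, \<omega>'). (\<tau> \<omega>, \<omega>')) \<in> ?P \<Otimes>\<^sub>M ?P \<rightarrow>\<^sub>M ?N" by (simp add: case_prod_unfold)
 qed (rule measurable_prob_algebraD[OF kern])
 have knE: "emeasure (kn \<omega>) E = emeasure (K (\<tau> \<omega>) (\<omega> (\<tau> \<omega>))) {\<omega>' \<in> skip_free_paths S Tm. (\<tau> \<omega>, \<omega>') \<in> E}"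
  if "\<omega> \<in> skip_free_paths S Tm" "E \<in> sets ?N" for \<omega> E
 proof -
  have "(%\<omega>'. (\<tau> \<omega>, \<omega>')) \<in> K (\<tau> \<omega>) (\<omega> (\<tau> \<omega>)) \<rightarrow>\<^sub>M ?N"
   unfolding measurable_kernel_cong[OF inT[OF that(1)]] by simp
  from emeasure_distr[OF this that(2)] show ?thesis
   unfolding kn_def kernel_at(3)[OF inT[OF that(1)]] by (simp add: vimage_def Int_def conj_commute)
 qed
 define MA where "MA = density (K 0 x) (indicator A)"
 define \<mu>1 where "\<mu>1 = distr MA ?N (%\<omega>. (\<tau> \<omega>, path_shift Tm (\<tau> \<omega>) \<omega>))"
 define \<mu>2 where "\<mu>2 = MA \<bind> kn"
 have MAs: "sets MA = sets ?P" "space MA = skip_free_paths S Tm" unfolding MA_def using Kx by auto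
 have mMA: "(f \<in> MA \<rightarrow>\<^sub>M N) = (f \<in> ?P \<rightarrow>\<^sub>M N)" for f :: "(real => real) => 'x" and N
  by (rule arg_cong[where f="%A. f \<in> A"], rule measurable_cong_sets) (simp_all add: MAs)
 have pm: "(%\<omega>. (\<tau> \<omega>, path_shift Tm (\<tau> \<omega>) \<omega>)) \<in> ?P \<rightarrow>\<^sub>M ?N"
  by (intro measurable_Pair tm sh)
 have AK: "A \<in> sets (K 0 x)" using AP Kx by simp
 have mu1: "emeasure \<mu>1 E = emeasure (K 0 x) {\<omega> \<in> A. (\<tau> \<omega>, path_shift Tm (\<tau> \<omega>) \<omega>) \<in> E}" if E: "E \<in> sets ?N" for E
 proof -
  have s: "{\<omega> \<in> skip_free_paths S Tm. (\<tau> \<omega>, path_shift Tm (\<tau> \<omega>) \<omega>) \<in> E} \<in> sets ?P"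
   using measurable_sets[OF pm E] by (simp add: vimage_def Int_def conj_commute)
  have "emeasure \<mu>1 E = emeasure MA {\<omega> \<in> skip_free_paths S Tm. (\<tau> \<omega>, path_shift Tm (\<tau> \<omega>) \<omega>) \<in> E}"
   unfolding \<mu>1_def by (subst emeasure_distr) (use pm E mMA MAs in \<open>auto simp: vimage_def Int_def conj_commute\<close>)
  also have "... = emeasure (K 0 x) (A \<inter> {\<omega> \<in> skip_free_paths S Tm. (\<tau> \<omega>, path_shift Tm (\<tau> \<omega>) \<omega>) \<in> E})"
   unfolding MA_def by (rule emeasure_restricted[OF AK]) (use s Kx in simp)
  also have "A \<inter> {\<omega> \<in> skip_free_paths S Tm. (\<tau> \<omega>, path_shift Tm (\<tau> \<omega>) \<omega>) \<in> E} = {\<omega> \<in> A. (\<tau> \<omega>, path_shift Tm (\<tau> \<omega>) \<omega>) \<in> E}"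
   using sets.sets_into_space[OF AP] by auto
  finally show ?thesis .
 qed
 have knm: "(%\<omega>. emeasure (kn \<omega>) E) \<in> K 0 x \<rightarrow>\<^sub>M borel" if "E \<in> sets ?N" for E
  unfolding measurable_kernel_cong[OF z x]
  by (rule measurable_compose[OF kn measurable_emeasure_subprob_algebra[OF that]])
 have mu2: "emeasure \<mu>2 E = (\<integral>\<^sup>+\<omega>. indicator A \<omega> * emeasure (kn \<omega>) E \<partial>K 0 x)" if E: "E \<in> sets ?N" for E
 proof -
  have "emeasure \<mu>2 E = (\<integral>\<^sup>+\<omega>. emeasure (kn \<omega>) E \<partial>MA)"
   unfolding \<mu>2_def by (rule emeasure_bind) (use MAs Kx.not_empty Kx kn E mMA in auto)
  also have "... = (\<integral>\<^sup>+\<omega>. indicator A \<omega> * emeasure (kn \<omega>) E \<partial>K 0 x)"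
   unfolding MA_def by (rule nn_integral_density) (use AK knm[OF E] in auto)
  finally show ?thesis .
 qed
 have "\<mu>1 = \<mu>2"
 proof (rule measure_eqI_generator_eq[OF Int_stable_pair_measure_generator[of borel ?P]])
  let ?E = "{a \<times> b |a b. a \<in> sets borel \<and> b \<in> sets ?P} :: (real \<times> (real => real)) set set"
  show "?E \<subseteq> Pow (space ?N)"
   using sets.space_closed[of ?P] by (auto simp: space_pair_measure)
  show "sets \<mu>1 = sigma_sets (space ?N) ?E"
   by (simp add: \<mu>1_def sets_pair_measure space_pair_measure)
  have "sets \<mu>2 = sets ?N"
   unfolding \<mu>2_def
  proof (rule sets_bind)
   show "sets (kn \<omega>) = sets ?N" for \<omega> by (simp add: kn_def)
  qed (use MAs Kx.not_empty Kx in auto)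
  thus "sets \<mu>2 = sigma_sets (space ?N) ?E" by (simp add: sets_pair_measure space_pair_measure)
  have fin: "emeasure \<mu>1 E \<noteq> \<infinity>" if "E \<in> sets ?N" for E using mu1[OF that] by simp
  have "UNIV \<times> skip_free_paths S Tm \<in> ?E"
   using sets.top[of ?P] by (intro CollectI exI[of _ UNIV] exI[of _ "skip_free_paths S Tm"]) auto
  thus "range (%_::nat. space ?N) \<subseteq> ?E" by (auto simp: space_pair_measure)
  show "(\<Union>i::nat. space ?N) = space ?N" by simp
  show "emeasure \<mu>1 (space ?N) \<noteq> \<infinity>" by (rule fin) simp
  fix R assume "R \<in> ?E"
  then obtain U B where R: "R = U \<times> B" and U: "U \<in> sets borel" and B: "B \<in> sets ?P" by auto
  define A' where "A' = A \<inter> {\<omega> \<in> skip_free_paths S Tm. \<tau> \<omega> \<in> U}"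
  have "{\<omega> \<in> skip_free_paths S Tm. \<tau> \<omega> \<in> U} \<in> sets (F.pre_sigma \<tau>)"
   using measurable_sets[OF F.measurable_stopping_time_pre_sigma[OF st] U]
   by (simp add: F.space_pre_sigma vimage_def Int_def conj_commute)
  hence A': "A' \<in> sets (F.pre_sigma \<tau>)" unfolding A'_def using A by auto
  have A'P: "A' \<in> sets (K 0 x)" using A' pre_sigma_subset[OF st rng] Kx by auto
  have "emeasure \<mu>1 R = emeasure (K 0 x) {\<omega> \<in> A. (\<tau> \<omega>, path_shift Tm (\<tau> \<omega>) \<omega>) \<in> R}"
   by (rule mu1) (use U B R in auto)
  also have "{\<omega> \<in> A. (\<tau> \<omega>, path_shift Tm (\<tau> \<omega>) \<omega>) \<in> R} = {\<omega> \<in> A'. path_shift Tm (\<tau> \<omega>) \<omega> \<in> B}"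
   using sets.sets_into_space[OF AP] by (auto simp: R A'_def)
  also have "emeasure (K 0 x) ... = ennreal (measure (K 0 x) {\<omega> \<in> A'. path_shift Tm (\<tau> \<omega>) \<omega> \<in> B})"
   by (rule Kx.emeasure_eq_measure)
  also have "measure (K 0 x) {\<omega> \<in> A'. path_shift Tm (\<tau> \<omega>) \<omega> \<in> B} =
   (\<integral>\<omega>. indicator A' \<omega> * measure (K (0 + \<tau> \<omega>) (\<omega> (\<tau> \<omega>))) B \<partial>K 0 x)"
   by (rule strong_markov[OF z x st rng A' B])
  also have "ennreal ... = (\<integral>\<^sup>+\<omega>. ennreal (indicator A' \<omega> * measure (K (0 + \<tau> \<omega>) (\<omega> (\<tau> \<omega>))) B) \<partial>K 0 x)"
  proof (rule nn_integral_eq_integral[symmetric])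
   have "(%\<omega>. measure (K (0 + \<tau> \<omega>) (\<omega> (\<tau> \<omega>))) B) \<in> K 0 x \<rightarrow>\<^sub>M borel"
    unfolding measurable_kernel_cong[OF z x] add_0
    by (rule measurable_compose[OF kern measurable_measure_prob_algebra[OF B]])
   hence m: "(%\<omega>. indicator A' \<omega> * measure (K (0 + \<tau> \<omega>) (\<omega> (\<tau> \<omega>))) B) \<in> K 0 x \<rightarrow>\<^sub>M borel"
    using A'P by measurable
   show "integrable (K 0 x) (%\<omega>. indicator A' \<omega> * measure (K (0 + \<tau> \<omega>) (\<omega> (\<tau> \<omega>))) B)"
   proof (rule Kx.integrable_const_bound[where B=1, OF AE_I2 m])
    fix \<omega> assume "\<omega> \<in> space (K 0 x)"
    hence "\<omega> \<in> skip_free_paths S Tm" using Kx by simp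
    from prob_space.prob_le_1[OF kernel_at(2)[OF inT[OF this]], of B]
    show "norm (indicator A' \<omega> * measure (K (0 + \<tau> \<omega>) (\<omega> (\<tau> \<omega>))) B) \<le> 1"
     by (auto simp: indicator_def)
   qed
  qed (simp add: AE_I2)
  also have "... = (\<integral>\<^sup>+\<omega>. indicator A \<omega> * emeasure (kn \<omega>) R \<partial>K 0 x)"
  proof (rule nn_integral_cong)
   fix \<omega> assume "\<omega> \<in> space (K 0 x)"
   hence w: "\<omega> \<in> skip_free_paths S Tm" using Kx by simp
   interpret Kw: prob_space "K (\<tau> \<omega>) (\<omega> (\<tau> \<omega>))" by (rule kernel_at(2)[OF inT[OF w]])
   have RN: "R \<in> sets ?N" using U B R by auto
   have "{\<omega>' \<in> skip_free_paths S Tm. (\<tau> \<omega>, \<omega>') \<in> R} = (if \<tau> \<omega> \<in> U then B else {})"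
    using sets.sets_into_space[OF B] by (auto simp: R)
   thus "ennreal (indicator A' \<omega> * measure (K (0 + \<tau> \<omega>) (\<omega> (\<tau> \<omega>))) B) = indicator A \<omega> * emeasure (kn \<omega>) R"
    unfolding knE[OF w RN] using w by (auto simp: A'_def Kw.emeasure_eq_measure indicator_def)
  qed
  also have "... = emeasure \<mu>2 R" by (rule mu2[symmetric]) (use U B R in auto)
  finally show "emeasure \<mu>1 R = emeasure \<mu>2 R" .
 qed
 hence "emeasure \<mu>1 E = emeasure \<mu>2 E" by simp
 also have "emeasure \<mu>2 E = (\<integral>\<^sup>+\<omega>. indicator A \<omega> * emeasure (K (\<tau> \<omega>) (\<omega> (\<tau> \<omega>))) {\<omega>' \<in> skip_free_paths S Tm. (\<tau> \<omega>, \<omega>') \<in> E} \<partial>K 0 x)"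
  unfolding mu2[OF E] by (rule nn_integral_cong) (use Kx knE E in simp)
 finally show ?thesis unfolding mu1[OF E] .
qed

lemma strong_markov_at:
 assumes x: "x \<in> S" and st: "stopping_time (history S Tm) \<tau>" and rng: "\<tau> \<in> skip_free_paths S Tm \<rightarrow> Tm"
  and A: "A \<in> sets (past S Tm \<tau>)"
  and T: "T \<in> Tm" and C: "C \<in> sets borel" and le: "\<And>\<omega>. \<omega> \<in> A ==> \<tau> \<omega> \<le> T"
 shows "emeasure (K 0 x) {\<omega> \<in> A. \<omega> T \<in> C} = (\<integral>\<^sup>+\<omega>. indicator A \<omega> * trans_prob T (\<tau> \<omega>) (\<omega> (\<tau> \<omega>)) C \<partial>K 0 x)"
proof -
 let ?P = "path_space S Tm"
 define E where "E = {p \<in> Tm \<times> skip_free_paths S Tm. snd p (remaining T (fst p)) \<in> C}"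
 have TmB: "Tm \<in> sets borel" by (rule admissible_time(7)[OF setting])
 have "(%p. snd p (remaining T (fst p))) \<in> restrict_space borel Tm \<Otimes>\<^sub>M ?P \<rightarrow>\<^sub>M borel"
 proof (rule measurable_path_at[OF setting, where f="%p. remaining T (fst p)" and g=snd])
  show "(%p. remaining T (fst p)) \<in> restrict_space borel Tm \<Otimes>\<^sub>M ?P \<rightarrow>\<^sub>M borel"
   by (rule measurable_compose[OF measurable_fst measurable_restrict_space1[OF remaining_measurable]])
  show "(%p. remaining T (fst p)) \<in> space (restrict_space borel Tm \<Otimes>\<^sub>M ?P) \<rightarrow> Tm"
   using remaining_in_time[OF T] by (auto simp: space_pair_measure space_restrict_space)
 qed simp
 from measurable_sets[OF this C] have E1: "E \<in> sets (restrict_space borel Tm \<Otimes>\<^sub>M ?P)"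
  by (simp add: E_def space_pair_measure space_restrict_space vimage_def Int_def conj_commute)
 have "sets (restrict_space borel Tm \<Otimes>\<^sub>M ?P) \<subseteq> sets (borel \<Otimes>\<^sub>M ?P)"
  unfolding sets_pair_measure[of "restrict_space borel Tm"]
  by (rule sets.sigma_sets_subset')
   (use TmB sets.top[of ?P] in \<open>auto simp: sets_restrict_space space_restrict_space intro!: pair_measureI\<close>)
 hence E: "E \<in> sets (borel \<Otimes>\<^sub>M ?P)" using E1 by auto
 have sub: "A \<subseteq> skip_free_paths S Tm" using A pre_sigma_subset[OF st rng] sets.sets_into_space[of A ?P] by auto
 have eq: "(\<tau> \<omega>, path_shift Tm (\<tau> \<omega>) \<omega>) \<in> E \<longleftrightarrow> \<omega> T \<in> C" if "\<omega> \<in> A" for \<omega>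
 proof -
  have w: "\<omega> \<in> skip_free_paths S Tm" "\<tau> \<omega> \<in> Tm" "\<tau> \<omega> \<le> T" using that sub rng le by auto
  have "T - \<tau> \<omega> \<in> Tm" using admissible_time(4)[OF setting w(2) T w(3)] .
  thus ?thesis using path_shift_in_paths[OF setting w(2,1)] w by (simp add: E_def remaining_def path_shift_def)
 qed
 have "{\<omega> \<in> A. \<omega> T \<in> C} = {\<omega> \<in> A. (\<tau> \<omega>, path_shift Tm (\<tau> \<omega>) \<omega>) \<in> E}" using eq by auto
 hence "emeasure (K 0 x) {\<omega> \<in> A. \<omega> T \<in> C} = (\<integral>\<^sup>+\<omega>. indicator A \<omega> * emeasure (K (\<tau> \<omega>) (\<omega> (\<tau> \<omega>))) {\<omega>' \<in> skip_free_paths S Tm. (\<tau> \<omega>, \<omega>') \<in> E} \<partial>K 0 x)"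
  using strong_markov_joint[OF x st rng A E] by simp
 also have "... = (\<integral>\<^sup>+\<omega>. indicator A \<omega> * trans_prob T (\<tau> \<omega>) (\<omega> (\<tau> \<omega>)) C \<partial>K 0 x)"
 proof (rule nn_integral_cong)
  fix \<omega> assume "\<omega> \<in> space (K 0 x)"
  show "indicator A \<omega> * emeasure (K (\<tau> \<omega>) (\<omega> (\<tau> \<omega>))) {\<omega>' \<in> skip_free_paths S Tm. (\<tau> \<omega>, \<omega>') \<in> E} =
   indicator A \<omega> * trans_prob T (\<tau> \<omega>) (\<omega> (\<tau> \<omega>)) C"
  proof (cases "\<omega> \<in> A")
   case True
   hence "\<tau> \<omega> \<in> Tm" using sub rng by auto
   hence "{\<omega>' \<in> skip_free_paths S Tm. (\<tau> \<omega>, \<omega>') \<in> E} = {\<omega>' \<in> skip_free_paths S Tm. \<omega>' (remaining T (\<tau> \<omega>)) \<in> C}"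
    by (auto simp: E_def)
   thus ?thesis by (simp add: trans_prob_def)
  qed simp
 qed
 finally show ?thesis .
qed

text \<open>
  The past enters through a nonnegative weight instead of an event; this is needed because
  freezing the other particle leaves a function of the past.
\<close>

lemma strong_markov_weighted:
 assumes x: "x \<in> S" and st: "stopping_time (history S Tm) \<tau>" and rng: "\<tau> \<in> skip_free_paths S Tm \<rightarrow> Tm"
  and \<phi>: "\<phi> \<in> past S Tm \<tau> \<rightarrow>\<^sub>M (borel :: ennreal measure)"
  and T: "T \<in> Tm" and C: "C \<in> sets borel" and le: "\<And>\<omega>. \<omega> \<in> skip_free_paths S Tm ==> \<tau> \<omega> > T ==> \<phi> \<omega> = 0"
 shows "(\<integral>\<^sup>+\<omega>. \<phi> \<omega> * indicator C (\<omega> T) \<partial>K 0 x) = (\<integral>\<^sup>+\<omega>. \<phi> \<omega> * trans_prob T (\<tau> \<omega>) (\<omega> (\<tau> \<omega>)) C \<partial>K 0 x)"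
proof -
 interpret F: filtration "skip_free_paths S Tm" "history S Tm" by (rule filtration_history)
 have z: "0 \<in> Tm" by (rule admissible_time(1)[OF setting])
 note Kx = kernel_at[OF z x]
 let ?P = "path_space S Tm" and ?R = "F.pre_sigma \<tau>"
 have tm: "\<tau> \<in> ?P \<rightarrow>\<^sub>M borel" by (rule stopping_time_path_measurable[OF st])
 have rng': "\<tau> \<in> space ?P \<rightarrow> Tm" using rng by simp
 have trm: "(%\<omega>. trans_prob T (\<tau> \<omega>) (\<omega> (\<tau> \<omega>)) C) \<in> ?P \<rightarrow>\<^sub>M borel"
  by (rule trans_prob_measurable[OF T C tm rng' measurable_path_at[OF setting tm rng']])
   (use rng skip_free_paths_PiE[of _ S Tm] in \<open>auto simp: PiE_iff\<close>)
 define D where "D = {\<omega> \<in> skip_free_paths S Tm. \<tau> \<omega> \<le> T}"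
 have DR: "D \<in> sets ?R"
  using measurable_sets[OF F.measurable_stopping_time_pre_sigma[OF st], of "{..T}"]
  by (simp add: D_def F.space_pre_sigma vimage_def Int_def conj_commute)
 have RP: "sets ?R \<subseteq> sets ?P" by (rule pre_sigma_subset[OF st rng])
 have DP: "D \<in> sets (K 0 x)" using DR RP Kx by auto
 have idm: "(%\<omega>. \<omega>) \<in> K 0 x \<rightarrow>\<^sub>M ?R"
  unfolding measurable_kernel_cong[OF z x]
  by (rule measurableI) (use RP sets.sets_into_space[of _ ?R] F.space_pre_sigma in \<open>auto simp: Int_absorb2\<close>)
 define u where "u = (%\<omega>. indicator D \<omega> * indicator C (\<omega> T) :: ennreal)"
 define v where "v = (%\<omega>. indicator D \<omega> * trans_prob T (\<tau> \<omega>) (\<omega> (\<tau> \<omega>)) C)"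
 have ev: "(%\<omega>. \<omega> T) \<in> K 0 x \<rightarrow>\<^sub>M borel"
  unfolding measurable_kernel_cong[OF z x] by (rule path_eval_measurable)
 have um: "u \<in> K 0 x \<rightarrow>\<^sub>M borel"
  unfolding u_def using DP C ev
  by (intro borel_measurable_times_ennreal borel_measurable_indicator measurable_compose[OF _ borel_measurable_indicator]) auto
 have vm: "v \<in> K 0 x \<rightarrow>\<^sub>M borel"
  unfolding v_def using DP measurable_kernel_cong[OF z x] trm
  by (intro borel_measurable_times_ennreal borel_measurable_indicator) auto
 have "distr (density (K 0 x) u) ?R (%\<omega>. \<omega>) = distr (density (K 0 x) v) ?R (%\<omega>. \<omega>)"
 proof (rule measure_eqI)
  fix A assume "A \<in> sets (distr (density (K 0 x) u) ?R (%\<omega>. \<omega>))"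
  hence A: "A \<in> sets ?R" by simp
  have AP: "A \<in> sets (K 0 x)" using A RP Kx by auto
  have sub: "A \<subseteq> skip_free_paths S Tm" using sets.sets_into_space[OF A] F.space_pre_sigma by auto
  have e: "emeasure (distr (density (K 0 x) w) ?R (%\<omega>. \<omega>)) A = (\<integral>\<^sup>+\<omega>. w \<omega> * indicator A \<omega> \<partial>K 0 x)"
   if "w \<in> K 0 x \<rightarrow>\<^sub>M borel" for w
  proof -
   have "emeasure (distr (density (K 0 x) w) ?R (%\<omega>. \<omega>)) A = emeasure (density (K 0 x) w) A"
    using idm A sub Kx by (subst emeasure_distr) (auto simp: Int_absorb2)
   thus ?thesis using emeasure_density[OF that AP] by simp
  qed
  have "(\<integral>\<^sup>+\<omega>. u \<omega> * indicator A \<omega> \<partial>K 0 x) = (\<integral>\<^sup>+\<omega>. indicator {\<omega> \<in> A \<inter> D. \<omega> T \<in> C} \<omega> \<partial>K 0 x)"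
   by (rule nn_integral_cong) (auto simp: u_def indicator_def)
  also have "... = emeasure (K 0 x) {\<omega> \<in> A \<inter> D. \<omega> T \<in> C}"
  proof (rule nn_integral_indicator)
   have "(%\<omega>. \<omega> T) -` C \<inter> skip_free_paths S Tm \<in> sets (K 0 x)"
    using measurable_sets[OF path_eval_measurable C, of T S Tm] Kx by simp
   hence "A \<inter> D \<inter> ((%\<omega>. \<omega> T) -` C \<inter> skip_free_paths S Tm) \<in> sets (K 0 x)" using AP DP by auto
   also have "A \<inter> D \<inter> ((%\<omega>. \<omega> T) -` C \<inter> skip_free_paths S Tm) = {\<omega> \<in> A \<inter> D. \<omega> T \<in> C}" using sub by auto
   finally show "{\<omega> \<in> A \<inter> D. \<omega> T \<in> C} \<in> sets (K 0 x)" .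
  qed
  also have "... = (\<integral>\<^sup>+\<omega>. indicator (A \<inter> D) \<omega> * trans_prob T (\<tau> \<omega>) (\<omega> (\<tau> \<omega>)) C \<partial>K 0 x)"
   by (rule strong_markov_at[OF x st rng _ T C]) (use A DR in \<open>auto simp: D_def\<close>)
  also have "... = (\<integral>\<^sup>+\<omega>. v \<omega> * indicator A \<omega> \<partial>K 0 x)"
   by (rule nn_integral_cong) (auto simp: v_def indicator_def)
  finally show "emeasure (distr (density (K 0 x) u) ?R (%\<omega>. \<omega>)) A = emeasure (distr (density (K 0 x) v) ?R (%\<omega>. \<omega>)) A"
   unfolding e[OF um] e[OF vm] .
 qed simp
 hence "(\<integral>\<^sup>+\<omega>. \<phi> \<omega> \<partial>distr (density (K 0 x) u) ?R (%\<omega>. \<omega>)) = (\<integral>\<^sup>+\<omega>. \<phi> \<omega> \<partial>distr (density (K 0 x) v) ?R (%\<omega>. \<omega>))" by simp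
 moreover have "(\<integral>\<^sup>+\<omega>. \<phi> \<omega> \<partial>distr (density (K 0 x) w) ?R (%\<omega>. \<omega>)) = (\<integral>\<^sup>+\<omega>. w \<omega> * \<phi> \<omega> \<partial>K 0 x)"
  if "w \<in> K 0 x \<rightarrow>\<^sub>M borel" for w
  using idm \<phi> that by (subst nn_integral_distr) (auto intro!: nn_integral_density measurable_compose[OF idm])
 ultimately have "(\<integral>\<^sup>+\<omega>. u \<omega> * \<phi> \<omega> \<partial>K 0 x) = (\<integral>\<^sup>+\<omega>. v \<omega> * \<phi> \<omega> \<partial>K 0 x)" using um vm by simp
 moreover have "(\<integral>\<^sup>+\<omega>. u \<omega> * \<phi> \<omega> \<partial>K 0 x) = (\<integral>\<^sup>+\<omega>. \<phi> \<omega> * indicator C (\<omega> T) \<partial>K 0 x)"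
  by (rule nn_integral_cong) (use le Kx in \<open>auto simp: u_def D_def indicator_def not_le\<close>)
 moreover have "(\<integral>\<^sup>+\<omega>. v \<omega> * \<phi> \<omega> \<partial>K 0 x) = (\<integral>\<^sup>+\<omega>. \<phi> \<omega> * trans_prob T (\<tau> \<omega>) (\<omega> (\<tau> \<omega>)) C \<partial>K 0 x)"
  by (rule nn_integral_cong) (use le Kx in \<open>auto simp: v_def D_def indicator_def not_le mult.commute\<close>)
 ultimately show ?thesis by simp
qed

text \<open>
  At the meeting time both particles sit at the same place, so both have the same transition
  probability to the final time. Applying the strong Markov property to each coordinate in turn,
  with the other path frozen, shows that the final positions are conditionally independent with a
  common law.
\<close>

lemma swap_futures_nn:
 fixes \<tau> :: "(real => real) => (real => real) => real" and A :: "(real => real) => (real => real) => bool"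
 defines "\<Omega> \<equiv> skip_free_paths S Tm" and "P \<equiv> path_space S Tm"
 assumes xy: "x \<in> S" "y \<in> S" and T: "T \<in> Tm"
  and rng: "\<And>f g. f \<in> \<Omega> ==> g \<in> \<Omega> ==> \<tau> f g \<in> Tm"
  and st1: "\<And>g. g \<in> \<Omega> ==> stopping_time (history S Tm) (%f. \<tau> f g)"
  and st2: "\<And>f. f \<in> \<Omega> ==> stopping_time (history S Tm) (%g. \<tau> f g)"
  and A1: "\<And>g. g \<in> \<Omega> ==> {f \<in> \<Omega>. A f g} \<in> sets (filtration.pre_sigma \<Omega> (history S Tm) (%f. \<tau> f g))"
  and A2: "\<And>f. f \<in> \<Omega> ==> {g \<in> \<Omega>. A f g} \<in> sets (filtration.pre_sigma \<Omega> (history S Tm) (%g. \<tau> f g))"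
  and \<tau>m: "(%(f, g). \<tau> f g) \<in> P \<Otimes>\<^sub>M P \<rightarrow>\<^sub>M borel" and Am: "Measurable.pred (P \<Otimes>\<^sub>M P) (%(f, g). A f g)"
  and meet: "\<And>f g. f \<in> \<Omega> ==> g \<in> \<Omega> ==> A f g ==> \<tau> f g \<le> T \<and> f (\<tau> f g) = g (\<tau> f g)"
  and CD: "C \<in> sets borel" "D \<in> sets borel"
 shows "(\<integral>\<^sup>+f. \<integral>\<^sup>+g. of_bool (A f g) * indicator C (f T) * indicator D (g T) \<partial>K 0 y \<partial>K 0 x) =
  (\<integral>\<^sup>+f. \<integral>\<^sup>+g. of_bool (A f g) * indicator D (f T) * indicator C (g T) \<partial>K 0 y \<partial>K 0 x)"
proof -
 interpret F: filtration \<Omega> "history S Tm" unfolding \<Omega>_def by (rule filtration_history)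
 have z: "0 \<in> Tm" by (rule admissible_time(1)[OF setting])
 note Kx = kernel_at[OF z xy(1)] and Ky = kernel_at[OF z xy(2)]
 interpret Kx: prob_space "K 0 x" by (rule Kx)
 interpret Ky: prob_space "K 0 y" by (rule Ky)
 interpret XY: pair_prob_space "K 0 x" "K 0 y" ..
 have sp: "space (K 0 x) = \<Omega>" "space (K 0 y) = \<Omega>" "space P = \<Omega>" using Kx Ky by (auto simp: \<Omega>_def P_def)
 have setsXY: "sets (K 0 x \<Otimes>\<^sub>M K 0 y) = sets (P \<Otimes>\<^sub>M P)"
  by (rule sets_pair_measure_cong) (simp_all add: Kx Ky P_def)
 have mXY: "(h \<in> K 0 x \<Otimes>\<^sub>M K 0 y \<rightarrow>\<^sub>M N) = (h \<in> P \<Otimes>\<^sub>M P \<rightarrow>\<^sub>M N)" for h :: "_ => 'x" and N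
  by (rule arg_cong[where f="%A. h \<in> A"], rule measurable_cong_sets) (simp_all add: setsXY)
 have \<tau>m': "(%p. \<tau> (fst p) (snd p)) \<in> P \<Otimes>\<^sub>M P \<rightarrow>\<^sub>M borel" using \<tau>m by (simp add: case_prod_unfold)
 have \<tau>r: "(%p. \<tau> (fst p) (snd p)) \<in> space (P \<Otimes>\<^sub>M P) \<rightarrow> Tm"
  by (intro funcsetI rng) (simp_all add: space_pair_measure sp mem_Times_iff)
 have valS: "f u \<in> S" if "f \<in> \<Omega>" "u \<in> Tm" for f u
  using skip_free_paths_PiE[of f S Tm] that unfolding \<Omega>_def by (auto simp: PiE_iff)
 have Aind: "(%p. of_bool (A (fst p) (snd p)) :: ennreal) \<in> P \<Otimes>\<^sub>M P \<rightarrow>\<^sub>M borel"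
 proof -
  have "{p \<in> space (P \<Otimes>\<^sub>M P). A (fst p) (snd p)} \<in> sets (P \<Otimes>\<^sub>M P)"
   using Am by (simp add: pred_def case_prod_unfold)
  from borel_measurable_indicator[OF this] show ?thesis
   by (rule measurable_cong[THEN iffD1, rotated]) (simp add: indicator_def)
 qed
 have evf: "(%p. indicator C (fst p T) :: ennreal) \<in> P \<Otimes>\<^sub>M P \<rightarrow>\<^sub>M borel" if "C \<in> sets borel" for C
  unfolding P_def by (rule measurable_compose[OF measurable_fst measurable_compose[OF path_eval_measurable borel_measurable_indicator[OF that]]])
 have evg: "(%p. indicator C (snd p T) :: ennreal) \<in> P \<Otimes>\<^sub>M P \<rightarrow>\<^sub>M borel" if "C \<in> sets borel" for C
  unfolding P_def by (rule measurable_compose[OF measurable_snd measurable_compose[OF path_eval_measurable borel_measurable_indicator[OF that]]])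
 have trg: "(%p. trans_prob T (\<tau> (fst p) (snd p)) (snd p (\<tau> (fst p) (snd p))) C) \<in> P \<Otimes>\<^sub>M P \<rightarrow>\<^sub>M borel" if "C \<in> sets borel" for C
 proof (rule trans_prob_measurable[OF T that \<tau>m' \<tau>r])
  show "(%p. snd p (\<tau> (fst p) (snd p))) \<in> P \<Otimes>\<^sub>M P \<rightarrow>\<^sub>M borel"
   by (rule measurable_path_at[OF setting \<tau>m' \<tau>r]) (simp add: P_def)
  show "(%p. snd p (\<tau> (fst p) (snd p))) \<in> space (P \<Otimes>\<^sub>M P) \<rightarrow> S"
   by (intro funcsetI valS funcset_mem[OF \<tau>r]) (simp_all add: space_pair_measure sp mem_Times_iff)
 qed
 have main: "(\<integral>\<^sup>+f. \<integral>\<^sup>+g. of_bool (A f g) * indicator C (f T) * indicator D (g T) \<partial>K 0 y \<partial>K 0 x) =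
   (\<integral>\<^sup>+g. \<integral>\<^sup>+f. of_bool (A f g) * trans_prob T (\<tau> f g) (f (\<tau> f g)) C * trans_prob T (\<tau> f g) (f (\<tau> f g)) D \<partial>K 0 x \<partial>K 0 y)"
  if CD: "C \<in> sets borel" "D \<in> sets borel" for C D
 proof -
  have "(\<integral>\<^sup>+f. \<integral>\<^sup>+g. of_bool (A f g) * indicator C (f T) * indicator D (g T) \<partial>K 0 y \<partial>K 0 x) =
    (\<integral>\<^sup>+f. \<integral>\<^sup>+g. of_bool (A f g) * indicator C (f T) * trans_prob T (\<tau> f g) (g (\<tau> f g)) D \<partial>K 0 y \<partial>K 0 x)"
  proof (rule nn_integral_cong, unfold sp)
   fix f assume f: "f \<in> \<Omega>"
   show "(\<integral>\<^sup>+g. of_bool (A f g) * indicator C (f T) * indicator D (g T) \<partial>K 0 y) =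
    (\<integral>\<^sup>+g. of_bool (A f g) * indicator C (f T) * trans_prob T (\<tau> f g) (g (\<tau> f g)) D \<partial>K 0 y)"
   proof (rule strong_markov_weighted[OF xy(2) st2[OF f] _ _ T CD(2)], fold \<Omega>_def)
    show "\<tau> f \<in> \<Omega> \<rightarrow> Tm" using rng[OF f] by auto
    have "(%g. indicator {g \<in> \<Omega>. A f g} g * indicator C (f T) :: ennreal) \<in> F.pre_sigma (\<tau> f) \<rightarrow>\<^sub>M borel"
     using A2[OF f] by measurable
    thus "(%g. of_bool (A f g) * indicator C (f T) :: ennreal) \<in> F.pre_sigma (\<tau> f) \<rightarrow>\<^sub>M borel"
     by (rule measurable_cong[THEN iffD1, rotated]) (simp add: indicator_def F.space_pre_sigma)
    show "of_bool (A f g) * indicator C (f T) = (0::ennreal)" if "g \<in> \<Omega>" "T < \<tau> f g" for g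
     using meet[OF f that(1)] that(2) by (auto simp: not_le[symmetric])
   qed
  qed
  also have "... = (\<integral>\<^sup>+g. \<integral>\<^sup>+f. of_bool (A f g) * indicator C (f T) * trans_prob T (\<tau> f g) (g (\<tau> f g)) D \<partial>K 0 x \<partial>K 0 y)"
  proof (rule XY.Fubini'[symmetric])
   show "(%(f, g). of_bool (A f g) * indicator C (f T) * trans_prob T (\<tau> f g) (g (\<tau> f g)) D) \<in> borel_measurable (K 0 x \<Otimes>\<^sub>M K 0 y)"
    unfolding mXY case_prod_unfold
    by (intro borel_measurable_times_ennreal Aind evf trg CD)
  qed
  also have "... = (\<integral>\<^sup>+g. \<integral>\<^sup>+f. of_bool (A f g) * trans_prob T (\<tau> f g) (f (\<tau> f g)) C * trans_prob T (\<tau> f g) (f (\<tau> f g)) D \<partial>K 0 x \<partial>K 0 y)"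
  proof (rule nn_integral_cong, unfold sp)
   fix g assume g: "g \<in> \<Omega>"
   let ?\<phi> = "%f. of_bool (A f g) * trans_prob T (\<tau> f g) (g (\<tau> f g)) D"
   have "(\<integral>\<^sup>+f. ?\<phi> f * indicator C (f T) \<partial>K 0 x) = (\<integral>\<^sup>+f. ?\<phi> f * trans_prob T (\<tau> f g) (f (\<tau> f g)) C \<partial>K 0 x)"
   proof (rule strong_markov_weighted[OF xy(1) st1[OF g] _ _ T CD(1)], fold \<Omega>_def)
    show r: "(%f. \<tau> f g) \<in> \<Omega> \<rightarrow> Tm" using rng g by auto
    have tp: "(%f. \<tau> f g) \<in> F.pre_sigma (%f. \<tau> f g) \<rightarrow>\<^sub>M borel"
     by (rule F.measurable_stopping_time_pre_sigma[OF st1[OF g]])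
    have r': "(%f. \<tau> f g) \<in> space (F.pre_sigma (%f. \<tau> f g)) \<rightarrow> Tm" using r by (simp add: F.space_pre_sigma)
    have gt: "(%f. g (\<tau> f g)) \<in> F.pre_sigma (%f. \<tau> f g) \<rightarrow>\<^sub>M borel"
     by (rule measurable_path_at[OF setting tp r', of "%_. g"]) (use g in \<open>simp add: \<Omega>_def\<close>)
    have "(%f. trans_prob T (\<tau> f g) (g (\<tau> f g)) D) \<in> F.pre_sigma (%f. \<tau> f g) \<rightarrow>\<^sub>M borel"
     by (rule trans_prob_measurable[OF T CD(2) tp r' gt]) (use valS[OF g] r' in auto)
    hence "(%f. indicator {f \<in> \<Omega>. A f g} f * trans_prob T (\<tau> f g) (g (\<tau> f g)) D) \<in> F.pre_sigma (%f. \<tau> f g) \<rightarrow>\<^sub>M borel"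
     by (intro borel_measurable_times_ennreal borel_measurable_indicator A1[OF g])
    thus "?\<phi> \<in> F.pre_sigma (%f. \<tau> f g) \<rightarrow>\<^sub>M borel"
     by (rule measurable_cong[THEN iffD1, rotated]) (simp add: indicator_def F.space_pre_sigma)
    show "?\<phi> f = (0::ennreal)" if "f \<in> \<Omega>" "T < \<tau> f g" for f
     using meet[OF that(1) g] that(2) by (auto simp: not_le[symmetric])
   qed
   also have "(\<integral>\<^sup>+f. ?\<phi> f * trans_prob T (\<tau> f g) (f (\<tau> f g)) C \<partial>K 0 x) =
    (\<integral>\<^sup>+f. of_bool (A f g) * trans_prob T (\<tau> f g) (f (\<tau> f g)) C * trans_prob T (\<tau> f g) (f (\<tau> f g)) D \<partial>K 0 x)"
   proof (rule nn_integral_cong, unfold sp)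
    fix f assume f: "f \<in> \<Omega>"
    show "?\<phi> f * trans_prob T (\<tau> f g) (f (\<tau> f g)) C =
     of_bool (A f g) * trans_prob T (\<tau> f g) (f (\<tau> f g)) C * trans_prob T (\<tau> f g) (f (\<tau> f g)) D"
     using meet[OF f g] by (cases "A f g") (simp_all add: mult.commute)
   qed
   finally show "(\<integral>\<^sup>+f. of_bool (A f g) * indicator C (f T) * trans_prob T (\<tau> f g) (g (\<tau> f g)) D \<partial>K 0 x) =
    (\<integral>\<^sup>+f. of_bool (A f g) * trans_prob T (\<tau> f g) (f (\<tau> f g)) C * trans_prob T (\<tau> f g) (f (\<tau> f g)) D \<partial>K 0 x)"
    by (simp add: mult_ac)
  qed
  finally show ?thesis .
 qed
 show ?thesis unfolding main[OF CD] main[OF CD(2,1)] by (simp add: mult_ac)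
qed

text \<open>
  The final positions are exchangeable on the meeting event, hence an antisymmetric function of
  them integrates to zero.
\<close>

lemma swap_futures:
 fixes \<tau> :: "(real => real) => (real => real) => real" and A :: "(real => real) => (real => real) => bool"
  and G :: "real \<times> real => real"
 defines "\<Omega> \<equiv> skip_free_paths S Tm" and "P \<equiv> path_space S Tm"
 assumes xy: "x \<in> S" "y \<in> S" and T: "T \<in> Tm"
  and rng: "\<And>f g. f \<in> \<Omega> ==> g \<in> \<Omega> ==> \<tau> f g \<in> Tm"
  and st1: "\<And>g. g \<in> \<Omega> ==> stopping_time (history S Tm) (%f. \<tau> f g)"
  and st2: "\<And>f. f \<in> \<Omega> ==> stopping_time (history S Tm) (%g. \<tau> f g)"
  and A1: "\<And>g. g \<in> \<Omega> ==> {f \<in> \<Omega>. A f g} \<in> sets (filtration.pre_sigma \<Omega> (history S Tm) (%f. \<tau> f g))"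
  and A2: "\<And>f. f \<in> \<Omega> ==> {g \<in> \<Omega>. A f g} \<in> sets (filtration.pre_sigma \<Omega> (history S Tm) (%g. \<tau> f g))"
  and \<tau>m: "(%(f, g). \<tau> f g) \<in> P \<Otimes>\<^sub>M P \<rightarrow>\<^sub>M borel" and Am: "Measurable.pred (P \<Otimes>\<^sub>M P) (%(f, g). A f g)"
  and meet: "\<And>f g. f \<in> \<Omega> ==> g \<in> \<Omega> ==> A f g ==> \<tau> f g \<le> T \<and> f (\<tau> f g) = g (\<tau> f g)"
  and G: "G \<in> borel_measurable (borel \<Otimes>\<^sub>M borel)" and anti: "\<And>u v. G (v, u) = - G (u, v)"
 shows "(\<integral>p. of_bool (A (fst p) (snd p)) * G (fst p T, snd p T) \<partial>(K 0 x \<Otimes>\<^sub>M K 0 y)) = 0"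
proof -
 have z: "0 \<in> Tm" by (rule admissible_time(1)[OF setting])
 note Kx = kernel_at[OF z xy(1)] and Ky = kernel_at[OF z xy(2)]
 interpret Kx: prob_space "K 0 x" by (rule Kx)
 interpret Ky: prob_space "K 0 y" by (rule Ky)
 interpret XY: pair_prob_space "K 0 x" "K 0 y" ..
 let ?Q = "K 0 x \<Otimes>\<^sub>M K 0 y" and ?B = "borel \<Otimes>\<^sub>M borel :: (real \<times> real) measure"
 have setsXY: "sets ?Q = sets (P \<Otimes>\<^sub>M P)"
  by (rule sets_pair_measure_cong) (simp_all add: Kx Ky P_def)
 have mXY: "(h \<in> ?Q \<rightarrow>\<^sub>M N) = (h \<in> P \<Otimes>\<^sub>M P \<rightarrow>\<^sub>M N)" for h :: "_ => 'x" and N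
  by (rule arg_cong[where f="%A. h \<in> A"], rule measurable_cong_sets) (simp_all add: setsXY)
 define a where "a p = (of_bool (A (fst p) (snd p)) :: real)" for p
 have a0: "0 \<le> a p" "ennreal (a p) = of_bool (A (fst p) (snd p))" for p
  by (simp_all add: a_def)
 have am: "a \<in> borel_measurable ?Q"
 proof -
  have "{p \<in> space (P \<Otimes>\<^sub>M P). A (fst p) (snd p)} \<in> sets (P \<Otimes>\<^sub>M P)"
   using Am by (simp add: pred_def case_prod_unfold)
  from borel_measurable_indicator[OF this] show ?thesis unfolding mXY a_def
   by (rule measurable_cong[THEN iffD1, rotated]) (simp add: indicator_def)
 qed
 have e1: "(%p. fst p T) \<in> ?Q \<rightarrow>\<^sub>M borel" "(%p. snd p T) \<in> ?Q \<rightarrow>\<^sub>M borel"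
  unfolding mXY P_def
  by (rule measurable_compose[OF measurable_fst path_eval_measurable], rule measurable_compose[OF measurable_snd path_eval_measurable])
 have e2: "(%p. (fst p T, snd p T)) \<in> ?Q \<rightarrow>\<^sub>M ?B" "(%p. (snd p T, fst p T)) \<in> ?Q \<rightarrow>\<^sub>M ?B"
  by (rule measurable_Pair[OF e1(1,2)], rule measurable_Pair[OF e1(2,1)])
 define QA where "QA = density ?Q (%p. ennreal (a p))"
 have e3: "(%p. (fst p T, snd p T)) \<in> QA \<rightarrow>\<^sub>M ?B" "(%p. (snd p T, fst p T)) \<in> QA \<rightarrow>\<^sub>M ?B"
  using e2 by (auto simp: QA_def)
 have R: "emeasure (distr QA ?B h) (C \<times> D) = (\<integral>\<^sup>+p. ennreal (a p) * indicator (C \<times> D) (h p) \<partial>?Q)"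
  if "C \<in> sets borel" "D \<in> sets borel" "h \<in> ?Q \<rightarrow>\<^sub>M ?B" for C D h
 proof -
  have CD: "C \<times> D \<in> sets ?B" using that by auto
  have hm: "h -` (C \<times> D) \<inter> space ?Q \<in> sets ?Q" by (rule measurable_sets[OF that(3) CD])
  have "emeasure (distr QA ?B h) (C \<times> D) = emeasure QA (h -` (C \<times> D) \<inter> space ?Q)"
   using that(3) CD by (subst emeasure_distr) (auto simp: QA_def)
  also have "... = (\<integral>\<^sup>+p. ennreal (a p) * indicator (h -` (C \<times> D) \<inter> space ?Q) p \<partial>?Q)"
   unfolding QA_def using am hm by (intro emeasure_density) auto
  also have "... = (\<integral>\<^sup>+p. ennreal (a p) * indicator (C \<times> D) (h p) \<partial>?Q)"
   by (rule nn_integral_cong) (auto simp: indicator_def)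
  finally show ?thesis .
 qed
 have it: "(\<integral>\<^sup>+p. ennreal (a p) * indicator C (fst p T) * indicator D (snd p T) \<partial>?Q) =
   (\<integral>\<^sup>+f. \<integral>\<^sup>+g. of_bool (A f g) * indicator C (f T) * indicator D (g T) \<partial>K 0 y \<partial>K 0 x)"
  if "C \<in> sets borel" "D \<in> sets borel" for C D
 proof -
  have "(%p. ennreal (a p) * indicator C (fst p T) * indicator D (snd p T)) \<in> borel_measurable ?Q"
   using am that e1 by measurable
  from Ky.nn_integral_fst[OF this] show ?thesis by (simp add: a0)
 qed
 have eq: "distr QA ?B (%p. (fst p T, snd p T)) = distr QA ?B (%p. (snd p T, fst p T))"
 proof (rule measure_eqI_generator_eq[OF Int_stable_pair_measure_generator[of borel borel], where A="%_. UNIV" and \<Omega>=UNIV])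
  let ?E = "{c \<times> d |c d. c \<in> sets borel \<and> d \<in> sets borel} :: (real \<times> real) set set"
  fix R assume "R \<in> ?E"
  then obtain C D where CD: "R = C \<times> D" "C \<in> sets borel" "D \<in> sets borel" by auto
  have "emeasure (distr QA ?B (%p. (fst p T, snd p T))) R = (\<integral>\<^sup>+p. ennreal (a p) * indicator C (fst p T) * indicator D (snd p T) \<partial>?Q)"
   unfolding CD(1) R[OF CD(2,3) e2(1)] by (rule nn_integral_cong) (simp add: indicator_def)
  also have "... = (\<integral>\<^sup>+p. ennreal (a p) * indicator D (fst p T) * indicator C (snd p T) \<partial>?Q)"
   unfolding it[OF CD(2,3)] it[OF CD(3,2)]
   by (rule swap_futures_nn[OF xy T rng[unfolded \<Omega>_def] st1[unfolded \<Omega>_def] st2[unfolded \<Omega>_def] A1[unfolded \<Omega>_def] A2[unfolded \<Omega>_def] \<tau>m[unfolded P_def] Am[unfolded P_def] meet[unfolded \<Omega>_def] CD(2,3)])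
  also have "... = emeasure (distr QA ?B (%p. (snd p T, fst p T))) R"
   unfolding CD(1) R[OF CD(2,3) e2(2)] by (rule nn_integral_cong) (auto split: split_indicator)
  finally show "emeasure (distr QA ?B (%p. (fst p T, snd p T))) R = emeasure (distr QA ?B (%p. (snd p T, fst p T))) R" .
 next
  have "emeasure QA (space QA) \<le> emeasure ?Q (space ?Q)"
  proof -
   have "emeasure QA (space QA) = (\<integral>\<^sup>+p. ennreal (a p) * indicator (space ?Q) p \<partial>?Q)"
    unfolding QA_def using am by (subst emeasure_density) auto
   also have "... \<le> (\<integral>\<^sup>+p. 1 \<partial>?Q)" by (rule nn_integral_mono) (auto simp: a_def indicator_def)
   finally show ?thesis by simp
  qed
  also have "... < \<infinity>" using XY.emeasure_space_1 by simp
  finally show "emeasure (distr QA ?B (%p. (fst p T, snd p T))) UNIV \<noteq> \<infinity>" for i :: nat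
   using emeasure_distr[OF e3(1), of UNIV] sets.top[of ?B] by (simp add: space_pair_measure)
 qed (auto simp: sets_pair_measure intro!: exI[of _ UNIV])
 have I: "(\<integral>p. a p * G (h p) \<partial>?Q) = (\<integral>q. G q \<partial>distr QA ?B h)" if "h \<in> ?Q \<rightarrow>\<^sub>M ?B" for h
 proof -
  have "(\<integral>q. G q \<partial>distr QA ?B h) = (\<integral>p. G (h p) \<partial>QA)"
   using that G by (intro integral_distr) (auto simp: QA_def)
  also have "... = (\<integral>p. a p *\<^sub>R G (h p) \<partial>?Q)"
   unfolding QA_def using that G am
   by (intro integral_density measurable_compose[OF that G]) (auto simp: a0)
  finally show ?thesis by simp
 qed
 have "(\<integral>p. a p * G (fst p T, snd p T) \<partial>?Q) = (\<integral>p. a p * G (snd p T, fst p T) \<partial>?Q)"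
  unfolding I[OF e2(1)] I[OF e2(2)] eq ..
 also have "... = - (\<integral>p. a p * G (fst p T, snd p T) \<partial>?Q)"
  by (subst anti) simp
 finally show ?thesis unfolding a_def by simp
qed

end

section \<open>Merging neighbours\<close>

text \<open>
  Every particle follows its left neighbour from the first meeting on. This agrees with
  \<^const>\<open>coalesce\<close> for paths that do not swap, but it only involves meetings of
  neighbours, for which the exchange of futures is easy to state.
\<close>

primrec merging :: "real set => (nat => real => real) => nat => real => real" where
 "merging Tm X 0 = X 0"
| "merging Tm X (Suc n) = (%t. if \<exists>s\<in>Tm. s \<le> t \<and> X (Suc n) s = merging Tm X n s then merging Tm X n t else X (Suc n) t)"

definition merged :: "real set => (nat => real => real) => nat => real => bool" where
 "merged Tm X n t \<longleftrightarrow> 0 < n \<and> (\<exists>s\<in>Tm. s \<le> t \<and> X n s = merging Tm X (n - 1) s)"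

lemma merging_rec: "merging Tm X n t = (if merged Tm X n t then merging Tm X (n - 1) t else X n t)"
 by (cases n) (auto simp: merged_def)

lemma merged_mono: "merged Tm X n s ==> s \<le> t ==> merged Tm X n t"
 unfolding merged_def using order_trans by blast

definition nice_path :: "real set => real set => (real => real) => bool" where
 "nice_path S Tm f \<longleftrightarrow> regular_path Tm f \<and> (if S = UNIV then Tm = {0..} \<and> continuous_on Tm f else f ` Tm \<subseteq> \<int>)"

lemma nice_path_skip_free:
 assumes "admissible_setting S Tm" "f \<in> skip_free_paths S Tm" shows "nice_path S Tm f"
proof -
 have "S = UNIV ==> Tm = {0..} \<and> continuous_on Tm f" "S \<noteq> UNIV ==> S = \<int>"
  using assms Ints_neq_UNIV by (auto simp: admissible_setting_def skip_free_paths_def)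
 moreover have "f ` Tm \<subseteq> S" using skip_free_paths_PiE[OF assms(2)] by auto
 ultimately show ?thesis using regular_path_skip_free[OF assms] by (auto simp: nice_path_def)
qed

lemma nice_path_diff:
 assumes "nice_path S Tm f" "nice_path S Tm g" shows "regular_path Tm (%t. f t - g t)"
 by (rule regular_path_compose2[of Tm f g "%x y. x - y"])
  (use assms in \<open>auto simp: nice_path_def case_prod_unfold intro!: continuous_intros split: if_splits\<close>)

lemma nice_path_glue:
 assumes adm: "admissible_setting S Tm" and f: "nice_path S Tm f" and g: "nice_path S Tm g"
 shows "nice_path S Tm (%t. if \<exists>s\<in>Tm. s \<le> t \<and> f s = g s then g t else f t)" (is "nice_path S Tm ?h")
proof (cases "\<exists>s\<in>Tm. f s = g s")
 case False
 hence "?h = f" by auto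
 thus ?thesis using f by simp
next
 case True
 define \<tau> where "\<tau> = Inf {s\<in>Tm. f s - g s = 0}"
 have t: "\<tau> \<in> Tm" "f \<tau> = g \<tau>" "\<And>s. s \<in> Tm ==> f s = g s ==> \<tau> \<le> s"
  using Inf_zero_attained[OF adm nice_path_diff[OF f g]] True unfolding \<tau>_def by auto
 have "(\<exists>s\<in>Tm. s \<le> t \<and> f s = g s) \<longleftrightarrow> \<tau> \<le> t" for t
  using t order_trans by blast
 hence h: "?h = (%t. if \<tau> \<le> t then g t else f t)" (is "_ = ?k") by simp
 have rc: "(?k \<longlongrightarrow> ?k u) (at u within Tm \<inter> {u<..})" if u: "u \<in> Tm" for u
 proof (cases "\<tau> \<le> u")
  case True
  have "(g \<longlongrightarrow> g u) (at u within Tm \<inter> {u<..})" using g u by (auto simp: nice_path_def regular_path_def)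
  moreover have "eventually (%x. ?k x = g x) (at u within Tm \<inter> {u<..})"
   unfolding eventually_at by (rule exI[of _ 1]) (use True in auto)
  ultimately show ?thesis using True by (subst filterlim_cong[OF refl refl]) auto
 next
  case False
  have "(f \<longlongrightarrow> f u) (at u within Tm \<inter> {u<..})" using f u by (auto simp: nice_path_def regular_path_def)
  moreover have "eventually (%x. ?k x = f x) (at u within Tm \<inter> {u<..})"
   unfolding eventually_at by (rule exI[of _ "\<tau> - u"]) (use False in \<open>auto simp: dist_real_def\<close>)
  ultimately show ?thesis using False by (subst filterlim_cong[OF refl refl]) auto
 qed
 show ?thesis
 proof (cases "S = UNIV")
  case True
  hence c: "continuous_on Tm f" "continuous_on Tm g" and T: "Tm = {0..}" using f g by (auto simp: nice_path_def)
  have "continuous_on Tm (%u. if u \<le> \<tau> then f u else g u)"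
   by (rule continuous_on_cases_le) (use c t in \<open>auto intro: continuous_on_subset\<close>)
  moreover have "(%u. if u \<le> \<tau> then f u else g u) = ?k" using t(2) by (auto simp: fun_eq_iff)
  ultimately have "continuous_on Tm ?k" by (rule back_subst[of "continuous_on Tm"])
  thus ?thesis unfolding h using rc True T by (auto simp: nice_path_def regular_path_def)
 next
  case False
  hence "f ` Tm \<subseteq> \<int>" "g ` Tm \<subseteq> \<int>" using f g by (auto simp: nice_path_def)
  hence "?k ` Tm \<subseteq> \<int>" by auto
  thus ?thesis unfolding h using rc False by (simp add: nice_path_def regular_path_def)
 qed
qed

lemma nice_path_merging:
 assumes adm: "admissible_setting S Tm" and "\<And>i. i \<le> n ==> X i \<in> skip_free_paths S Tm"
 shows "nice_path S Tm (merging Tm X n)"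
 using assms(2)
proof (induction n)
 case 0 thus ?case using nice_path_skip_free[OF adm] by simp
next
 case (Suc n)
 thus ?case unfolding merging.simps by (intro nice_path_glue[OF adm nice_path_skip_free[OF adm] Suc.IH]) auto
qed

lemma merging_measurable:
 assumes adm: "admissible_setting S Tm"
  and ev: "\<And>i u. i \<le> n ==> u \<in> Tm ==> u \<le> t ==> (%\<omega>. X \<omega> i u) \<in> borel_measurable N"
  and path: "\<And>i \<omega>. i \<le> n ==> \<omega> \<in> space N ==> X \<omega> i \<in> skip_free_paths S Tm"
 shows "\<And>u. u \<in> Tm ==> u \<le> t ==> (%\<omega>. merging Tm (X \<omega>) n u) \<in> borel_measurable N"
  and "\<And>u. u \<le> t ==> Measurable.pred N (%\<omega>. merged Tm (X \<omega>) n u)"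
proof -
 have M: "Measurable.pred N (%\<omega>. merged Tm (X \<omega>) n u)"
  if mm: "\<And>u. 0 < n ==> u \<in> Tm ==> u \<le> t ==> (%\<omega>. merging Tm (X \<omega>) (n - 1) u) \<in> borel_measurable N"
   and ev: "\<And>i u. i \<le> n ==> u \<in> Tm ==> u \<le> t ==> (%\<omega>. X \<omega> i u) \<in> borel_measurable N"
   and path: "\<And>i \<omega>. i \<le> n ==> \<omega> \<in> space N ==> X \<omega> i \<in> skip_free_paths S Tm"
   and u: "u \<le> t" for n u
 proof (cases "n = 0")
  case True thus ?thesis by (simp add: merged_def)
 next
  case False
  have "Measurable.pred N (%\<omega>. \<exists>q\<in>Tm. q \<le> u \<and> X \<omega> n q - merging Tm (X \<omega>) (n - 1) q = 0)"
  proof (rule pred_hits_zero[OF adm])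
   show "regular_path Tm (%q. X \<omega> n q - merging Tm (X \<omega>) (n - 1) q)" if "\<omega> \<in> space N" for \<omega>
    by (rule nice_path_diff[OF nice_path_skip_free[OF adm] nice_path_merging[OF adm]]) (use path that in auto)
   fix q assume q: "q \<in> Tm" "q \<le> u"
   have [measurable]: "(%\<omega>. X \<omega> n q) \<in> borel_measurable N" "(%\<omega>. merging Tm (X \<omega>) (n - 1) q) \<in> borel_measurable N"
    using q ev mm False u by auto
   show "(%\<omega>. X \<omega> n q - merging Tm (X \<omega>) (n - 1) q) \<in> borel_measurable N" by measurable
  qed
  thus ?thesis using False by (simp add: merged_def)
 qed
 have mg: "(%\<omega>. merging Tm (X \<omega>) m u) \<in> borel_measurable N" if "m \<le> n" "u \<in> Tm" "u \<le> t" for m u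
  using that
 proof (induction m arbitrary: u)
  case 0 thus ?case using ev[of 0 u] by simp
 next
  case (Suc m)
  have p: "Measurable.pred N (%\<omega>. merged Tm (X \<omega>) (Suc m) u)"
   by (rule M) (use Suc ev path in auto)
  show ?case unfolding merging_rec[of _ _ "Suc m"]
   by (rule measurable_If) (use p Suc ev[of "Suc m" u] in \<open>auto simp: pred_def\<close>)
 qed
 show "(%\<omega>. merging Tm (X \<omega>) n u) \<in> borel_measurable N" if "u \<in> Tm" "u \<le> t" for u using mg that by auto
 show "Measurable.pred N (%\<omega>. merged Tm (X \<omega>) n u)" if "u \<le> t" for u
  by (rule M) (use mg ev path that in auto)
qed

text \<open>
  The first time at which particle \<open>n\<close> joins its left neighbour, with \<open>T +
  1\<close> standing for never. It is a stopping time in each coordinate separately.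
\<close>

definition merge_time :: "real set => real => (nat => real => real) => nat => real" where
 "merge_time Tm T X n = (if merged Tm X n T then Inf {s\<in>Tm. X n s - merging Tm X (n - 1) s = 0} else T + 1)"

lemma merge_time:
 assumes adm: "admissible_setting S Tm" and T: "T \<in> Tm" and path: "\<And>i. i \<le> n ==> X i \<in> skip_free_paths S Tm"
 shows "merge_time Tm T X n \<in> Tm"
  and "merge_time Tm T X n \<le> t \<longleftrightarrow> T + 1 \<le> t \<or> merged Tm X n (min t T)"
  and "merge_time Tm T X n \<le> T ==> 0 < n \<and> X n (merge_time Tm T X n) = merging Tm X (n - 1) (merge_time Tm T X n)"
proof -
 have A: "merge_time Tm T X n \<in> Tm \<and> (merge_time Tm T X n \<le> t \<longleftrightarrow> T + 1 \<le> t \<or> merged Tm X n (min t T)) \<and>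
   (merge_time Tm T X n \<le> T \<longrightarrow> 0 < n \<and> X n (merge_time Tm T X n) = merging Tm X (n - 1) (merge_time Tm T X n))" for t
 proof (cases "merged Tm X n T")
  case False
  hence "\<not> merged Tm X n (min t T)" using merged_mono[of Tm X n "min t T" T] by auto
  thus ?thesis using False T admissible_time(5)[OF adm] by (auto simp: merge_time_def)
 next
  case True
  let ?v = "%s. X n s - merging Tm X (n - 1) s"
  have "regular_path Tm ?v"
   by (rule nice_path_diff[OF nice_path_skip_free[OF adm] nice_path_merging[OF adm]]) (use path in auto)
  moreover have n: "0 < n" and ex: "\<exists>s\<in>Tm. ?v s = 0" using True by (auto simp: merged_def)
  ultimately have *: "merge_time Tm T X n \<in> Tm" "?v (merge_time Tm T X n) = 0"
   "\<And>s. s \<in> Tm ==> ?v s = 0 ==> merge_time Tm T X n \<le> s"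
   using Inf_zero_attained[OF adm, of ?v] True by (auto simp: merge_time_def)
  have le: "merge_time Tm T X n \<le> T" using True *(3) unfolding merged_def by force
  have "merged Tm X n u \<longleftrightarrow> merge_time Tm T X n \<le> u" for u
   using n *(1,2) *(3) unfolding merged_def by force
  thus ?thesis using le * n by auto
 qed
 thus "merge_time Tm T X n \<in> Tm"
  "merge_time Tm T X n \<le> t \<longleftrightarrow> T + 1 \<le> t \<or> merged Tm X n (min t T)"
  "merge_time Tm T X n \<le> T ==> 0 < n \<and> X n (merge_time Tm T X n) = merging Tm X (n - 1) (merge_time Tm T X n)"
  by blast+
qed

text \<open>
  In a sorted system the clusters are intervals; \<open>L\<close> collects their least elements,
  and \<open>leader L i\<close> is the particle whose independent path particle \<open>i\<close>
  follows.
\<close>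

definition leader :: "nat set => nat => nat" where "leader L i = Max {m\<in>L. m \<le> i}"

lemma leader_eqI: "m \<in> L ==> m \<le> i ==> (\<And>l. l \<in> L ==> l \<le> i ==> l \<le> m) ==> leader L i = m"
 unfolding leader_def by (rule Max_eqI) auto

lemma leader_props:
 assumes "0 \<in> L" shows "leader L i \<in> L" "leader L i \<le> i" "\<And>l. l \<in> L ==> l \<le> i ==> l \<le> leader L i"
proof -
 have f: "finite {m\<in>L. m \<le> i}" "{m\<in>L. m \<le> i} \<noteq> {}" using assms by auto
 show "leader L i \<in> L" "leader L i \<le> i" using Max_in[OF f] by (auto simp: leader_def)
 show "l \<le> leader L i" if "l \<in> L" "l \<le> i" for l using Max_ge[OF f(1), of l] that by (auto simp: leader_def)
qed

lemma leader_cong: "(\<And>m. m \<le> i ==> m \<in> L \<longleftrightarrow> m \<in> L') ==> leader L i = leader L' i"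
 unfolding leader_def by (rule arg_cong[where f=Max]) auto

lemma merging_leader: "merging Tm X n t = X (leader {m. \<not> merged Tm X m t} n) t"
proof (induction n)
 case 0
 have "leader {m. \<not> merged Tm X m t} 0 = 0" by (rule leader_eqI) (auto simp: merged_def)
 thus ?case by simp
next
 case (Suc n)
 show ?case
 proof (cases "merged Tm X (Suc n) t")
  case True
  have "leader {m. \<not> merged Tm X m t} (Suc n) = leader {m. \<not> merged Tm X m t} n"
   unfolding leader_def by (rule arg_cong[where f=Max]) (use True le_Suc_eq in auto)
  thus ?thesis using Suc True by (subst merging_rec) simp
 next
  case False
  hence "leader {m. \<not> merged Tm X m t} (Suc n) = Suc n" by (intro leader_eqI) auto
  thus ?thesis using False by (subst merging_rec) simp
 qed
qed

definition cluster_pfaff :: "nat => nat set => (nat => real) => real" where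
 "cluster_pfaff N L x = pfaff (map (%i. x (leader L i)) [0..<N])"

text \<open>
  Splitting off the cluster of \<open>n\<close> from that of \<open>r\<close> changes the Pfaffian
  by a function antisymmetric in the positions of the two leaders, by the exchange rule for
  blocks.
\<close>

lemma cluster_pfaff_merge_antisym:
 assumes L: "0 \<in> L" "L \<subseteq> {..<N}" and n: "n < N" "n \<notin> L" and r: "r = leader L n"
  and x': "x' r = x n" "x' n = x r" "\<And>i. i \<noteq> r ==> i \<noteq> n ==> x' i = x i"
 shows "cluster_pfaff N L x' - cluster_pfaff N (insert n L) x' = - (cluster_pfaff N L x - cluster_pfaff N (insert n L) x)"
proof -
 have rL: "r \<in> L" "r < n" "\<And>l. l \<in> L ==> l \<le> n ==> l \<le> r"
 proof -
  show "r \<in> L" using leader_props(1)[OF L(1)] by (simp add: r)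
  thus "r < n" using leader_props(2)[OF L(1), of n] n(2) unfolding r by (metis le_neq_implies_less)
  show "\<And>l. l \<in> L ==> l \<le> n ==> l \<le> r" unfolding r by (rule leader_props(3)[OF L(1)])
 qed
 obtain n' where n': "n < n'" "n' \<le> N" "\<And>l. l \<in> L ==> n < l ==> n' \<le> l" "n' < N ==> n' \<in> L"
 proof (cases "\<exists>l\<in>L. n < l")
  case True
  let ?n = "LEAST l. l \<in> L \<and> n < l"
  have "?n \<in> L \<and> n < ?n" by (rule LeastI_ex) (use True in blast)
  thus ?thesis using L(2) by (intro that[of ?n]) (auto intro: Least_le)
 next
  case False
  thus ?thesis using n by (intro that[of N]) auto
 qed
 have split: "[0..<N] = [0..<r] @ [r..<n] @ [n..<n'] @ [n'..<N]"
 proof -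
  have upt: "[i..<k] = [i..<j] @ [j..<k]" if "i \<le> j" "j \<le> k" for i j k :: nat
   using upt_add_eq_append[OF that(1), of "k - j"] that(2) by simp
  have "[0..<N] = [0..<r] @ [r..<N]" by (rule upt) (use rL(2) n(1) in linarith)+
  also have "[r..<N] = [r..<n] @ [n..<N]" by (rule upt) (use rL(2) n(1) in linarith)+
  also have "[n..<N] = [n..<n'] @ [n'..<N]" by (rule upt) (use n'(1,2) in linarith)+
  finally show ?thesis .
 qed
 define A where "A = map (%i. x (leader L i)) [0..<r]"
 define B where "B = map (%i. x (leader L i)) [n'..<N]"
 have l1: "leader L i = r" if "r \<le> i" "i < n'" for i
 proof (rule leader_eqI)
  show "l \<le> r" if "l \<in> L" "l \<le> i" for l
   using rL(3)[OF that(1)] n'(3)[OF that(1)] that(2) \<open>i < n'\<close> by linarith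
 qed (fact rL(1), fact that(1))
 have l2: "leader (insert n L) i = n" if "n \<le> i" "i < n'" for i
 proof (rule leader_eqI)
  show "l \<le> n" if "l \<in> insert n L" "l \<le> i" for l
   using that n'(3)[of l] \<open>i < n'\<close> by (cases "l \<le> n") auto
 qed (rule insertI1, fact that(1))
 have l3: "leader (insert n L) i = leader L i" if "i < n" for i
  by (rule leader_cong) (use that in auto)
 have l4: "leader (insert n L) i = leader L i" "leader L i > n" if "n' \<le> i" "i < N" for i
 proof -
  have "n' \<in> L" using n'(4) that by auto
  hence g: "n' \<le> leader L i" using leader_props(3)[OF L(1)] that by auto
  show "leader (insert n L) i = leader L i"
  proof (rule leader_eqI)
   show "l \<le> leader L i" if "l \<in> insert n L" "l \<le> i" for l
    using that leader_props(3)[OF L(1), of l i] g n'(1) by auto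
  qed (use leader_props(1,2)[OF L(1), of i] in simp_all)
  show "leader L i > n" using g n' by auto
 qed
 have l5: "leader L i < r" if "i < r" for i using leader_props(2)[OF L(1), of i] that by auto
 have R: "map (%i. c) [a..<b] = replicate (b - a) c" for a b :: nat and c :: real
  by (simp add: map_replicate_const)
 have rep: "map f [a..<b] = replicate (b - a) c" if "\<And>i. a \<le> i ==> i < b ==> f i = c" for f :: "nat => real" and a b c
  using that by (subst R[symmetric]) (auto intro: map_cong)
 have main: "cluster_pfaff N L z = pfaff (A @ replicate ((n - r) + (n' - n)) (z r) @ B)"
   "cluster_pfaff N (insert n L) z = pfaff (A @ replicate (n - r) (z r) @ replicate (n' - n) (z n) @ B)"
  if z: "\<And>i. i \<noteq> r ==> i \<noteq> n ==> z i = x i" for z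
 proof -
  have a1: "z (leader L i) = x (leader L i)" "leader (insert n L) i = leader L i" if "i < r" for i
  proof -
   show "z (leader L i) = x (leader L i)" using l5[OF that] rL(2) by (intro z) linarith+
   show "leader (insert n L) i = leader L i" using that rL(2) by (intro l3) linarith
  qed
  have a: "map (%i. z (leader L i)) [0..<r] = A" "map (%i. z (leader (insert n L) i)) [0..<r] = A"
   unfolding A_def by (rule map_cong[OF refl], simp only: set_upt atLeastLessThan_iff a1)+
  have b1: "z (leader L i) = x (leader L i)" if "n' \<le> i" "i < N" for i
   using l4(2)[OF that] rL(2) by (intro z) linarith+
  have b: "map (%i. z (leader L i)) [n'..<N] = B" "map (%i. z (leader (insert n L) i)) [n'..<N] = B"
   unfolding B_def by (rule map_cong[OF refl], simp only: set_upt atLeastLessThan_iff b1 l4(1))+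
  have c: "map (%i. z (leader L i)) [r..<n] = replicate (n - r) (z r)"
   "map (%i. z (leader (insert n L) i)) [r..<n] = replicate (n - r) (z r)"
   "map (%i. z (leader L i)) [n..<n'] = replicate (n' - n) (z r)"
   "map (%i. z (leader (insert n L) i)) [n..<n'] = replicate (n' - n) (z n)"
  proof -
   have k1: "z (leader L i) = z r" "z (leader (insert n L) i) = z r" if "r \<le> i" "i < n" for i
    using l1[of i] l3[of i] that n'(1) by (simp_all only: less_trans[of i n n'])
   show "map (%i. z (leader L i)) [r..<n] = replicate (n - r) (z r)"
    "map (%i. z (leader (insert n L) i)) [r..<n] = replicate (n - r) (z r)"
    by (rule rep, erule k1, assumption)+
   have k2: "z (leader L i) = z r" "z (leader (insert n L) i) = z n" if "n \<le> i" "i < n'" for i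
    using l1[of i] l2[of i] that rL(2) by (simp_all only: less_imp_le[OF less_le_trans[of r n i]])
   show "map (%i. z (leader L i)) [n..<n'] = replicate (n' - n) (z r)"
    "map (%i. z (leader (insert n L) i)) [n..<n'] = replicate (n' - n) (z n)"
    by (rule rep, erule k2, assumption)+
  qed
  show "cluster_pfaff N L z = pfaff (A @ replicate ((n - r) + (n' - n)) (z r) @ B)"
   "cluster_pfaff N (insert n L) z = pfaff (A @ replicate (n - r) (z r) @ replicate (n' - n) (z n) @ B)"
   unfolding cluster_pfaff_def split map_append a b c by (simp_all add: replicate_add)
 qed
 show ?thesis
  using pfaff_block_swap[of A "n - r" "x r" "n' - n" "x n" B]
   main[OF refl] main[where z=x', unfolded x'(1,2)] x'(3) by simp
qed

text \<open>
  The mergers are undone one after the other, in the order of their times, so that the changes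
  telescope. Ties are ordered by index.
\<close>

lemma sum_telescope_sets:
 fixes g :: "nat set => real" and \<tau> :: "nat => real"
 assumes "finite Q"
 defines "bef \<equiv> %m n. \<tau> m < \<tau> n \<or> \<tau> m = \<tau> n \<and> m \<le> n"
 shows "(\<Sum>n\<in>Q. g {m\<in>Q. bef m n} - g ({m\<in>Q. bef m n} - {n})) = g Q - g {}"
 using assms(1)
proof (induction "card Q" arbitrary: Q)
 case 0 thus ?case by simp
next
 case (Suc c)
 have ne: "Q \<noteq> {}" and fin: "finite Q" using Suc(2,3) by auto
 define t where "t = Max (\<tau> ` Q)"
 define q where "q = Max {m\<in>Q. \<tau> m = t}"
 have t: "\<tau> m \<le> t" if "m \<in> Q" for m using fin that unfolding t_def by (intro Max_ge) auto
 have "t \<in> \<tau> ` Q" using fin ne unfolding t_def by (intro Max_in) auto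
 hence tex: "\<exists>m\<in>Q. \<tau> m = t" by auto
 have f2: "finite {m\<in>Q. \<tau> m = t}" "{m\<in>Q. \<tau> m = t} \<noteq> {}" using fin tex by auto
 have q: "q \<in> Q" "\<tau> q = t" "\<And>m. m \<in> Q ==> \<tau> m = t ==> m \<le> q"
  using Max_in[OF f2] Max_ge[OF f2(1)] unfolding q_def by auto
 have all: "bef m q" if "m \<in> Q" for m using t[OF that] q that by (force simp: bef_def)
 have none: "\<not> bef q n" if "n \<in> Q" "n \<noteq> q" for n using t[OF that(1)] q that by (force simp: bef_def)
 have e1: "{m\<in>Q. bef m q} = Q" using all by auto
 have e2: "{m\<in>Q. bef m n} = {m\<in>Q - {q}. bef m n}" if "n \<in> Q - {q}" for n using none that by auto
 have "(\<Sum>n\<in>Q. g {m\<in>Q. bef m n} - g ({m\<in>Q. bef m n} - {n})) = (g Q - g (Q - {q})) +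
   (\<Sum>n\<in>Q - {q}. g {m\<in>Q. bef m n} - g ({m\<in>Q. bef m n} - {n}))"
  by (subst sum.remove[OF fin q(1)]) (simp add: e1)
 also have "(\<Sum>n\<in>Q - {q}. g {m\<in>Q. bef m n} - g ({m\<in>Q. bef m n} - {n})) =
   (\<Sum>n\<in>Q - {q}. g {m\<in>Q - {q}. bef m n} - g ({m\<in>Q - {q}. bef m n} - {n}))"
  by (rule sum.cong[OF refl]) (simp only: e2)
 also have "... = g (Q - {q}) - g {}" by (rule Suc(1)) (use Suc(2) fin q(1) in auto)
 finally show ?case by simp
qed

lemma pfaff_bounded: "\<exists>C. \<forall>xs. length xs = n \<longrightarrow> \<bar>pfaff xs\<bar> \<le> C"
proof (induction n rule: less_induct)
 case (less n)
 show ?case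
 proof (cases n)
  case 0 thus ?thesis by (intro exI[of _ 1]) auto
 next
  case (Suc m)
  show ?thesis
  proof (cases m)
   case 0
   show ?thesis by (intro exI[of _ 0]) (auto simp: Suc 0 length_Suc_conv)
  next
   case (Suc l)
   obtain C where C: "\<And>xs. length xs = l ==> \<bar>pfaff xs\<bar> \<le> C" using less[of l] Suc \<open>n = Suc m\<close> by auto
   have "\<bar>pfaff xs\<bar> \<le> (\<Sum>i<m. 2 * C)" if xs: "length xs = n" for xs
   proof -
    obtain y ys where y: "xs = y # ys" "length ys = m" using xs \<open>n = Suc m\<close> by (cases xs) auto
    have "\<bar>pfaff xs\<bar> \<le> (\<Sum>i<m. \<bar>(-1) ^ i * order_weight y (ys ! i) * pfaff (del i ys)\<bar>)"
     unfolding y(1) pfaff.simps y(2) by (rule sum_abs)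
    also have "... \<le> (\<Sum>i<m. 2 * C)"
    proof (rule sum_mono)
     fix i assume "i \<in> {..<m}"
     hence "length (del i ys) = l" using y(2) Suc by simp
     hence "\<bar>pfaff (del i ys)\<bar> \<le> C" by (rule C)
     moreover have "\<bar>order_weight y (ys ! i)\<bar> \<le> 2" by (simp add: order_weight_def)
     ultimately show "\<bar>(-1) ^ i * order_weight y (ys ! i) * pfaff (del i ys)\<bar> \<le> 2 * C"
      by (simp add: abs_mult power_abs mult_mono)
    qed
    finally show ?thesis .
   qed
   thus ?thesis by blast
  qed
 qed
qed

lemma order_weight_measurable [measurable]:
 assumes [measurable]: "f \<in> borel_measurable N" "g \<in> borel_measurable N"
 shows "(%p. order_weight (f p) (g p)) \<in> borel_measurable N"
 unfolding order_weight_def by measurable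

lemma pfaff_measurable:
 assumes "\<And>h. h \<in> set hs ==> h \<in> borel_measurable N"
 shows "(%p. pfaff (map (%h. h p) hs)) \<in> borel_measurable N"
 using assms
proof (induction "length hs" arbitrary: hs rule: less_induct)
 case less
 show ?case
 proof (cases hs)
  case Nil thus ?thesis by simp
 next
  case (Cons h hs')
  have eq: "pfaff (map (%h. h p) hs) = (\<Sum>i<length hs'. (-1) ^ i * order_weight (h p) ((hs' ! i) p) * pfaff (map (%h. h p) (del i hs')))" for p
   unfolding Cons list.map pfaff.simps length_map
   by (rule sum.cong) (auto simp: take_map drop_map)
  show ?thesis unfolding eq
  proof (intro borel_measurable_sum borel_measurable_times borel_measurable_const order_weight_measurable)
   fix i assume i: "i \<in> {..<length hs'}"
   show "h \<in> borel_measurable N" "hs' ! i \<in> borel_measurable N" using less(2) Cons i by auto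
   show "(%p. pfaff (map (%h. h p) (del i hs'))) \<in> borel_measurable N"
    by (rule less(1)) (use less(2) Cons i in \<open>auto dest: in_set_takeD in_set_dropD\<close>)
  qed
 qed
qed

lemma cluster_pfaff_measurable:
 assumes "\<And>i. i < N ==> (%p. x p (leader L i)) \<in> borel_measurable M"
 shows "(%p. cluster_pfaff N L (x p)) \<in> borel_measurable M"
proof -
 have "(%p. pfaff (map (%h. h p) (map (%i p. x p (leader L i)) [0..<N]))) \<in> borel_measurable M"
  by (rule pfaff_measurable) (use assms in auto)
 thus ?thesis by (simp add: cluster_pfaff_def comp_def)
qed

text \<open>Fubini: freeze all other coordinates and integrate the pair first.\<close>

lemma integral_PiM_zero_pairwise:
 fixes f :: "('i => 'a) => real"
 assumes prob: "\<And>i. i \<in> I ==> prob_space (M i)" and I: "finite I" "r \<in> I" "n \<in> I" "r \<noteq> n"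
  and f: "f \<in> borel_measurable (PiM I M)" "\<And>X. \<bar>f X\<bar> \<le> B"
  and 0: "\<And>X. X \<in> space (PiM (I - {r, n}) M) ==> (\<integral>p. f (X(n := snd p, r := fst p)) \<partial>(M r \<Otimes>\<^sub>M M n)) = 0"
 shows "(\<integral>X. f X \<partial>PiM I M) = 0"
proof -
 define M' where "M' i = (if i \<in> I then M i else M r)" for i
 have pM': "prob_space (M' i)" for i using prob I by (auto simp: M'_def)
 interpret product_prob_space M'
  unfolding product_prob_space_def product_prob_space_axioms_def product_sigma_finite_def
  using pM' prob_space_imp_sigma_finite by auto
 interpret rn: pair_prob_space "M' r" "M' n" using pM' by (simp add: pair_prob_space_def pair_sigma_finite_def prob_space_imp_sigma_finite)
 define J where "J = I - {r, n}"
 have IJ: "I = insert r (insert n J)" using I by (auto simp: J_def)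
 have MM: "PiM I M = PiM I M'" "PiM J M = PiM J M'"
  by (rule PiM_cong; auto simp: M'_def J_def)+
 have Mrn: "M r = M' r" "M n = M' n" using I by (auto simp: M'_def)
 have finJ: "finite J" "n \<notin> J" "r \<notin> J" "finite (insert n J)" "r \<notin> insert n J" using I by (auto simp: J_def)
 interpret PI: prob_space "PiM (insert r (insert n J)) M'" by (rule prob_space_PiM) (rule pM')
 interpret PJ: prob_space "PiM (insert n J) M'" by (rule prob_space_PiM) (rule pM')
 have fm: "f \<in> borel_measurable (PiM (insert r (insert n J)) M')" using f(1) unfolding MM(1) unfolding IJ .
 have fi: "integrable (PiM (insert r (insert n J)) M') f"
  by (rule PI.integrable_const_bound[where B=B, OF _ fm]) (use f(2) in simp)
 define h where "h X = (\<integral>y. f (X(r := y)) \<partial>M' r)" for X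
 have upd: "(%p. f ((fst p)(r := snd p))) \<in> borel_measurable (PiM (insert n J) M' \<Otimes>\<^sub>M M' r)"
  by (rule measurable_compose[OF _ fm]) (simp add: measurable_add_dim[unfolded case_prod_unfold])
 have hm: "h \<in> borel_measurable (PiM (insert n J) M')"
  unfolding h_def
  by (rule sigma_finite_measure.borel_measurable_lebesgue_integral[OF prob_space_imp_sigma_finite[OF pM']])
   (use upd in \<open>simp add: case_prod_unfold\<close>)
 have hB: "\<bar>h X\<bar> \<le> \<bar>B\<bar>" for X
 proof -
  have "\<bar>h X\<bar> \<le> (\<integral>y. \<bar>f (X(r := y))\<bar> \<partial>M' r)" unfolding h_def by (rule integral_abs_bound)
  also have "... \<le> (\<integral>y. \<bar>B\<bar> \<partial>M' r)"
   by (rule integral_mono') (use order_trans[OF f(2) abs_ge_self] in auto)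
  finally show ?thesis using prob_space.prob_space[OF pM'[of r]] by simp
 qed
 have hi: "integrable (PiM (insert n J) M') h"
  by (rule PJ.integrable_const_bound[where B="\<bar>B\<bar>", OF _ hm]) (use hB in simp)
 have "(\<integral>X. f X \<partial>PiM I M) = (\<integral>X. h X \<partial>PiM (insert n J) M')"
  unfolding MM(1) unfolding IJ h_def by (rule product_integral_insert[OF finJ(4,5) fi])
 also have "... = (\<integral>X. (\<integral>z. h (X(n := z)) \<partial>M' n) \<partial>PiM J M')"
  by (rule product_integral_insert[OF finJ(1,2) hi])
 also have "... = (\<integral>X. 0 \<partial>PiM J M')"
 proof (rule Bochner_Integration.integral_cong[OF refl])
  fix X assume X: "X \<in> space (PiM J M')"
  have m: "(%p. f (X(n := snd p, r := fst p))) \<in> borel_measurable (M' r \<Otimes>\<^sub>M M' n)"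
  proof (rule measurable_compose[OF _ upd, of "%p. (X(n := snd p), fst p)", simplified])
   have "(%z. X(n := z)) \<in> M' n \<rightarrow>\<^sub>M PiM (insert n J) M'"
    by (rule measurable_component_update[OF X finJ(2)])
   thus "(%p. (X(n := snd p), fst p)) \<in> M' r \<Otimes>\<^sub>M M' n \<rightarrow>\<^sub>M PiM (insert n J) M' \<Otimes>\<^sub>M M' r"
    by (intro measurable_Pair measurable_compose[OF measurable_snd] measurable_fst)
  qed
  have i: "integrable (M' r \<Otimes>\<^sub>M M' n) (%(y, z). f (X(n := z, r := y)))"
   by (rule rn.integrable_const_bound[where B=B]) (use m f(2) in \<open>auto simp: case_prod_unfold\<close>)
  have "(\<integral>z. h (X(n := z)) \<partial>M' n) = (\<integral>p. f (X(n := snd p, r := fst p)) \<partial>(M' r \<Otimes>\<^sub>M M' n))"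
   unfolding h_def using rn.integral_snd[OF i] by (simp add: case_prod_unfold)
  also have "... = 0" using 0[of X] X unfolding J_def[symmetric] MM(2) Mrn by simp
  finally show "(\<integral>z. h (X(n := z)) \<partial>M' n) = 0" .
 qed
 finally show ?thesis by simp
qed


section \<open>Merging does not change the expected Pfaffian\<close>

definition merges_before :: "real set => real => (nat => real => real) => nat => nat => bool" where
 "merges_before Tm T X m n \<longleftrightarrow> merge_time Tm T X m < merge_time Tm T X n \<or>
   merge_time Tm T X m = merge_time Tm T X n \<and> m \<le> n"

text \<open>
  Particle \<open>n\<close> merges by time \<open>T\<close>, and \<open>L\<close> is the set of
  the particles that have not merged up to then. On this event the change of the Pfaffian caused
  by the merger is a fixed function of the final positions.
\<close>

definition merge_event :: "real set => real => nat => nat => nat set => (nat => real => real) => bool" where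
 "merge_event Tm T N n L X \<longleftrightarrow> merge_time Tm T X n \<le> T \<and> (\<forall>m<N. m \<in> L \<longleftrightarrow> \<not> merges_before Tm T X m n)"

lemma merge_event_iff:
 assumes "L \<subseteq> {..<N}"
 shows "merge_event Tm T N n L X \<longleftrightarrow> merge_time Tm T X n \<le> T \<and> {m. m < N \<and> \<not> merges_before Tm T X m n} = L"
 using assms unfolding merge_event_def by auto

lemma merges_before_cases:
 "merges_before Tm T X m n \<longleftrightarrow> (if m \<le> n then \<not> merge_time Tm T X n < merge_time Tm T X m else merge_time Tm T X m < merge_time Tm T X n)"
 by (auto simp: merges_before_def)

lemma merge_event_meet:
 assumes adm: "admissible_setting S Tm" and T: "T \<in> Tm" and path: "\<And>i. i < N ==> X i \<in> skip_free_paths S Tm"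
  and n: "n < N" and L: "0 \<in> L" "L \<subseteq> {..<N}" and ev: "merge_event Tm T N n L X"
 shows "X (leader L n) (merge_time Tm T X n) = X n (merge_time Tm T X n)" "n \<notin> L"
proof -
 let ?t = "merge_time Tm T X n"
 have le: "?t \<le> T" using ev by (simp add: merge_event_def)
 have p: "X i \<in> skip_free_paths S Tm" if "i \<le> n" for i using path n that by auto
 note mt = merge_time[OF adm T]
 have pos: "0 < n" and meet: "X n ?t = merging Tm X (n - 1) ?t" using mt(3)[OF p le] by auto
 show nL: "n \<notin> L" using ev n by (auto simp: merge_event_def merges_before_def)
 have "m \<in> L \<longleftrightarrow> \<not> merged Tm X m ?t" if "m \<le> n - 1" for m
 proof -
  have "m < n" "m < N" using that pos n by auto
  hence "m \<in> L \<longleftrightarrow> \<not> merge_time Tm T X m \<le> ?t" using ev by (auto simp: merge_event_def merges_before_def)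
  also have "merge_time Tm T X m \<le> ?t \<longleftrightarrow> T + 1 \<le> ?t \<or> merged Tm X m (min ?t T)"
   by (rule mt(2)) (use p \<open>m < n\<close> in auto)
  finally show ?thesis using le by (auto simp: min_def)
 qed
 hence "leader L (n - 1) = leader {m. \<not> merged Tm X m ?t} (n - 1)" by (intro leader_cong) auto
 moreover have "leader L n = leader L (n - 1)"
 proof -
  have "m \<le> n \<longleftrightarrow> m \<le> n - 1" if "m \<in> L" for m
   using that nL pos by (cases "m = n") auto
  thus ?thesis unfolding leader_def by (intro arg_cong[where f=Max]) auto
 qed
 ultimately show "X (leader L n) ?t = X n ?t"
  unfolding meet merging_leader by simp
qed

lemma merge_time_measurable:
 assumes adm: "admissible_setting S Tm" and T: "T \<in> Tm"
  and ev: "\<And>i u. i \<le> n ==> u \<in> Tm ==> u \<le> t ==> (%\<omega>. X \<omega> i u) \<in> borel_measurable N"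
  and path: "\<And>i \<omega>. i \<le> n ==> \<omega> \<in> space N ==> X \<omega> i \<in> skip_free_paths S Tm"
 shows "Measurable.pred N (%\<omega>. merge_time Tm T (X \<omega>) n \<le> t)"
proof -
 have m: "Measurable.pred N (%\<omega>. merged Tm (X \<omega>) n (min t T))"
  by (rule merging_measurable(2)[OF adm, of n t X N "min t T"], rule ev, assumption+, rule path, assumption+, rule min.cobounded1)
 have eq: "merge_time Tm T (X \<omega>) n \<le> t \<longleftrightarrow> T + 1 \<le> t \<or> merged Tm (X \<omega>) n (min t T)" if "\<omega> \<in> space N" for \<omega>
  by (rule merge_time(2)[OF adm T], rule path[OF _ that])
 have "Measurable.pred N (%\<omega>. T + 1 \<le> t \<or> merged Tm (X \<omega>) n (min t T))"
  by (rule pred_intros_logic(5)[OF _ m]) simp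
 thus ?thesis
  using measurable_cong[of N "%\<omega>. merge_time Tm T (X \<omega>) n \<le> t" "%\<omega>. T + 1 \<le> t \<or> merged Tm (X \<omega>) n (min t T)" "count_space UNIV"] eq
  by blast
qed

lemma pred_iff_not_if:
 assumes "Measurable.pred Q A" "Measurable.pred Q B"
 shows "Measurable.pred Q (%f. c \<longleftrightarrow> \<not> (if d then \<not> A f else B f))"
 by (cases c; cases d) (simp_all add: assms pred_intros_logic(2)[OF assms(1)] pred_intros_logic(2)[OF assms(2)])

context skip_free_process begin

lemma merge_time_section:
 assumes T: "T \<in> Tm" and X: "\<And>i. i \<noteq> r ==> i < N ==> X i \<in> skip_free_paths S Tm" and m: "m < N"
 shows "stopping_time (history S Tm) (%f. merge_time Tm T (X(r := f)) m)"
proof (rule stopping_timeI)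
 fix t
 show "Measurable.pred (history S Tm t) (%f. merge_time Tm T (X(r := f)) m \<le> t)"
 proof (rule merge_time_measurable[OF setting T])
  show "(%f. (X(r := f)) i u) \<in> borel_measurable (history S Tm t)" if "u \<in> Tm" "u \<le> t" for i u
   using that by (cases "i = r") (simp_all add: history_eval_measurable)
 qed (use X m in auto)
qed

lemma merge_event_section:
 assumes T: "T \<in> Tm" and X: "\<And>i. i \<noteq> r ==> i < N ==> X i \<in> skip_free_paths S Tm" and n: "n < N"
 shows "{f \<in> skip_free_paths S Tm. merge_event Tm T N n L (X(r := f))} \<in>
  sets (past S Tm (%f. merge_time Tm T (X(r := f)) n))"
proof -
 interpret F: filtration "skip_free_paths S Tm" "history S Tm" by (rule filtration_history)
 let ?\<tau> = "%m f. merge_time Tm T (X(r := f)) m"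
 have st: "stopping_time (history S Tm) (?\<tau> m)" if "m < N" for m by (rule merge_time_section[OF T X that])
 note stn = st[OF n]
 have \<tau>n: "?\<tau> n \<in> borel_measurable (F.pre_sigma (?\<tau> n))" by (rule F.measurable_stopping_time_pre_sigma[OF stn])
 have a: "Measurable.pred (F.pre_sigma (?\<tau> n)) (%f. ?\<tau> n f < ?\<tau> m f)" if "m < N" for m
  by (rule F.stopping_time_less[OF stn st[OF that]])
 have b: "Measurable.pred (F.pre_sigma (?\<tau> n)) (%f. ?\<tau> m f < ?\<tau> n f)" if "m < N" for m
 proof -
  have smin: "stopping_time (history S Tm) (%f. min (?\<tau> m f) (?\<tau> n f))" by (rule stopping_time_min[OF st[OF that] stn])
  have "(%f. min (?\<tau> m f) (?\<tau> n f)) \<in> borel_measurable (F.pre_sigma (%f. min (?\<tau> m f) (?\<tau> n f)))"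
   by (rule F.measurable_stopping_time_pre_sigma[OF smin])
  moreover have "sets (F.pre_sigma (%f. min (?\<tau> m f) (?\<tau> n f))) \<subseteq> sets (F.pre_sigma (?\<tau> n))"
   by (rule F.mono_pre_sigma[OF smin stn]) simp
  ultimately have [measurable]: "(%f. min (?\<tau> m f) (?\<tau> n f)) \<in> borel_measurable (F.pre_sigma (?\<tau> n))"
   by (rule measurable_mono[OF order_refl refl _ _, THEN subsetD, rotated -1]) (simp_all add: F.space_pre_sigma)
  note \<tau>n[measurable]
  have "Measurable.pred (F.pre_sigma (?\<tau> n)) (%f. min (?\<tau> m f) (?\<tau> n f) < ?\<tau> n f)" by measurable
  moreover have "(%f. min (?\<tau> m f) (?\<tau> n f) < ?\<tau> n f) = (%f. ?\<tau> m f < ?\<tau> n f)"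
   by (simp add: fun_eq_iff min_less_iff_disj)
  ultimately show ?thesis by (simp only:)
 qed
 note \<tau>n[measurable]
 have c: "Measurable.pred (F.pre_sigma (?\<tau> n)) (%f. ?\<tau> n f \<le> T)" by measurable
 have d: "Measurable.pred (F.pre_sigma (?\<tau> n)) (%f. m \<in> L \<longleftrightarrow> \<not> merges_before Tm T (X(r := f)) m n)" if "m < N" for m
  unfolding merges_before_cases by (rule pred_iff_not_if[OF a[OF that] b[OF that]])
 have "Measurable.pred (F.pre_sigma (?\<tau> n)) (%f. \<forall>m\<in>{..<N}. m \<in> L \<longleftrightarrow> \<not> merges_before Tm T (X(r := f)) m n)"
  by (rule pred_intros_finite(3)) (use d in auto)
 hence "Measurable.pred (F.pre_sigma (?\<tau> n)) (%f. merge_event Tm T N n L (X(r := f)))"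
  unfolding merge_event_def lessThan_iff[symmetric] Ball_def[symmetric] by (rule pred_intros_logic(3)[OF c])
 thus ?thesis by (simp add: pred_def F.space_pre_sigma)
qed

lemma merge_event_measurable:
 assumes T: "T \<in> Tm" and n: "n < N"
  and ev: "\<And>i u. i < N ==> u \<in> Tm ==> (%\<omega>. X \<omega> i u) \<in> borel_measurable M"
  and path: "\<And>i \<omega>. i < N ==> \<omega> \<in> space M ==> X \<omega> i \<in> skip_free_paths S Tm"
 shows "\<And>m. m < N ==> (%\<omega>. merge_time Tm T (X \<omega>) m) \<in> borel_measurable M"
  and "Measurable.pred M (%\<omega>. merge_event Tm T N n L (X \<omega>))"
proof -
 have tm: "(%\<omega>. merge_time Tm T (X \<omega>) m) \<in> borel_measurable M" if "m < N" for m
 proof (rule borel_measurableI_le)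
  fix t
  have "Measurable.pred M (%\<omega>. merge_time Tm T (X \<omega>) m \<le> t)"
   by (rule merge_time_measurable[OF setting T]) (use ev path that in auto)
  thus "{\<omega> \<in> space M. merge_time Tm T (X \<omega>) m \<le> t} \<in> sets M" by (simp add: pred_def)
 qed
 thus "\<And>m. m < N ==> (%\<omega>. merge_time Tm T (X \<omega>) m) \<in> borel_measurable M" .
 have "Measurable.pred M (%\<omega>. \<forall>m\<in>{..<N}. m \<in> L \<longleftrightarrow> \<not> merges_before Tm T (X \<omega>) m n)"
 proof (rule pred_intros_finite(3))
  fix m assume "m \<in> {..<N}"
  hence [measurable]: "(%\<omega>. merge_time Tm T (X \<omega>) m) \<in> borel_measurable M" "(%\<omega>. merge_time Tm T (X \<omega>) n) \<in> borel_measurable M"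
   using tm n by auto
  show "Measurable.pred M (%\<omega>. m \<in> L \<longleftrightarrow> \<not> merges_before Tm T (X \<omega>) m n)"
   unfolding merges_before_cases by (rule pred_iff_not_if) measurable
 qed simp
 note d = this
 note tm[OF n, measurable]
 have c: "Measurable.pred M (%\<omega>. merge_time Tm T (X \<omega>) n \<le> T)" by measurable
 show "Measurable.pred M (%\<omega>. merge_event Tm T N n L (X \<omega>))"
  unfolding merge_event_def lessThan_iff[symmetric] Ball_def[symmetric] by (rule pred_intros_logic(3)[OF c d])
qed

lemma PiM_paths:
 assumes "x \<in> I \<rightarrow> S"
 shows "\<And>X i. X \<in> space (PiM I (%i. K 0 (x i))) ==> i \<in> I ==> X i \<in> skip_free_paths S Tm"
  and "\<And>i. i \<in> I ==> prob_space (K 0 (x i))"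
  and "\<And>i. i \<in> I ==> (%X. X i) \<in> PiM I (%i. K 0 (x i)) \<rightarrow>\<^sub>M path_space S Tm"
  and "\<And>i u. i \<in> I ==> (%X. X i u) \<in> borel_measurable (PiM I (%i. K 0 (x i)))"
proof -
 note k = kernel_at[OF admissible_time(1)[OF setting]]
 show 1: "X i \<in> skip_free_paths S Tm" if "X \<in> space (PiM I (%i. K 0 (x i)))" "i \<in> I" for X i
  using that k(3)[OF funcset_mem[OF assms that(2)]] by (auto simp: space_PiM PiE_iff)
 show "prob_space (K 0 (x i))" if "i \<in> I" for i using k(2)[OF funcset_mem[OF assms that]] .
 show 2: "(%X. X i) \<in> PiM I (%i. K 0 (x i)) \<rightarrow>\<^sub>M path_space S Tm" if "i \<in> I" for i
 proof -
  have "(%X. X i) \<in> PiM I (%i. K 0 (x i)) \<rightarrow>\<^sub>M K 0 (x i)" using that by (rule measurable_component_singleton)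
  moreover have "(PiM I (%i. K 0 (x i)) \<rightarrow>\<^sub>M K 0 (x i)) = (PiM I (%i. K 0 (x i)) \<rightarrow>\<^sub>M path_space S Tm)"
   by (rule measurable_cong_sets[OF refl k(1)[OF funcset_mem[OF assms that]]])
  ultimately show ?thesis by simp
 qed
 show "(%X. X i u) \<in> borel_measurable (PiM I (%i. K 0 (x i)))" if "i \<in> I" for i u
  by (rule measurable_compose[OF 2[OF that] path_eval_measurable])
qed

lemma cluster_pfaff_bounded: "\<exists>C\<ge>0. \<forall>L x. \<bar>cluster_pfaff N L x\<bar> \<le> C"
proof -
 obtain C where C: "\<And>xs. length xs = N ==> \<bar>pfaff xs\<bar> \<le> C" using pfaff_bounded[of N] by auto
 have "\<bar>cluster_pfaff N L x\<bar> \<le> C" for L x unfolding cluster_pfaff_def by (rule C) simp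
 thus ?thesis by (intro exI[of _ C]) (use abs_ge_zero order_trans in blast)
qed

text \<open>
  On the event, \<open>n\<close> meets the leader of the cluster to its left, and the change of
  the Pfaffian is antisymmetric in the two; so the exchange of futures applies to this pair.
\<close>

lemma expectation_merge_step:
 assumes x: "\<And>i. i < N ==> x i \<in> S" and T: "T \<in> Tm" and n: "n < N" "n \<notin> L" and L: "0 \<in> L" "L \<subseteq> {..<N}"
 shows "(\<integral>X. of_bool (merge_event Tm T N n L X) *
   (cluster_pfaff N L (%i. X i T) - cluster_pfaff N (insert n L) (%i. X i T)) \<partial>PiM {..<N} (%i. K 0 (x i))) = 0"
proof -
 let ?I = "{..<N}" and ?P = "path_space S Tm" and ?M = "%i. K 0 (x i)"
 have xI: "x \<in> ?I \<rightarrow> S" using x by auto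
 note PM = PiM_paths[OF xI]
 define r where "r = leader L n"
 have r: "r \<in> L" "r < n" using leader_props(1,2)[OF L(1), of n] n(2) unfolding r_def by (auto simp: le_less)
 hence rN: "r < N" "r \<noteq> n" using n by auto
 define W where "W y = cluster_pfaff N L y - cluster_pfaff N (insert n L) y" for y
 obtain C where C: "0 \<le> C" "\<And>L x. \<bar>cluster_pfaff N L x\<bar> \<le> C" using cluster_pfaff_bounded by blast
 have WB: "\<bar>W y\<bar> \<le> 2 * C" for y using C(2)[of L y] C(2)[of "insert n L" y] unfolding W_def by linarith
 have lN: "leader L i < N" "leader (insert n L) i < N" if "i < N" for i
  using leader_props(2)[OF L(1), of i] leader_props(2)[of "insert n L" i] L(1) that by auto
 have Wm: "(%p. W (y p)) \<in> borel_measurable Q" if "\<And>i. i < N ==> (%p. y p i) \<in> borel_measurable Q" for y and Q :: "'q measure"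
  unfolding W_def using lN that by (intro borel_measurable_diff cluster_pfaff_measurable) auto
 have "(\<integral>X. of_bool (merge_event Tm T N n L X) * W (%i. X i T) \<partial>PiM ?I ?M) = 0"
 proof (rule integral_PiM_zero_pairwise[where r=r and n=n and B="2 * C"])
  show "prob_space (?M i)" if "i \<in> ?I" for i using PM(2)[OF that] .
  show "finite ?I" "r \<in> ?I" "n \<in> ?I" "r \<noteq> n" using rN n by auto
  have "Measurable.pred (PiM ?I ?M) (%X. merge_event Tm T N n L X)"
   by (rule merge_event_measurable(2)[OF T n(1)]) (use PM in auto)
  hence [measurable]: "(%X. of_bool (merge_event Tm T N n L X) :: real) \<in> borel_measurable (PiM ?I ?M)" by measurable
  have [measurable]: "(%X. W (%i. X i T)) \<in> borel_measurable (PiM ?I ?M)"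
   by (rule Wm) (use PM(4) in auto)
  show "(%X. of_bool (merge_event Tm T N n L X) * W (%i. X i T)) \<in> borel_measurable (PiM ?I ?M)" by measurable
  show "\<bar>of_bool (merge_event Tm T N n L X) * W (%i. X i T)\<bar> \<le> 2 * C" for X
   using WB[of "%i. X i T"] C(1) by (cases "merge_event Tm T N n L X") auto
  fix X0 assume X0: "X0 \<in> space (PiM (?I - {r, n}) ?M)"
  have X0p: "X0 i \<in> skip_free_paths S Tm" if "i < N" "i \<noteq> r" "i \<noteq> n" for i
   using PiM_paths(1)[of x "?I - {r, n}", OF _ X0] x that by auto
  define Z where "Z f g = X0(n := g, r := f)" for f g
  have Zi: "Z f g i = (if i = r then f else if i = n then g else X0 i)" for f g i using rN by (simp add: Z_def)
  have Zp: "Z f g i \<in> skip_free_paths S Tm" if "f \<in> skip_free_paths S Tm" "g \<in> skip_free_paths S Tm" "i < N" for f g i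
   using X0p that by (auto simp: Zi)
  define G where "G p = W (%i. if i = r then fst p else if i = n then snd p else X0 i T)" for p
  have ZZ: "Z f g = (X0(n := g))(r := f)" "Z f g = (X0(r := f))(n := g)" for f g
   using rN by (auto simp: Z_def fun_eq_iff)
  have PPev: "(%p. Z (fst p) (snd p) i u) \<in> borel_measurable (?P \<Otimes>\<^sub>M ?P)" for i u
   unfolding Zi by (cases "i = r"; cases "i = n") (auto intro: measurable_compose[OF measurable_fst path_eval_measurable] measurable_compose[OF measurable_snd path_eval_measurable])
  have PPp: "Z (fst p) (snd p) i \<in> skip_free_paths S Tm" if "p \<in> space (?P \<Otimes>\<^sub>M ?P)" "i < N" for p i
   by (rule Zp) (use that in \<open>auto simp: space_pair_measure\<close>)
  have "(\<integral>p. of_bool (merge_event Tm T N n L (Z (fst p) (snd p))) * G (fst p T, snd p T) \<partial>(?M r \<Otimes>\<^sub>M ?M n)) = 0"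
  proof (rule swap_futures[where \<tau>="%f g. merge_time Tm T (Z f g) n" and A="%f g. merge_event Tm T N n L (Z f g)"])
   show "x r \<in> S" "x n \<in> S" "T \<in> Tm" using x rN n T by auto
   show "merge_time Tm T (Z f g) n \<in> Tm" if "f \<in> skip_free_paths S Tm" "g \<in> skip_free_paths S Tm" for f g
    by (rule merge_time(1)[OF setting T Zp[OF that]]) (use n in auto)
   show "stopping_time (history S Tm) (%f. merge_time Tm T (Z f g) n)" if "g \<in> skip_free_paths S Tm" for g
    unfolding ZZ(1) by (rule merge_time_section[OF T _ n(1)]) (use X0p that in auto)
   show "stopping_time (history S Tm) (%g. merge_time Tm T (Z f g) n)" if "f \<in> skip_free_paths S Tm" for f
    unfolding ZZ(2) by (rule merge_time_section[OF T _ n(1)]) (use X0p that in auto)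
   show "{f \<in> skip_free_paths S Tm. merge_event Tm T N n L (Z f g)} \<in> sets (past S Tm (%f. merge_time Tm T (Z f g) n))"
    if "g \<in> skip_free_paths S Tm" for g
    unfolding ZZ(1) by (rule merge_event_section[OF T _ n(1)]) (use X0p that in auto)
   show "{g \<in> skip_free_paths S Tm. merge_event Tm T N n L (Z f g)} \<in> sets (past S Tm (%g. merge_time Tm T (Z f g) n))"
    if "f \<in> skip_free_paths S Tm" for f
    unfolding ZZ(2) by (rule merge_event_section[OF T _ n(1)]) (use X0p that in auto)
   show "(%(f, g). merge_time Tm T (Z f g) n) \<in> ?P \<Otimes>\<^sub>M ?P \<rightarrow>\<^sub>M borel"
    unfolding case_prod_unfold by (rule merge_event_measurable(1)[OF T n(1) PPev PPp n(1)])
   show "Measurable.pred (?P \<Otimes>\<^sub>M ?P) (%(f, g). merge_event Tm T N n L (Z f g))"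
    unfolding case_prod_unfold by (rule merge_event_measurable(2)[OF T n(1) PPev PPp])
   show "merge_time Tm T (Z f g) n \<le> T \<and> f (merge_time Tm T (Z f g) n) = g (merge_time Tm T (Z f g) n)"
    if "f \<in> skip_free_paths S Tm" "g \<in> skip_free_paths S Tm" "merge_event Tm T N n L (Z f g)" for f g
   proof
    show "merge_time Tm T (Z f g) n \<le> T" using that(3) by (simp add: merge_event_def)
    have "Z f g (leader L n) (merge_time Tm T (Z f g) n) = Z f g n (merge_time Tm T (Z f g) n)"
     by (rule merge_event_meet(1)[OF setting T Zp[OF that(1,2)] n(1) L that(3)])
    thus "f (merge_time Tm T (Z f g) n) = g (merge_time Tm T (Z f g) n)"
     using rN by (simp add: Zi r_def[symmetric])
   qed
   show "G \<in> borel_measurable (borel \<Otimes>\<^sub>M borel)"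
    unfolding G_def[abs_def]
   proof (rule Wm)
    fix i
    show "(%p. if i = r then fst p else if i = n then snd p else X0 i T) \<in> borel_measurable (borel \<Otimes>\<^sub>M borel)"
     by (cases "i = r"; cases "i = n") simp_all
   qed
   show "G (v, u) = - G (u, v)" for u v
    unfolding G_def W_def
    by (rule cluster_pfaff_merge_antisym[OF L n r_def]) (use rN in auto)
  qed
  moreover have "W (%i. Z f g i T) = G (f T, g T)" for f g
   unfolding G_def Zi by (rule arg_cong[where f=W]) auto
  ultimately show "(\<integral>p. of_bool (merge_event Tm T N n L (X0(n := snd p, r := fst p))) * W (%i. (X0(n := snd p, r := fst p)) i T) \<partial>(?M r \<Otimes>\<^sub>M ?M n)) = 0"
   by (simp only: Z_def[symmetric])
 qed
 thus ?thesis by (simp only: W_def)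
qed

text \<open>
  The difference of the two Pfaffians is a telescoping sum over the mergers. Each is classified by
  the set \<open>L\<close> of the leaders that remain, and every term has mean zero.
\<close>

lemma expectation_merging:
 assumes x: "\<And>i. i < N ==> x i \<in> S" and T: "T \<in> Tm"
 shows "(\<integral>X. pfaff (map (%i. merging Tm X i T) [0..<N]) \<partial>PiM {..<N} (%i. K 0 (x i))) =
   (\<integral>X. pfaff (map (%i. X i T) [0..<N]) \<partial>PiM {..<N} (%i. K 0 (x i)))"
proof -
 let ?I = "{..<N}" and ?M = "PiM {..<N} (%i. K 0 (x i))"
 have xI: "x \<in> ?I \<rightarrow> S" using x by auto
 note PM = PiM_paths[OF xI]
 interpret P: prob_space ?M by (rule prob_space_PiM) (use PM(2) in auto)
 let ?y = "%X i. X i T" and ?W = "cluster_pfaff N"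
 define \<L> where "\<L> = {L. 0 \<in> L \<and> L \<subseteq> ?I}"
 have fL: "finite \<L>" unfolding \<L>_def by (rule finite_subset[of _ "Pow ?I"]) auto
 define D where "D n L X = of_bool (merge_event Tm T N n L X) * (?W L (?y X) - ?W (insert n L) (?y X))" for n L X
 have key: "pfaff (map (%i. merging Tm X i T) [0..<N]) - pfaff (map (%i. X i T) [0..<N]) = (\<Sum>n<N. \<Sum>L\<in>\<L>. of_bool (n \<notin> L) * D n L X)"
  if X: "X \<in> space ?M" for X
 proof -
  have p: "X i \<in> skip_free_paths S Tm" if "i < N" for i using PM(1)[OF X, of i] that by auto
  define \<tau> where "\<tau> m = merge_time Tm T X m" for m
  define Q where "Q = {n. n < N \<and> \<tau> n \<le> T}"
  have Q0: "0 \<notin> Q" by (simp add: Q_def \<tau>_def merge_time_def merged_def)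
  have merged: "\<tau> m \<le> T \<longleftrightarrow> merged Tm X m T" if "m < N" for m
   unfolding \<tau>_def using merge_time(2)[OF setting T, of m X T] p that by auto
  have lead: "merging Tm X i T = X (leader (?I - Q) i) T" if "i < N" for i
   unfolding merging_leader by (rule arg_cong[where f="%j. X j T"], rule leader_cong) (use that merged in \<open>auto simp: Q_def\<close>)
  have 1: "pfaff (map (%i. merging Tm X i T) [0..<N]) = ?W (?I - Q) (?y X)"
   unfolding cluster_pfaff_def by (rule arg_cong[where f=pfaff]) (auto simp: lead)
  have "leader ?I i = i" if "i < N" for i by (rule leader_eqI) (use that in auto)
  hence 2: "pfaff (map (%i. X i T) [0..<N]) = ?W (?I - {}) (?y X)"
   unfolding cluster_pfaff_def by (intro arg_cong[where f=pfaff]) auto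
  let ?b = "%m n. \<tau> m < \<tau> n \<or> \<tau> m = \<tau> n \<and> m \<le> n"
  let ?g = "%R. ?W (?I - R) (?y X)"
  have "(\<Sum>L\<in>\<L>. of_bool (n \<notin> L) * D n L X) = (if n \<in> Q then ?g {m\<in>Q. ?b m n} - ?g ({m\<in>Q. ?b m n} - {n}) else 0)" if n: "n < N" for n
  proof (cases "n \<in> Q")
   case False
   hence "\<not> merge_time Tm T X n \<le> T" using n by (auto simp: Q_def \<tau>_def)
   hence "D n L X = 0" for L by (simp add: D_def merge_event_def)
   thus ?thesis using False by simp
  next
   case True
   \<comment> \<open>the particles that have not merged when \<open>n\<close> does\<close>
   define L0 where "L0 = ?I - {m\<in>Q. ?b m n}"
   have L0: "L0 \<in> \<L>" "n \<notin> L0" using Q0 n True by (auto simp: L0_def \<L>_def)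
   have L0b: "L0 = {m. m < N \<and> \<not> merges_before Tm T X m n}"
    using True by (auto simp: L0_def Q_def merges_before_def \<tau>_def)
   have "merge_event Tm T N n L X \<longleftrightarrow> L = L0" if "L \<in> \<L>" for L
    using True merge_event_iff[of L N Tm T n X] that unfolding L0b by (auto simp: Q_def \<tau>_def \<L>_def)
   hence "(\<Sum>L\<in>\<L>. of_bool (n \<notin> L) * D n L X) = (\<Sum>L\<in>\<L>. if L = L0 then ?W L0 (?y X) - ?W (insert n L0) (?y X) else 0)"
    using L0(2) by (intro sum.cong refl) (auto simp: D_def)
   also have "... = ?W L0 (?y X) - ?W (insert n L0) (?y X)" using fL L0(1) by simp
   also have "insert n L0 = ?I - ({m\<in>Q. ?b m n} - {n})" using n by (auto simp: L0_def)
   finally show ?thesis using True by (simp add: L0_def)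
  qed
  hence "(\<Sum>n<N. \<Sum>L\<in>\<L>. of_bool (n \<notin> L) * D n L X) = (\<Sum>n<N. if n \<in> Q then ?g {m\<in>Q. ?b m n} - ?g ({m\<in>Q. ?b m n} - {n}) else 0)"
   by (intro sum.cong) auto
  also have "... = (\<Sum>n\<in>Q. ?g {m\<in>Q. ?b m n} - ?g ({m\<in>Q. ?b m n} - {n}))"
   by (rule sum.mono_neutral_cong_right) (auto simp: Q_def)
  also have "... = ?g Q - ?g {}" by (rule sum_telescope_sets) (simp add: Q_def)
  finally show ?thesis unfolding 1 2 by simp
 qed
 obtain C where C: "0 \<le> C" "\<And>L x. \<bar>?W L x\<bar> \<le> C" using cluster_pfaff_bounded by blast
 have Wm: "(%X. ?W L (?y X)) \<in> borel_measurable ?M" if "0 \<in> L" for L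
  by (rule cluster_pfaff_measurable, rule PM(4)) (use leader_props(2)[OF that] le_less_trans in auto)
 have Di: "integrable ?M (D n L)" if "n < N" "L \<in> \<L>" for n L
 proof (rule P.integrable_const_bound[where B="2 * C"])
  have [measurable]: "(%X. ?W L (?y X)) \<in> borel_measurable ?M" "(%X. ?W (insert n L) (?y X)) \<in> borel_measurable ?M"
   using Wm that by (auto simp: \<L>_def)
  have "Measurable.pred ?M (%X. merge_event Tm T N n L X)"
   by (rule merge_event_measurable(2)[OF T that(1)]) (use PM in auto)
  hence [measurable]: "(%X. of_bool (merge_event Tm T N n L X) :: real) \<in> borel_measurable ?M" by measurable
  show "D n L \<in> borel_measurable ?M" unfolding D_def[abs_def] by measurable
  have "\<bar>D n L X\<bar> \<le> 2 * C" for X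
   using C(2)[of L "?y X"] C(2)[of "insert n L" "?y X"] C(1) by (cases "merge_event Tm T N n L X") (auto simp: D_def)
  thus "AE X in ?M. norm (D n L X) \<le> 2 * C" by simp
 qed
 have Di0: "(\<integral>X. of_bool (n \<notin> L) * D n L X \<partial>?M) = 0" if "n < N" "L \<in> \<L>" for n L
 proof (cases "n \<in> L")
  case False
  thus ?thesis using expectation_merge_step[of N x, OF x T that(1) False] that(2) by (simp add: D_def \<L>_def)
 qed simp
 have pm: "(%X. pfaff (map (%i. X i T) [0..<N])) \<in> borel_measurable ?M"
 proof -
  have "(%X. pfaff (map (%h. h X) (map (%i X. X i T) [0..<N]))) \<in> borel_measurable ?M"
   by (rule pfaff_measurable) (use PM(4) in auto)
  thus ?thesis by (simp add: comp_def)
 qed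
 obtain C' where C': "\<And>xs. length xs = N ==> \<bar>pfaff xs\<bar> \<le> C'" using pfaff_bounded[of N] by auto
 have pi: "integrable ?M (%X. pfaff (map (%i. X i T) [0..<N]))"
  by (rule P.integrable_const_bound[where B=C', OF _ pm]) (use C' in simp)
 have "(\<integral>X. pfaff (map (%i. merging Tm X i T) [0..<N]) \<partial>?M) =
   (\<integral>X. pfaff (map (%i. X i T) [0..<N]) + (\<Sum>n<N. \<Sum>L\<in>\<L>. of_bool (n \<notin> L) * D n L X) \<partial>?M)"
  by (rule Bochner_Integration.integral_cong[OF refl]) (use key in \<open>simp add: algebra_simps\<close>)
 also have "... = (\<integral>X. pfaff (map (%i. X i T) [0..<N]) \<partial>?M) + (\<Sum>n<N. \<Sum>L\<in>\<L>. (\<integral>X. of_bool (n \<notin> L) * D n L X \<partial>?M))"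
  using Di pi by (subst Bochner_Integration.integral_add) (auto simp: Bochner_Integration.integral_sum)
 also have "(\<Sum>n<N. \<Sum>L\<in>\<L>. (\<integral>X. of_bool (n \<notin> L) * D n L X \<partial>?M)) = 0"
  by (intro sum.neutral ballI Di0) auto
 finally show ?thesis by simp
qed

end

declare merging.simps(2) [simp del]

section \<open>Merging and coalescing agree almost surely\<close>

text \<open>
  The order is preserved until the first meeting; holds almost surely for particles started in
  order.
\<close>

definition no_swaps :: "real set => nat => (nat => real => real) => bool" where
 "no_swaps Tm N X \<longleftrightarrow> (\<forall>j<N. \<forall>i<j. \<forall>t\<in>Tm. X j t < X i t \<longrightarrow> (\<exists>u\<in>Tm. u \<le> t \<and> X i u = X j u))"

lemma merging_sorted:
 assumes ns: "no_swaps Tm N X" and "n < N" "i \<le> n" "t \<in> Tm"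
 shows "merging Tm X i t \<le> merging Tm X n t"
 using assms(2-)
proof (induction n arbitrary: i t)
 case 0 thus ?case by simp
next
 case (Suc n)
 have IH: "merging Tm X i t \<le> merging Tm X n t" if "i \<le> n" "t \<in> Tm" for i t using Suc that by simp
 have step: "merging Tm X n t \<le> merging Tm X (Suc n) t" if t: "t \<in> Tm" for t
 proof (cases "merged Tm X (Suc n) t")
  case True thus ?thesis by (subst (2) merging_rec) simp
 next
  case False
  have no: "\<not> X (Suc n) t < merging Tm X n t" if "t \<in> Tm" "\<not> merged Tm X (Suc n) t" for t
   using that
  proof (induction "n - leader {m. \<not> merged Tm X m t} n" arbitrary: t rule: less_induct)
   case less
   let ?L = "%t. {m. \<not> merged Tm X m t}"
   define r where "r = leader (?L t) n"
   have 0: "0 \<in> ?L t" for t by (simp add: merged_def)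
   have r: "\<not> merged Tm X r t" "r \<le> n" using leader_props(1,2)[OF 0, of t n] by (auto simp: r_def)
   show ?case
   proof
    assume lt: "X (Suc n) t < merging Tm X n t"
    hence "X (Suc n) t < X r t" by (simp add: merging_leader r_def)
    then obtain u where u: "u \<in> Tm" "u \<le> t" "X r u = X (Suc n) u"
     using ns Suc(2) r(2) less(2) unfolding no_swaps_def by (metis le_imp_less_Suc)
    have nm: "\<not> merged Tm X (Suc n) u" "\<not> merged Tm X r u" using less(3) r(1) u(2) merged_mono by blast+
    have "merging Tm X r u = X r u" using nm(2) by (subst merging_rec) simp
    hence "X (Suc n) u \<le> merging Tm X n u" using IH[OF r(2) u(1)] u(3) by simp
    moreover have ne: "X (Suc n) u \<noteq> merging Tm X n u" using nm(1) u(1) by (auto simp: merged_def)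
    ultimately have lt': "X (Suc n) u < merging Tm X n u" by simp
    have "r \<le> leader (?L u) n" using leader_props(3)[OF 0] nm(2) r(2) by auto
    moreover have "leader (?L u) n \<noteq> r" using ne u(3) unfolding merging_leader by auto
    ultimately have "n - leader (?L u) n < n - leader (?L t) n"
     using leader_props(2)[OF 0, of u n] by (simp add: r_def[symmetric])
    from less(1)[OF this u(1) nm(1)] lt' show False by simp
   qed
  qed
  show ?thesis using no[OF t False] False by (subst (2) merging_rec) simp
 qed
 show ?case
 proof (cases "i = Suc n")
  case False
  thus ?thesis using IH[of i t] step[of t] Suc(3,4) by auto
 qed simp
qed

lemma merging_stays_merged:
 assumes ns: "no_swaps Tm N X" and "j < N" "i \<le> j" "s \<in> Tm" "s \<le> t"
  and eq: "merging Tm X i s = merging Tm X j s"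
 shows "merging Tm X i t = merging Tm X j t"
 using assms(2-)
proof (induction j)
 case 0 thus ?case by simp
next
 case (Suc j)
 show ?case
 proof (cases "i = Suc j")
  case False
  hence ij: "i \<le> j" using Suc by auto
  have e: "merging Tm X i s = merging Tm X j s" "merging Tm X j s = merging Tm X (Suc j) s"
   using merging_sorted[OF ns, of j i s] merging_sorted[OF ns, of "Suc j" j s] Suc ij by auto
  have "merged Tm X (Suc j) s"
  proof (rule ccontr)
   assume "\<not> merged Tm X (Suc j) s"
   hence "merging Tm X (Suc j) s = X (Suc j) s" by (subst merging_rec) simp
   with e(2) Suc(4) \<open>\<not> merged Tm X (Suc j) s\<close> show False by (auto simp: merged_def)
  qed
  hence "merged Tm X (Suc j) t" using Suc merged_mono by blast
  hence "merging Tm X (Suc j) t = merging Tm X j t" by (subst merging_rec) simp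
  thus ?thesis using Suc e(1) ij by simp
 qed simp
qed

text \<open>
  Without swaps the first particle that \<open>n\<close> meets among its predecessors already
  moves with the left neighbour of \<open>n\<close>.
\<close>

lemma coalesce_eq_merging:
 assumes adm: "admissible_setting S Tm" and ns: "no_swaps Tm N X" and path: "\<And>i. i < N ==> X i \<in> skip_free_paths S Tm"
  and "n \<le> N" "i < n" "t \<in> Tm"
 shows "coalesce Tm X n i t = merging Tm X i t"
 using assms(4-)
proof (induction n arbitrary: i t)
 case 0 thus ?case by simp
next
 case (Suc n)
 let ?Z = "coalesce Tm X n"
 have Z: "?Z j s = merging Tm X j s" if "j < n" "s \<in> Tm" for j s using Suc that by simp
 show ?case
 proof (cases "i = n")
  case False thus ?thesis using Z Suc by (auto simp: Let_def)
 next
  case True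
  let ?H = "{s \<in> Tm. \<exists>j<n. ?Z j s = X n s}"
  have n: "n < N" using Suc by simp
  have Hm: "merged Tm X n s" if s: "s \<in> ?H" for s
  proof -
   obtain j where j: "j < n" "merging Tm X j s = X n s" using s Z by auto
   show ?thesis
   proof (rule ccontr)
    assume nm: "\<not> merged Tm X n s"
    hence "merging Tm X n s = X n s" by (subst merging_rec) simp
    moreover have "merging Tm X j s \<le> merging Tm X (n - 1) s" "merging Tm X (n - 1) s \<le> merging Tm X n s"
     using merging_sorted[OF ns, of "n - 1" j s] merging_sorted[OF ns, of n "n - 1" s] j n s by auto
    ultimately have "merging Tm X (n - 1) s = X n s" using j by simp
    thus False using nm j s by (auto simp: merged_def)
   qed
  qed
  have mH: "\<exists>s'\<in>?H. s' \<le> s" if m: "merged Tm X n s" for s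
  proof -
   obtain s' where "s' \<in> Tm" "s' \<le> s" "X n s' = merging Tm X (n - 1) s'" "0 < n" using m by (auto simp: merged_def)
   thus ?thesis using Z[of "n - 1" s'] by (intro bexI[of _ s']) (auto intro!: exI[of _ "n - 1"])
  qed
  have fol: "coalesce Tm X (Suc n) n t = (if \<exists>s\<in>?H. s \<le> t then ?Z (LEAST j. j < n \<and> ?Z j (Inf ?H) = X n (Inf ?H)) t else X n t)"
   using \<open>t \<in> Tm\<close> by (simp add: Let_def follow_def)
  show ?thesis
  proof (cases "merged Tm X n t")
   case False
   hence "\<not> (\<exists>s\<in>?H. s \<le> t)" using Hm merged_mono by blast
   hence "coalesce Tm X (Suc n) n t = X n t" unfolding fol by (rule if_not_P)
   thus ?thesis using False True by (subst merging_rec) simp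
  next
   case True': True
   let ?v = "%s. X n s - merging Tm X (n - 1) s"
   have rv: "regular_path Tm ?v"
    by (rule nice_path_diff[OF nice_path_skip_free[OF adm] nice_path_merging[OF adm]]) (use path n in auto)
   have ex: "\<exists>s\<in>Tm. ?v s = 0" and n0: "0 < n" using True' by (auto simp: merged_def)
   define \<tau> where "\<tau> = Inf {s\<in>Tm. ?v s = 0}"
   have \<tau>: "\<tau> \<in> Tm" "?v \<tau> = 0" "\<And>s. s \<in> Tm ==> ?v s = 0 ==> \<tau> \<le> s"
    using Inf_zero_attained[OF adm rv ex] unfolding \<tau>_def by auto
   have \<tau>H: "\<tau> \<in> ?H" using \<tau> Z[of "n - 1" \<tau>] n0 by (auto intro!: exI[of _ "n - 1"])
   have min: "\<tau> \<le> s" if sH: "s \<in> ?H" for s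
   proof -
    have ms: "merged Tm X n s" by (rule Hm[OF sH])
    obtain s' where "s' \<in> Tm" "s' \<le> s" "?v s' = 0" using ms by (auto simp: merged_def)
    thus ?thesis using \<tau>(3) by fastforce
   qed
   have Inf: "Inf ?H = \<tau>" by (rule cInf_eq_minimum[OF \<tau>H min])
   define j where "j = (LEAST j. j < n \<and> ?Z j \<tau> = X n \<tau>)"
   have "\<exists>j. j < n \<and> ?Z j \<tau> = X n \<tau>" using \<tau>H by auto
   hence j: "j < n \<and> ?Z j \<tau> = X n \<tau>" unfolding j_def by (rule LeastI_ex)
   have le: "\<tau> \<le> t" using mH[OF True'] min by fastforce
   have "merging Tm X j \<tau> = merging Tm X (n - 1) \<tau>" using j Z[of j \<tau>] \<tau>(1,2) by simp
   hence "merging Tm X j t = merging Tm X (n - 1) t"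
    by (rule merging_stays_merged[OF ns _ _ \<tau>(1) le, rotated 2]) (use j n in auto)
   moreover have "coalesce Tm X (Suc n) n t = ?Z j t"
    unfolding fol Inf j_def[symmetric] using mH[OF True'] by (rule if_P)
   ultimately have "coalesce Tm X (Suc n) n t = merging Tm X (n - 1) t" using Z[of j t] j \<open>t \<in> Tm\<close> by simp
   thus ?thesis using True True' by (subst merging_rec) simp
  qed
 qed
qed

lemma merging_initial:
 assumes "admissible_setting S Tm"
 shows "merging Tm X n 0 = X n 0"
proof -
 have "merging Tm X (n - 1) 0 = X n 0" if m: "merged Tm X n 0"
 proof -
  obtain s where "s \<in> Tm" "s \<le> 0" "X n s = merging Tm X (n - 1) s" using m by (auto simp: merged_def)
  moreover have "s = 0" using admissible_time(2)[OF assms \<open>s \<in> Tm\<close>] \<open>s \<le> 0\<close> by simp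
  ultimately show ?thesis by simp
 qed
 thus ?thesis by (subst merging_rec) simp
qed

text \<open>
  A particle that starts where its left neighbour starts merges at once and can be left out. This
  allows \<open>b w = a (Suc w)\<close>.
\<close>

lemma merging_subfamily:
 assumes adm: "admissible_setting S Tm" and e0: "e 0 = (0::nat)"
  and e: "\<And>k. Suc k < N' ==> e k < e (Suc k)" and eN: "\<And>k. k < N' ==> e k < N"
  and dup: "\<And>k m. Suc k < N' ==> e k < m ==> m < e (Suc k) ==> X m 0 = X (m - 1) 0"
  and "k < N'" "t \<in> Tm"
 shows "merging Tm X (e k) t = merging Tm (%n. X (e n)) k t"
 using assms(6,7)
proof (induction k arbitrary: t)
 case 0 thus ?case by (simp add: e0)
next
 case (Suc k)
 have lt: "e k < e (Suc k)" using e Suc by simp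
 have stay: "merging Tm X m t = merging Tm X (e k) t" if "e k \<le> m" "m < e (Suc k)" "t \<in> Tm" for m t
  using that
 proof (induction m)
  case 0 thus ?case by simp
 next
  case (Suc m)
  show ?case
  proof (cases "e k = Suc m")
   case False
   hence "X (Suc m) 0 = X m 0" using dup[of k "Suc m"] Suc \<open>Suc k < N'\<close> by auto
   hence "merged Tm X (Suc m) t"
    using merging_initial[OF adm, of X m] admissible_time(1,2)[OF adm] Suc by (auto simp: merged_def intro!: bexI[of _ 0])
   hence "merging Tm X (Suc m) t = merging Tm X m t" by (subst merging_rec) simp
   thus ?thesis using Suc False by simp
  qed simp
 qed
 have prev: "merging Tm X (e (Suc k) - 1) t = merging Tm (%n. X (e n)) k t" if "t \<in> Tm" for t
  using stay[of "e (Suc k) - 1" t] Suc that lt by auto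
 have "merged Tm X (e (Suc k)) t \<longleftrightarrow> merged Tm (%n. X (e n)) (Suc k) t"
  unfolding merged_def using prev lt by auto
 thus ?case
  using prev[OF \<open>t \<in> Tm\<close>] by (subst (1 2) merging_rec) simp
qed

lemma distr_PiM_pair:
 assumes prob: "\<And>k. k \<in> I ==> prob_space (M k)" and ij: "i \<in> I" "j \<in> I" "i \<noteq> j" and fin: "finite I"
 shows "distr (PiM I M) (M i \<Otimes>\<^sub>M M j) (%X. (X i, X j)) = M i \<Otimes>\<^sub>M M j"
proof (rule pair_measure_eqI[symmetric])
 show "sigma_finite_measure (M i)" "sigma_finite_measure (M j)"
  using prob ij prob_space_imp_sigma_finite by auto
 fix A B assume AB: "A \<in> sets (M i)" "B \<in> sets (M j)"
 define M' where "M' k = (if k \<in> I then M k else M i)" for k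
 have pM': "prob_space (M' k)" for k using prob ij by (auto simp: M'_def)
 interpret product_prob_space M'
  unfolding product_prob_space_def product_prob_space_axioms_def product_sigma_finite_def
  using pM' prob_space_imp_sigma_finite by auto
 have MM: "PiM I M = PiM I M'" by (rule PiM_cong) (auto simp: M'_def)
 let ?C = "%k. if k = i then A else if k = j then B else space (M k)"
 have C: "?C k \<in> sets (M' k)" if "k \<in> I" for k using that AB by (auto simp: M'_def)
 have sub: "Pi\<^sub>E I ?C \<subseteq> Pi\<^sub>E I (%k. space (M k))"
  by (rule PiE_mono) (use sets.sets_into_space[OF AB(1)] sets.sets_into_space[OF AB(2)] in auto)
 have "(%X. (X i, X j)) -` (A \<times> B) \<inter> space (PiM I M) = Pi\<^sub>E I ?C"
 proof (intro equalityI subsetI)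
  fix X assume "X \<in> (%X. (X i, X j)) -` (A \<times> B) \<inter> space (PiM I M)"
  thus "X \<in> Pi\<^sub>E I ?C" by (auto simp: space_PiM PiE_iff)
 next
  fix X assume X: "X \<in> Pi\<^sub>E I ?C"
  have "X i \<in> A" "X j \<in> B" using PiE_mem[OF X ij(1)] PiE_mem[OF X ij(2)] ij(3) by auto
  thus "X \<in> (%X. (X i, X j)) -` (A \<times> B) \<inter> space (PiM I M)" using X sub by (auto simp: space_PiM)
 qed
 hence "emeasure (distr (PiM I M) (M i \<Otimes>\<^sub>M M j) (%X. (X i, X j))) (A \<times> B) = emeasure (PiM I M') (Pi\<^sub>E I ?C)"
  using AB ij by (subst emeasure_distr) (auto simp: MM[symmetric])
 also have "... = (\<Prod>k\<in>I. emeasure (M' k) (?C k))" by (rule emeasure_PiM[OF fin C])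
 also have "... = (\<Prod>k\<in>{i, j}. emeasure (M' k) (?C k))"
 proof (rule prod.mono_neutral_right[OF fin])
  show "\<forall>k\<in>I - {i, j}. emeasure (M' k) (?C k) = 1"
   using prob by (auto simp: M'_def prob_space.emeasure_space_1)
 qed (use ij in auto)
 also have "... = emeasure (M i) A * emeasure (M j) B" using ij by (simp add: M'_def)
 finally show "emeasure (M i) A * emeasure (M j) B = emeasure (distr (PiM I M) (M i \<Otimes>\<^sub>M M j) (%X. (X i, X j))) (A \<times> B)" ..
qed simp

lemma pred_eq_borel:
 fixes f g :: "'a => real"
 assumes "f \<in> borel_measurable M" "g \<in> borel_measurable M" shows "Measurable.pred M (%x. f x = g x)"
 unfolding pred_def by (rule borel_measurable_eq[OF assms])

text \<open>
  The map \<open>f\<close> need not be measurable: that its law is a probability measure makes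
  preimages measurable enough for the law of \<open>U\<close> to be read off from an almost surely
  equal measurable event. It is used for the coalescing map.
\<close>

lemma emeasure_distr_AE:
 assumes P: "prob_space (distr Q N f)" and U: "U \<in> sets N" and Q: "prob_space Q"
  and G: "G \<in> sets Q" and AE: "AE X in Q. f X \<in> space N \<longrightarrow> (f X \<in> U \<longleftrightarrow> X \<in> G)"
 shows "emeasure (distr Q N f) U = emeasure Q G"
proof -
 interpret Q: prob_space Q by (rule Q)
 interpret P: prob_space "distr Q N f" by (rule P)
 let ?\<mu> = "%A. emeasure Q (f -` A \<inter> space Q)"
 have conv: "emeasure (distr Q N f) A = (if A \<in> sets N \<and> measure_space (space N) (sets N) ?\<mu> then ?\<mu> A else 0)" for A
  unfolding distr_def by (subst emeasure_measure_of_conv) (simp add: sets.sigma_sets_eq)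
 have ms: "measure_space (space N) (sets N) ?\<mu>"
  using P.emeasure_space_1 conv[of "space N"] by (auto split: if_splits)
 have e: "emeasure (distr Q N f) A = ?\<mu> A" if "A \<in> sets N" for A using conv that ms by simp
 have "?\<mu> (space N) = 1" using e[of "space N"] P.emeasure_space_1 by simp
 moreover from this have "f -` space N \<inter> space Q \<in> sets Q" using emeasure_notin_sets by fastforce
 ultimately have "AE X in Q. X \<in> f -` space N \<inter> space Q" by (simp add: Q.emeasure_eq_1_AE[symmetric] Q.emeasure_eq_measure Q.prob_eq_1)
 with AE have AE': "AE X in Q. X \<in> space Q \<and> (f X \<in> U \<longleftrightarrow> X \<in> G)" by eventually_elim auto
 show ?thesis
 proof (cases "f -` U \<inter> space Q \<in> sets Q")
  case True
  have "?\<mu> U = emeasure Q G"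
   by (rule emeasure_eq_AE[OF _ True G]) (use AE' in eventually_elim, auto)
  thus ?thesis using e[OF U] by simp
 next
  case False
  hence 0: "emeasure (distr Q N f) U = 0" using e[OF U] by (simp add: emeasure_notin_sets)
  have Uc: "space N - U \<in> sets N" using U by auto
  have "emeasure (distr Q N f) (space N - U) = 1"
   using P.emeasure_space_1 emeasure_compl[of U "distr Q N f"] U 0 by simp
  hence "1 = ?\<mu> (space N - U)" using e[OF Uc] by simp
  also have "... \<le> emeasure Q (space Q - G)"
  proof (rule emeasure_mono_AE)
   show "AE X in Q. X \<in> f -` (space N - U) \<inter> space Q \<longrightarrow> X \<in> space Q - G"
    using AE' by eventually_elim auto
  qed (use G in auto)
  finally have "1 \<le> measure Q (space Q - G)" by (simp add: Q.emeasure_eq_measure)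
  hence "measure Q G = 0" using Q.prob_compl[OF G] measure_nonneg[of Q G] by simp
  thus ?thesis using 0 by (simp add: Q.emeasure_eq_measure)
 qed
qed

context skip_free_process begin

lemma AE_start:
 assumes "x \<in> I \<rightarrow> S" "finite I" shows "AE X in PiM I (%i. K 0 (x i)). \<forall>i\<in>I. X i 0 = x i"
proof (rule AE_finite_allI[OF assms(2)])
 fix i assume i: "i \<in> I"
 note z = admissible_time(1)[OF setting]
 show "AE X in PiM I (%i. K 0 (x i)). X i 0 = x i"
  by (rule AE_PiM_component[OF PiM_paths(2)[OF assms(1)] i]) (use start[OF z] assms i in auto)
qed

lemma AE_no_swap_pair:
 assumes x: "x \<in> I \<rightarrow> S" and I: "finite I" "i \<in> I" "j \<in> I" "i \<noteq> j" and le: "x i \<le> x j"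
 shows "AE X in PiM I (%i. K 0 (x i)). \<forall>t\<in>Tm. X j t < X i t \<longrightarrow> (\<exists>u\<in>Tm. u \<le> t \<and> X i u = X j u)"
proof (cases "x i = x j")
 case True
 from AE_start[OF x I(1)] show ?thesis
  by eventually_elim (use I True admissible_time(1,2)[OF setting] in \<open>auto intro!: bexI[of _ 0]\<close>)
next
 case False
 let ?M = "%i. K 0 (x i)"
 have xS: "x i \<in> S" "x j \<in> S" using x I by auto
 have m: "(%X. (X i, X j)) \<in> PiM I ?M \<rightarrow>\<^sub>M ?M i \<Otimes>\<^sub>M ?M j" using I by measurable
 have "AE p in ?M i \<Otimes>\<^sub>M ?M j. case p of (f, g) => \<forall>t\<in>Tm. g t < f t \<longrightarrow> (\<exists>u\<in>Tm. u \<le> t \<and> f u = g u)"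
  using no_swap[OF admissible_time(1)[OF setting] xS] False le by simp
 hence "AE p in distr (PiM I ?M) (?M i \<Otimes>\<^sub>M ?M j) (%X. (X i, X j)). case p of (f, g) => \<forall>t\<in>Tm. g t < f t \<longrightarrow> (\<exists>u\<in>Tm. u \<le> t \<and> f u = g u)"
  by (subst distr_PiM_pair[OF PiM_paths(2)[OF x] I(2-4,1)])
 from AE_distrD[OF m this] show ?thesis by simp
qed

lemma AE_no_swaps:
 assumes x: "x \<in> {..<N} \<rightarrow> S" and mono: "mono_on {..<N} x"
 shows "AE X in PiM {..<N} (%i. K 0 (x i)). no_swaps Tm N X"
proof -
 have "AE X in PiM {..<N} (%i. K 0 (x i)). \<forall>j\<in>{..<N}. \<forall>i\<in>{..<j}. \<forall>t\<in>Tm. X j t < X i t \<longrightarrow> (\<exists>u\<in>Tm. u \<le> t \<and> X i u = X j u)"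
  by (intro AE_finite_allI finite_lessThan AE_no_swap_pair[OF x]) (use mono_onD[OF mono] in auto)
 thus ?thesis by eventually_elim (auto simp: no_swaps_def)
qed

text \<open>
  Merged particles are sorted, and on sorted lists the Pfaffian is the indicator of coalesced
  pairs.
\<close>

lemma prob_pairs_merged:
 assumes x: "x \<in> {..<N} \<rightarrow> S" and mono: "mono_on {..<N} x" and T: "T \<in> Tm" and N: "even N"
 shows "(\<integral>X. pfaff (map (%i. X i T) [0..<N]) \<partial>PiM {..<N} (%i. K 0 (x i))) =
   measure (PiM {..<N} (%i. K 0 (x i)))
    {X \<in> space (PiM {..<N} (%i. K 0 (x i))). \<forall>j<N div 2. merging Tm X (2 * j) T = merging Tm X (2 * j + 1) T}"
  and "{X \<in> space (PiM {..<N} (%i. K 0 (x i))). \<forall>j<N div 2. merging Tm X (2 * j) T = merging Tm X (2 * j + 1) T} \<in> sets (PiM {..<N} (%i. K 0 (x i)))"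
proof -
 let ?M = "PiM {..<N} (%i. K 0 (x i))"
 let ?P = "%X. \<forall>j<N div 2. merging Tm X (2 * j) T = merging Tm X (2 * j + 1) T"
 have mm: "(%X. merging Tm X i T) \<in> borel_measurable ?M" if "i < N" for i
  by (rule merging_measurable(1)[OF setting, of i T]) (use that PiM_paths[OF x] T in auto)
 have pP: "Measurable.pred ?M ?P"
 proof -
  have "Measurable.pred ?M (%X. \<forall>j\<in>{..<N div 2}. merging Tm X (2 * j) T = merging Tm X (2 * j + 1) T)"
  proof (rule pred_intros_finite(3))
   fix j assume "j \<in> {..<N div 2}"
   hence "2 * j < N" "2 * j + 1 < N" by auto
   from mm[OF this(1)] mm[OF this(2)] show "Measurable.pred ?M (%X. merging Tm X (2 * j) T = merging Tm X (2 * j + 1) T)"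
    by (rule pred_eq_borel)
  qed simp
  thus ?thesis by (simp only: Ball_def lessThan_iff)
 qed
 show s: "{X \<in> space ?M. ?P X} \<in> sets ?M" using pP by (simp only: pred_def)
 have pm: "(%X. pfaff (map (%i. merging Tm X i T) [0..<N])) \<in> borel_measurable ?M"
 proof -
  have "(%X. pfaff (map (%h. h X) (map (%i X. merging Tm X i T) [0..<N]))) \<in> borel_measurable ?M"
   by (rule pfaff_measurable) (use mm in auto)
  thus ?thesis by (simp add: comp_def)
 qed
 have "(\<integral>X. pfaff (map (%i. X i T) [0..<N]) \<partial>?M) = (\<integral>X. pfaff (map (%i. merging Tm X i T) [0..<N]) \<partial>?M)"
  by (rule expectation_merging[symmetric]) (use x T in auto)
 also have "... = (\<integral>X. indicator {X \<in> space ?M. ?P X} X \<partial>?M)"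
 proof (rule integral_cong_AE[OF pm])
  show "AE X in ?M. pfaff (map (%i. merging Tm X i T) [0..<N]) = indicator {X \<in> space ?M. ?P X} X"
   using AE_no_swaps[OF x mono] AE_space
  proof eventually_elim
   fix X assume ns: "no_swaps Tm N X" and X: "X \<in> space ?M"
   have "sorted (map (%i. merging Tm X i T) [0..<N])"
    using merging_sorted[OF ns _ _ T] by (auto simp: sorted_iff_nth_mono)
   from pfaff_sorted[OF this] show "pfaff (map (%i. merging Tm X i T) [0..<N]) = indicator {X \<in> space ?M. ?P X} X"
    using N X by (auto simp: indicator_def)
  qed
 qed (rule borel_measurable_indicator[OF s])
 also have "... = measure ?M ({X \<in> space ?M. ?P X} \<inter> space ?M)" by (rule Bochner_Integration.integral_indicator)
 also have "{X \<in> space ?M. ?P X} \<inter> space ?M = {X \<in> space ?M. ?P X}" by blast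
 finally show "(\<integral>X. pfaff (map (%i. X i T) [0..<N]) \<partial>?M) = measure ?M {X \<in> space ?M. ?P X}" .
qed

text \<open>
  The law of the coalescing system is given for distinct starting points, so repeated starting
  points are first removed and then restored on the side of the independent paths.
\<close>

lemma prob_pairs_coalesced:
 assumes cs: "coalescing_system S Tm K M Y"
  and x: "x \<in> {..<N} \<rightarrow> S" and mono: "mono_on {..<N} x" and T: "T \<in> Tm" and N: "even N"
 shows "measure M {\<omega> \<in> space M. \<forall>j<N div 2. Y (x (2 * j)) \<omega> T = Y (x (2 * j + 1)) \<omega> T} =
   (\<integral>X. pfaff (map (%i. X i T) [0..<N]) \<partial>PiM {..<N} (%i. K 0 (x i)))"
proof (cases "N = 0")
 case True
 interpret coalescing_system S Tm K M Y by (rule cs)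
 interpret E: prob_space "PiM {..<0::nat} (%i. K 0 (x i))" by (rule prob_space_PiM) auto
 show ?thesis using prob_space E.prob_space by (simp add: True)
next
 case False
 interpret coalescing_system S Tm K M Y by (rule cs)
 let ?Q = "PiM {..<N} (%i. K 0 (x i))"
 interpret Q: prob_space ?Q by (rule prob_space_PiM) (use PiM_paths(2)[OF x] in auto)
 \<comment> \<open>the indices at which a new starting point begins; \<open>e\<close> enumerates them, and \<open>r i\<close> will be the number of the last one up to \<open>i\<close>\<close>
 define D where "D = {i. i < N \<and> (i = 0 \<or> x (i - 1) \<noteq> x i)}"
 define es where "es = sorted_list_of_set D"
 define n where "n = card D"
 define e where "e = (%k. es ! k)"
 have fD: "finite D" and D0: "0 \<in> D" using False by (auto simp: D_def)
 have es: "set es = D" "sorted es" "distinct es" "length es = n" using fD by (auto simp: es_def n_def)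
 have n0: "0 < n" using fD D0 by (auto simp: n_def card_gt_0_iff)
 have eD: "e k \<in> D" if "k < n" for k using that es by (auto simp: e_def)
 have einc: "e k < e l" if "k < l" "l < n" for k l
  using es(2-4) that by (simp add: e_def sorted_wrt_nth_less strict_sorted_iff)
 have eex: "\<exists>k<n. e k = i" if "i \<in> D" for i using that es(1,4) by (auto simp: e_def set_conv_nth)
 have e0: "e 0 = 0"
 proof -
  obtain k where "k < n" "e k = 0" using eex[OF D0] by auto
  thus ?thesis using einc[of 0 k] by (cases "k = 0") auto
 qed
 have eN: "e k < N" if "k < n" for k using eD[OF that] by (auto simp: D_def)
 have notD: "m \<notin> D" if "Suc k < n" "e k < m" "m < e (Suc k)" for k m
 proof
  assume "m \<in> D"
  then obtain l where l: "l < n" "e l = m" using eex by auto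
  have "k < l" using einc[of l k] l that by (cases "l < k"; cases "l = k") auto
  moreover have "l < Suc k" using einc[of "Suc k" l] l that by (cases "Suc k < l"; cases "l = Suc k") auto
  ultimately show False by simp
 qed
 have "\<exists>r. \<forall>i<N. r i < n \<and> e (r i) \<le> i \<and> (\<forall>m. e (r i) < m \<and> m \<le> i \<longrightarrow> m \<notin> D)"
 proof -
  have "\<exists>k. k < n \<and> e k \<le> i \<and> (\<forall>m. e k < m \<and> m \<le> i \<longrightarrow> m \<notin> D)" if "i < N" for i
  proof -
   have p: "leader D i \<in> D" "leader D i \<le> i" "\<And>l. l \<in> D ==> l \<le> i ==> l \<le> leader D i" using leader_props[OF D0] by auto
   obtain k where "k < n" "e k = leader D i" using eex[OF p(1)] by auto
   thus ?thesis using p by (intro exI[of _ k]) force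
  qed
  thus ?thesis by metis
 qed
 then obtain r where r: "\<And>i. i < N ==> r i < n" "\<And>i. i < N ==> e (r i) \<le> i"
  "\<And>i m. i < N ==> e (r i) < m ==> m \<le> i ==> m \<notin> D" by blast
 have xr: "x (e (r i)) = x i" if i: "i < N" for i
 proof -
  have "x m = x (e (r i))" if "e (r i) \<le> m" "m \<le> i" for m
   using that
  proof (induction m)
   case (Suc m)
   show ?case
   proof (cases "e (r i) = Suc m")
    case False
    hence "x m = x (Suc m)" using r(3)[OF i, of "Suc m"] Suc(2,3) i by (auto simp: D_def)
    thus ?thesis using Suc False by simp
   qed simp
  qed simp
  from this[OF r(2)[OF i] order_refl] show ?thesis by (rule sym)
 qed
 define x' where "x' = (%k. x (e k))"
 have x'S: "x' \<in> {..<n} \<rightarrow> S" using x eN by (auto simp: x'_def)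
 have x'mono: "strict_mono_on {..<n} x'"
 proof (rule strict_mono_onI)
  fix k l assume kl: "k \<in> {..<n}" "l \<in> {..<n}" "k < l"
  have l: "e l \<in> D" "e l \<noteq> 0" "e k \<le> e l - 1" "e l < N" using kl einc[of k l] eD[of l] eN[of l] by auto
  have "x (e l - 1) \<le> x (e l)" by (rule mono_onD[OF mono]) (use l in auto)
  moreover have "x (e l - 1) \<noteq> x (e l)" using l by (auto simp: D_def)
  ultimately have "x (e l - 1) < x (e l)" by simp
  moreover have "x (e k) \<le> x (e l - 1)" using mono_onD[OF mono, of "e k" "e l - 1"] l by auto
  ultimately show "x' k < x' l" by (simp add: x'_def)
 qed
 let ?Q' = "PiM {..<n} (%k. K 0 (x' k))" and ?PP = "PiM {..<n} (%_. path_space S Tm)"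
 interpret Q': prob_space ?Q' by (rule prob_space_PiM) (use PiM_paths(2)[OF x'S] in auto)
 note lw = law[OF x'S x'mono]
 let ?f = "%X. \<lambda>i\<in>{..<n}. coalesce Tm X n i" and ?y = "%\<omega>. \<lambda>i\<in>{..<n}. Y (x' i) \<omega>"
 have ym: "?y \<in> M \<rightarrow>\<^sub>M ?PP"
  by (rule measurable_restrict) (use path_measurable x'S in auto)
 define U where "U = {Z \<in> space ?PP. \<forall>j<N div 2. Z (r (2 * j)) T = Z (r (2 * j + 1)) T}"
 have rj: "r (2 * j) < n" "r (2 * j + 1) < n" "2 * j < N" "2 * j + 1 < N" if "j < N div 2" for j
  using that r(1)[of "2 * j"] r(1)[of "2 * j + 1"] by auto
 have U: "U \<in> sets ?PP"
 proof -
  have "Measurable.pred ?PP (%Z. \<forall>j\<in>{..<N div 2}. Z (r (2 * j)) T = Z (r (2 * j + 1)) T)"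
  proof (rule pred_intros_finite(3))
   fix j assume "j \<in> {..<N div 2}"
   hence j: "j < N div 2" by simp
   have "(%Z. Z (r (2 * j)) T) \<in> borel_measurable ?PP" "(%Z. Z (r (2 * j + 1)) T) \<in> borel_measurable ?PP"
    by (rule measurable_compose[OF _ path_eval_measurable], rule measurable_component_singleton, use rj[OF j] in simp)+
   thus "Measurable.pred ?PP (%Z. Z (r (2 * j)) T = Z (r (2 * j + 1)) T)"
    by (rule pred_eq_borel)
  qed simp
  thus ?thesis by (simp only: U_def pred_def Ball_def lessThan_iff)
 qed
 define G where "G = {X \<in> space ?Q'. \<forall>j<N div 2. merging Tm X (r (2 * j)) T = merging Tm X (r (2 * j + 1)) T}"
 have mm: "(%X. merging Tm X i T) \<in> borel_measurable ?Q'" if "i < n" for i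
  by (rule merging_measurable(1)[OF setting, of i T]) (use that PiM_paths[OF x'S] T in auto)
 have G: "G \<in> sets ?Q'"
 proof -
  have "Measurable.pred ?Q' (%X. \<forall>j\<in>{..<N div 2}. merging Tm X (r (2 * j)) T = merging Tm X (r (2 * j + 1)) T)"
  proof (rule pred_intros_finite(3))
   fix j assume "j \<in> {..<N div 2}"
   hence j: "j < N div 2" by simp
   from mm[OF rj(1)[OF j]] mm[OF rj(2)[OF j]]
   show "Measurable.pred ?Q' (%X. merging Tm X (r (2 * j)) T = merging Tm X (r (2 * j + 1)) T)"
    by (rule pred_eq_borel)
  qed simp
  thus ?thesis by (simp only: G_def pred_def Ball_def lessThan_iff)
 qed
 have "measure M {\<omega> \<in> space M. \<forall>j<N div 2. Y (x (2 * j)) \<omega> T = Y (x (2 * j + 1)) \<omega> T} = measure (distr M ?PP ?y) U"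
 proof -
  have "{\<omega> \<in> space M. \<forall>j<N div 2. Y (x (2 * j)) \<omega> T = Y (x (2 * j + 1)) \<omega> T} = ?y -` U \<inter> space M"
  proof -
   have "?y \<omega> (r i) = Y (x i) \<omega>" if "i < N" for i \<omega> using r(1)[OF that] xr[OF that] by (simp add: x'_def)
   thus ?thesis using rj(3,4) measurable_space[OF ym] by (auto simp: U_def)
  qed
  thus ?thesis using measure_distr[OF ym U] by simp
 qed
 also have "... = measure ?Q' G"
 proof -
  have P: "prob_space (distr ?Q' ?PP ?f)"
   using prob_space_distr[OF ym] unfolding lw .
  have AE: "AE X in ?Q'. ?f X \<in> space ?PP \<longrightarrow> (?f X \<in> U) = (X \<in> G)"
   using AE_no_swaps[OF x'S strict_mono_on_imp_mono_on[OF x'mono]] AE_space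
  proof eventually_elim
   case (elim X)
   have f: "?f X i T = merging Tm X i T" if "i < n" for i
   proof -
    have "coalesce Tm X n i T = merging Tm X i T"
     by (rule coalesce_eq_merging[OF setting elim(1) PiM_paths(1)[OF x'S elim(2)] order_refl that T]) simp
    thus ?thesis using that by simp
   qed
   have "?f X (r (2 * j)) T = ?f X (r (2 * j + 1)) T \<longleftrightarrow> merging Tm X (r (2 * j)) T = merging Tm X (r (2 * j + 1)) T"
    if "j < N div 2" for j
    by (simp only: f[OF rj(1)[OF that]] f[OF rj(2)[OF that]])
   thus ?case using elim(2) unfolding U_def G_def mem_Collect_eq by blast
  qed
  have "emeasure (distr ?Q' ?PP ?f) U = emeasure ?Q' G"
   by (rule emeasure_distr_AE[where Q="?Q'" and N="?PP" and f="?f" and U=U and G=G, OF P U Q'.prob_space_axioms G AE])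
  thus ?thesis unfolding lw by (simp add: measure_def)
 qed
 also have "... = measure ?Q {X \<in> space ?Q. \<forall>j<N div 2. merging Tm X (2 * j) T = merging Tm X (2 * j + 1) T}" (is "_ = measure ?Q ?G0")
 proof -
  have inj: "inj_on e {..<n}" using einc by (auto simp: inj_on_def) (metis linorder_neqE_nat nat_neq_iff)
  let ?e = "%X. \<lambda>k\<in>{..<n}. X (e k)"
  have d: "distr ?Q ?Q' ?e = ?Q'"
   unfolding x'_def
   by (rule distr_PiM_reindex[where M="%i. K 0 (x i)"]) (use PiM_paths(2)[OF x] inj eN in auto)
  have em: "?e \<in> ?Q \<rightarrow>\<^sub>M ?Q'"
   by (rule measurable_restrict) (use eN in \<open>auto simp: x'_def\<close>)
  have "measure ?Q' G = measure (distr ?Q ?Q' ?e) G" by (simp only: d)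
  also have "... = measure ?Q (?e -` G \<inter> space ?Q)" by (rule measure_distr[OF em G])
  also have "... = measure ?Q ?G0"
  proof (rule measure_eq_AE)
   show "AE X in ?Q. X \<in> ?e -` G \<inter> space ?Q \<longleftrightarrow> X \<in> ?G0"
    using AE_no_swaps[OF x mono] AE_start[OF x finite_lessThan] AE_space
   proof eventually_elim
    case (elim X)
    have "merging Tm X i t = merging Tm (%k. X (e k)) (r i) t" if i: "i < N" and t: "t \<in> Tm" for i t
    proof -
     have dup: "X m 0 = X (m - 1) 0" if "m \<notin> D" "m < N" "0 < m" for m
      using that elim(2) by (auto simp: D_def)
     have "merging Tm X (e (r i)) t = merging Tm (%k. X (e k)) (r i) t"
     proof (rule merging_subfamily[where e=e and N'=n and N=N and X=X, OF setting e0])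
      show "X m 0 = X (m - 1) 0" if "Suc k < n" "e k < m" "m < e (Suc k)" for k m
       using notD[OF that] that eN[of "Suc k"] by (intro dup) auto
      show "e k < e (Suc k)" if "Suc k < n" for k by (rule einc[OF lessI that])
     qed (fact eN, fact r(1)[OF i], fact t)
     moreover have "merging Tm X (e (r i)) t = merging Tm X i t"
     proof (rule merging_stays_merged[OF elim(1) i r(2)[OF i] admissible_time(1)[OF setting] admissible_time(2)[OF setting t]])
      show "merging Tm X (e (r i)) 0 = merging Tm X i 0"
       unfolding merging_initial[OF setting] using elim(2) xr[OF i] eN[OF r(1)[OF i]] i by simp
     qed
     ultimately show ?thesis by simp
    qed
    moreover have "merging Tm (?e X) k T = merging Tm (%k. X (e k)) k T" if "k < n" for k
    proof -
     have "merging Tm A k = merging Tm B k" if "\<And>i. i \<le> k ==> A i = B i" for A B :: "nat => real => real"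
      using that
     proof (induction k)
      case (Suc k)
      hence "merging Tm A k = merging Tm B k" "A (Suc k) = B (Suc k)" by auto
      thus ?case unfolding merging.simps(2) by (simp only:)
     qed simp
     from this[of "?e X" "%k. X (e k)"] that show ?thesis by auto
    qed
    ultimately have c: "merging Tm X i T = merging Tm (?e X) (r i) T" if "i < N" for i
     using that r(1)[OF that] T by metis
    have "(\<forall>j<N div 2. merging Tm (?e X) (r (2 * j)) T = merging Tm (?e X) (r (2 * j + 1)) T) \<longleftrightarrow>
      (\<forall>j<N div 2. merging Tm X (2 * j) T = merging Tm X (2 * j + 1) T)"
     by (intro all_cong) (simp only: c[OF rj(3)] c[OF rj(4)])
    thus ?case
     by (simp only: vimage_eq Int_iff G_def mem_Collect_eq elim(3) measurable_space[OF em elim(3)] simp_thms)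
   qed
  qed (rule measurable_sets[OF em G], rule prob_pairs_merged(2)[OF x mono T N])
  finally show ?thesis .
 qed
 also have "... = (\<integral>X. pfaff (map (%i. X i T) [0..<N]) \<partial>?Q)"
  by (rule prob_pairs_merged(1)[OF x mono T N, symmetric])
 finally show ?thesis .
qed

end

section \<open>Signs of matchings\<close>

text \<open>
  Signs of permutations are computed as products of these over pairs; unlike a count of inversions
  such a product is easy to rearrange.
\<close>

definition before_sign :: "nat => nat => int" where "before_sign u v = (if u < v then 1 else - 1)"

lemma before_sign_swap: "u \<noteq> v ==> before_sign u v = - before_sign v u"
 by (auto simp: before_sign_def)

definition pairs_below :: "nat set => (nat \<times> nat) set" where "pairs_below V = {(i, j). i \<in> V \<and> j \<in> V \<and> i < j}"

lemma finite_pairs_below: "finite V ==> finite (pairs_below V)"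
 by (rule finite_subset[of _ "V \<times> V"]) (auto simp: pairs_below_def)

lemma prod_pairs_below_permute:
 fixes h :: "nat => nat => 'a :: comm_monoid_mult"
 assumes q: "q permutes V" and sym: "\<And>u v. u \<in> V ==> v \<in> V ==> h u v = h v u"
 shows "(\<Prod>(i, j)\<in>pairs_below V. h (q i) (q j)) = (\<Prod>(i, j)\<in>pairs_below V. h i j)"
proof -
 let ?o = "%u v. (min u v, max u v) :: nat \<times> nat"
 have q': "inv q permutes V" by (rule permutes_inv[OF q])
 have in': "q i \<in> V \<longleftrightarrow> i \<in> V" "inv q i \<in> V \<longleftrightarrow> i \<in> V" for i
  using permutes_in_image[OF q] permutes_in_image[OF q'] by auto
 have c: "inv q (q i) = i" "q (inv q i) = i" for i using permutes_inverses[OF q] by auto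
 have neq: "\<not> q i < q j ==> q j < q i" "\<not> inv q i < inv q j ==> inv q j < inv q i" if "i < j" for i j
  using c that by (metis nat_neq_iff)+
 have neq': "q i \<noteq> q j" "inv q i \<noteq> inv q j" if "i < j" for i j
  using c that by (metis nat_neq_iff)+
 show ?thesis
 proof (rule prod.reindex_bij_witness[where j="%(i, j). ?o (q i) (q j)" and i="%(i, j). ?o (inv q i) (inv q j)"])
  fix a assume a: "a \<in> pairs_below V"
  show "(case case a of (i, j) => ?o (q i) (q j) of (i, j) => ?o (inv q i) (inv q j)) = a"
   using a by (auto simp: pairs_below_def min_def max_def c)
  show "(case a of (i, j) => ?o (q i) (q j)) \<in> pairs_below V"
   using a neq neq' in' by (auto simp: pairs_below_def min_def max_def le_less)
  show "(case case a of (i, j) => ?o (q i) (q j) of (i, j) => h i j) = (case a of (i, j) => h (q i) (q j))"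
   using a in' sym by (auto simp: pairs_below_def min_def max_def)
 next
  fix b assume b: "b \<in> pairs_below V"
  show "(case case b of (i, j) => ?o (inv q i) (inv q j) of (i, j) => ?o (q i) (q j)) = b"
   using b by (auto simp: pairs_below_def min_def max_def c)
  show "(case b of (i, j) => ?o (inv q i) (inv q j)) \<in> pairs_below V"
   using b neq neq' in' by (auto simp: pairs_below_def min_def max_def le_less)
 qed
qed

definition inversion_sign :: "nat set => (nat => nat) => int" where
 "inversion_sign V p = (\<Prod>(i, j)\<in>pairs_below V. before_sign (p i) (p j))"

lemma inversion_sign_compose:
 assumes p: "p permutes V" and q: "q permutes V"
 shows "inversion_sign V (p \<circ> q) = inversion_sign V p * inversion_sign V q"
proof -
 let ?h = "%u v. before_sign (p u) (p v) * before_sign u v"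
 have sym: "?h u v = ?h v u" for u v
 proof (cases "u = v")
  case False
  hence "p u \<noteq> p v" using permutes_inj[OF p] by (auto dest: injD)
  with False show ?thesis by (auto simp: before_sign_def)
 qed simp
 have id: "(\<Prod>(i, j)\<in>pairs_below V. ?h i j) = inversion_sign V p"
  unfolding inversion_sign_def by (rule prod.cong) (auto simp: pairs_below_def before_sign_def)
 have "inversion_sign V (p \<circ> q) = (\<Prod>(i, j)\<in>pairs_below V. ?h (q i) (q j) * before_sign (q i) (q j))"
  unfolding inversion_sign_def by (rule prod.cong) (auto simp: before_sign_def)
 also have "... = (\<Prod>(i, j)\<in>pairs_below V. ?h (q i) (q j)) * inversion_sign V q"
  unfolding inversion_sign_def by (simp add: case_prod_unfold prod.distrib)
 also have "(\<Prod>(i, j)\<in>pairs_below V. ?h (q i) (q j)) = inversion_sign V p"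
  unfolding id[symmetric] by (rule prod_pairs_below_permute[OF q]) (rule sym)
 finally show ?thesis .
qed

lemma inversion_sign_transpose:
 assumes V: "finite V" and ab: "a \<in> V" "b \<in> V" "a < b"
 shows "inversion_sign V (Transposition.transpose a b) = - 1"
proof -
 let ?m = "{c \<in> V. a < c \<and> c < b}"
 let ?B = "Pair a ` insert b ?m \<union> (%c. (c, b)) ` ?m"
 have BV: "?B \<subseteq> pairs_below V" using ab by (auto simp: pairs_below_def)
 have mem: "(i, j) \<in> ?B \<longleftrightarrow> i = a \<and> j \<le> b \<or> j = b \<and> a < i" if "i \<in> V" "j \<in> V" "i < j" for i j
  using that by auto
 have out: "\<forall>p\<in>pairs_below V - ?B. (case p of (i, j) => before_sign (Transposition.transpose a b i) (Transposition.transpose a b j)) = 1"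
 proof
  fix p assume p: "p \<in> pairs_below V - ?B"
  obtain i j where ij: "p = (i, j)" by (cases p)
  hence "i < j" "\<not> (i = a \<and> j \<le> b \<or> j = b \<and> a < i)" using p mem[of i j] by (auto simp: pairs_below_def)
  thus "(case p of (i, j) => before_sign (Transposition.transpose a b i) (Transposition.transpose a b j)) = 1"
   using ab(3) unfolding ij by (auto simp: before_sign_def Transposition.transpose_def)
 qed
 have inB: "(case p of (i, j) => before_sign (Transposition.transpose a b i) (Transposition.transpose a b j)) = - 1" if "p \<in> ?B" for p
  using that ab(3) by (auto simp: before_sign_def Transposition.transpose_def)
 have "inversion_sign V (Transposition.transpose a b) = (\<Prod>p\<in>?B. - 1)"
  unfolding inversion_sign_def
  by (rule prod.mono_neutral_cong_right[OF finite_pairs_below[OF V] BV out inB])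
 also have "... = (-1) ^ card ?B" by simp
 also have "card ?B = card (Pair a ` insert b ?m) + card ((%c. (c, b)) ` ?m)"
  using V ab by (intro card_Un_disjoint) auto
 also have "card (Pair a ` insert b ?m) = card (insert b ?m)" by (rule card_image) (simp add: inj_on_def)
 also have "card ((%c. (c, b)) ` ?m) = card ?m" by (rule card_image) (simp add: inj_on_def)
 also have "card (insert b ?m) = Suc (card ?m)" using V by (subst card_insert_disjoint) auto
 finally show ?thesis by simp
qed

text \<open>Both sides are multiplicative and agree on transpositions.\<close>

lemma sign_eq_inversion_sign:
 assumes "finite V" "p permutes V" shows "sign p = inversion_sign V p"
 using assms(2,1)
proof (induction p rule: permutes_induct)
 case id
 have "inversion_sign V id = 1"
  unfolding inversion_sign_def by (rule prod.neutral) (auto simp: pairs_below_def before_sign_def)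
 thus ?case by (simp only: sign_id)
next
 case (swap a b p)
 have t: "Transposition.transpose a b permutes V" using swap by (intro permutes_swap_id) auto
 have "inversion_sign V (Transposition.transpose a b) = - 1"
  using inversion_sign_transpose[OF assms(1), of a b] inversion_sign_transpose[OF assms(1), of b a] swap
  by (cases "a < b") (auto simp: transpose_commute)
 hence 1: "inversion_sign V (Transposition.transpose a b \<circ> p) = - inversion_sign V p"
  unfolding inversion_sign_compose[OF t swap(4)] by simp
 have 2: "sign (Transposition.transpose a b \<circ> p) = - sign p"
  using swap permutes_imp_permutation[OF assms(1)] by (subst sign_compose) (auto simp: sign_swap_id permutation_swap_id)
 show ?case unfolding 1 2 using swap by simp
qed

definition list_sign :: "nat list => int" where
 "list_sign ws = (\<Prod>j<length ws. \<Prod>i<j. before_sign (ws ! i) (ws ! j))"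

lemma list_sign_snoc: "distinct (ws @ [a]) ==> list_sign (ws @ [a]) = list_sign ws * (\<Prod>u\<in>set ws. before_sign u a)"
proof -
 assume d: "distinct (ws @ [a])"
 have "(\<Prod>i<length ws. before_sign (ws ! i) a) = (\<Prod>u\<in>set ws. before_sign u a)"
  by (rule prod.reindex_bij_betw) (use d bij_betw_nth in auto)
 thus ?thesis by (simp add: list_sign_def nth_append)
qed

lemma word_permutes:
 assumes "distinct ws" "set ws = {1..length ws}"
 shows "(%p. if p \<in> {1..length ws} then ws ! (p - 1) else p) permutes {1..length ws}"
proof -
 let ?V = "{1..length ws}" and ?p = "%p. if p \<in> {1..length ws} then ws ! (p - 1) else p"
 have "bij_betw ?p ?V ?V"
 proof -
  have "bij_betw (%p. p - 1) ?V {..<length ws}" by (rule bij_betw_byWitness[where f'=Suc]) auto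
  moreover have "bij_betw ((!) ws) {..<length ws} ?V" using assms by (intro bij_betw_nth) auto
  ultimately have "bij_betw ((!) ws \<circ> (%p. p - 1)) ?V ?V" by (rule bij_betw_trans)
  thus ?thesis by (rule bij_betw_cong[THEN iffD1, rotated]) auto
 qed
 thus ?thesis by (rule bij_imp_permutes) auto
qed

lemma sign_word:
 assumes "distinct ws" "set ws = {1..length ws}"
 shows "sign (%p. if p \<in> {1..length ws} then ws ! (p - 1) else p) = list_sign ws"
proof -
 let ?V = "{1..length ws}" and ?p = "%p. if p \<in> {1..length ws} then ws ! (p - 1) else p"
 have p: "?p permutes ?V" by (rule word_permutes[OF assms])
 have "sign ?p = inversion_sign ?V ?p" by (rule sign_eq_inversion_sign[OF _ p]) simp
 also have "... = (\<Prod>(j, i)\<in>Sigma {..<length ws} (%j. {..<j}). before_sign (ws ! i) (ws ! j))"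
  unfolding inversion_sign_def
  by (rule prod.reindex_bij_witness[where i="%(j, i). (Suc i, Suc j)" and j="%(i, j). (j - 1, i - 1)"])
   (auto simp: pairs_below_def)
 also have "... = list_sign ws" unfolding list_sign_def by (rule prod.Sigma[symmetric]) auto
 finally show ?thesis .
qed

definition perfect_on :: "nat set => nat set set => bool" where
 "perfect_on V M \<longleftrightarrow> partition_on V M \<and> (\<forall>e\<in>M. card e = 2)"

lemma perfect_matchings_iff: "M \<in> perfect_matchings k \<longleftrightarrow> perfect_on {1..2 * k} M"
 by (simp add: perfect_matchings_def perfect_on_def)

lemma perfect_onD:
 assumes "perfect_on V M"
 shows "\<Union>M = V" "\<And>e. e \<in> M ==> card e = 2" "\<And>e f. e \<in> M ==> f \<in> M ==> e \<noteq> f ==> e \<inter> f = {}"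
  "\<And>e. e \<in> M ==> finite e" "\<And>e. e \<in> M ==> e \<noteq> {}" "\<And>e. e \<in> M ==> e \<subseteq> V"
 using assms unfolding perfect_on_def partition_on_def disjoint_def
 by (auto intro: card_ge_0_finite)

lemma perfect_onI:
 assumes "\<Union>M = V" "\<And>e. e \<in> M ==> card e = 2" "\<And>e f. e \<in> M ==> f \<in> M ==> e \<noteq> f ==> e \<inter> f = {}"
 shows "perfect_on V M"
 using assms unfolding perfect_on_def partition_on_def disjoint_def by fastforce

lemma finite_perfect: "finite V ==> finite {M. perfect_on V M}"
 by (rule finite_subset[of _ "Pow (Pow V)"]) (auto dest: perfect_onD)

lemma perfect_on_finite: "finite V ==> perfect_on V M ==> finite M"
 using perfect_onD(1) finite_UnionD by blast

lemma edge_Min_Max: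
 assumes "card e = 2" shows "e = {Min e, Max e}" "Min e < Max e" "Min e \<in> e" "Max e \<in> e"
proof -
 obtain x y where xy: "e = {x, y}" "x \<noteq> y" using assms by (auto simp: card_2_iff)
 thus "e = {Min e, Max e}" "Min e < Max e" "Min e \<in> e" "Max e \<in> e"
  by (auto simp: min_def max_def)
qed

lemma Min_inj_on_matching: "perfect_on V M ==> inj_on Min M"
 using perfect_onD(2,3) edge_Min_Max(3) unfolding inj_on_def by (metis disjoint_iff)

text \<open>
  Multiplying over all four pairs of ends gives \<open>- 1\<close> exactly when the two disjoint
  edges cross.
\<close>

definition chi :: "nat set => nat set => int" where "chi e f = (\<Prod>u\<in>e. \<Prod>v\<in>f. before_sign u v)"

lemma chi_commute:
 assumes "card e = 2" "e \<inter> f = {}" shows "chi e f = chi f e"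
proof -
 have "chi f e = (\<Prod>u\<in>e. \<Prod>v\<in>f. before_sign v u)" unfolding chi_def by (rule prod.swap)
 also have "... = (\<Prod>v\<in>f. \<Prod>u\<in>e. before_sign v u)" by (rule prod.swap)
 also have "... = (\<Prod>v\<in>f. \<Prod>u\<in>e. before_sign u v)"
 proof (rule prod.cong[OF refl])
  fix v assume "v \<in> f"
  hence "(\<Prod>u\<in>e. before_sign v u) = (\<Prod>u\<in>e. - before_sign u v)"
   using assms(2) by (intro prod.cong refl before_sign_swap) auto
  also have "... = (\<Prod>u\<in>e. before_sign u v)" using assms(1) by (simp add: prod_uminus)
  finally show "(\<Prod>u\<in>e. before_sign v u) = (\<Prod>u\<in>e. before_sign u v)" .
 qed
 also have "... = chi e f" unfolding chi_def by (rule prod.swap)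
 finally show ?thesis by simp
qed

definition edge_pairs :: "('e => nat) => 'e set => ('e \<times> 'e) set" where
 "edge_pairs key M = {(e, f). e \<in> M \<and> f \<in> M \<and> key e < key f}"

lemma finite_edge_pairs [simp]: "finite M ==> finite (edge_pairs key M)"
 by (rule finite_subset[of _ "M \<times> M"]) (auto simp: edge_pairs_def)

text \<open>
  The factor of a pair of edges is symmetric, so the choice of an orientation of the pairs does
  not matter.
\<close>

lemma prod_edge_pairs_key:
 fixes h :: "'e => 'e => int"
 assumes "inj_on k M" "inj_on k' M" "\<And>e f. e \<in> M ==> f \<in> M ==> e \<noteq> f ==> h e f = h f e"
 shows "(\<Prod>(e, f)\<in>edge_pairs k M. h e f) = (\<Prod>(e, f)\<in>edge_pairs k' M. h e f)"
proof -
 have l: "\<not> k e < k f ==> k f < k e" "\<not> k' e < k' f ==> k' f < k' e" if "e \<in> M" "f \<in> M" "e \<noteq> f" for e f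
  using assms(1,2) that by (metis inj_onD linorder_neqE_nat)+
 show ?thesis
 proof (rule prod.reindex_bij_witness[where j="%(e, f). if k' e < k' f then (e, f) else (f, e)"
    and i="%(e, f). if k e < k f then (e, f) else (f, e)"])
  fix p assume "p \<in> edge_pairs k M"
  then obtain e f where p: "p = (e, f)" "e \<in> M" "f \<in> M" "k e < k f" "e \<noteq> f" by (auto simp: edge_pairs_def)
  show "(case case p of (e, f) => if k' e < k' f then (e, f) else (f, e) of (e, f) => if k e < k f then (e, f) else (f, e)) = p"
   using p(4) by (simp add: p(1))
  show "(case p of (e, f) => if k' e < k' f then (e, f) else (f, e)) \<in> edge_pairs k' M"
   using p(2,3) l(2)[OF p(2,3,5)] by (simp add: p(1) edge_pairs_def)
  show "(case case p of (e, f) => if k' e < k' f then (e, f) else (f, e) of (e, f) => h e f) = (case p of (e, f) => h e f)"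
   using assms(3)[OF p(2,3,5)] by (simp add: p(1))
 next
  fix p assume "p \<in> edge_pairs k' M"
  then obtain e f where p: "p = (e, f)" "e \<in> M" "f \<in> M" "k' e < k' f" "e \<noteq> f" by (auto simp: edge_pairs_def)
  show "(case case p of (e, f) => if k e < k f then (e, f) else (f, e) of (e, f) => if k' e < k' f then (e, f) else (f, e)) = p"
   using p(4) by (simp add: p(1))
  show "(case p of (e, f) => if k e < k f then (e, f) else (f, e)) \<in> edge_pairs k M"
   using p(2,3) l(1)[OF p(2,3,5)] by (simp add: p(1) edge_pairs_def)
 qed
qed

definition crossing_sign :: "nat set set => int" where
 "crossing_sign M = (\<Prod>(e, f)\<in>edge_pairs Min M. chi e f)"

lemma sorted_key_list_of_inj_set:
 fixes f :: "'a => nat"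
 assumes inj: "inj_on f A" and fin: "finite A"
 shows "set (sorted_key_list_of_set f A) = A" "sorted (map f (sorted_key_list_of_set f A))"
  "distinct (sorted_key_list_of_set f A)"
proof -
 interpret F: folding_on A "insort_key f" "[]"
  by unfold_locales (use inj in \<open>auto simp: fun_eq_iff inj_on_def intro: insort_key_left_comm\<close>)
 have eq: "sorted_key_list_of_set f = F.F" by (simp add: sorted_key_list_of_set_def fun_eq_iff)
 have "finite B ==> B \<subseteq> A ==> set (F.F B) = B \<and> sorted (map f (F.F B)) \<and> distinct (F.F B)" for B
  by (induction B rule: finite_induct)
   (simp_all add: F.insert set_insort_key sorted_insort_key distinct_insort)
 from this[OF fin] show "set (sorted_key_list_of_set f A) = A" "sorted (map f (sorted_key_list_of_set f A))"
  "distinct (sorted_key_list_of_set f A)" by (simp_all add: eq)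
qed

text \<open>
  In the word of the matching the pairs inside an edge contribute \<open>1\<close>, and the pairs
  from two edges contribute the crossing sign of these edges.
\<close>

lemma matching_sgn_crossing:
 assumes M: "M \<in> perfect_matchings k" shows "matching_sgn k M = crossing_sign M"
proof -
 have P: "perfect_on {1..2 * k} M" using M by (simp add: perfect_matchings_iff)
 have fin: "finite M" by (rule perfect_on_finite[OF _ P]) simp
 note inj = Min_inj_on_matching[OF P]
 define es where "es = sorted_key_list_of_set Min M"
 have es1: "set es = M" unfolding es_def by (rule sorted_key_list_of_inj_set(1)[OF inj fin])
 have es3: "sorted (map Min es)" unfolding es_def by (rule sorted_key_list_of_inj_set(2)[OF inj fin])
 have es2: "distinct es" unfolding es_def by (rule sorted_key_list_of_inj_set(3)[OF inj fin])
 have es: "set es = M" "distinct es" "sorted (map Min es)" "length es = card M"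
  using es1 es2 es3 distinct_card[OF es2] by simp_all
 have srt: "sorted_wrt (<) (map Min es)"
  using es inj by (simp add: strict_sorted_iff distinct_map)
 let ?w = "%es. concat (map (%e. [Min e, Max e]) es)"
 have w: "set (?w es) = \<Union>(set es)" if "set es \<subseteq> M" for es
 proof -
  have "set (?w es) = (\<Union>e\<in>set es. {Min e, Max e})" by auto
  also have "... = \<Union>(set es)" 
  proof -
   have "(\<Union>e\<in>set es. {Min e, Max e}) = (\<Union>e\<in>set es. e)"
   proof (rule SUP_cong[OF refl])
    fix e assume "e \<in> set es"
    thus "{Min e, Max e} = e" using edge_Min_Max(1)[OF perfect_onD(2)[OF P]] that by blast
   qed
   thus ?thesis by simp
  qed
  finally show ?thesis .
 qed
 have dw: "distinct (?w es)" if "set es \<subseteq> M" "distinct es" for es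
  using that
 proof (induction es)
  case (Cons e es)
  have eM: "e \<in> M" using Cons(2) by simp
  have e: "Min e < Max e" "{Min e, Max e} = e" using edge_Min_Max[OF perfect_onD(2)[OF P eM]] by simp_all
  have "e \<inter> f = {}" if "f \<in> set es" for f using perfect_onD(3)[OF P, of e f] Cons that by auto
  hence "Min e \<notin> \<Union>(set es)" "Max e \<notin> \<Union>(set es)" using e(2) by blast+
  thus ?case using Cons e w[of es] by simp
 qed simp
 have ls: "list_sign (?w es) = (\<Prod>j<length es. \<Prod>i<j. chi (es ! i) (es ! j))" if "set es \<subseteq> M" "distinct es" for es
  using that
 proof (induction es rule: rev_induct)
  case Nil show ?case by (simp add: list_sign_def)
 next
  case (snoc e es)
  have eM: "e \<in> M" using snoc by auto
  have e: "Min e < Max e" "{Min e, Max e} = e" using edge_Min_Max[OF perfect_onD(2)[OF P eM]] by simp_all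
  have d: "distinct (?w es @ [Min e, Max e])" using dw[of "es @ [e]"] snoc by simp
  have "list_sign (?w (es @ [e])) = list_sign ((?w es @ [Min e]) @ [Max e])" by simp
  also have "... = list_sign (?w es) * (\<Prod>u\<in>set (?w es). before_sign u (Min e)) * (\<Prod>u\<in>set (?w es @ [Min e]). before_sign u (Max e))"
   using d by (subst list_sign_snoc, simp)+ simp
  also have "(\<Prod>u\<in>set (?w es @ [Min e]). before_sign u (Max e)) = (\<Prod>u\<in>set (?w es). before_sign u (Max e))"
  proof -
   have n: "Min e \<notin> set (?w es)" using d by simp
   have "set (?w es @ [Min e]) = insert (Min e) (set (?w es))" by simp
   thus ?thesis using e(1) by (simp only: prod.insert[OF finite_set n]) (simp add: before_sign_def)
  qed
  also have "list_sign (?w es) * (\<Prod>u\<in>set (?w es). before_sign u (Min e)) * ... = list_sign (?w es) * (\<Prod>u\<in>set (?w es). \<Prod>v\<in>{Min e, Max e}. before_sign u v)"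
  proof -
   have "(\<Prod>v\<in>{Min e, Max e}. before_sign u v) = before_sign u (Min e) * before_sign u (Max e)" for u
    using e(1) by simp
   thus ?thesis by (simp only: prod.distrib mult.assoc)
  qed
  also have "(\<Prod>u\<in>set (?w es). \<Prod>v\<in>{Min e, Max e}. before_sign u v) = (\<Prod>u\<in>\<Union>(set es). \<Prod>v\<in>e. before_sign u v)"
   using w[of es] snoc e(2) by simp
  also have "... = (\<Prod>f\<in>set es. chi f e)"
   unfolding chi_def using perfect_onD[OF P] snoc
   by (subst prod.Union_disjoint) (auto simp: subset_iff)
  also have "... = (\<Prod>i<length es. chi (es ! i) e)"
   using snoc by (intro prod.reindex_bij_betw[symmetric] bij_betw_nth) auto
  finally show ?case using snoc by (simp add: nth_append)
 qed
 have "length (?w es) = card (set (?w es))" using distinct_card[OF dw[of es]] es by simp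
 also have "... = 2 * k" using w[of es] es perfect_onD(1)[OF P] by simp
 finally have len: "length (?w es) = 2 * k" .
 have "matching_sgn k M = list_sign (?w es)"
  unfolding matching_sgn_def matching_word_def es_def[symmetric]
  using sign_word[OF dw[of es]] w[of es] es perfect_onD(1)[OF P] unfolding len by simp
 also have "... = (\<Prod>j<length es. \<Prod>i<j. chi (es ! i) (es ! j))" by (rule ls) (use es in auto)
 also have "... = (\<Prod>(j, i)\<in>Sigma {..<length es} (%j. {..<j}). chi (es ! i) (es ! j))"
  by (rule prod.Sigma) auto
 also have "... = crossing_sign M"
 proof -
  have lt: "Min (es ! i) < Min (es ! j) \<longleftrightarrow> i < j" if "i < length es" "j < length es" for i j
   using sorted_wrt_nth_less[OF srt, of i j] sorted_wrt_nth_less[OF srt, of j i] that by (cases i j rule: linorder_cases) auto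
  let ?h = "%p. (es ! snd p, es ! fst p)"
  have "bij_betw ?h (Sigma {..<length es} (%j. {..<j})) (edge_pairs Min M)"
   unfolding bij_betw_def
  proof (intro conjI equalityI subsetI)
   show "inj_on ?h (Sigma {..<length es} (%j. {..<j}))"
    using es(2) by (auto simp: inj_on_def nth_eq_iff_index_eq)
  next
   fix p assume "p \<in> ?h ` Sigma {..<length es} (%j. {..<j})"
   then obtain i j where "p = (es ! i, es ! j)" "i < j" "j < length es" by auto
   thus "p \<in> edge_pairs Min M" using lt[of i j] es(1) by (auto simp: edge_pairs_def)
  next
   fix p assume "p \<in> edge_pairs Min M"
   then obtain e f where p: "p = (e, f)" "e \<in> set es" "f \<in> set es" "Min e < Min f" by (auto simp: edge_pairs_def es(1))
   obtain i where i: "i < length es" "e = es ! i" using p(2) by (metis in_set_conv_nth)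
   obtain j where j: "j < length es" "f = es ! j" using p(3) by (metis in_set_conv_nth)
   note ij = i(2) j(2) i(1) j(1)
   have "i < j" using lt[of i j] p(4) ij by simp
   thus "p \<in> ?h ` Sigma {..<length es} (%j. {..<j})"
    using p(1) ij by (intro image_eqI[of _ _ "(j, i)"]) auto
  qed
  from prod.reindex_bij_betw[OF this, of "%p. chi (fst p) (snd p)"] show ?thesis
   by (simp add: crossing_sign_def case_prod_unfold)
 qed
 finally show ?thesis .
qed

section \<open>The Pfaffian as a sum over matchings\<close>

definition edge_weight :: "(nat => real) => nat set => real" where
 "edge_weight x e = order_weight (x (Min e)) (x (Max e))"

lemma perfect_on_insert:
 assumes ab: "a \<noteq> b" "a \<notin> V" "b \<notin> V" and M: "perfect_on V M"
 shows "perfect_on (insert a (insert b V)) (insert {a, b} M)"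
proof (rule perfect_onI)
 show "\<Union>(insert {a, b} M) = insert a (insert b V)" using perfect_onD(1)[OF M] by auto
 show "card e = 2" if "e \<in> insert {a, b} M" for e using perfect_onD(2)[OF M] ab that by auto
 have new: "{a, b} \<inter> f = {}" if "f \<in> M" for f using perfect_onD(6)[OF M that] ab by auto
 show "e \<inter> f = {}" if "e \<in> insert {a, b} M" "f \<in> insert {a, b} M" "e \<noteq> f" for e f
 proof (cases "e = {a, b}")
  case True
  hence "f \<in> M" using that by simp
  thus ?thesis unfolding True by (rule new)
 next
  case False
  hence e: "e \<in> M" using that by simp
  show ?thesis
  proof (cases "f = {a, b}")
   case True
   show ?thesis unfolding True using new[OF e] by (simp only: Int_commute)
  qed (use perfect_onD(3)[OF M e] that in simp)
 qed
qed

lemma perfect_on_remove: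
 assumes M: "perfect_on V M" and e: "e \<in> M"
 shows "perfect_on (V - e) (M - {e})"
proof (rule perfect_onI)
 show "\<Union>(M - {e}) = V - e" using perfect_onD(1,3)[OF M] e by blast
qed (use perfect_onD(2,3)[OF M] in auto)

text \<open>
  The partner of the first point ranges over the rest. Removing its edge removes as many
  crossings, modulo 2, as there are points below the partner, which is the sign in the recursion.
\<close>

lemma pfaff_eq_matching_sum:
 assumes "sorted_wrt (<) vs"
 shows "pfaff (map x vs) = (\<Sum>M | perfect_on (set vs) M. of_int (crossing_sign M) * (\<Prod>e\<in>M. edge_weight x e))"
 using assms
proof (induction "length vs" arbitrary: vs rule: less_induct)
 case less
 show ?case
 proof (cases vs)
  case Nil
  have "{M. perfect_on {} M} = {{}}"
   by (auto simp: perfect_on_def partition_on_def)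
  thus ?thesis by (simp add: Nil crossing_sign_def edge_pairs_def)
 next
  case (Cons a us)
  have srt: "sorted_wrt (<) us" "\<And>u. u \<in> set us ==> a < u" "distinct us" using less(2) Cons by (auto simp: strict_sorted_iff)
  have idx: "us ! i < us ! j" if "i < j" "j < length us" for i j using srt(1) that by (simp add: sorted_wrt_nth_less)
  define V where "V i = set (del i us)" for i
  have V: "set us = insert (us ! i) (V i)" "us ! i \<notin> V i" if i: "i < length us" for i
  proof -
   have "us = take i us @ us ! i # drop (Suc i) us" by (rule id_take_nth_drop[OF i])
   thus "set us = insert (us ! i) (V i)" unfolding V_def by (metis Un_insert_right list.simps(15) set_append)
   have "distinct (take i us @ us ! i # drop (Suc i) us)" using srt(3) id_take_nth_drop[OF i] by simp
   thus "us ! i \<notin> V i" unfolding V_def by simp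
  qed
  have aV: "a \<notin> V i" if "i < length us" for i
  proof
   assume "a \<in> V i"
   hence "a \<in> set us" using V(1)[OF that] by (simp only: insertI2)
   from srt(2)[OF this] show False by simp
  qed
  have anu: "a \<noteq> us ! i" "a < us ! i" if "i < length us" for i
   using srt(2)[OF nth_mem[OF that]] by simp_all
  \<comment> \<open>the matchings of the points other than the first one and its partner \<open>us ! i\<close>\<close>
  define \<M> where "\<M> i = {M. perfect_on (V i) M}" for i
  have fM: "finite (\<M> i)" for i unfolding \<M>_def by (rule finite_perfect) (simp add: V_def)
  have notin: "{a, us ! i} \<notin> M" if "M \<in> \<M> i" "i < length us" for i M
   using that perfect_onD(6)[of "V i" M "{a, us ! i}"] aV[OF that(2)] by (auto simp: \<M>_def)
  have un: "{M. perfect_on (set vs) M} = (\<Union>i<length us. insert {a, us ! i} ` \<M> i)"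
  proof (intro equalityI subsetI)
   fix M assume "M \<in> {M. perfect_on (set vs) M}"
   hence M: "perfect_on (set vs) M" by simp
   obtain e where e: "e \<in> M" "a \<in> e" using perfect_onD(1)[OF M] Cons by auto
   obtain b where b: "e = {a, b}" "b \<noteq> a" using perfect_onD(2)[OF M e(1)] e(2) by (auto simp: card_2_iff)
   hence "b \<in> set us" using perfect_onD(6)[OF M e(1)] Cons by auto
   then obtain i where i: "i < length us" "b = us ! i" by (auto simp: in_set_conv_nth)
   have "set vs - e = V i" using V[OF i(1)] b i aV[OF i(1)] Cons by auto
   hence "M - {e} \<in> \<M> i" using perfect_on_remove[OF M e(1)] by (simp add: \<M>_def)
   thus "M \<in> (\<Union>i<length us. insert {a, us ! i} ` \<M> i)"
    using i b e(1) by (auto intro!: bexI[of _ i] image_eqI[of _ _ "M - {e}"])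
  next
   fix M assume "M \<in> (\<Union>i<length us. insert {a, us ! i} ` \<M> i)"
   then obtain i M' where i: "i < length us" "perfect_on (V i) M'" "M = insert {a, us ! i} M'" by (auto simp: \<M>_def)
   have "perfect_on (insert a (insert (us ! i) (V i))) M"
    unfolding i(3) by (rule perfect_on_insert[OF anu(1)[OF i(1)] aV[OF i(1)] V(2)[OF i(1)] i(2)])
   thus "M \<in> {M. perfect_on (set vs) M}" using V(1)[OF i(1)] Cons by simp
  qed
  have disj: "insert {a, us ! i} ` \<M> i \<inter> insert {a, us ! j} ` \<M> j = {}" if ij: "i < length us" "j < length us" "i \<noteq> j" for i j
  proof (rule ccontr)
   assume "\<not> ?thesis"
   then obtain M where M: "M \<in> insert {a, us ! i} ` \<M> i" "M \<in> insert {a, us ! j} ` \<M> j" by blast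
   have "M \<in> (\<Union>i<length us. insert {a, us ! i} ` \<M> i)" by (rule UN_I[of i]) (use ij M(1) in simp_all)
   hence P: "perfect_on (set vs) M" unfolding un[symmetric] by simp
   have "{a, us ! i} \<in> M" using M(1) by (rule imageE) (simp only: insertI1)
   moreover have "{a, us ! j} \<in> M" using M(2) by (rule imageE) (simp only: insertI1)
   ultimately have "{a, us ! i} = {a, us ! j}" using perfect_onD(3)[OF P, of "{a, us ! i}" "{a, us ! j}"] by blast
   hence "us ! i = us ! j" using anu ij by (auto simp: doubleton_eq_iff)
   thus False using srt(3) ij by (simp add: nth_eq_iff_index_eq)
  qed
  let ?F = "%M. of_int (crossing_sign M) * (\<Prod>e\<in>M. edge_weight x e)"
  have cs: "crossing_sign (insert {a, us ! i} M) = (-1) ^ i * crossing_sign M" if i: "i < length us" and M: "M \<in> \<M> i" for i M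
  proof -
   let ?e = "{a, us ! i}"
   have P: "perfect_on (V i) M" using M by (simp add: \<M>_def)
   have finM: "finite M" by (rule perfect_on_finite[OF _ P]) (simp add: V_def)
   have aM: "a < Min f" if "f \<in> M" for f
    using perfect_onD(6)[OF P that] edge_Min_Max(3)[OF perfect_onD(2)[OF P that]] V(1)[OF i] srt(2) by auto
   have Me: "Min ?e = a" using anu[OF i] by (simp add: min_def)
   have "edge_pairs Min (insert ?e M) = Pair ?e ` M \<union> edge_pairs Min M"
   proof (intro equalityI subsetI)
    fix p assume "p \<in> edge_pairs Min (insert ?e M)"
    then obtain e f where p: "p = (e, f)" "e \<in> insert ?e M" "f \<in> insert ?e M" "Min e < Min f" unfolding edge_pairs_def by blast
    have "f \<noteq> ?e"
    proof
     assume f: "f = ?e"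
     hence "e \<in> M" using p(2,4) by blast
     from aM[OF this] p(4) show False unfolding f Me by simp
    qed
    thus "p \<in> Pair ?e ` M \<union> edge_pairs Min M" using p unfolding edge_pairs_def by blast
   next
    fix p assume "p \<in> Pair ?e ` M \<union> edge_pairs Min M"
    thus "p \<in> edge_pairs Min (insert ?e M)"
    proof
     assume "p \<in> Pair ?e ` M"
     then obtain f where f: "p = (?e, f)" "f \<in> M" by blast
     have "Min ?e < Min f" unfolding Me by (rule aM[OF f(2)])
     thus ?thesis using f unfolding edge_pairs_def by blast
    qed (unfold edge_pairs_def, blast)
   qed
   moreover have "Pair ?e ` M \<inter> edge_pairs Min M = {}" using notin[OF M i] by (auto simp: edge_pairs_def)
   ultimately have "crossing_sign (insert ?e M) = (\<Prod>f\<in>M. chi ?e f) * crossing_sign M"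
    unfolding crossing_sign_def using finM by (simp add: prod.union_disjoint prod.reindex inj_on_def)
   also have "(\<Prod>f\<in>M. chi ?e f) = (\<Prod>u\<in>?e. \<Prod>f\<in>M. \<Prod>v\<in>f. before_sign u v)"
    unfolding chi_def by (rule prod.swap)
   also have "... = (\<Prod>u\<in>?e. \<Prod>v\<in>V i. before_sign u v)"
   proof (rule prod.cong[OF refl])
    fix u
    show "(\<Prod>f\<in>M. \<Prod>v\<in>f. before_sign u v) = (\<Prod>v\<in>V i. before_sign u v)"
     unfolding perfect_onD(1)[OF P, symmetric] using perfect_onD(3,4)[OF P]
     by (subst prod.Union_disjoint) auto
   qed
   also have "... = (\<Prod>v\<in>V i. before_sign a v) * (\<Prod>v\<in>V i. before_sign (us ! i) v)" using anu[OF i] by simp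
   also have "(\<Prod>v\<in>V i. before_sign a v) = 1" using V(1)[OF i] srt(2) by (intro prod.neutral) (auto simp: before_sign_def)
   also have "(\<Prod>v\<in>V i. before_sign (us ! i) v) = (-1) ^ i"
   proof -
    have d: "distinct (del i us)" using srt(3) by (simp add: set_take_disj_set_drop_if_distinct)
    have "(\<Prod>v\<in>V i. before_sign (us ! i) v) = prod_list (map (before_sign (us ! i)) (del i us))"
     unfolding V_def by (rule prod.distinct_set_conv_list[OF d])
    also have "... = prod_list (map (%_. - 1) (take i us)) * prod_list (map (%_. 1) (drop (Suc i) us))"
    proof -
     have "map (before_sign (us ! i)) (take i us) = map (%_. - 1) (take i us)"
      using idx i by (intro map_cong refl) (force simp: in_set_conv_nth before_sign_def)
     moreover have "map (before_sign (us ! i)) (drop (Suc i) us) = map (%_. 1) (drop (Suc i) us)"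
      using idx i by (intro map_cong refl) (force simp: in_set_conv_nth before_sign_def)
     ultimately show ?thesis by (simp only: map_append prod_list.append)
    qed
    also have "... = (-1) ^ i" using i by (simp add: map_replicate_const)
    finally show ?thesis .
   qed
   finally show ?thesis by simp
  qed
  have "(\<Sum>M | perfect_on (set vs) M. ?F M) = (\<Sum>i<length us. \<Sum>M\<in>insert {a, us ! i} ` \<M> i. ?F M)"
   unfolding un by (rule sum.UNION_disjoint) (use fM disj in auto)
  also have "... = (\<Sum>i<length us. \<Sum>M\<in>\<M> i. ?F (insert {a, us ! i} M))"
  proof (rule sum.cong[OF refl])
   fix i assume "i \<in> {..<length us}"
   hence "inj_on (insert {a, us ! i}) (\<M> i)" using notin by (intro inj_onI) (metis insert_ident lessThan_iff)
   from sum.reindex[OF this, of ?F] show "(\<Sum>M\<in>insert {a, us ! i} ` \<M> i. ?F M) = (\<Sum>M\<in>\<M> i. ?F (insert {a, us ! i} M))"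
    by (simp only: comp_def)
  qed
  also have "... = (\<Sum>i<length us. (-1) ^ i * order_weight (x a) (x (us ! i)) * (\<Sum>M\<in>\<M> i. ?F M))"
   unfolding sum_distrib_left
  proof (intro sum.cong refl)
   fix i M assume "i \<in> {..<length us}" and M: "M \<in> \<M> i"
   hence i: "i < length us" by simp
   have finM: "finite M" using M perfect_on_finite[of "V i" M] by (simp add: \<M>_def V_def)
   have "edge_weight x {a, us ! i} = order_weight (x a) (x (us ! i))"
    using anu[OF i] by (simp add: edge_weight_def min_def max_def)
   thus "?F (insert {a, us ! i} M) = (-1) ^ i * order_weight (x a) (x (us ! i)) * ?F M"
    using cs[OF i M] notin[OF M i] finM by simp
  qed
  also have "... = (\<Sum>i<length us. (-1) ^ i * order_weight (x a) (x (us ! i)) * pfaff (map x (del i us)))"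
  proof (rule sum.cong[OF refl])
   fix i assume "i \<in> {..<length us}"
   hence i: "i < length us" by simp
   have "sorted_wrt (<) (take i us @ us ! i # drop (Suc i) us)"
    by (subst id_take_nth_drop[OF i, symmetric]) (rule srt(1))
   hence "sorted_wrt (<) (del i us)" by (auto simp: sorted_wrt_append)
   hence "pfaff (map x (del i us)) = (\<Sum>M\<in>\<M> i. ?F M)"
    unfolding \<M>_def V_def using i Cons by (intro less(1)) auto
   thus "(-1) ^ i * order_weight (x a) (x (us ! i)) * (\<Sum>M\<in>\<M> i. ?F M) = (-1) ^ i * order_weight (x a) (x (us ! i)) * pfaff (map x (del i us))"
    by (simp only:)
  qed
  also have "... = pfaff (map x vs)"
   unfolding Cons list.map pfaff.simps length_map
   by (rule sum.cong[OF refl]) (simp only: lessThan_iff nth_map take_map drop_map map_append)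
  finally show ?thesis by (rule sym)
 qed
qed

section \<open>Walls and matchings\<close>

definition points :: "nat set => nat set" where "points B = {p. 1 \<le> p \<and> particle_color p \<in> B}"

lemma particle_color_pair: "1 \<le> w ==> particle_color (2 * w - 1) = w" "particle_color (2 * w) = w"
 by (auto simp: particle_color_def)

lemma particle_color_cases: "1 \<le> p ==> p = 2 * particle_color p - 1 \<or> p = 2 * particle_color p"
 unfolding particle_color_def by presburger

lemma points_eq: "0 \<notin> B ==> points B = (\<Union>w\<in>B. {2 * w - 1, 2 * w})"
proof (intro equalityI subsetI)
 fix p assume "p \<in> points B"
 thus "p \<in> (\<Union>w\<in>B. {2 * w - 1, 2 * w})" using particle_color_cases[of p] by (auto simp: points_def)
next
 fix p assume B: "0 \<notin> B" and "p \<in> (\<Union>w\<in>B. {2 * w - 1, 2 * w})"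
 then obtain w where w: "w \<in> B" "p = 2 * w - 1 \<or> p = 2 * w" by auto
 hence "1 \<le> w" using B by (cases w) auto
 thus "p \<in> points B" using w particle_color_pair[of w] by (auto simp: points_def)
qed

lemma points_atLeastAtMost: "points {1..k} = {1..2 * k}"
 by (auto simp: points_def particle_color_def)

lemma finite_points: "finite B ==> finite (points B)"
proof -
 assume "finite B"
 then obtain n where "B \<subseteq> {..n}" using finite_nat_iff_bounded_le by blast
 hence "points B \<subseteq> {..2 * n}" using particle_color_cases by (auto simp: points_def particle_color_def)
 thus ?thesis by (rule finite_subset) simp
qed

lemma prod_before_sign_points:
 assumes AB: "A \<inter> B = {}" "0 \<notin> A" "0 \<notin> B" "finite A" "finite B"
 shows "(\<Prod>u\<in>points A. \<Prod>v\<in>points B. before_sign u v) = 1"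
proof -
 have split: "(\<Prod>u\<in>points A. h u) = (\<Prod>w\<in>A. h (2 * w - 1) * h (2 * w))" if "0 \<notin> A" "finite A" for A and h :: "nat => int"
 proof -
  have "(\<Prod>u\<in>points A. h u) = (\<Prod>w\<in>A. \<Prod>u\<in>{2 * w - 1, 2 * w}. h u)"
   unfolding points_eq[OF that(1)]
  proof (rule prod.UNION_disjoint[OF that(2)])
   show "\<forall>i\<in>A. \<forall>j\<in>A. i \<noteq> j \<longrightarrow> {2 * i - 1, 2 * i} \<inter> {2 * j - 1, 2 * j} = {}"
   proof (intro ballI impI)
    fix i j assume "i \<in> A" "j \<in> A" "i \<noteq> j"
    hence "i \<noteq> 0" "j \<noteq> 0" using that(1) by metis+
    thus "{2 * i - 1, 2 * i} \<inter> {2 * j - 1, 2 * j} = {}" using \<open>i \<noteq> j\<close> by auto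
   qed
  qed auto
  also have "... = (\<Prod>w\<in>A. h (2 * w - 1) * h (2 * w))"
  proof (rule prod.cong[OF refl])
   fix w assume "w \<in> A"
   hence "2 * w - 1 \<noteq> 2 * w" using that by (cases w) auto
   thus "(\<Prod>u\<in>{2 * w - 1, 2 * w}. h u) = h (2 * w - 1) * h (2 * w)" by simp
  qed
  finally show ?thesis .
 qed
 have bs: "before_sign (2 * w - 1) v * before_sign (2 * w) v = 1" if "w \<in> A" "v \<in> points B" for w v
 proof -
  have "particle_color v \<noteq> w" "1 \<le> v" using that AB by (auto simp: points_def)
  moreover have "1 \<le> w" using that AB by (cases w) auto
  ultimately have "2 * w - 1 < v \<longleftrightarrow> 2 * w < v" using particle_color_cases[of v] by linarith
  thus ?thesis by (auto simp: before_sign_def)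
 qed
 show ?thesis
  unfolding split[OF AB(2,4)] prod.distrib[symmetric]
 proof (rule prod.neutral, rule ballI)
  fix w assume w: "w \<in> A"
  show "(\<Prod>v\<in>points B. before_sign (2 * w - 1) v * before_sign (2 * w) v) = 1"
   by (rule prod.neutral) (use bs[OF w] in blast)
 qed
qed

text \<open>
  The crossing factors between the two parts multiply up to a product over all pairs of their
  points. There the two ends of a wall, being adjacent numbers, contribute equal factors, whose
  product is 1.
\<close>

lemma crossing_sign_Un:
 assumes M1: "perfect_on (points A) M1" and M2: "perfect_on (points B) M2"
  and AB: "A \<inter> B = {}" "0 \<notin> A" "0 \<notin> B" "finite A" "finite B"
 shows "crossing_sign (M1 \<union> M2) = crossing_sign M1 * crossing_sign M2"
proof -
 have fin: "finite M1" "finite M2" using perfect_on_finite M1 M2 finite_points AB by blast+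
 have dP: "points A \<inter> points B = {}" using AB(1) by (auto simp: points_def)
 have e12: "e \<inter> f = {}" if "e \<in> M1" "f \<in> M2" for e f
  using perfect_onD(6)[OF M1 that(1)] perfect_onD(6)[OF M2 that(2)] dP by blast
 have d: "M1 \<inter> M2 = {}" using e12 perfect_onD(5)[OF M1] by blast
 have mne: "Min e \<noteq> Min f" if "e \<in> M1" "f \<in> M2" for e f
  using edge_Min_Max(3)[OF perfect_onD(2)[OF M1 that(1)]] edge_Min_Max(3)[OF perfect_onD(2)[OF M2 that(2)]] e12[OF that] by auto
 let ?X = "{(e, f). e \<in> M1 \<and> f \<in> M2 \<and> Min e < Min f}" and ?Y = "{(e, f). e \<in> M1 \<and> f \<in> M2 \<and> Min f < Min e}"
 have fXY: "finite ?X" "finite ?Y" by (rule finite_subset[of _ "M1 \<times> M2"]; use fin in auto)+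
 have ep: "edge_pairs Min (M1 \<union> M2) = (edge_pairs Min M1 \<union> edge_pairs Min M2) \<union> (?X \<union> prod.swap ` ?Y)"
  by (auto simp: edge_pairs_def image_iff)
 have "crossing_sign (M1 \<union> M2) = (crossing_sign M1 * crossing_sign M2) * ((\<Prod>(e, f)\<in>?X. chi e f) * (\<Prod>(e, f)\<in>prod.swap ` ?Y. chi e f))"
 proof -
  have "edge_pairs Min M1 \<inter> edge_pairs Min M2 = {}" "?X \<inter> prod.swap ` ?Y = {}"
   "(edge_pairs Min M1 \<union> edge_pairs Min M2) \<inter> (?X \<union> prod.swap ` ?Y) = {}"
   using d by (auto simp: edge_pairs_def)
  thus ?thesis
   unfolding crossing_sign_def ep using fin fXY by (simp add: prod.union_disjoint)
 qed
 also have "(\<Prod>(e, f)\<in>prod.swap ` ?Y. chi e f) = (\<Prod>(e, f)\<in>?Y. chi e f)"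
 proof (subst prod.reindex)
  show "inj_on prod.swap ?Y" by (auto simp: inj_on_def)
  show "prod ((%(e, f). chi e f) \<circ> prod.swap) ?Y = (\<Prod>(e, f)\<in>?Y. chi e f)"
   by (rule prod.cong) (auto intro!: chi_commute[symmetric] e12 perfect_onD(2)[OF M1])
 qed
 also have "(\<Prod>(e, f)\<in>?X. chi e f) * (\<Prod>(e, f)\<in>?Y. chi e f) = (\<Prod>(e, f)\<in>?X \<union> ?Y. chi e f)"
  using fXY by (intro prod.union_disjoint[symmetric]) auto
 also have "?X \<union> ?Y = M1 \<times> M2" using mne by (auto simp: neq_iff)
 also have "(\<Prod>(e, f)\<in>M1 \<times> M2. chi e f) = (\<Prod>e\<in>M1. \<Prod>f\<in>M2. \<Prod>u\<in>e. \<Prod>v\<in>f. before_sign u v)"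
  by (simp add: prod.cartesian_product chi_def)
 also have "... = (\<Prod>e\<in>M1. \<Prod>u\<in>e. \<Prod>f\<in>M2. \<Prod>v\<in>f. before_sign u v)"
  by (rule prod.cong[OF refl]) (rule prod.swap)
 also have "... = (\<Prod>u\<in>\<Union>M1. \<Prod>v\<in>\<Union>M2. before_sign u v)"
 proof -
  have "(\<Prod>f\<in>M2. \<Prod>v\<in>f. before_sign u v) = (\<Prod>v\<in>\<Union>M2. before_sign u v)" for u
   using perfect_onD(3,4)[OF M2] by (subst prod.Union_disjoint) auto
  moreover have "(\<Prod>e\<in>M1. \<Prod>u\<in>e. h u) = (\<Prod>u\<in>\<Union>M1. h u)" for h :: "nat => int"
   using perfect_onD(3,4)[OF M1] by (subst prod.Union_disjoint) auto
  ultimately show ?thesis by simp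
 qed
 also have "... = 1"
  unfolding perfect_onD(1)[OF M1] perfect_onD(1)[OF M2] by (rule prod_before_sign_points[OF AB])
 finally show ?thesis by simp
qed

definition flip :: "nat => nat => nat" where "flip w = Transposition.transpose (2 * w - 1) (2 * w)"

lemma flip_flip [simp]: "flip w (flip w p) = p" by (simp add: flip_def)
lemma inj_flip: "inj (flip w)" by (metis flip_flip injI)
lemma image_flip_flip [simp]: "flip w ` flip w ` e = e" by (simp add: image_image)

lemma flip_color: "1 \<le> w ==> particle_color (flip w p) = particle_color p"
 using particle_color_pair[of w] by (auto simp: flip_def Transposition.transpose_def)

lemma flip_pos: "1 \<le> w ==> 1 \<le> flip w p \<longleftrightarrow> 1 \<le> p"
 by (auto simp: flip_def Transposition.transpose_def)

lemma flip_less: "1 \<le> w ==> u \<noteq> v ==> {u, v} \<noteq> {2 * w - 1, 2 * w} ==> flip w u < flip w v \<longleftrightarrow> u < v"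
 by (auto simp: flip_def Transposition.transpose_def)

lemma perfect_on_flip:
 assumes w: "1 \<le> w" and M: "perfect_on (points B) M" shows "perfect_on (points B) ((`) (flip w) ` M)"
proof (rule perfect_onI)
 have "\<Union>((`) (flip w) ` M) = flip w ` points B" using perfect_onD(1)[OF M] by auto
 also have "flip w ` points B = points B"
 proof (intro equalityI subsetI)
  fix p assume "p \<in> points B"
  hence "flip w p \<in> points B" using flip_color[OF w] flip_pos[OF w] by (simp add: points_def)
  thus "p \<in> flip w ` points B" by (metis flip_flip image_eqI)
 qed (use flip_color[OF w] flip_pos[OF w] in \<open>auto simp: points_def\<close>)
 finally show "\<Union>((`) (flip w) ` M) = points B" .
 show "card e = 2" if "e \<in> (`) (flip w) ` M" for e
  using that perfect_onD(2)[OF M] card_image[OF inj_on_subset[OF inj_flip subset_UNIV]] by auto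
 show "e \<inter> f = {}" if ef0: "e \<in> (`) (flip w) ` M" "f \<in> (`) (flip w) ` M" "e \<noteq> f" for e f
 proof -
  obtain e' f' where ef: "e = flip w ` e'" "f = flip w ` f'" "e' \<in> M" "f' \<in> M" using ef0(1,2) by blast
  hence "e' \<inter> f' = {}" using perfect_onD(3)[OF M ef(3,4)] ef0(3) by blast
  thus ?thesis unfolding ef(1,2) image_Int[OF inj_flip, symmetric] by simp
 qed
qed

text \<open>
  Only the comparison of the two ends of the wall changes; they lie in different edges, so exactly
  one crossing factor changes its sign.
\<close>

lemma crossing_sign_flip:
 assumes w: "1 \<le> w" "w \<in> B" and M: "perfect_on (points B) M" and fin: "finite B" and nw: "{2 * w - 1, 2 * w} \<notin> M"
 shows "crossing_sign ((`) (flip w) ` M) = - crossing_sign M"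
proof -
 let ?s = "flip w"
 have finM: "finite M" using perfect_on_finite[OF finite_points[OF fin] M] .
 note P' = perfect_on_flip[OF w(1) M]
 have injim: "inj_on ((`) ?s) M" using inj_flip[of w] by (simp add: inj_on_def inj_image_eq_iff)
 have pts: "2 * w - 1 \<in> points B" "2 * w \<in> points B" using w particle_color_pair[of w] by (auto simp: points_def)
 obtain e0 f0 where ef: "e0 \<in> M" "2 * w - 1 \<in> e0" "f0 \<in> M" "2 * w \<in> f0" using pts perfect_onD(1)[OF M] by blast
 have ne: "e0 \<noteq> f0"
 proof
  assume "e0 = f0"
  hence "{2 * w - 1, 2 * w} \<subseteq> e0" "card e0 = 2" "card {2 * w - 1, 2 * w} = 2" using ef perfect_onD(2)[OF M] w by auto
  hence "{2 * w - 1, 2 * w} = e0" using perfect_onD(4)[OF M ef(1)] by (intro card_subset_eq) auto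
  thus False using nw ef(1) by simp
 qed
 have u1: "e = e0" if "e \<in> M" "2 * w - 1 \<in> e" for e using perfect_onD(3)[OF M that(1) ef(1)] that(2) ef(2) by auto
 have u2: "e = f0" if "e \<in> M" "2 * w \<in> e" for e using perfect_onD(3)[OF M that(1) ef(3)] that(2) ef(4) by auto
 have chis: "chi (?s ` e) (?s ` f) = (\<Prod>u\<in>e. \<Prod>v\<in>f. before_sign (?s u) (?s v))" for e f
  unfolding chi_def using inj_flip[of w] by (simp add: prod.reindex inj_on_def)
 have bs: "before_sign (?s u) (?s v) = before_sign u v * (if {u, v} = {2 * w - 1, 2 * w} then - 1 else 1)" if "u \<noteq> v" for u v
 proof (cases "{u, v} = {2 * w - 1, 2 * w}")
  case True
  hence "u = 2 * w - 1 \<and> v = 2 * w \<or> u = 2 * w \<and> v = 2 * w - 1" by (auto simp: doubleton_eq_iff)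
  thus ?thesis using w True by (auto simp: before_sign_def flip_def)
 qed (use flip_less[OF w(1) that] in \<open>simp add: before_sign_def\<close>)
 have chi': "chi (?s ` e) (?s ` f) = chi e f * (if {e, f} = {e0, f0} then - 1 else 1)" if e: "e \<in> M" and f: "f \<in> M" and "e \<noteq> f" for e f
 proof -
  have dj: "e \<inter> f = {}" by (rule perfect_onD(3)[OF M e f \<open>e \<noteq> f\<close>])
  have "chi (?s ` e) (?s ` f) = (\<Prod>u\<in>e. \<Prod>v\<in>f. before_sign u v * (if {u, v} = {2 * w - 1, 2 * w} then - 1 else 1))"
   unfolding chis using dj by (intro prod.cong refl bs) auto
  also have "... = chi e f * (\<Prod>u\<in>e. \<Prod>v\<in>f. if {u, v} = {2 * w - 1, 2 * w} then - 1 else 1)"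
   by (simp add: chi_def prod.distrib)
  also have "(\<Prod>u\<in>e. \<Prod>v\<in>f. if {u, v} = {2 * w - 1, 2 * w} then - 1 else 1 :: int) = (if {e, f} = {e0, f0} then - 1 else 1)"
  proof (cases "{e, f} = {e0, f0}")
   case True
   define a b where "a = (if e = e0 then 2 * w - 1 else 2 * w)" and "b = (if e = e0 then 2 * w else 2 * w - 1)"
   have ab: "a \<in> e" "b \<in> f" "{a, b} = {2 * w - 1, 2 * w}" using True ef ne by (auto simp: a_def b_def doubleton_eq_iff)
   have "{u, v} = {2 * w - 1, 2 * w} \<longleftrightarrow> u = a \<and> v = b" if "u \<in> e" "v \<in> f" for u v
    using that ab dj by (auto simp: doubleton_eq_iff)
   hence "(\<Prod>u\<in>e. \<Prod>v\<in>f. if {u, v} = {2 * w - 1, 2 * w} then - 1 else 1 :: int) = (\<Prod>u\<in>e. \<Prod>v\<in>f. if v = b then (if u = a then - 1 else 1) else 1)"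
    by (intro prod.cong refl) auto
   also have "... = - 1" using ab perfect_onD(4)[OF M] e f by (simp add: prod.delta)
   finally show ?thesis using True by simp
  next
   case False
   have "{u, v} \<noteq> {2 * w - 1, 2 * w}" if "u \<in> e" "v \<in> f" for u v
   proof
    assume "{u, v} = {2 * w - 1, 2 * w}"
    hence "u = 2 * w - 1 \<and> v = 2 * w \<or> u = 2 * w \<and> v = 2 * w - 1" by (auto simp: doubleton_eq_iff)
    thus False using False that u1[OF e] u2[OF e] u1[OF f] u2[OF f] by auto
   qed
   thus ?thesis using False by (simp add: prod.neutral)
  qed
  finally show ?thesis .
 qed
 let ?k = "%e. Min (?s ` e)"
 have "crossing_sign ((`) ?s ` M) = (\<Prod>(e, f)\<in>edge_pairs ?k M. chi (?s ` e) (?s ` f))"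
 proof -
  let ?h = "%p. (?s ` fst p, ?s ` snd p)"
  have "bij_betw ?h (edge_pairs ?k M) (edge_pairs Min ((`) ?s ` M))"
   unfolding bij_betw_def
  proof (intro conjI equalityI subsetI)
   show "inj_on ?h (edge_pairs ?k M)"
    using inj_flip[of w] by (auto simp: inj_on_def inj_image_eq_iff)
  next
   fix p assume "p \<in> ?h ` edge_pairs ?k M"
   thus "p \<in> edge_pairs Min ((`) ?s ` M)" unfolding edge_pairs_def by fastforce
  next
   fix p assume "p \<in> edge_pairs Min ((`) ?s ` M)"
   then obtain e f where "p = (?s ` e, ?s ` f)" "e \<in> M" "f \<in> M" "?k e < ?k f" unfolding edge_pairs_def by blast
   thus "p \<in> ?h ` edge_pairs ?k M" unfolding edge_pairs_def by (intro image_eqI[of _ _ "(e, f)"]) auto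
  qed
  from prod.reindex_bij_betw[OF this, of "%p. chi (fst p) (snd p)"] show ?thesis
   by (simp add: crossing_sign_def case_prod_unfold)
 qed
 also have "... = (\<Prod>(e, f)\<in>edge_pairs Min M. chi (?s ` e) (?s ` f))"
 proof (rule prod_edge_pairs_key)
  show "inj_on ?k M" using comp_inj_on[OF injim Min_inj_on_matching[OF P']] by (simp add: comp_def)
  show "inj_on Min M" by (rule Min_inj_on_matching[OF M])
  show "chi (?s ` e) (?s ` f) = chi (?s ` f) (?s ` e)" if "e \<in> M" "f \<in> M" "e \<noteq> f" for e f
  proof (rule chi_commute)
   show "card (?s ` e) = 2" using perfect_onD(2)[OF P'] that by auto
   show "?s ` e \<inter> ?s ` f = {}" using perfect_onD(3)[OF M that] inj_flip[of w] by (simp add: image_Int[symmetric])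
  qed
 qed
 also have "... = (\<Prod>(e, f)\<in>edge_pairs Min M. chi e f * (if {e, f} = {e0, f0} then - 1 else 1))"
  by (rule prod.cong[OF refl]) (use chi' in \<open>auto simp: edge_pairs_def\<close>)
 also have "... = crossing_sign M * (\<Prod>(e, f)\<in>edge_pairs Min M. if {e, f} = {e0, f0} then - 1 else 1)"
  unfolding crossing_sign_def by (simp add: case_prod_unfold prod.distrib)
 also have "(\<Prod>(e, f)\<in>edge_pairs Min M. if {e, f} = {e0, f0} then - 1 else 1 :: int) = - 1"
 proof -
  define p where "p = (if Min e0 < Min f0 then (e0, f0) else (f0, e0))"
  have "Min e0 \<noteq> Min f0" using Min_inj_on_matching[OF M] ne ef by (auto simp: inj_on_def)
  hence p: "p \<in> edge_pairs Min M" using ef by (auto simp: p_def edge_pairs_def)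
  have "(\<Prod>(e, f)\<in>edge_pairs Min M. if {e, f} = {e0, f0} then - 1 else 1 :: int) = (\<Prod>q\<in>edge_pairs Min M. if q = p then - 1 else 1)"
   by (rule prod.cong[OF refl]) (auto simp: p_def edge_pairs_def doubleton_eq_iff split: if_splits)
  also have "... = - 1" using p finM by (simp add: prod.delta)
  finally show ?thesis .
 qed
 finally show ?thesis by simp
qed

lemma flip_edge:
 assumes w: "1 \<le> w" and e: "card e = 2" "e \<noteq> {2 * w - 1, 2 * w}"
 shows "Min (flip w ` e) = flip w (Min e)" "Max (flip w ` e) = flip w (Max e)"
proof -
 note E = edge_Min_Max[OF e(1)]
 have lt: "flip w (Min e) < flip w (Max e)"
  using flip_less[OF w, of "Min e" "Max e"] E(1,2) e(2) by auto
 have im: "flip w ` e = {flip w (Min e), flip w (Max e)}" using E(1) by (metis image_empty image_insert)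
 show "Min (flip w ` e) = flip w (Min e)" "Max (flip w ` e) = flip w (Max e)"
  unfolding im using lt by (auto simp: min_def max_def)
qed

section \<open>Sums over set partitions\<close>

text \<open>
  The Moebius function of the partition lattice, from \<open>\<pi>\<close> to the one-block
  partition.
\<close>

definition cumulant_coeff :: "'a set set => real" where
 "cumulant_coeff \<pi> = (-1) ^ (card \<pi> - 1) * fact (card \<pi> - 1)"

text \<open>The trace of a partition on the complement of \<open>C\<close>.\<close>

definition remove_from_blocks :: "'a set => 'a set set => 'a set set" where
 "remove_from_blocks C \<pi> = (%B. B - C) ` \<pi> - {{}}"

lemma finite_partitions: "finite A ==> finite {\<pi>. partition_on A \<pi>}"
 by (rule finite_subset[of _ "Pow (Pow A)"]) (auto simp: partition_on_def)

lemma partition_on_finite: "finite A ==> partition_on A \<pi> ==> finite \<pi>"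
 unfolding partition_on_def by (metis finite_UnionD)

lemma partition_block_unique:
 assumes "partition_on A \<pi>" "B \<in> \<pi>" "B' \<in> \<pi>" "x \<in> B" "x \<in> B'" shows "B = B'"
 using assms unfolding partition_on_def disjoint_def by blast

text \<open>
  The partitions with a given trace on the complement of \<open>C\<close>, which has \<open>j
  \<ge> 1\<close> blocks, are the one where \<open>C\<close> is a block of its own and the
  \<open>j\<close> ones where it is added to a block. Their coefficients cancel, as
  \<open>j\<close> times \<open>(-1)^(j - 1) (j - 1)!\<close> is \<open>- (-1)^j j!\<close>.
\<close>

lemma sum_partitions_containing:
 fixes g :: "'a set set => real"
 assumes A: "finite A" and C: "C \<subseteq> A" "C \<noteq> {}" "A - C \<noteq> {}"
 shows "(\<Sum>\<pi> | partition_on A \<pi> \<and> (\<exists>B\<in>\<pi>. C \<subseteq> B). cumulant_coeff \<pi> * g (remove_from_blocks C \<pi>)) = 0"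
proof -
 let ?P = "{\<pi>. partition_on A \<pi> \<and> (\<exists>B\<in>\<pi>. C \<subseteq> B)}" and ?Q = "{\<pi>'. partition_on (A - C) \<pi>'}"
 \<comment> \<open>a fibre consists of the trace together with the block \<open>snd p\<close> to which \<open>C\<close> is added; the empty block stands for \<open>C\<close> on its own\<close>
 let ?h = "%p. insert (snd p \<union> C) (fst p - {snd p})"
 let ?j = "%\<pi>. (remove_from_blocks C \<pi>, \<Union>{B\<in>\<pi>. C \<subseteq> B} - C)"
 obtain c where c: "c \<in> C" using C by blast
 have blk: "\<Union>{B\<in>\<pi>. C \<subseteq> B} = B" if "partition_on A \<pi>" "B \<in> \<pi>" "C \<subseteq> B" for \<pi> B
  using partition_block_unique[OF that(1,2)] that c by blast
 have restr: "remove_from_blocks C \<pi> = (\<pi> - {B}) \<union> ({B - C} - {{}})" if "partition_on A \<pi>" "B \<in> \<pi>" "C \<subseteq> B" for \<pi> B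
 proof -
  have "B' - C = B'" "B' \<noteq> {}" if "B' \<in> \<pi> - {B}" for B'
  proof -
   have "B' \<inter> B = {}" using that \<open>partition_on A \<pi>\<close> \<open>B \<in> \<pi>\<close> unfolding partition_on_def disjoint_def by auto
   thus "B' - C = B'" using \<open>C \<subseteq> B\<close> by auto
   show "B' \<noteq> {}" using that \<open>partition_on A \<pi>\<close> unfolding partition_on_def by auto
  qed
  note rest = this
  have "(%B. B - C) ` (\<pi> - {B}) = \<pi> - {B}" using rest(1) by (force simp: image_iff)
  moreover have "\<pi> = insert B (\<pi> - {B})" using that(2) by auto
  ultimately have "(%B. B - C) ` \<pi> = insert (B - C) (\<pi> - {B})" by (metis image_insert)
  thus ?thesis unfolding remove_from_blocks_def using rest(2) by auto
 qed
 have cB: "B - C \<notin> \<pi> - {B}" if "partition_on A \<pi>" "B \<in> \<pi>" "C \<subseteq> B" for \<pi> B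
 proof
  assume a: "B - C \<in> \<pi> - {B}"
  hence "B - C \<noteq> {}" using partition_onD3[OF that(1)] by (metis DiffD1)
  then obtain x where "x \<in> B - C" by blast
  hence "B - C = B" using partition_block_unique[OF that(1), of "B - C" B x] a that by auto
  thus False using that(3) c by blast
 qed
 have hP: "partition_on A (?h (\<pi>', o'))" if p: "partition_on (A - C) \<pi>'" "o' \<in> insert {} \<pi>'" for \<pi>' o'
 proof (rule partition_onI)
  have e: "\<Union>\<pi>' = A - C" "{} \<notin> \<pi>'" using p(1) unfolding partition_on_def by auto
  have "\<Union>(?h (\<pi>', o')) = \<Union>\<pi>' \<union> C" using p(2) by auto
  thus "\<Union>(?h (\<pi>', o')) = A" using e C(1) by auto
  show "{} \<notin> ?h (\<pi>', o')" using e(2) c by auto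
  show "disjnt p q" if "p \<in> ?h (\<pi>', o')" "q \<in> ?h (\<pi>', o')" "p \<noteq> q" for p q
  proof -
   have d: "r \<inter> (o' \<union> C) = {}" if "r \<in> \<pi>' - {o'}" for r
   proof -
    have "r \<inter> C = {}" using that e(1) by auto
    moreover have "r \<inter> o' = {}" using that p unfolding partition_on_def disjoint_def by auto
    ultimately show ?thesis by auto
   qed
   have "r \<inter> s = {}" if "r \<in> \<pi>'" "s \<in> \<pi>'" "r \<noteq> s" for r s
    using that p(1) unfolding partition_on_def disjoint_def by auto
   note d' = this
   have "p = o' \<union> C \<or> p \<in> \<pi>' - {o'}" "q = o' \<union> C \<or> q \<in> \<pi>' - {o'}" using that by auto
   thus ?thesis unfolding disjnt_def using that(3) d[of p] d[of q] d'[of p q] by (metis DiffD1 Int_commute)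
  qed
 qed
 have "(\<Sum>\<pi>\<in>?P. cumulant_coeff \<pi> * g (remove_from_blocks C \<pi>)) =
   (\<Sum>p\<in>Sigma ?Q (insert {}). cumulant_coeff (?h p) * g (fst p))"
 proof (rule sum.reindex_bij_witness[where i="?h" and j="?j"])
  fix \<pi> assume "\<pi> \<in> ?P"
  then obtain B where B: "partition_on A \<pi>" "B \<in> \<pi>" "C \<subseteq> B" by auto
  note r = restr[OF B] and b = blk[OF B] and n = cB[OF B]
  show hj: "?h (?j \<pi>) = \<pi>"
  proof -
   have "?h (?j \<pi>) = insert B (\<pi> - {B} \<union> ({B - C} - {{}}) - {B - C})" using B(3) by (simp add: r b Un_absorb2)
   also have "... = insert B (\<pi> - {B})" using n by auto
   finally show ?thesis using B(2) by auto
  qed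
  have "partition_on (A - C) (remove_from_blocks C \<pi>)"
  proof (rule partition_onI)
   show "\<Union>(remove_from_blocks C \<pi>) = A - C" using B(1) unfolding remove_from_blocks_def partition_on_def by auto
   show "{} \<notin> remove_from_blocks C \<pi>" by (auto simp: remove_from_blocks_def)
   show "disjnt p q" if "p \<in> remove_from_blocks C \<pi>" "q \<in> remove_from_blocks C \<pi>" "p \<noteq> q" for p q
    using that B(1) unfolding remove_from_blocks_def partition_on_def disjoint_def disjnt_def by blast
  qed
  moreover have "B - C \<in> insert {} (remove_from_blocks C \<pi>)" unfolding r by auto
  ultimately show "?j \<pi> \<in> Sigma ?Q (insert {})" using b by simp
  show "cumulant_coeff (?h (?j \<pi>)) * g (fst (?j \<pi>)) = cumulant_coeff \<pi> * g (remove_from_blocks C \<pi>)"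
   unfolding hj by simp
 next
  fix p assume "p \<in> Sigma ?Q (insert {})"
  then obtain \<pi>' o' where p: "p = (\<pi>', o')" "partition_on (A - C) \<pi>'" "o' \<in> insert {} \<pi>'" by (cases p) auto
  have P: "partition_on A (?h p)" unfolding p(1) by (rule hP[OF p(2,3)])
  have B: "o' \<union> C \<in> ?h p" "C \<subseteq> o' \<union> C" by (auto simp: p)
  show "?h p \<in> ?P" using P B by blast
  have e: "\<Union>\<pi>' = A - C" "{} \<notin> \<pi>'" using p(2) unfolding partition_on_def by auto
  have oC: "(o' \<union> C) - C = o'" using p(3) e by auto
  have ni: "o' \<union> C \<notin> \<pi>'" using e(1) c by auto
  have "remove_from_blocks C (?h p) = (?h p - {o' \<union> C}) \<union> ({o'} - {{}})"
   using restr[OF P B] unfolding oC .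
  also have "... = \<pi>'" using p(3) ni e(2) by (auto simp: p(1))
  finally show "?j (?h p) = p" using blk[OF P B] oC by (simp add: p(1))
 qed
 also have "... = (\<Sum>\<pi>'\<in>?Q. \<Sum>o'\<in>insert {} \<pi>'. cumulant_coeff (?h (\<pi>', o')) * g \<pi>')"
  using A partition_on_finite[of "A - C"] finite_partitions[of "A - C"]
  by (subst sum.Sigma) (auto simp: case_prod_unfold)
 also have "... = 0"
 proof (rule sum.neutral, rule ballI)
  fix \<pi>' assume "\<pi>' \<in> ?Q"
  hence p: "partition_on (A - C) \<pi>'" by simp
  have fin: "finite \<pi>'" by (rule partition_on_finite[OF _ p]) (use A in simp)
  have e: "\<Union>\<pi>' = A - C" "{} \<notin> \<pi>'" using p unfolding partition_on_def by auto
  have ni: "X \<union> C \<notin> \<pi>'" for X using e(1) c by auto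
  obtain j where j: "card \<pi>' = Suc j" using e(1) C(3) fin by (metis Sup_empty card_0_eq not0_implies_Suc)
  have 1: "cumulant_coeff (?h (\<pi>', {})) = (-1) ^ Suc j * fact (Suc j)"
   using ni[of "{}"] fin e(2) j by (simp add: cumulant_coeff_def)
  have 2: "cumulant_coeff (?h (\<pi>', o')) = (-1) ^ j * fact j" if o': "o' \<in> \<pi>'" for o'
  proof -
   have "card (?h (\<pi>', o')) = Suc (card (\<pi>' - {o'}))" using ni[of o'] fin by (simp add: card_insert_disjoint)
   also have "... = Suc j" using j o' fin by simp
   finally show ?thesis by (simp add: cumulant_coeff_def)
  qed
  have "(\<Sum>o'\<in>insert {} \<pi>'. cumulant_coeff (?h (\<pi>', o')) * g \<pi>') =
    cumulant_coeff (?h (\<pi>', {})) * g \<pi>' + (\<Sum>o'\<in>\<pi>'. cumulant_coeff (?h (\<pi>', o')) * g \<pi>')"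
   by (rule sum.insert[OF fin e(2)])
  also have "(\<Sum>o'\<in>\<pi>'. cumulant_coeff (?h (\<pi>', o')) * g \<pi>') = (\<Sum>o'\<in>\<pi>'. (-1) ^ j * fact j * g \<pi>')"
   by (rule sum.cong[OF refl]) (simp only: 2)
  finally show "(\<Sum>o'\<in>insert {} \<pi>'. cumulant_coeff (?h (\<pi>', o')) * g \<pi>') = 0"
   unfolding 1 by (simp add: j algebra_simps)
 qed
 finally show ?thesis .
qed

lemma prod_sum_subsets:
 fixes f :: "'a set => real"
 assumes "finite \<pi>" "disjoint \<pi>" "\<And>B. B \<in> \<pi> ==> finite B"
 shows "(\<Prod>B\<in>\<pi>. \<Sum>D\<in>Pow B. f D) = (\<Sum>D\<in>Pow (\<Union>\<pi>). \<Prod>B\<in>\<pi>. f (B \<inter> D))"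
 using assms
proof (induction \<pi> rule: finite_induct)
 case (insert B \<pi>)
 have d: "B \<inter> \<Union>\<pi> = {}" using insert(2,4) unfolding disjoint_def by auto
 have dj: "disjoint \<pi>" using insert(4) unfolding disjoint_def by auto
 have "(\<Prod>B\<in>insert B \<pi>. \<Sum>D\<in>Pow B. f D) = (\<Sum>D\<in>Pow B. f D) * (\<Sum>D\<in>Pow (\<Union>\<pi>). \<Prod>B\<in>\<pi>. f (B \<inter> D))"
  using insert.IH[OF dj] insert by simp
 also have "... = (\<Sum>p\<in>Pow B \<times> Pow (\<Union>\<pi>). f (fst p) * (\<Prod>B\<in>\<pi>. f (B \<inter> snd p)))"
  by (simp add: sum_product sum.cartesian_product case_prod_unfold)
 also have "... = (\<Sum>D\<in>Pow (\<Union>(insert B \<pi>)). \<Prod>B\<in>insert B \<pi>. f (B \<inter> D))"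
 proof (rule sum.reindex_bij_witness[where i="%D. (B \<inter> D, D - B)" and j="%p. fst p \<union> snd p"])
  fix p assume p: "p \<in> Pow B \<times> Pow (\<Union>\<pi>)"
  hence s1: "fst p \<subseteq> B" "snd p \<subseteq> \<Union>\<pi>" by (simp_all only: mem_Times_iff Pow_iff)
  hence s2: "snd p \<inter> B = {}" using d by blast
  note s = s1(1) s2 s1(2)
  show "(B \<inter> (fst p \<union> snd p), fst p \<union> snd p - B) = p"
   by (rule prod_eqI; simp only: fst_conv snd_conv; use s in blast)
  show "fst p \<union> snd p \<in> Pow (\<Union>(insert B \<pi>))" using s by auto
  have "B \<inter> (fst p \<union> snd p) = fst p" using s by auto
  moreover have "E \<inter> (fst p \<union> snd p) = E \<inter> snd p" if "E \<in> \<pi>" for E using s d that by blast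
  ultimately show "(\<Prod>B\<in>insert B \<pi>. f (B \<inter> (fst p \<union> snd p))) = f (fst p) * (\<Prod>B\<in>\<pi>. f (B \<inter> snd p))"
   using insert(1,2) by simp
 qed (use d in auto)
 finally show ?case .
qed simp

text \<open>
  Expanding all blocks gives a sum over subsets \<open>D\<close> of the whole set. If
  \<open>D\<close> misses a point \<open>w\<close>, the term depends only on the trace of the
  partition off \<open>w\<close> and sums to zero by cancellation. This expresses that a cumulant
  of order at least 2 ignores the additive constants in \<open>1 - X\<close>.
\<close>

lemma partition_sum_complement:
 fixes m :: "'a set => real"
 assumes A: "finite A" "2 \<le> card A" and m: "m {} = 1"
 shows "(\<Sum>\<pi> | partition_on A \<pi>. cumulant_coeff \<pi> * (\<Prod>B\<in>\<pi>. \<Sum>D\<in>Pow B. (-1) ^ card D * m D)) =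
  (-1) ^ card A * (\<Sum>\<pi> | partition_on A \<pi>. cumulant_coeff \<pi> * (\<Prod>B\<in>\<pi>. m B))"
proof -
 let ?f = "%D. (-1) ^ card D * m D" and ?P = "{\<pi>. partition_on A \<pi>}"
 have fb: "finite B" if "partition_on A \<pi>" "B \<in> \<pi>" for \<pi> B
  using that A(1) unfolding partition_on_def by (metis Union_upper finite_subset)
 have "(\<Sum>\<pi>\<in>?P. cumulant_coeff \<pi> * (\<Prod>B\<in>\<pi>. \<Sum>D\<in>Pow B. ?f D)) = (\<Sum>\<pi>\<in>?P. \<Sum>D\<in>Pow A. cumulant_coeff \<pi> * (\<Prod>B\<in>\<pi>. ?f (B \<inter> D)))"
 proof (rule sum.cong[OF refl])
  fix \<pi> assume "\<pi> \<in> ?P"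
  hence p: "partition_on A \<pi>" by simp
  have "(\<Prod>B\<in>\<pi>. \<Sum>D\<in>Pow B. ?f D) = (\<Sum>D\<in>Pow (\<Union>\<pi>). \<Prod>B\<in>\<pi>. ?f (B \<inter> D))"
   by (rule prod_sum_subsets) (use partition_on_finite[OF A(1) p] p fb[OF p] in \<open>auto simp: partition_on_def\<close>)
  also have "\<Union>\<pi> = A" using p unfolding partition_on_def by simp
  finally show "cumulant_coeff \<pi> * (\<Prod>B\<in>\<pi>. \<Sum>D\<in>Pow B. ?f D) = (\<Sum>D\<in>Pow A. cumulant_coeff \<pi> * (\<Prod>B\<in>\<pi>. ?f (B \<inter> D)))"
   by (simp only: sum_distrib_left)
 qed
 also have "... = (\<Sum>D\<in>Pow A. \<Sum>\<pi>\<in>?P. cumulant_coeff \<pi> * (\<Prod>B\<in>\<pi>. ?f (B \<inter> D)))" by (rule sum.swap)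
 also have "... = (\<Sum>D\<in>{A}. \<Sum>\<pi>\<in>?P. cumulant_coeff \<pi> * (\<Prod>B\<in>\<pi>. ?f (B \<inter> D)))"
 proof (rule sum.mono_neutral_right)
  show "\<forall>D\<in>Pow A - {A}. (\<Sum>\<pi>\<in>?P. cumulant_coeff \<pi> * (\<Prod>B\<in>\<pi>. ?f (B \<inter> D))) = 0"
  proof
   fix D assume "D \<in> Pow A - {A}"
   then obtain w where w: "w \<in> A" "w \<notin> D" by auto
   have ne: "A - {w} \<noteq> {}"
   proof
    assume "A - {w} = {}"
    hence "card A \<le> card {w}" by (intro card_mono) auto
    thus False using A(2) by simp
   qed
   have cov: "\<exists>B\<in>\<pi>. {w} \<subseteq> B" if "partition_on A \<pi>" for \<pi> using that w(1) unfolding partition_on_def by auto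
   have "(\<Prod>B\<in>\<pi>. ?f (B \<inter> D)) = (\<Prod>B\<in>remove_from_blocks {w} \<pi>. ?f (B \<inter> D))" if p: "partition_on A \<pi>" for \<pi>
   proof -
    have "(\<Prod>B\<in>remove_from_blocks {w} \<pi>. ?f (B \<inter> D)) = (\<Prod>B\<in>(%B. B - {w}) ` \<pi>. ?f (B \<inter> D))"
     unfolding remove_from_blocks_def using partition_on_finite[OF A(1) p] m
     by (intro prod.mono_neutral_left) auto
    also have "... = prod ((%B. ?f (B \<inter> D)) \<circ> (%B. B - {w})) \<pi>"
    proof (rule prod.reindex_nontrivial[OF partition_on_finite[OF A(1) p]])
     fix B1 B2 assume B: "B1 \<in> \<pi>" "B2 \<in> \<pi>" "B1 \<noteq> B2" "B1 - {w} = B2 - {w}"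
     hence "B1 \<inter> B2 = {}" using p unfolding partition_on_def disjoint_def by auto
     hence e: "B1 - {w} = {}" using B(4) by blast
     show "?f ((B1 - {w}) \<inter> D) = 1" unfolding e using m by simp
    qed
    also have "... = (\<Prod>B\<in>\<pi>. ?f (B \<inter> D))"
    proof (rule prod.cong[OF refl])
     fix B
     have "(B - {w}) \<inter> D = B \<inter> D" using w(2) by auto
     thus "((%B. ?f (B \<inter> D)) \<circ> (%B. B - {w})) B = ?f (B \<inter> D)" by simp
    qed
    finally show ?thesis by simp
   qed
   hence "(\<Sum>\<pi>\<in>?P. cumulant_coeff \<pi> * (\<Prod>B\<in>\<pi>. ?f (B \<inter> D))) =
     (\<Sum>\<pi> | partition_on A \<pi> \<and> (\<exists>B\<in>\<pi>. {w} \<subseteq> B). cumulant_coeff \<pi> * (\<Prod>B\<in>remove_from_blocks {w} \<pi>. ?f (B \<inter> D)))"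
    using cov by (intro sum.cong) auto
   also have "... = 0" by (rule sum_partitions_containing) (use A(1) w(1) ne in auto)
   finally show "(\<Sum>\<pi>\<in>?P. cumulant_coeff \<pi> * (\<Prod>B\<in>\<pi>. ?f (B \<inter> D))) = 0" .
  qed
 qed (use A in auto)
 also have "... = (\<Sum>\<pi>\<in>?P. (-1) ^ card A * (cumulant_coeff \<pi> * (\<Prod>B\<in>\<pi>. m B)))"
 proof -
  have "cumulant_coeff \<pi> * (\<Prod>B\<in>\<pi>. ?f (B \<inter> A)) = (-1) ^ card A * (cumulant_coeff \<pi> * (\<Prod>B\<in>\<pi>. m B))"
   if p: "partition_on A \<pi>" for \<pi>
  proof -
   have "(\<Prod>B\<in>\<pi>. ?f (B \<inter> A)) = (\<Prod>B\<in>\<pi>. (-1) ^ card B * m B)"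
   proof (rule prod.cong[OF refl])
    fix B assume "B \<in> \<pi>"
    hence "B \<inter> A = B" using p unfolding partition_on_def by auto
    thus "?f (B \<inter> A) = (-1) ^ card B * m B" by simp
   qed
   also have "... = (-1) ^ (\<Sum>B\<in>\<pi>. card B) * (\<Prod>B\<in>\<pi>. m B)" by (simp add: prod.distrib power_sum)
   also have "(\<Sum>B\<in>\<pi>. card B) = card A"
    using card_Union_disjoint[of \<pi>] p fb[OF p] unfolding partition_on_def disjoint_def pairwise_def disjnt_def by auto
   finally show ?thesis by simp
  qed
  hence "(\<Sum>\<pi>\<in>?P. cumulant_coeff \<pi> * (\<Prod>B\<in>\<pi>. ?f (B \<inter> A))) = (\<Sum>\<pi>\<in>?P. (-1) ^ card A * (cumulant_coeff \<pi> * (\<Prod>B\<in>\<pi>. m B)))"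
   by (intro sum.cong[OF refl]) (simp only: mem_Collect_eq)
  thus ?thesis by (simp only: sum.insert finite.emptyI empty_iff not_False_eq_True sum.empty add_0_right)
 qed
 finally show ?thesis by (simp only: sum_distrib_left)
qed

section \<open>Connected matchings\<close>

definition refines :: "nat set set => nat set set => bool" where
 "refines M \<pi> \<longleftrightarrow> (\<forall>e\<in>M. \<exists>B\<in>\<pi>. particle_color ` e \<subseteq> B)"

text \<open>
  \<open>C\<close> is a union of components of the graph on walls in which the matching edges
  connect their colors.
\<close>

definition closed_walls :: "nat set set => nat set => bool" where
 "closed_walls M C \<longleftrightarrow> (\<forall>e\<in>M. particle_color ` e \<inter> C \<noteq> {} \<longrightarrow> particle_color ` e \<subseteq> C)"

definition connected_walls :: "nat set => nat set set => bool" where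
 "connected_walls A M \<longleftrightarrow> (\<forall>C. C \<subseteq> A \<and> C \<noteq> {} \<and> closed_walls M C \<longrightarrow> C = A)"

lemma perfect_on_Un:
 assumes M1: "perfect_on V1 M1" and M2: "perfect_on V2 M2" and d: "V1 \<inter> V2 = {}"
 shows "perfect_on (V1 \<union> V2) (M1 \<union> M2)"
proof (rule perfect_onI)
 show "\<Union>(M1 \<union> M2) = V1 \<union> V2" using perfect_onD(1)[OF M1] perfect_onD(1)[OF M2] by auto
 show "card e = 2" if "e \<in> M1 \<union> M2" for e using that perfect_onD(2)[OF M1] perfect_onD(2)[OF M2] by auto
 have x: "e \<inter> f = {}" if "e \<in> M1" "f \<in> M2" for e f
  using perfect_onD(6)[OF M1 that(1)] perfect_onD(6)[OF M2 that(2)] d by blast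
 show "e \<inter> f = {}" if "e \<in> M1 \<union> M2" "f \<in> M1 \<union> M2" "e \<noteq> f" for e f
  using that perfect_onD(3)[OF M1, of e f] perfect_onD(3)[OF M2, of e f] x[of e f] x[of f e] by blast
qed

text \<open>Choosing a matching for every block amounts to choosing one matching that refines the partition.\<close>

lemma prod_sum_matchings:
 fixes f :: "nat set set => real"
 assumes "finite \<pi>" "disjoint \<pi>" "\<And>B. B \<in> \<pi> ==> finite B \<and> 0 \<notin> B" and f0: "f {} = 1"
  and f: "\<And>A B M1 M2. perfect_on (points A) M1 ==> perfect_on (points B) M2 ==> A \<inter> B = {} ==> 0 \<notin> A ==> 0 \<notin> B ==>
    finite A ==> finite B ==> f (M1 \<union> M2) = f M1 * f M2"
 shows "(\<Prod>B\<in>\<pi>. \<Sum>M | perfect_on (points B) M. f M) = (\<Sum>M | perfect_on (points (\<Union>\<pi>)) M \<and> refines M \<pi>. f M)"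
 using assms(1-3)
proof (induction \<pi> rule: finite_induct)
 case empty
 have "{M. perfect_on (points {}) M \<and> refines M {}} = {{}}"
  by (auto simp: points_def refines_def perfect_on_def partition_on_def)
 thus ?case using f0 by simp
next
 case (insert B \<pi>)
 have d: "B \<inter> \<Union>\<pi> = {}" using insert(2,4) unfolding disjoint_def by auto
 have dj: "disjoint \<pi>" using insert(4) unfolding disjoint_def by auto
 have fin: "finite B" "finite (\<Union>\<pi>)" "0 \<notin> B" "0 \<notin> \<Union>\<pi>" using insert(1,5) by auto
 have dp: "points B \<inter> points (\<Union>\<pi>) = {}" using d by (auto simp: points_def)
 have pU: "points (\<Union>(insert B \<pi>)) = points B \<union> points (\<Union>\<pi>)" by (auto simp: points_def)
 let ?R = "{M. perfect_on (points (\<Union>\<pi>)) M \<and> refines M \<pi>}" and ?L = "{M. perfect_on (points B) M}"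
 have "(\<Prod>B\<in>insert B \<pi>. \<Sum>M | perfect_on (points B) M. f M) = (\<Sum>M\<in>?L. f M) * (\<Sum>M\<in>?R. f M)"
  using insert.IH[OF dj] insert by simp
 also have "... = (\<Sum>p\<in>?L \<times> ?R. f (fst p) * f (snd p))"
  by (simp add: sum_product sum.cartesian_product case_prod_unfold)
 also have "... = (\<Sum>M | perfect_on (points (\<Union>(insert B \<pi>))) M \<and> refines M (insert B \<pi>). f M)"
 proof (rule sum.reindex_bij_witness[where i="%M. ({e\<in>M. e \<subseteq> points B}, {e\<in>M. \<not> e \<subseteq> points B})" and j="%p. fst p \<union> snd p"])
  fix p assume "p \<in> ?L \<times> ?R"
  then obtain M1 M2 where p: "p = (M1, M2)" "perfect_on (points B) M1" "perfect_on (points (\<Union>\<pi>)) M2" "refines M2 \<pi>" by auto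
  have 1: "e \<subseteq> points B" if "e \<in> M1" for e by (rule perfect_onD(6)[OF p(2) that])
  have 2: "\<not> e \<subseteq> points B" if "e \<in> M2" for e using perfect_onD(5,6)[OF p(3) that] dp by blast
  show "({e\<in>fst p \<union> snd p. e \<subseteq> points B}, {e\<in>fst p \<union> snd p. \<not> e \<subseteq> points B}) = p"
   unfolding p(1) using 1 2 by auto
  have "refines M1 {B}" unfolding refines_def points_def using 1 by (auto simp: points_def)
  thus "fst p \<union> snd p \<in> {M. perfect_on (points (\<Union>(insert B \<pi>))) M \<and> refines M (insert B \<pi>)}"
   unfolding pU p(1) using perfect_on_Un[OF p(2,3) dp] p(4) by (auto simp: refines_def)
  show "f (fst p \<union> snd p) = f (fst p) * f (snd p)"
   unfolding p(1) using f[OF p(2,3) d fin(3,4,1,2)] by simp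
 next
  fix M assume "M \<in> {M. perfect_on (points (\<Union>(insert B \<pi>))) M \<and> refines M (insert B \<pi>)}"
  hence M: "perfect_on (points B \<union> points (\<Union>\<pi>)) M" "refines M (insert B \<pi>)" unfolding pU by auto
  show "fst ({e\<in>M. e \<subseteq> points B}, {e\<in>M. \<not> e \<subseteq> points B}) \<union> snd ({e\<in>M. e \<subseteq> points B}, {e\<in>M. \<not> e \<subseteq> points B}) = M" by auto
  have pe: "1 \<le> v" if "e \<in> M" "v \<in> e" for e v using perfect_onD(6)[OF M(1) that(1)] that(2) by (auto simp: points_def)
  have r: "\<exists>B'\<in>\<pi>. e \<subseteq> points B'" if "e \<in> M" "\<not> e \<subseteq> points B" for e
  proof -
   obtain B' where B': "B' \<in> insert B \<pi>" "particle_color ` e \<subseteq> B'" using M(2) \<open>e \<in> M\<close> by (auto simp: refines_def)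
   hence "e \<subseteq> points B'" using pe[OF that(1)] by (auto simp: points_def)
   thus ?thesis using that(2) B'(1) by auto
  qed
  have r': "e \<subseteq> points (\<Union>\<pi>)" if "e \<in> M" "\<not> e \<subseteq> points B" for e
   using r[OF that] by (auto simp: points_def)
  have L: "perfect_on (points B) {e\<in>M. e \<subseteq> points B}"
  proof (rule perfect_onI)
   have "v \<in> \<Union>{e\<in>M. e \<subseteq> points B}" if v: "v \<in> points B" for v
   proof -
    obtain e where e: "e \<in> M" "v \<in> e" using perfect_onD(1)[OF M(1)] v by blast
    hence "e \<subseteq> points B" using r'[OF e(1)] v dp by blast
    thus ?thesis using e by blast
   qed
   thus "\<Union>{e\<in>M. e \<subseteq> points B} = points B" by blast
  qed (use perfect_onD(2,3)[OF M(1)] in auto)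
  have R: "perfect_on (points (\<Union>\<pi>)) {e\<in>M. \<not> e \<subseteq> points B}"
  proof (rule perfect_onI)
   have "v \<in> \<Union>{e\<in>M. \<not> e \<subseteq> points B}" if v: "v \<in> points (\<Union>\<pi>)" for v
   proof -
    obtain e where e: "e \<in> M" "v \<in> e" using perfect_onD(1)[OF M(1)] v by blast
    hence "\<not> e \<subseteq> points B" using v dp by blast
    thus ?thesis using e by blast
   qed
   thus "\<Union>{e\<in>M. \<not> e \<subseteq> points B} = points (\<Union>\<pi>)" using r' by blast
  qed (use perfect_onD(2,3)[OF M(1)] in auto)
  have "refines {e\<in>M. \<not> e \<subseteq> points B} \<pi>" unfolding refines_def
  proof
   fix e assume "e \<in> {e\<in>M. \<not> e \<subseteq> points B}"
   then obtain B' where "B' \<in> \<pi>" "e \<subseteq> points B'" using r by auto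
   thus "\<exists>B\<in>\<pi>. particle_color ` e \<subseteq> B" by (auto simp: points_def)
  qed
  thus "({e\<in>M. e \<subseteq> points B}, {e\<in>M. \<not> e \<subseteq> points B}) \<in> ?L \<times> ?R" using L R by simp
 qed
 finally show ?case .
qed

text \<open>
  Let \<open>C\<close> be the component of some wall. A partition refined by the matching has
  \<open>C\<close> inside a block, and its other requirements concern the trace off
  \<open>C\<close>; so the sum cancels unless \<open>C\<close> is everything.
\<close>

lemma sum_partitions_refined:
 assumes A: "finite A" "A \<noteq> {}" "0 \<notin> A" and M: "perfect_on (points A) M"
 shows "(\<Sum>\<pi> | partition_on A \<pi> \<and> refines M \<pi>. cumulant_coeff \<pi>) = of_bool (connected_walls A M)"
proof -
 obtain w0 where w0: "w0 \<in> A" using A by blast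
 have Mne: "particle_color ` e \<noteq> {}" "particle_color ` e \<subseteq> A" if "e \<in> M" for e
  using perfect_onD(5,6)[OF M that] by (auto simp: points_def)
 \<comment> \<open>the component of \<open>w0\<close>\<close>
 define C where "C = \<Inter>{C. C \<subseteq> A \<and> w0 \<in> C \<and> closed_walls M C}"
 have clA: "closed_walls M A" using Mne(2) by (simp add: closed_walls_def)
 have C: "w0 \<in> C" "C \<subseteq> A" "closed_walls M C"
 proof -
  show "w0 \<in> C" by (auto simp: C_def)
  show "C \<subseteq> A" unfolding C_def using w0 clA by (intro Inter_lower) auto
  show "closed_walls M C" unfolding closed_walls_def
  proof (intro ballI impI)
   fix e assume e: "e \<in> M" "particle_color ` e \<inter> C \<noteq> {}"
   have "particle_color ` e \<subseteq> C'" if "C' \<subseteq> A" "w0 \<in> C'" "closed_walls M C'" for C'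
    using that e unfolding closed_walls_def C_def by blast
   thus "particle_color ` e \<subseteq> C" unfolding C_def by blast
  qed
 qed
 have minC: "C \<subseteq> C'" if "C' \<subseteq> A" "w0 \<in> C'" "closed_walls M C'" for C' using that by (auto simp: C_def)
 have blkC: "\<exists>B\<in>\<pi>. C \<subseteq> B" if p: "partition_on A \<pi>" and r: "refines M \<pi>" for \<pi>
 proof -
  obtain B where B: "B \<in> \<pi>" "w0 \<in> B" using w0 p unfolding partition_on_def by auto
  have "closed_walls M B" unfolding closed_walls_def
  proof (intro ballI impI)
   fix e assume e: "e \<in> M" "particle_color ` e \<inter> B \<noteq> {}"
   obtain B' where B': "B' \<in> \<pi>" "particle_color ` e \<subseteq> B'" using r e(1) by (auto simp: refines_def)
   hence "B' = B" using partition_block_unique[OF p B'(1) B(1)] e(2) by blast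
   thus "particle_color ` e \<subseteq> B" using B' by simp
  qed
  moreover have "B \<subseteq> A" using B p unfolding partition_on_def by auto
  ultimately show ?thesis using minC B by blast
 qed
 show ?thesis
 proof (cases "C = A")
  case True
  have con: "connected_walls A M" unfolding connected_walls_def
  proof (intro allI impI)
   fix C' assume C': "C' \<subseteq> A \<and> C' \<noteq> {} \<and> closed_walls M C'"
   have co: "closed_walls M (A - C')" unfolding closed_walls_def
   proof (intro ballI impI)
    fix e assume e: "e \<in> M" "particle_color ` e \<inter> (A - C') \<noteq> {}"
    hence "particle_color ` e \<inter> C' = {}" using C' unfolding closed_walls_def by blast
    thus "particle_color ` e \<subseteq> A - C'" using Mne(2)[OF e(1)] by blast
   qed
   have "w0 \<in> C'"
   proof (rule ccontr)
    assume "w0 \<notin> C'"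
    hence "C \<subseteq> A - C'" using minC[of "A - C'"] co w0 by simp
    thus False using True C' by auto
   qed
   thus "C' = A" using minC[of C'] C' True by auto
  qed
  have "{\<pi>. partition_on A \<pi> \<and> refines M \<pi>} = {{A}}"
  proof (intro equalityI subsetI)
   fix \<pi> assume "\<pi> \<in> {\<pi>. partition_on A \<pi> \<and> refines M \<pi>}"
   hence p: "partition_on A \<pi>" "refines M \<pi>" by auto
   obtain B where B: "B \<in> \<pi>" "A \<subseteq> B" using blkC[OF p] True by auto
   have "B' = B" if "B' \<in> \<pi>" for B'
   proof -
    have "B' \<noteq> {}" using partition_onD3[OF p(1)] that by metis
    then obtain x where x: "x \<in> B'" by blast
    hence "x \<in> B" using p(1) that B(2) unfolding partition_on_def by auto
    thus ?thesis using partition_block_unique[OF p(1) that B(1) x] by simp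
   qed
   moreover have "B = A" using B p(1) unfolding partition_on_def by auto
   ultimately show "\<pi> \<in> {{A}}" using B(1) by auto
  qed (use A Mne(2) in \<open>auto simp: partition_on_def refines_def\<close>)
  thus ?thesis using con by (simp add: cumulant_coeff_def)
 next
  case False
  have "\<not> connected_walls A M" using C False unfolding connected_walls_def by blast
  define g where "g \<pi>' = (of_bool (\<forall>e\<in>M. particle_color ` e \<inter> C = {} \<longrightarrow> (\<exists>B\<in>\<pi>'. particle_color ` e \<subseteq> B)) :: real)" for \<pi>'
  have ex: "(\<exists>B\<in>remove_from_blocks C \<pi>. K \<subseteq> B) \<longleftrightarrow> (\<exists>B\<in>\<pi>. K \<subseteq> B - C)" if "K \<noteq> {}" for K \<pi>
  proof
   assume "\<exists>B\<in>\<pi>. K \<subseteq> B - C"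
   then obtain B where B: "B \<in> \<pi>" "K \<subseteq> B - C" by blast
   hence "B - C \<in> remove_from_blocks C \<pi>" using that unfolding remove_from_blocks_def by blast
   thus "\<exists>B\<in>remove_from_blocks C \<pi>. K \<subseteq> B" using B(2) by blast
  qed (auto simp: remove_from_blocks_def)
  have g: "g (remove_from_blocks C \<pi>) = of_bool (refines M \<pi>)" if p: "partition_on A \<pi>" "\<exists>B\<in>\<pi>. C \<subseteq> B" for \<pi>
  proof -
   have "(\<exists>B\<in>\<pi>. particle_color ` e \<subseteq> B) \<longleftrightarrow> (particle_color ` e \<inter> C = {} \<longrightarrow> (\<exists>B\<in>remove_from_blocks C \<pi>. particle_color ` e \<subseteq> B))" if e: "e \<in> M" for e
   proof (cases "particle_color ` e \<inter> C = {}")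
    case True
    have "(\<exists>B\<in>remove_from_blocks C \<pi>. particle_color ` e \<subseteq> B) \<longleftrightarrow> (\<exists>B\<in>\<pi>. particle_color ` e \<subseteq> B - C)"
     by (rule ex[OF Mne(1)[OF e]])
    moreover have "particle_color ` e \<subseteq> B - C \<longleftrightarrow> particle_color ` e \<subseteq> B" for B
     using True by (simp only: Diff_eq Int_subset_iff disjoint_eq_subset_Compl simp_thms)
    ultimately show ?thesis using True by (simp only: simp_thms)
   next
    case False
    hence "particle_color ` e \<subseteq> C" using C(3) e unfolding closed_walls_def by blast
    hence "\<exists>B\<in>\<pi>. particle_color ` e \<subseteq> B" using p(2) by (meson order_trans)
    thus ?thesis using False by blast
   qed
   thus ?thesis unfolding g_def refines_def by simp
  qed
  have "(\<Sum>\<pi> | partition_on A \<pi> \<and> refines M \<pi>. cumulant_coeff \<pi>) =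
    (\<Sum>\<pi> | partition_on A \<pi> \<and> (\<exists>B\<in>\<pi>. C \<subseteq> B). cumulant_coeff \<pi> * g (remove_from_blocks C \<pi>))"
   by (rule sum.mono_neutral_cong_left)
    (use finite_subset[OF _ finite_partitions[OF A(1)]] g blkC in \<open>auto intro!: finite_subset[OF _ finite_partitions[OF A(1)]]\<close>)
  also have "... = 0" by (rule sum_partitions_containing) (use A C False in auto)
  finally show ?thesis using \<open>\<not> connected_walls A M\<close> by simp
 qed
qed

lemma partition_sum_connected:
 fixes f :: "nat set set => real"
 assumes A: "finite A" "A \<noteq> {}" "0 \<notin> A" and f0: "f {} = 1"
  and f: "\<And>A B M1 M2. perfect_on (points A) M1 ==> perfect_on (points B) M2 ==> A \<inter> B = {} ==> 0 \<notin> A ==> 0 \<notin> B ==>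
    finite A ==> finite B ==> f (M1 \<union> M2) = f M1 * f M2"
 shows "(\<Sum>\<pi> | partition_on A \<pi>. cumulant_coeff \<pi> * (\<Prod>B\<in>\<pi>. \<Sum>M | perfect_on (points B) M. f M)) =
  (\<Sum>M | perfect_on (points A) M \<and> connected_walls A M. f M)"
proof -
 let ?P = "{\<pi>. partition_on A \<pi>}" and ?M = "{M. perfect_on (points A) M}"
 have fin: "finite ?P" "finite ?M" using finite_partitions[OF A(1)] finite_perfect[OF finite_points[OF A(1)]] by auto
 have "(\<Sum>\<pi>\<in>?P. cumulant_coeff \<pi> * (\<Prod>B\<in>\<pi>. \<Sum>M | perfect_on (points B) M. f M)) =
   (\<Sum>\<pi>\<in>?P. \<Sum>M\<in>?M. of_bool (refines M \<pi>) * cumulant_coeff \<pi> * f M)"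
 proof (rule sum.cong[OF refl])
  fix \<pi> assume "\<pi> \<in> ?P"
  hence p: "partition_on A \<pi>" by simp
  hence U: "\<Union>\<pi> = A" "disjoint \<pi>" unfolding partition_on_def by auto
  have "(\<Prod>B\<in>\<pi>. \<Sum>M | perfect_on (points B) M. f M) = (\<Sum>M | perfect_on (points (\<Union>\<pi>)) M \<and> refines M \<pi>. f M)"
  proof (rule prod_sum_matchings[OF partition_on_finite[OF A(1) p] U(2) _ f0 f])
   show "finite B \<and> 0 \<notin> B" if "B \<in> \<pi>" for B using that U(1) A by (metis Union_upper finite_subset subsetD)
  qed
  also have "... = (\<Sum>M\<in>?M. of_bool (refines M \<pi>) * f M)"
   unfolding U by (rule sum.mono_neutral_cong_left) (use fin in auto)
  finally show "cumulant_coeff \<pi> * (\<Prod>B\<in>\<pi>. \<Sum>M | perfect_on (points B) M. f M) =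
    (\<Sum>M\<in>?M. of_bool (refines M \<pi>) * cumulant_coeff \<pi> * f M)"
   by (simp add: sum_distrib_left mult_ac)
 qed
 also have "... = (\<Sum>M\<in>?M. \<Sum>\<pi>\<in>?P. of_bool (refines M \<pi>) * cumulant_coeff \<pi> * f M)" by (rule sum.swap)
 also have "... = (\<Sum>M\<in>?M. of_bool (connected_walls A M) * f M)"
 proof (rule sum.cong[OF refl])
  fix M assume "M \<in> ?M"
  hence M: "perfect_on (points A) M" by simp
  have "(\<Sum>\<pi>\<in>?P. of_bool (refines M \<pi>) * cumulant_coeff \<pi>) = (\<Sum>\<pi> | partition_on A \<pi> \<and> refines M \<pi>. cumulant_coeff \<pi>)"
   by (rule sum.mono_neutral_cong_right) (use fin in auto)
  also have "... = of_bool (connected_walls A M)" by (rule sum_partitions_refined[OF A M])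
  finally show "(\<Sum>\<pi>\<in>?P. of_bool (refines M \<pi>) * cumulant_coeff \<pi> * f M) = of_bool (connected_walls A M) * f M"
   by (simp only: sum_distrib_right[symmetric])
 qed
 also have "... = (\<Sum>M | perfect_on (points A) M \<and> connected_walls A M. f M)"
  by (rule sum.mono_neutral_cong_right) (use fin in auto)
 finally show ?thesis .
qed


text \<open>A closed set of walls is never left when one goes around the cycle.\<close>

lemma connected_walls_if_hamiltonian:
 assumes M: "perfect_on (points {1..k}) M" and H: "hamiltonian_cycle {1..2 * k} (wall_edges k \<union> M)"
 shows "connected_walls {1..k} M"
 unfolding connected_walls_def
proof (intro allI impI)
 fix C assume C: "C \<subseteq> {1..k} \<and> C \<noteq> {} \<and> closed_walls M C"
 obtain vs where vs: "distinct vs" "set vs = {1..2 * k}"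
  "wall_edges k \<union> M = {{vs ! i, vs ! (Suc i mod length vs)} | i. i < length vs}"
  using H unfolding hamiltonian_cycle_def by blast
 have same: "particle_color u \<in> C \<longleftrightarrow> particle_color v \<in> C" if "{u, v} \<in> wall_edges k \<union> M" for u v
 proof (cases "{u, v} \<in> M")
  case True
  have cl: "closed_walls M C" using C by simp
  have "particle_color ` {u, v} \<inter> C \<noteq> {} \<longrightarrow> particle_color ` {u, v} \<subseteq> C"
   by (rule bspec[OF cl[unfolded closed_walls_def] True])
  thus ?thesis by auto
 next
  case False
  hence "{u, v} \<in> wall_edges k" using that by blast
  then obtain w where w0: "{u, v} = {2 * w - 1, 2 * w}" "w \<in> {1..k}" unfolding wall_edges_def by blast
  hence w: "{u, v} = {2 * w - 1, 2 * w}" "1 \<le> w" by (simp_all only: atLeastAtMost_iff)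
  hence "u = 2 * w - 1 \<and> v = 2 * w \<or> u = 2 * w \<and> v = 2 * w - 1" by (simp only: doubleton_eq_iff)
  thus ?thesis using particle_color_pair(1)[OF w(2)] particle_color_pair(2)[of w] by auto
 qed
 have step: "particle_color (vs ! i) \<in> C \<longleftrightarrow> particle_color (vs ! (Suc i mod length vs)) \<in> C" if "i < length vs" for i
  by (rule same) (use vs(3) that in blast)
 have all: "particle_color (vs ! i) \<in> C \<longleftrightarrow> particle_color (vs ! 0) \<in> C" if "i < length vs" for i
  using that
 proof (induction i)
  case (Suc i)
  thus ?case using step[of i] by simp
 qed simp
 obtain w where w: "w \<in> C" "1 \<le> w" "w \<le> k" using C by fastforce
 have "2 * w \<in> set vs" using w vs(2) by auto
 then obtain i where i: "i < length vs" "vs ! i = 2 * w" by (auto simp: in_set_conv_nth)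
 have 0: "particle_color (vs ! 0) \<in> C" using all[OF i(1)] i(2) w particle_color_pair(2)[of w] by simp
 have "w' \<in> C" if w': "w' \<in> {1..k}" for w'
 proof -
  have "2 * w' \<in> set vs" using w' vs(2) by auto
  then obtain i where i: "i < length vs" "vs ! i = 2 * w'" by (auto simp: in_set_conv_nth)
  thus ?thesis using all[OF i(1)] 0 particle_color_pair(2)[of w'] by simp
 qed
 thus "C = {1..k}" using C by blast
qed

text \<open>
  Start at a point and follow wall and matching edges in turn. If the walk met the far end of an
  earlier wall edge, it would retrace itself, and the retracing would have to turn around at a
  fixed point of one of the two partner maps.
\<close>

lemma alternating_walk_distinct:
 fixes wp mp :: "nat => nat" and a :: "nat => nat"
 assumes wp: "\<And>v. wp (wp v) = v" and mp: "\<And>v. mp (mp v) = v"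
  and a: "\<And>i. a (Suc i) = mp (wp (a i))"
  and nfix: "\<And>i. wp (a i) \<noteq> a i" "\<And>i. mp (wp (a i)) \<noteq> wp (a i)"
 shows "a i \<noteq> wp (a j)"
proof -
 have main: "a (j + d) \<noteq> wp (a j)" for j d
 proof (induction d arbitrary: j rule: less_induct)
  case (less d)
  consider "d = 0" | "d = 1" | d' where "d = Suc (Suc d')" by (metis One_nat_def nat.exhaust)
  thus ?case
  proof cases
   case 1 thus ?thesis using not_sym[OF nfix(1)[of j]] by simp
  next
   case 2 thus ?thesis using nfix(2)[of j] a[of j] by simp
  next
   case 3
   show ?thesis
   proof
    assume "a (j + d) = wp (a j)"
    hence "mp (wp (a (Suc j + d'))) = wp (a j)" using a[of "Suc j + d'"] 3 by simp
    hence "wp (a (Suc j + d')) = a (Suc j)" using mp a[of j] by metis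
    hence "a (Suc j + d') = wp (a (Suc j))" using wp by metis
    thus False using less.IH[of d' "Suc j"] 3 by simp
   qed
  qed
 qed
 show ?thesis
 proof (cases "j \<le> i")
  case True thus ?thesis using main[of j "i - j"] by simp
 next
  case False thus ?thesis using main[of i "j - i"] wp by (metis le_add_diff_inverse nat_le_linear)
 qed
qed

text \<open>
  The alternating walk from the point 1 returns first to 1 itself, since it is given by the
  iterates of a permutation. The walls that it visits form a closed set, hence all walls, so the
  walk is a Hamiltonian cycle.
\<close>

lemma hamiltonian_if_connected_walls:
 assumes k: "1 \<le> k" and M: "perfect_on (points {1..k}) M" and con: "connected_walls {1..k} M"
 shows "hamiltonian_cycle {1..2 * k} (wall_edges k \<union> M)"
proof -
 let ?V = "{1..2 * k}"
 have V: "points {1..k} = ?V" by (rule points_atLeastAtMost)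
 note MD = perfect_onD[OF M[unfolded V]]
 \<comment> \<open>the partner of a point along its wall edge, and below \<open>mp\<close> along its matching edge\<close>
 define wp where "wp v = (if v = 0 then 0 else if odd v then v + 1 else v - 1)" for v :: nat
 have wp: "wp (wp v) = v" "v \<in> ?V ==> wp v \<in> ?V" "v \<noteq> 0 ==> wp v \<noteq> v" "v \<noteq> 0 ==> particle_color (wp v) = particle_color v" for v
  by (auto simp: wp_def particle_color_def elim!: oddE evenE) presburger
 have ex: "\<exists>u. u \<noteq> v \<and> {v, u} \<in> M" if "v \<in> ?V" for v
 proof -
  have "v \<in> \<Union>M" unfolding MD(1) by (rule that)
  then obtain e where e: "e \<in> M" "v \<in> e" by blast
  obtain x y where xy: "e = {x, y}" "x \<noteq> y" using MD(2)[OF e(1)] by (auto simp: card_2_iff)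
  hence "v = x \<or> v = y" using e(2) by auto
  thus ?thesis using xy e(1) by (metis insert_commute)
 qed
 define mp where "mp v = (if v \<in> ?V then SOME u. u \<noteq> v \<and> {v, u} \<in> M else v)" for v
 have mp1: "mp v \<noteq> v" "{v, mp v} \<in> M" if "v \<in> ?V" for v
  using someI_ex[OF ex[OF that]] that by (auto simp: mp_def)
 have mpV: "mp v \<in> ?V" if "v \<in> ?V" for v using MD(6)[OF mp1(2)[OF that]] by auto
 have mpu: "u = mp v" if "{v, u} \<in> M" "v \<in> ?V" "u \<noteq> v" for u v
 proof -
  have "{v, u} = {v, mp v}" using MD(3)[OF that(1) mp1(2)[OF that(2)]] by blast
  thus ?thesis using that(3) by (auto simp: doubleton_eq_iff)
 qed
 have mpmp: "mp (mp v) = v" for v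
 proof (cases "v \<in> ?V")
  case True
  thus ?thesis using mpu[of "mp v" v] mp1[OF True] mpV[OF True] by (simp add: insert_commute)
 next
  case False
  hence "mp v = v" by (simp only: mp_def if_False)
  thus ?thesis by simp
 qed
 define p where "p = mp \<circ> wp"
 have pV: "p v \<in> ?V" if "v \<in> ?V" for v using wp(2) mpV that by (simp add: p_def)
 have injp: "inj p" by (rule injI) (metis p_def comp_apply wp(1) mpmp)
 define a where "a i = (p ^^ i) 1" for i
 have a: "a (Suc i) = mp (wp (a i))" "a 0 = 1" for i by (simp_all add: a_def p_def)
 have aV: "a i \<in> ?V" for i
 proof (induction i)
  case 0 show ?case using k by (simp add: a_def)
 next
  case (Suc i) thus ?case using pV[of "a i"] by (simp add: a p_def)
 qed
 have "finite {y. \<exists>n. y = (p ^^ n) 1}"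
  by (rule finite_subset[of _ ?V]) (use aV in \<open>auto simp: a_def\<close>)
 from funpow_inj_finite[OF injp this] obtain n0 where n0: "0 < n0" "a n0 = 1" unfolding a_def by metis
 define n where "n = (LEAST n. 0 < n \<and> a n = 1)"
 have n: "0 < n" "a n = 1" using LeastI[of "%n. 0 < n \<and> a n = 1", OF conjI[OF n0]] by (simp_all add: n_def)
 have nmin: "a i \<noteq> 1" if "0 < i" "i < n" for i using not_less_Least[of i "%n. 0 < n \<and> a n = 1"] that by (auto simp: n_def)
 have injpow: "inj (p ^^ i)" for i by (rule inj_fn[OF injp])
 have adist: "a i \<noteq> a j" if "i < j" "j < n" for i j
 proof
  assume "a i = a j"
  hence "(p ^^ i) ((p ^^ (j - i)) 1) = (p ^^ i) 1" using that by (simp add: a_def funpow_add[symmetric, THEN fun_cong, unfolded comp_apply])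
  hence "a (j - i) = 1" using injpow[of i] unfolding a_def by (simp add: inj_eq)
  moreover have "0 < j - i" "j - i < n" using that by linarith+
  ultimately show False using nmin by blast
 qed
 have adist': "a i = a j \<longleftrightarrow> i = j" if "i < n" "j < n" for i j
  using adist[of i j] adist[of j i] that by (cases i j rule: linorder_cases) auto
 have nz: "v \<noteq> 0" if "v \<in> ?V" for v using that by auto
 have ab: "a i \<noteq> wp (a j)" for i j
  by (rule alternating_walk_distinct[of wp mp a, OF wp(1) mpmp a(1)])
   (use wp(3)[OF nz[OF aV]] mp1(1)[OF wp(2)[OF aV]] in auto)
 \<comment> \<open>the walk visits \<open>a i\<close> and then the other end of the same wall\<close>
 define vs where "vs = map (%m. if even m then a (m div 2) else wp (a (m div 2))) [0..<2 * n]"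
 have len: "length vs = 2 * n" by (simp add: vs_def)
 have nth: "vs ! (2 * i) = a i" "vs ! (Suc (2 * i)) = wp (a i)" if "i < n" for i using that by (simp_all add: vs_def)
 have wpinj: "wp u = wp v \<longleftrightarrow> u = v" for u v using wp(1) by metis
 have dist: "distinct vs" unfolding vs_def distinct_map
 proof (intro conjI inj_onI)
  fix m m' assume m: "m \<in> set [0..<2 * n]" "m' \<in> set [0..<2 * n]"
   "(if even m then a (m div 2) else wp (a (m div 2))) = (if even m' then a (m' div 2) else wp (a (m' div 2)))"
  have lt: "m div 2 < n" "m' div 2 < n" using m by auto
  have "even m \<longleftrightarrow> even m'" using m(3) ab[of "m div 2" "m' div 2"] ab[of "m' div 2" "m div 2"] by (auto split: if_splits)
  moreover from this have "m div 2 = m' div 2" using m(3) adist'[OF lt] wpinj by (auto split: if_splits)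
  ultimately show "m = m'" by (metis dvd_mult_div_cancel odd_two_times_div_two_succ)
 qed simp
 have setvs: "set vs = a ` {..<n} \<union> (%i. wp (a i)) ` {..<n}"
 proof (intro equalityI subsetI)
  fix v assume "v \<in> set vs"
  then obtain m where "m < 2 * n" "v = (if even m then a (m div 2) else wp (a (m div 2)))" by (auto simp: vs_def)
  thus "v \<in> a ` {..<n} \<union> (%i. wp (a i)) ` {..<n}" by (auto split: if_splits)
 next
  fix v assume "v \<in> a ` {..<n} \<union> (%i. wp (a i)) ` {..<n}"
  then obtain i where i: "i < n" "v = a i \<or> v = wp (a i)" by auto
  have "vs ! (2 * i) \<in> set vs" "vs ! (Suc (2 * i)) \<in> set vs" using i(1) len by (auto intro!: nth_mem)
  thus "v \<in> set vs" using i nth[OF i(1)] by auto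
 qed
 have prev: "\<exists>j<n. a i = mp (wp (a j))" if "i < n" for i
 proof (cases i)
  case 0
  obtain j where j: "n = Suc j" using gr0_implies_Suc[OF n(1)] by blast
  have "a i = mp (wp (a j))" using a(1)[of j] n(2) a(2) unfolding j 0 by simp
  thus ?thesis using j by blast
 next
  case (Suc j)
  have "a i = mp (wp (a j))" unfolding Suc by (rule a(1))
  moreover have "j < n" using that unfolding Suc by (rule Suc_lessD)
  ultimately show ?thesis by blast
 qed
 have nxt: "a (Suc i) = a (if Suc i = n then 0 else Suc i)" for i
  using n(2) a(2) by auto
 have cl_wp: "wp v \<in> set vs" if "v \<in> set vs" for v using that unfolding setvs using wp(1) by auto
 have cl_mp: "mp v \<in> set vs" if v: "v \<in> set vs" for v
 proof -
  from v consider i where "i < n" "v = a i" | i where "i < n" "v = wp (a i)" unfolding setvs by auto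
  thus ?thesis
  proof cases
   case 1
   then obtain j where "j < n" "a i = mp (wp (a j))" using prev by blast
   thus ?thesis using 1 mpmp unfolding setvs by auto
  next
   case 2
   have "mp v = a (if Suc i = n then 0 else Suc i)" using 2 a(1) nxt by metis
   thus ?thesis using 2 n(1) unfolding setvs by auto
  qed
 qed
 have vsV: "set vs \<subseteq> ?V" unfolding setvs using aV wp(2)[OF aV] by blast
 let ?C = "particle_color ` set vs"
 have colvs: "v \<in> set vs" if vV: "v \<in> ?V" and vC: "particle_color v \<in> ?C" for v
 proof -
  obtain u where u: "u \<in> set vs" "particle_color v = particle_color u" using vC by auto
  have "v = u \<or> v = wp u" using u(2) vV vsV u(1) by (auto simp: particle_color_def wp_def elim!: oddE evenE)
  thus ?thesis using u(1) cl_wp by auto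
 qed
 have CC: "?C = {1..k}"
 proof -
  have "closed_walls M ?C" unfolding closed_walls_def
  proof (intro ballI impI)
   fix e assume e: "e \<in> M" "particle_color ` e \<inter> ?C \<noteq> {}"
   then obtain c where c: "c \<in> particle_color ` e" "c \<in> ?C" by (meson disjoint_iff)
   obtain v where v0: "c = particle_color v" "v \<in> e" using c(1) by (rule imageE)
   have v: "v \<in> e" "particle_color v \<in> ?C" using v0 c(2) by (simp_all only:)
   have vV: "v \<in> ?V" by (rule subsetD[OF MD(6)[OF e(1)] v(1)])
   have vin: "v \<in> set vs" by (rule colvs[OF vV v(2)])
   have "e = {v, mp v}" using MD(3)[OF e(1) mp1(2)[OF vV]] v(1) by blast
   thus "particle_color ` e \<subseteq> ?C" using vin cl_mp[OF vin] by auto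
  qed
  moreover have "?C \<subseteq> {1..k}" using vsV V by (auto simp: points_def)
  moreover have "?C \<noteq> {}" unfolding setvs using n(1) by auto
  ultimately show ?thesis using con unfolding connected_walls_def by blast
 qed
 have colV: "particle_color v \<in> {1..k}" if "v \<in> ?V" for v
 proof -
  have "v \<in> points {1..k}" unfolding V by (rule that)
  thus ?thesis by (simp only: points_def mem_Collect_eq)
 qed
 have sV: "set vs = ?V"
  using vsV by (rule subset_antisym) (rule subsetI, rule colvs, assumption, simp only: CC colV)
 have we: "{v, wp v} \<in> wall_edges k" if "v \<in> ?V" for v
 proof -
  have "1 \<le> v" using that by simp
  hence "{v, wp v} = {2 * particle_color v - 1, 2 * particle_color v}" by (auto simp: particle_color_def wp_def elim!: oddE evenE)
  moreover note colV[OF that]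
  ultimately show ?thesis unfolding wall_edges_def by blast
 qed
 have "wall_edges k \<union> M = {{vs ! m, vs ! (Suc m mod length vs)} | m. m < length vs}" (is "_ = ?E")
 proof (intro equalityI subsetI)
  have E1: "{a i, wp (a i)} \<in> ?E" if "i < n" for i
   using that nth[OF that] len by (intro CollectI exI[of _ "2 * i"]) auto
  have E2: "{wp (a i), a (Suc i)} \<in> ?E" if i: "i < n" for i
  proof -
   have "vs ! (Suc (Suc (2 * i)) mod (2 * n)) = a (Suc i)"
   proof (cases "Suc i = n")
    case True
    hence "Suc (Suc (2 * i)) mod (2 * n) = 0" by auto
    thus ?thesis using nth(1)[of 0] n a(2) True by simp
   next
    case False
    hence "Suc (Suc (2 * i)) mod (2 * n) = 2 * Suc i" using i by simp
    thus ?thesis using nth(1)[of "Suc i"] i False by simp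
   qed
   thus ?thesis using i nth[OF i] len by (intro CollectI exI[of _ "Suc (2 * i)"]) auto
  qed
  fix e assume "e \<in> wall_edges k \<union> M"
  then consider "e \<in> wall_edges k" | "e \<in> M" by blast
  thus "e \<in> ?E"
  proof cases
   case 1
   then obtain w where w: "w \<in> {1..k}" "e = {2 * w - 1, 2 * w}" by (auto simp: wall_edges_def)
   have "2 * w \<in> set vs" using w(1) sV by auto
   then obtain i where i: "i < n" "2 * w = a i \<or> 2 * w = wp (a i)" unfolding setvs by auto
   have "wp (2 * w) = 2 * w - 1" using w(1) by (auto simp: wp_def)
   hence "e = {a i, wp (a i)}" using i(2) wp(1)[of "a i"] w(2) by auto
   thus ?thesis using E1[OF i(1)] by simp
  next
   case 2
   obtain v where v: "v \<in> e" using MD(5)[OF 2] by blast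
   have vV: "v \<in> ?V" using MD(6)[OF 2] v by blast
   have e: "e = {v, mp v}" using MD(3)[OF 2 mp1(2)[OF vV]] v by blast
   have "v \<in> set vs" unfolding sV by (rule vV)
   then consider i where "i < n" "v = a i" | i where "i < n" "v = wp (a i)" unfolding setvs by auto
   thus ?thesis
   proof cases
    case 1
    then obtain j where j: "j < n" "a i = mp (wp (a j))" using prev by blast
    have "e = {wp (a j), a (Suc j)}" unfolding e using 1 j mpmp a(1) by (simp add: insert_commute)
    thus ?thesis using E2[OF j(1)] by simp
   next
    case i: 2
    have "e = {wp (a i), a (Suc i)}" unfolding e using i a(1) by simp
    thus ?thesis using E2[OF i(1)] by simp
   qed
  qed
 next
  fix e assume "e \<in> ?E"
  then obtain m where m: "m < 2 * n" "e = {vs ! m, vs ! (Suc m mod (2 * n))}" using len by auto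
  show "e \<in> wall_edges k \<union> M"
  proof (cases "even m")
   case True
   then obtain i where i: "m = 2 * i" "i < n" using m(1) by (auto elim!: evenE)
   hence "e = {a i, wp (a i)}" using m(2) nth[OF i(2)] by simp
   thus ?thesis using we[OF aV] by simp
  next
   case False
   then obtain i where i: "m = Suc (2 * i)" "i < n" using m(1) by (auto elim!: oddE)
   have "vs ! (Suc m mod (2 * n)) = a (Suc i)"
   proof (cases "Suc i = n")
    case True
    hence "Suc m mod (2 * n) = 0" using i by auto
    thus ?thesis using nth(1)[of 0] n a(2) True by simp
   next
    case False
    hence "Suc m mod (2 * n) = 2 * Suc i" using i by simp
    thus ?thesis using nth(1)[of "Suc i"] i False by simp
   qed
   hence "e = {wp (a i), mp (wp (a i))}" using m(2) i nth[OF i(2)] a(1) by simp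
   thus ?thesis using mp1(2)[OF wp(2)[OF aV]] by simp
  qed
 qed
 thus ?thesis unfolding hamiltonian_cycle_def using dist sV by blast
qed

lemma connected_matching_iff:
 assumes "1 \<le> k" "perfect_on (points {1..k}) M"
 shows "connected_matching k M \<longleftrightarrow> connected_walls {1..k} M"
 using connected_walls_if_hamiltonian[OF assms(2)] hamiltonian_if_connected_walls[OF assms]
 unfolding connected_matching_def by blast

text \<open>A wall edge in the matching would make its wall a component.\<close>

lemma connected_walls_no_wall_edge:
 assumes M: "perfect_on (points A) M" and con: "connected_walls A M" and w: "w \<in> A" "A \<noteq> {w}" "1 \<le> w"
 shows "{2 * w - 1, 2 * w} \<notin> M"
proof
 assume e: "{2 * w - 1, 2 * w} \<in> M"
 have "closed_walls M {w}" unfolding closed_walls_def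
 proof (intro ballI impI)
  fix f assume f: "f \<in> M" "particle_color ` f \<inter> {w} \<noteq> {}"
  then obtain v where v: "v \<in> f" "particle_color v = w" by blast
  have "1 \<le> v" using perfect_onD(6)[OF M f(1)] v(1) by (auto simp: points_def)
  hence "v \<in> {2 * w - 1, 2 * w}" using particle_color_cases[of v] v(2) by auto
  hence "f = {2 * w - 1, 2 * w}" using perfect_onD(3)[OF M f(1) e] v(1) by blast
  thus "particle_color ` f \<subseteq> {w}" using particle_color_pair(1)[OF w(3)] particle_color_pair(2)[of w] by simp
 qed
 hence "{w} = A" using con w(1) unfolding connected_walls_def by (metis empty_subsetI insert_not_empty insert_subset)
 thus False using w(2) by simp
qed

section \<open>The coloring coefficient on non-crossing configurations\<close>

text \<open>Exchanges the two ends of every wall in the set.\<close>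

definition flip_set :: "nat set => nat => nat" where
 "flip_set W p = (if particle_color p \<in> W then flip (particle_color p) p else p)"

lemma flip_fixes: "1 \<le> w ==> particle_color p \<noteq> w ==> flip w p = p"
 using particle_color_pair(1)[of w] particle_color_pair(2)[of w] by (auto simp: flip_def Transposition.transpose_def)

lemma flip_set_color: "0 \<notin> W ==> particle_color (flip_set W p) = particle_color p"
 using flip_color[of "particle_color p" p] by (cases "particle_color p = 0") (auto simp: flip_set_def)

lemma flip_set_flip_set: "0 \<notin> W ==> flip_set W (flip_set W p) = p"
 using flip_set_color[of W p] unfolding flip_set_def by (cases "particle_color p \<in> W") (simp_all add: flip_set_def)

lemma flip_set_insert: "w \<notin> W ==> 1 \<le> w ==> 0 \<notin> W ==> flip_set (insert w W) = flip w \<circ> flip_set W"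
proof
 fix p assume w: "w \<notin> W" "1 \<le> w" "0 \<notin> W"
 show "flip_set (insert w W) p = (flip w \<circ> flip_set W) p"
 proof (cases "particle_color p = w")
  case True thus ?thesis using w by (simp add: flip_set_def)
 next
  case False
  hence "flip w (flip_set W p) = flip_set W p" using w(2) flip_set_color[OF w(3), of p] by (intro flip_fixes) simp_all
  thus ?thesis using False by (simp add: flip_set_def)
 qed
qed

lemma flip_set_permutes: "W \<subseteq> {1..k} ==> flip_set W permutes {1..2 * k}"
proof -
 assume W: "W \<subseteq> {1..k}"
 hence 0: "0 \<notin> W" by auto
 have "flip_set W p = p" if "p \<notin> {1..2 * k}" for p
 proof -
  have "particle_color p \<notin> {1..k}" using that by (auto simp: particle_color_def)
  thus ?thesis using W by (auto simp: flip_set_def)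
 qed
 moreover have "\<exists>!p. flip_set W p = q" for q
  using flip_set_flip_set[OF 0] by metis
 ultimately show ?thesis by (simp add: permutes_def)
qed

lemma connected_walls_image:
 assumes "\<And>p. particle_color (s p) = particle_color p"
 shows "connected_walls A ((`) s ` M) \<longleftrightarrow> connected_walls A M"
proof -
 have "particle_color ` s ` e = particle_color ` e" for e using assms by (simp add: image_image)
 hence "closed_walls ((`) s ` M) C \<longleftrightarrow> closed_walls M C" for C by (simp add: closed_walls_def)
 thus ?thesis by (simp add: connected_walls_def)
qed

lemma matching_flip_set:
 assumes k: "2 \<le> k" and W: "W \<subseteq> {1..k}" and M: "perfect_on (points {1..k}) M" and con: "connected_walls {1..k} M"
 shows "perfect_on (points {1..k}) ((`) (flip_set W) ` M)" "connected_walls {1..k} ((`) (flip_set W) ` M)"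
  "crossing_sign ((`) (flip_set W) ` M) = (-1) ^ card W * crossing_sign M"
proof -
 have "finite W" using W finite_subset by blast
 hence "W \<subseteq> {1..k} \<longrightarrow> perfect_on (points {1..k}) ((`) (flip_set W) ` M) \<and> connected_walls {1..k} ((`) (flip_set W) ` M) \<and>
  crossing_sign ((`) (flip_set W) ` M) = (-1) ^ card W * crossing_sign M"
 proof (induction W rule: finite_induct)
  case empty
  have "flip_set {} = (%p. p)" by (simp add: flip_set_def fun_eq_iff)
  thus ?case using M con by simp
 next
  case (insert w W)
  show ?case
  proof
   assume wW: "insert w W \<subseteq> {1..k}"
   let ?N = "(`) (flip_set W) ` M"
   have N: "perfect_on (points {1..k}) ?N" "connected_walls {1..k} ?N" "crossing_sign ?N = (-1) ^ card W * crossing_sign M"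
    using insert.IH wW by auto
   have w: "1 \<le> w" "w \<in> {1..k}" "{1..k} \<noteq> {w}"
   proof -
    show "1 \<le> w" "w \<in> {1..k}" using wW by auto
    show "{1..k} \<noteq> {w}"
    proof
     assume "{1..k} = {w}"
     hence "card {1..k} = 1" by simp
     thus False using k by simp
    qed
   qed
   have 0: "0 \<notin> W" using wW by auto
   have eq: "(`) (flip_set (insert w W)) ` M = (`) (flip w) ` ?N"
    unfolding flip_set_insert[OF insert(2) w(1) 0] by (simp add: image_comp comp_def)
   have nw: "{2 * w - 1, 2 * w} \<notin> ?N" by (rule connected_walls_no_wall_edge[OF N(1,2) w(2,3,1)])
   show "perfect_on (points {1..k}) ((`) (flip_set (insert w W)) ` M) \<and> connected_walls {1..k} ((`) (flip_set (insert w W)) ` M) \<and>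
     crossing_sign ((`) (flip_set (insert w W)) ` M) = (-1) ^ card (insert w W) * crossing_sign M"
    unfolding eq using perfect_on_flip[OF w(1) N(1)] connected_walls_image[of "flip w" "{1..k}" ?N, OF flip_color[OF w(1)]] N(2)
     crossing_sign_flip[OF w(1,2) N(1) _ nw] N(3) insert(1,2) by simp
  qed
 qed
 with W show "perfect_on (points {1..k}) ((`) (flip_set W) ` M)" "connected_walls {1..k} ((`) (flip_set W) ` M)"
  "crossing_sign ((`) (flip_set W) ` M) = (-1) ^ card W * crossing_sign M" by auto
qed

lemma flip_set_less:
 assumes "0 \<notin> W" "1 \<le> u" "1 \<le> v" "u \<noteq> v" "particle_color u \<noteq> particle_color v"
 shows "flip_set W u < flip_set W v \<longleftrightarrow> u < v"
proof -
 have c: "particle_color (flip_set W u) = particle_color u" "particle_color (flip_set W v) = particle_color v"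
  using flip_set_color[OF assms(1)] by auto
 have "x < y \<longleftrightarrow> particle_color x < particle_color y" if "particle_color x \<noteq> particle_color y" for x y
  using that unfolding particle_color_def by presburger
 thus ?thesis using assms(5) c by simp
qed

text \<open>
  The lifts are the true positions composed with \<open>flip_set W\<close>. As the positions of
  the ends of every wall are in order, each exchanged wall contributes the factor \<open>-
  1\<close> to the lift sign.
\<close>

lemma sum_lifts:
 assumes pos: "pos permutes {1..2 * k}" and q: "\<And>p. p \<in> {1..2 * k} ==> q ! (pos p - 1) = p"
  and nc: "\<And>w. w \<in> {1..k} ==> pos (2 * w - 1) < pos (2 * w)" and len: "length q = 2 * k"
 shows "(\<Sum>\<sigma> | is_lift k (map particle_color q) \<sigma> \<and> compatible \<sigma> M. lift_sign k \<sigma>) =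
  (\<Sum>W\<in>Pow {1..k}. (-1) ^ card W * of_bool (compatible (pos \<circ> flip_set W) M))"
proof -
 let ?I = "map particle_color q" and ?V = "{1..2 * k}"
 have posV: "pos p \<in> ?V \<longleftrightarrow> p \<in> ?V" for p using permutes_in_image[OF pos] .
 have pinj: "pos u = pos v \<longleftrightarrow> u = v" for u v using permutes_inj[OF pos] by (auto dest: injD)
 have wV: "2 * w - 1 \<in> ?V" "2 * w \<in> ?V" if "w \<in> {1..k}" for w using that by auto
 have cells: "{p \<in> ?V. ?I ! (p - 1) = w} = {pos (2 * w - 1), pos (2 * w)}" if w: "w \<in> {1..k}" for w
 proof -
  have w1: "1 \<le> w" using w by simp
  have cv: "r = 2 * w - 1 \<or> r = 2 * w \<longleftrightarrow> particle_color r = w" if "r \<in> ?V" for r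
   using that particle_color_cases[of r] particle_color_pair(1)[OF w1] particle_color_pair(2)[of w] by auto
  have "p \<in> {p \<in> ?V. ?I ! (p - 1) = w} \<longleftrightarrow> p \<in> {pos (2 * w - 1), pos (2 * w)}" for p
  proof -
   obtain r where r: "p = pos r" using permutes_surj[OF pos] by (metis surjD)
   have "p \<in> {p \<in> ?V. ?I ! (p - 1) = w} \<longleftrightarrow> r \<in> ?V \<and> particle_color r = w"
   proof -
    have "?I ! (p - 1) = particle_color r" if "r \<in> ?V"
    proof -
     have "pos r - 1 < length q" using posV[of r] that len by auto
     thus ?thesis using q[OF that] r by simp
    qed
    thus ?thesis using posV[of r] r by auto
   qed
   also have "... \<longleftrightarrow> p \<in> {pos (2 * w - 1), pos (2 * w)}" using cv[of r] wV[OF w] unfolding r by (auto simp: pinj)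
   finally show ?thesis .
  qed
  thus ?thesis by blast
 qed
 have lift_iff: "is_lift k ?I \<sigma> \<longleftrightarrow> \<sigma> permutes ?V \<and> (\<forall>w\<in>{1..k}. {\<sigma> (2 * w - 1), \<sigma> (2 * w)} = {pos (2 * w - 1), pos (2 * w)})" for \<sigma>
  unfolding is_lift_def using cells by simp
 have fs: "flip_set W (2 * w - 1) = (if w \<in> W then 2 * w else 2 * w - 1)" "flip_set W (2 * w) = (if w \<in> W then 2 * w - 1 else 2 * w)" if "w \<in> {1..k}" for W w
  using particle_color_pair(1)[of w] particle_color_pair(2)[of w] that by (auto simp: flip_set_def flip_def)
 have sgn: "lift_sign k (pos \<circ> flip_set W) = (-1) ^ card W" if "W \<subseteq> {1..k}" for W
 proof -
  have "lift_sign k (pos \<circ> flip_set W) = (\<Prod>w=1..k. if w \<in> W then - 1 else 1)"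
   unfolding lift_sign_def
  proof (rule prod.cong[OF refl])
   fix w assume w: "w \<in> {1..k}"
   show "(-1) ^ of_bool ((pos \<circ> flip_set W) (2 * w) < (pos \<circ> flip_set W) (2 * w - 1)) = (if w \<in> W then - 1 else 1 :: int)"
    unfolding comp_apply fs[OF w] using nc[OF w] by auto
  qed
  also have "... = (\<Prod>w\<in>{1..k} \<inter> W. - 1)" by (rule prod.inter_restrict[symmetric]) simp
  also have "{1..k} \<inter> W = W" using that by auto
  finally show ?thesis by (simp only: prod_constant)
 qed
 have perm: "pos \<circ> flip_set W permutes ?V" if "W \<subseteq> {1..k}" for W
  by (rule permutes_compose[OF flip_set_permutes[OF that] pos])
 let ?g = "%\<sigma>. {w \<in> {1..k}. \<sigma> (2 * w - 1) = pos (2 * w)}"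
 have gf: "?g (pos \<circ> flip_set W) = W" if "W \<subseteq> {1..k}" for W
 proof -
  have "(pos \<circ> flip_set W) (2 * w - 1) = pos (2 * w) \<longleftrightarrow> w \<in> W" if w: "w \<in> {1..k}" for w
   unfolding comp_apply fs[OF w] pinj using w by auto
  thus ?thesis using that by auto
 qed
 have fg: "pos \<circ> flip_set (?g \<sigma>) = \<sigma>" if L: "is_lift k ?I \<sigma>" for \<sigma>
 proof -
  have sp: "\<sigma> permutes ?V" using L lift_iff by blast
  \<comment> \<open>the walls whose ends the lift exchanges\<close>
  define D where "D = ?g \<sigma>"
  have D: "w \<in> D \<longleftrightarrow> \<sigma> (2 * w - 1) = pos (2 * w)" if "w \<in> {1..k}" for w using that by (simp add: D_def)
  have DV: "D \<subseteq> {1..k}" by (auto simp: D_def)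
  have "(pos \<circ> flip_set D) p = \<sigma> p" for p
  proof (cases "p \<in> ?V")
   case False
   show ?thesis unfolding permutes_not_in[OF sp False] by (rule permutes_not_in[OF perm[OF DV] False])
  next
   case True
   define c where "c = particle_color p"
   have w: "c \<in> {1..k}" using True by (auto simp: particle_color_def c_def)
   have "{\<sigma> (2 * c - 1), \<sigma> (2 * c)} = {pos (2 * c - 1), pos (2 * c)}" using L w unfolding lift_iff by blast
   hence cs: "\<sigma> (2 * c - 1) = pos (2 * c - 1) \<and> \<sigma> (2 * c) = pos (2 * c) \<or> \<sigma> (2 * c - 1) = pos (2 * c) \<and> \<sigma> (2 * c) = pos (2 * c - 1)"
    by (simp only: doubleton_eq_iff)
   have "2 * c - 1 \<noteq> 2 * c" using w unfolding atLeastAtMost_iff by linarith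
   hence ne: "pos (2 * c - 1) \<noteq> pos (2 * c)" unfolding pinj .
   have "p = 2 * c - 1 \<or> p = 2 * c" using particle_color_cases[of p] True unfolding c_def by simp
   thus ?thesis
   proof
    assume p: "p = 2 * c - 1"
    show ?thesis unfolding comp_apply p fs[OF w] using D[OF w] cs ne by (cases "c \<in> D") simp_all
   next
    assume p: "p = 2 * c"
    show ?thesis unfolding comp_apply p fs[OF w] using D[OF w] cs ne by (cases "c \<in> D") simp_all
   qed
  qed
  thus ?thesis unfolding D_def by (rule ext)
 qed
 have lf: "is_lift k ?I (pos \<circ> flip_set W)" if W: "W \<subseteq> {1..k}" for W
  unfolding lift_iff
 proof (intro conjI ballI perm[OF W])
  fix w assume w: "w \<in> {1..k}"
  show "{(pos \<circ> flip_set W) (2 * w - 1), (pos \<circ> flip_set W) (2 * w)} = {pos (2 * w - 1), pos (2 * w)}"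
   unfolding comp_apply fs[OF w] by (auto simp: insert_commute)
 qed
 have "(\<Sum>\<sigma> | is_lift k ?I \<sigma> \<and> compatible \<sigma> M. lift_sign k \<sigma>) = (\<Sum>W | W \<in> Pow {1..k} \<and> compatible (pos \<circ> flip_set W) M. (-1) ^ card W)"
 proof (rule sum.reindex_bij_witness[where i="%W. pos \<circ> flip_set W" and j="?g"])
  fix \<sigma> assume "\<sigma> \<in> {\<sigma>. is_lift k ?I \<sigma> \<and> compatible \<sigma> M}"
  hence s: "is_lift k ?I \<sigma>" "compatible \<sigma> M" by auto
  show "pos \<circ> flip_set (?g \<sigma>) = \<sigma>" by (rule fg[OF s(1)])
  show "?g \<sigma> \<in> {W. W \<in> Pow {1..k} \<and> compatible (pos \<circ> flip_set W) M}" using fg[OF s(1)] s(2) by auto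
  have "lift_sign k (pos \<circ> flip_set (?g \<sigma>)) = (-1) ^ card (?g \<sigma>)" by (rule sgn) auto
  thus "(-1) ^ card (?g \<sigma>) = lift_sign k \<sigma>" unfolding fg[OF s(1)] by simp
 next
  fix W assume W: "W \<in> {W. W \<in> Pow {1..k} \<and> compatible (pos \<circ> flip_set W) M}"
  show "?g (pos \<circ> flip_set W) = W" using W by (intro gf) auto
  show "pos \<circ> flip_set W \<in> {\<sigma>. is_lift k ?I \<sigma> \<and> compatible \<sigma> M}" using W lf[of W] by auto
 qed
 also have "... = (\<Sum>W\<in>Pow {1..k}. (-1) ^ card W * of_bool (compatible (pos \<circ> flip_set W) M))"
  by (rule sum.mono_neutral_cong_left) auto
 finally show ?thesis .
qed

text \<open>
  An edge of a connected matching joins two walls, and exchanging the ends of walls does not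
  change the order of points of different walls.
\<close>

lemma compatible_flip_set:
 assumes k: "2 \<le> k" and M: "perfect_on (points {1..k}) M" and con: "connected_walls {1..k} M" and W: "W \<subseteq> {1..k}"
 shows "compatible (pos \<circ> flip_set W) M \<longleftrightarrow> compatible pos ((`) (flip_set W) ` M)"
proof -
 have 0: "0 \<notin> W" using W by auto
 have lt: "flip_set W u < flip_set W v \<longleftrightarrow> u < v" if e: "{u, v} \<in> M" "u \<noteq> v" for u v
 proof (rule flip_set_less[OF 0 _ _ e(2)])
  show uv: "1 \<le> u" "1 \<le> v" using perfect_onD(6)[OF M e(1)] by (auto simp: points_def)
  show "particle_color u \<noteq> particle_color v"
  proof
   assume c: "particle_color u = particle_color v"
   have w: "particle_color u \<in> {1..k}" "1 \<le> particle_color u" using perfect_onD(6)[OF M e(1)] by (auto simp: points_def)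
   have "{u, v} = {2 * particle_color u - 1, 2 * particle_color u}"
    using particle_color_cases[OF uv(1)] particle_color_cases[OF uv(2)] c e(2) by (metis insert_commute)
   moreover have "{1..k} \<noteq> {particle_color u}"
   proof
    assume "{1..k} = {particle_color u}"
    hence "card {1..k} = 1" by simp
    thus False using k by simp
   qed
   ultimately show False using connected_walls_no_wall_edge[OF M con w(1) _ w(2)] e(1) by simp
  qed
 qed
 have ne: "u \<noteq> v" if "{u, v} \<in> M" for u v using perfect_onD(2)[OF M that] by auto
 show ?thesis unfolding compatible_def
 proof (intro iffI allI impI)
  fix i j assume H: "\<forall>i j. {i, j} \<in> M \<and> i < j \<longrightarrow> (pos \<circ> flip_set W) j < (pos \<circ> flip_set W) i" and ij: "{i, j} \<in> (`) (flip_set W) ` M \<and> i < j"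
  obtain e where e: "e \<in> M" "{i, j} = flip_set W ` e" using ij by auto
  have "flip_set W ` {i, j} = e" unfolding e(2) using flip_set_flip_set[OF 0] by (simp add: image_image)
  hence e': "{flip_set W i, flip_set W j} \<in> M" using e(1) by simp
  have "flip_set W i < flip_set W j" using lt[OF e' ne[OF e']] ij flip_set_flip_set[OF 0] by simp
  hence "(pos \<circ> flip_set W) (flip_set W j) < (pos \<circ> flip_set W) (flip_set W i)" using H e' by blast
  thus "pos j < pos i" using flip_set_flip_set[OF 0] by simp
 next
  fix i j assume H: "\<forall>i j. {i, j} \<in> (`) (flip_set W) ` M \<and> i < j \<longrightarrow> pos j < pos i" and ij: "{i, j} \<in> M \<and> i < j"
  have "flip_set W ` {i, j} \<in> (`) (flip_set W) ` M" using ij by blast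
  hence "{flip_set W i, flip_set W j} \<in> (`) (flip_set W) ` M" by simp
  moreover have "flip_set W i < flip_set W j" using lt[of i j] ij by simp
  ultimately show "(pos \<circ> flip_set W) j < (pos \<circ> flip_set W) i" using H by simp
 qed
qed

text \<open>
  The sign of an exchange of walls in the lift sign cancels against its sign in the matching, so
  each of the \<open>2\<^sup>k\<close> lifts contributes the same sum over connected matchings.
\<close>

lemma coloring_coeff_noncrossing:
 assumes k: "2 \<le> k" and pos: "pos permutes {1..2 * k}" and q: "\<And>p. p \<in> {1..2 * k} ==> q ! (pos p - 1) = p"
  and nc: "\<And>w. w \<in> {1..k} ==> pos (2 * w - 1) < pos (2 * w)" and len: "length q = 2 * k"
 shows "coloring_coeff k (map particle_color q) =
  (- 2) ^ k * (\<Sum>M | perfect_on (points {1..k}) M \<and> connected_walls {1..k} M. crossing_sign M * of_bool (compatible pos M))"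
proof -
 let ?CM = "{M. perfect_on (points {1..k}) M \<and> connected_walls {1..k} M}"
 have pm: "M \<in> perfect_matchings k \<longleftrightarrow> perfect_on (points {1..k}) M" for M
  by (simp only: perfect_matchings_iff points_atLeastAtMost)
 have k1: "1 \<le> k" using k by simp
 have CM: "{M. M \<in> perfect_matchings k \<and> connected_matching k M} = ?CM"
  unfolding pm using connected_matching_iff[OF k1] by blast
 have "(\<Sum>M\<in>?CM. matching_sgn k M * (\<Sum>\<sigma> | is_lift k (map particle_color q) \<sigma> \<and> compatible \<sigma> M. lift_sign k \<sigma>)) =
   (\<Sum>M\<in>?CM. \<Sum>W\<in>Pow {1..k}. crossing_sign ((`) (flip_set W) ` M) * of_bool (compatible pos ((`) (flip_set W) ` M)))"
 proof (rule sum.cong[OF refl])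
  fix M assume "M \<in> ?CM"
  hence M: "perfect_on (points {1..k}) M" "connected_walls {1..k} M" by auto
  have ms: "matching_sgn k M = crossing_sign M"
   by (rule matching_sgn_crossing) (use M(1) pm in blast)
  have t: "crossing_sign M * ((-1) ^ card W * of_bool (compatible (pos \<circ> flip_set W) M)) =
    crossing_sign ((`) (flip_set W) ` M) * of_bool (compatible pos ((`) (flip_set W) ` M))" if W: "W \<subseteq> {1..k}" for W
   unfolding compatible_flip_set[OF k M W] matching_flip_set(3)[OF k W M] by (simp only: mult_ac)
  have sl: "(\<Sum>\<sigma> | is_lift k (map particle_color q) \<sigma> \<and> compatible \<sigma> M. lift_sign k \<sigma>) =
    (\<Sum>W\<in>Pow {1..k}. (-1) ^ card W * of_bool (compatible (pos \<circ> flip_set W) M))"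
   by (rule sum_lifts[OF pos q nc len])
  show "matching_sgn k M * (\<Sum>\<sigma> | is_lift k (map particle_color q) \<sigma> \<and> compatible \<sigma> M. lift_sign k \<sigma>) =
    (\<Sum>W\<in>Pow {1..k}. crossing_sign ((`) (flip_set W) ` M) * of_bool (compatible pos ((`) (flip_set W) ` M)))"
   unfolding sl ms sum_distrib_left by (rule sum.cong[OF refl]) (use t in blast)
 qed
 also have "... = (\<Sum>W\<in>Pow {1..k}. \<Sum>M\<in>?CM. crossing_sign ((`) (flip_set W) ` M) * of_bool (compatible pos ((`) (flip_set W) ` M)))"
  by (rule sum.swap)
 also have "... = (\<Sum>W\<in>Pow {1..k}. \<Sum>M\<in>?CM. crossing_sign M * of_bool (compatible pos M))"
 proof (rule sum.cong[OF refl])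
  fix W assume "W \<in> Pow {1..k}"
  hence W: "W \<subseteq> {1..k}" "0 \<notin> W" by auto
  have inv: "(`) (flip_set W) ` (`) (flip_set W) ` M = M" for M
   using flip_set_flip_set[OF W(2)] by (simp add: image_image)
  show "(\<Sum>M\<in>?CM. crossing_sign ((`) (flip_set W) ` M) * of_bool (compatible pos ((`) (flip_set W) ` M))) = (\<Sum>M\<in>?CM. crossing_sign M * of_bool (compatible pos M))"
   by (rule sum.reindex_bij_witness[where i="(`) ((`) (flip_set W))" and j="(`) ((`) (flip_set W))"])
    (use inv matching_flip_set(1,2)[OF k W(1)] in auto)
 qed
 also have "... = 2 ^ k * (\<Sum>M\<in>?CM. crossing_sign M * of_bool (compatible pos M))" by (simp add: card_Pow)
 finally show ?thesis unfolding coloring_coeff_def CM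
  by (simp add: power_mult_distrib[symmetric] mult.assoc[symmetric])
qed

section \<open>Uniformly random tie-breaking\<close>

text \<open>
  Formulated by a filter because filters commute with stable sorting and with the renaming of
  entries.
\<close>

definition comes_before :: "'a list => 'a => 'a => bool" where
 "comes_before xs u v \<longleftrightarrow> filter (%y. y = u \<or> y = v) xs = [u, v]"

lemma filter_pair_cases:
 assumes "distinct xs" "u \<in> set xs" "v \<in> set xs" "u \<noteq> v"
 shows "comes_before xs u v \<longleftrightarrow> \<not> comes_before xs v u"
proof -
 let ?f = "filter (%y. y = u \<or> y = v) xs"
 have f: "set ?f = {u, v}" "distinct ?f" using assms by auto
 have "length ?f = 2" using distinct_card[OF f(2)] f(1) assms(4) by simp
 then obtain a b where ab: "?f = [a, b]" by (auto simp: numeral_2_eq_2 length_Suc_conv)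
 hence "{a, b} = {u, v}" using f(1) by simp
 hence "?f = [u, v] \<or> ?f = [v, u]" using ab by (auto simp: doubleton_eq_iff)
 moreover have "filter (%y. y = v \<or> y = u) xs = ?f" by (rule filter_cong) auto
 ultimately show ?thesis using assms(4) unfolding comes_before_def by auto
qed

lemma comes_before_nth:
 assumes xs: "distinct xs" and b: "comes_before xs u v" and ij: "i < length xs" "xs ! i = u" "j < length xs" "xs ! j = v"
 shows "i < j"
proof -
 obtain us vs where 1: "xs = us @ u # vs" "\<forall>x\<in>set us. \<not> (x = u \<or> x = v)" "[v] = filter (%y. y = u \<or> y = v) vs"
  using filter_eq_ConsD[OF b[unfolded comes_before_def]] by auto
 have "xs ! length us = u" "length us < length xs" using 1 by auto
 hence i: "i = length us" using nth_eq_iff_index_eq[OF xs ij(1)] ij(2) by auto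
 have "\<not> j < length us" using 1 ij(4) by (metis nth_append nth_mem)
 moreover have "v \<in> set vs" using arg_cong[OF 1(3), of set] by auto
 hence "u \<noteq> v" using xs 1(1) by auto
 hence "j \<noteq> i" using ij by auto
 ultimately show ?thesis using i by simp
qed

text \<open>This is where stability of the sorting enters: ties keep their order.\<close>

lemma comes_before_sort_key:
 assumes r: "distinct \<rho>" "u \<in> set \<rho>" "v \<in> set \<rho>" "u \<noteq> v"
 shows "comes_before (sort_key x \<rho>) u v \<longleftrightarrow> (x u :: real) < x v \<or> x u = x v \<and> comes_before \<rho> u v"
proof -
 have less: "comes_before (sort_key x \<rho>) u v" if u: "u \<in> set \<rho>" "v \<in> set \<rho>" "u \<noteq> v" and lt: "x u < x v" for u v
 proof (rule ccontr)
  have d: "distinct (sort_key x \<rho>)" "u \<in> set (sort_key x \<rho>)" "v \<in> set (sort_key x \<rho>)" using u r(1) by auto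
  assume "\<not> comes_before (sort_key x \<rho>) u v"
  hence b: "comes_before (sort_key x \<rho>) v u" using filter_pair_cases[OF d u(3)] by simp
  obtain i j where ij: "i < length (sort_key x \<rho>)" "sort_key x \<rho> ! i = v" "j < length (sort_key x \<rho>)" "sort_key x \<rho> ! j = u"
   using d by (metis in_set_conv_nth)
  have "i < j" by (rule comes_before_nth[OF d(1) b ij])
  hence "map x (sort_key x \<rho>) ! i \<le> map x (sort_key x \<rho>) ! j"
   using sorted_nth_mono[OF sorted_sort_key, of i j x \<rho>] ij by simp
  thus False using ij lt by simp
 qed
 consider "x u < x v" | "x v < x u" | "x u = x v" by linarith
 thus ?thesis
 proof cases
  case 1 thus ?thesis using less[OF r(2-4)] by simp
 next
  case 2
  have "comes_before (sort_key x \<rho>) v u" by (rule less) (use r 2 in auto)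
  hence "\<not> comes_before (sort_key x \<rho>) u v" using filter_pair_cases[of "sort_key x \<rho>" u v] r by simp
  thus ?thesis using 2 by simp
 next
  case 3
  have e: "filter (%y. y = u \<or> y = v) ys = filter (%y. y = u \<or> y = v) (filter (%y. x y = x u) ys)" for ys
   using 3 by (induction ys) auto
  have "filter (%y. y = u \<or> y = v) (sort_key x \<rho>) = filter (%y. y = u \<or> y = v) \<rho>"
   unfolding e[of "sort_key x \<rho>"] sort_key_stable by (rule e[symmetric])
  thus ?thesis using 3 by (simp add: comes_before_def)
 qed
qed

text \<open>
  Exchanging the two ends of an edge in the list is an involution that reverses their order and
  keeps the order in disjoint edges, so each edge halves the count.
\<close>

lemma card_permutations_comes_before:
 fixes E :: "nat set set"
 assumes V: "finite V" and E: "finite E" "\<And>e. e \<in> E ==> card e = 2 \<and> e \<subseteq> V" "\<And>e f. e \<in> E ==> f \<in> E ==> e \<noteq> f ==> e \<inter> f = {}"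
 shows "card {\<rho> \<in> permutations_of_set V. \<forall>e\<in>E. comes_before \<rho> (Max e) (Min e)} * 2 ^ card E = card (permutations_of_set V)"
 using E
proof (induction E rule: finite_induct)
 case (insert e E)
 let ?P = "%\<rho>. \<forall>f\<in>E. comes_before \<rho> (Max f) (Min f)"
 let ?A = "{\<rho> \<in> permutations_of_set V. ?P \<rho>}"
 let ?R = "{\<rho> \<in> ?A. comes_before \<rho> (Max e) (Min e)}" and ?L = "{\<rho> \<in> ?A. comes_before \<rho> (Min e) (Max e)}"
 let ?t = "Transposition.transpose (Min e) (Max e)"
 have IH: "card ?A * 2 ^ card E = card (permutations_of_set V)" using insert by auto
 have e: "e \<subseteq> V" "Min e < Max e" "Min e \<in> e" "Max e \<in> e" "e = {Min e, Max e}" using insert(4)[of e] edge_Min_Max[of e] by auto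
 have finA: "finite ?A" by (rule finite_subset[of _ "permutations_of_set V"]) auto
 have tt: "?t (?t y) = y" for y by simp
 have tV: "?t ` V = V" using e by (intro permutes_image[OF permutes_swap_id]) auto
 have mp: "map ?t \<rho> \<in> permutations_of_set V" if "\<rho> \<in> permutations_of_set V" for \<rho>
  using that tV by (auto simp: permutations_of_set_def distinct_map)
 have cb: "comes_before (map ?t \<rho>) u v \<longleftrightarrow> comes_before \<rho> (?t u) (?t v)" for \<rho> u v
 proof -
  have i: "?t y = u \<longleftrightarrow> y = ?t u" for y u by (metis tt)
  have "filter (%y. y = u \<or> y = v) (map ?t \<rho>) = map ?t (filter (%y. y = ?t u \<or> y = ?t v) \<rho>)"
   by (simp add: filter_map comp_def i)
  moreover have "map ?t ys = [u, v] \<longleftrightarrow> ys = [?t u, ?t v]" for ys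
   by (auto simp: i map_eq_Cons_conv)
  ultimately show ?thesis by (simp add: comes_before_def)
 qed
 have fixE: "?t (Max f) = Max f" "?t (Min f) = Min f" if "f \<in> E" for f
 proof -
  have "f \<inter> e = {}" using insert(5)[of f e] insert(2) that by auto
  moreover have "Max f \<in> f" "Min f \<in> f" using edge_Min_Max[of f] insert(4)[of f] that by auto
  ultimately show "?t (Max f) = Max f" "?t (Min f) = Min f"
   using e(3,4) by (auto simp: Transposition.transpose_def)
 qed
 have mA: "map ?t \<rho> \<in> ?A" if "\<rho> \<in> ?A" for \<rho> using that mp[of \<rho>] by (auto simp: cb fixE)
 have "bij_betw (map ?t) ?R ?L"
 proof (rule bij_betw_byWitness[where f'="map ?t"])
  show "\<forall>\<rho>\<in>?R. map ?t (map ?t \<rho>) = \<rho>" "\<forall>\<rho>\<in>?L. map ?t (map ?t \<rho>) = \<rho>" by (simp_all add: comp_def)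
  have "map ?t \<rho> \<in> ?L" if "\<rho> \<in> ?R" for \<rho>
  proof -
   have "comes_before (map ?t \<rho>) (Min e) (Max e)" unfolding cb using that by simp
   thus ?thesis using mA[of \<rho>] that by blast
  qed
  thus "map ?t ` ?R \<subseteq> ?L" by blast
  have "map ?t \<rho> \<in> ?R" if "\<rho> \<in> ?L" for \<rho>
  proof -
   have "comes_before (map ?t \<rho>) (Max e) (Min e)" unfolding cb using that by simp
   thus ?thesis using mA[of \<rho>] that by blast
  qed
  thus "map ?t ` ?L \<subseteq> ?R" by blast
 qed
 hence "card ?R = card ?L" by (rule bij_betw_same_card)
 moreover have "?A = ?R \<union> ?L" "?R \<inter> ?L = {}"
 proof -
  have dj: "comes_before \<rho> (Max e) (Min e) \<longleftrightarrow> \<not> comes_before \<rho> (Min e) (Max e)" if "\<rho> \<in> ?A" for \<rho>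
   by (rule filter_pair_cases) (use that e in \<open>auto simp: permutations_of_set_def\<close>)
  show "?A = ?R \<union> ?L" using dj by blast
  show "?R \<inter> ?L = {}" using dj by blast
 qed
 hence "card ?A = card ?R + card ?L" using finA card_Un_disjoint[of ?R ?L] by (metis (no_types, lifting) finite_Un)
 ultimately have "card ?R * 2 = card ?A" by simp
 hence "card ?R * 2 ^ card (insert e E) = card (permutations_of_set V)"
  using IH insert(1,2) by (simp add: mult.assoc[symmetric])
 moreover have "?R = {\<rho> \<in> permutations_of_set V. \<forall>f\<in>insert e E. comes_before \<rho> (Max f) (Min f)}" by auto
 ultimately show ?case by (simp only:)
qed simp

text \<open>
  Inverted edges are compatible for every tie-breaking, tied edges for half of them, independently
  of each other since they are disjoint, and the others for none.
\<close>

lemma tie_breaking_average: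
 assumes M: "perfect_on V M" and V: "finite V"
 shows "(\<integral>\<rho>. of_bool (\<forall>e\<in>M. comes_before (sort_key x \<rho>) (Max e) (Min e)) \<partial>measure_pmf (pmf_of_set (permutations_of_set V))) =
  (\<Prod>e\<in>M. edge_weight x e / 2)"
proof -
 let ?P = "permutations_of_set V"
 have fP: "finite ?P" "?P \<noteq> {}" using V by auto
 have fM: "finite M" by (rule perfect_on_finite[OF V M])
 have E: "Min e < Max e" "Min e \<in> V" "Max e \<in> V" if "e \<in> M" for e
  using edge_Min_Max[OF perfect_onD(2)[OF M that]] perfect_onD(6)[OF M that] by auto
 have cb: "comes_before (sort_key x \<rho>) (Max e) (Min e) \<longleftrightarrow> x (Max e) < x (Min e) \<or> x (Max e) = x (Min e) \<and> comes_before \<rho> (Max e) (Min e)"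
  if "\<rho> \<in> ?P" "e \<in> M" for \<rho> e
  by (rule comes_before_sort_key) (use that E[OF that(2)] in \<open>auto simp: permutations_of_set_def\<close>)
 have "(\<integral>\<rho>. of_bool (\<forall>e\<in>M. comes_before (sort_key x \<rho>) (Max e) (Min e)) \<partial>measure_pmf (pmf_of_set ?P)) =
   (\<Sum>\<rho>\<in>?P. of_bool (\<forall>e\<in>M. comes_before (sort_key x \<rho>) (Max e) (Min e))) / real (card ?P)"
  by (rule integral_pmf_of_set[OF fP(2,1)])
 also have "... = (\<Prod>e\<in>M. edge_weight x e / 2)"
 proof (cases "\<exists>e\<in>M. x (Min e) < x (Max e)")
  case True
  then obtain e where e: "e \<in> M" "x (Min e) < x (Max e)" by blast
  have "(\<Sum>\<rho>\<in>?P. of_bool (\<forall>e\<in>M. comes_before (sort_key x \<rho>) (Max e) (Min e)) :: real) = 0"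
  proof (rule sum.neutral, rule ballI)
   fix \<rho> assume "\<rho> \<in> ?P"
   hence "\<not> comes_before (sort_key x \<rho>) (Max e) (Min e)" using cb[of \<rho> e] e by auto
   thus "of_bool (\<forall>e\<in>M. comes_before (sort_key x \<rho>) (Max e) (Min e)) = (0 :: real)" using e(1) by auto
  qed
  moreover have "(\<Prod>e\<in>M. edge_weight x e / 2) = 0"
   using e(2) by (intro prod_zero[OF fM] bexI[OF _ e(1)]) (simp add: edge_weight_def order_weight_def)
  ultimately show ?thesis by simp
 next
  case False
  hence ge: "x (Max e) \<le> x (Min e)" if "e \<in> M" for e using that by (meson not_less)
  define E where "E = {e\<in>M. x (Max e) = x (Min e)}"
  have EM: "E \<subseteq> M" by (auto simp: E_def)
  have fE: "finite E" by (rule finite_subset[OF EM fM])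
  have iff: "(\<forall>e\<in>M. comes_before (sort_key x \<rho>) (Max e) (Min e)) \<longleftrightarrow> (\<forall>e\<in>E. comes_before \<rho> (Max e) (Min e))" if "\<rho> \<in> ?P" for \<rho>
   using cb[OF that] ge by (auto simp: E_def le_less)
  have c: "card {\<rho> \<in> ?P. \<forall>e\<in>E. comes_before \<rho> (Max e) (Min e)} * 2 ^ card E = card ?P"
   by (rule card_permutations_comes_before[OF V fE]) (use EM perfect_onD(2,3,6)[OF M] in blast)+
  have "(\<Sum>\<rho>\<in>?P. of_bool (\<forall>e\<in>M. comes_before (sort_key x \<rho>) (Max e) (Min e)) :: real) = (\<Sum>\<rho>\<in>?P. of_bool (\<forall>e\<in>E. comes_before \<rho> (Max e) (Min e)))"
   by (rule sum.cong[OF refl]) (simp only: iff)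
  also have "... = real (card {\<rho> \<in> ?P. \<forall>e\<in>E. comes_before \<rho> (Max e) (Min e)})"
   using fP(1) by (simp add: sum.If_cases of_bool_def Int_def)
  also have "... = real (card ?P) / 2 ^ card E"
   unfolding c[symmetric] by simp
  finally have s: "(\<Sum>\<rho>\<in>?P. of_bool (\<forall>e\<in>M. comes_before (sort_key x \<rho>) (Max e) (Min e)) :: real) = real (card ?P) / 2 ^ card E" .
  have "(\<Prod>e\<in>M. edge_weight x e / 2) = (\<Prod>e\<in>M. if e \<in> E then 1 / 2 else 1)"
  proof (rule prod.cong[OF refl])
   fix e assume "e \<in> M"
   thus "edge_weight x e / 2 = (if e \<in> E then 1 / 2 else 1)"
    using ge[of e] by (auto simp: edge_weight_def order_weight_def E_def)
  qed
  also have "... = (\<Prod>e\<in>M \<inter> E. 1 / 2)" by (rule prod.inter_restrict[symmetric, OF fM])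
  also have "M \<inter> E = E" using EM by auto
  finally have "(\<Prod>e\<in>M. edge_weight x e / 2) = 1 / 2 ^ card E" by (simp add: power_one_over)
  moreover have "card ?P \<noteq> 0" using fP by simp
  ultimately show ?thesis unfolding s by simp
 qed
 finally show ?thesis .
qed

section \<open>Averaging over the ties\<close>

lemma positions_exist:
 assumes q: "distinct q" "set q = {1..length q}"
 obtains pos where "pos permutes {1..length q}" "\<And>p. p \<in> {1..length q} ==> q ! (pos p - 1) = p"
  "\<And>u v. u \<in> {1..length q} ==> v \<in> {1..length q} ==> u \<noteq> v ==> pos u < pos v \<longleftrightarrow> comes_before q u v"
proof -
 let ?V = "{1..length q}" and ?w = "%p. if p \<in> {1..length q} then q ! (p - 1) else p"
 note w = word_permutes[OF q]
 define pos where "pos = inv ?w"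
 have pos: "pos permutes ?V" unfolding pos_def by (rule permutes_inv[OF w])
 have posV: "pos p \<in> ?V" if "p \<in> ?V" for p using permutes_in_image[OF pos] that by blast
 have nth: "q ! (pos p - 1) = p" if "p \<in> ?V" for p
 proof -
  have "?w (pos p) = p" unfolding pos_def by (rule permutes_inverses(1)[OF w])
  thus ?thesis using posV[OF that] by (simp only: if_True)
 qed
 have less: "pos u < pos v" if "u \<in> ?V" "v \<in> ?V" "comes_before q u v" for u v
 proof -
  have "pos u - 1 < length q" "pos v - 1 < length q" "1 \<le> pos u" using posV[OF that(1)] posV[OF that(2)] by auto
  thus ?thesis using comes_before_nth[OF q(1) that(3) _ nth[OF that(1)] _ nth[OF that(2)]] by simp
 qed
 show ?thesis
 proof (rule that[OF pos nth])
  show "pos u < pos v \<longleftrightarrow> comes_before q u v" if uv: "u \<in> ?V" "v \<in> ?V" "u \<noteq> v" for u v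
  proof
   assume l: "pos u < pos v"
   have "\<not> comes_before q v u" using less[OF uv(2,1)] l by auto
   thus "comes_before q u v" using filter_pair_cases[OF q(1), of u v] uv q(2) by blast
  qed (rule less[OF uv(1,2)])
 qed
qed

text \<open>The part of the matching expansion of the Pfaffian that belongs to connected matchings.\<close>

definition connected_weight :: "nat => (nat => real) => real" where
 "connected_weight k y = (\<Sum>M | perfect_on (points {1..k}) M \<and> connected_walls {1..k} M.
   of_int (crossing_sign M) * (\<Prod>e\<in>M. edge_weight y e))"

lemma finite_connected: "finite {M. perfect_on (points {1..k}) M \<and> connected_walls {1..k} M}"
 by (rule finite_subset[OF _ finite_perfect[OF finite_points[of "{1..k}"]]]) auto

text \<open>
  The factor \<open>(- 2)^k\<close> from the lifts meets the factor \<open>1 / 2\<close> of each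
  of the \<open>k\<close> edges.
\<close>

lemma tie_averaged_coeff:
 assumes k: "2 \<le> k" and y: "\<And>w. w \<in> {1..k} ==> y (2 * w - 1) < (y (2 * w) :: real)"
 shows "(\<integral>\<rho>. real_of_int (coloring_coeff k (map particle_color (sort_key y \<rho>)))
   \<partial>measure_pmf (pmf_of_set (permutations_of_set {1..2 * k}))) = (-1) ^ k * connected_weight k y"
proof -
 let ?V = "{1..2 * k}" and ?CM = "{M. perfect_on (points {1..k}) M \<and> connected_walls {1..k} M}"
 let ?P = "permutations_of_set ?V"
 let ?R = "measure_pmf (pmf_of_set ?P)"
 let ?b = "%\<rho> M. of_bool (\<forall>e\<in>M. comes_before (sort_key y \<rho>) (Max e) (Min e)) :: real"
 have fP: "finite ?P" "?P \<noteq> {}" by auto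
 have V: "points {1..k} = ?V" by (rule points_atLeastAtMost)
 have c: "real_of_int (coloring_coeff k (map particle_color (sort_key y \<rho>))) = (- 2) ^ k * (\<Sum>M\<in>?CM. of_int (crossing_sign M) * ?b \<rho> M)"
  if \<rho>: "\<rho> \<in> ?P" for \<rho>
 proof -
  define q where "q = sort_key y \<rho>"
  have r: "distinct \<rho>" "set \<rho> = ?V" using \<rho> by (auto simp: permutations_of_set_def)
  hence q: "distinct q" "set q = ?V" by (auto simp: q_def)
  have len: "length q = 2 * k" using distinct_card[OF q(1)] q(2) by simp
  have q': "set q = {1..length q}" unfolding len by (rule q(2))
  obtain pos where pos: "pos permutes ?V" "\<And>p. p \<in> ?V ==> q ! (pos p - 1) = p"
   "\<And>u v. u \<in> ?V ==> v \<in> ?V ==> u \<noteq> v ==> pos u < pos v \<longleftrightarrow> comes_before q u v"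
   using positions_exist[OF q(1) q'] unfolding len by blast
  have nc: "pos (2 * w - 1) < pos (2 * w)" if w: "w \<in> {1..k}" for w
  proof -
   have m: "2 * w - 1 \<in> ?V" "2 * w \<in> ?V" "2 * w - 1 \<noteq> 2 * w" using w by auto
   show ?thesis unfolding pos(3)[OF m] q_def
    using comes_before_sort_key[OF r(1), of "2 * w - 1" "2 * w" y] m y[OF w] unfolding r(2) by blast
  qed
  have comp: "compatible pos M \<longleftrightarrow> (\<forall>e\<in>M. comes_before q (Max e) (Min e))" if M: "perfect_on (points {1..k}) M" for M
  proof -
   have e: "Min e < Max e" "e = {Min e, Max e}" "Min e \<in> ?V" "Max e \<in> ?V" if "e \<in> M" for e
    using edge_Min_Max[OF perfect_onD(2)[OF M that]] perfect_onD(6)[OF M that] unfolding V by auto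
   have "compatible pos M \<longleftrightarrow> (\<forall>e\<in>M. pos (Max e) < pos (Min e))"
    unfolding compatible_def
   proof (intro iffI ballI allI impI)
    fix f assume H: "\<forall>i j. {i, j} \<in> M \<and> i < j \<longrightarrow> pos j < pos i" and f: "f \<in> M"
    have "{Min f, Max f} \<in> M" using f e(2)[OF f] by metis
    thus "pos (Max f) < pos (Min f)" using H e(1)[OF f] by blast
   next
    fix i j assume H: "\<forall>e\<in>M. pos (Max e) < pos (Min e)" and ij: "{i, j} \<in> M \<and> i < j"
    hence "pos (Max {i, j}) < pos (Min {i, j})" by blast
    thus "pos j < pos i" using ij by (simp add: min_def max_def split: if_splits)
   qed
   also have "... \<longleftrightarrow> (\<forall>e\<in>M. comes_before q (Max e) (Min e))"
   proof (rule ball_cong[OF refl])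
    fix f assume f: "f \<in> M"
    show "pos (Max f) < pos (Min f) \<longleftrightarrow> comes_before q (Max f) (Min f)"
     by (rule pos(3)) (use e[OF f] in auto)
   qed
   finally show ?thesis .
  qed
  have cc: "coloring_coeff k (map particle_color q) = (- 2) ^ k * (\<Sum>M\<in>?CM. crossing_sign M * of_bool (compatible pos M))"
   by (rule coloring_coeff_noncrossing[OF k pos(1) pos(2) nc len])
  also have "(\<Sum>M\<in>?CM. crossing_sign M * of_bool (compatible pos M)) =
    (\<Sum>M\<in>?CM. crossing_sign M * of_bool (\<forall>e\<in>M. comes_before q (Max e) (Min e)))"
  proof (rule sum.cong[OF refl])
   fix M assume "M \<in> ?CM"
   hence "perfect_on (points {1..k}) M" by blast
   thus "crossing_sign M * of_bool (compatible pos M) = crossing_sign M * of_bool (\<forall>e\<in>M. comes_before q (Max e) (Min e))"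
    by (simp only: comp)
  qed
  finally show ?thesis unfolding q_def[symmetric] by simp
 qed
 have "(\<integral>\<rho>. real_of_int (coloring_coeff k (map particle_color (sort_key y \<rho>))) \<partial>?R) =
   (\<integral>\<rho>. (- 2) ^ k * (\<Sum>M\<in>?CM. of_int (crossing_sign M) * ?b \<rho> M) \<partial>?R)"
  unfolding integral_pmf_of_set[OF fP(2,1)]
  by (rule arg_cong[where f="%s. s / _"], rule sum.cong[OF refl], rule c)
 also have "... = (- 2) ^ k * (\<Sum>M\<in>?CM. of_int (crossing_sign M) * (\<integral>\<rho>. ?b \<rho> M \<partial>?R))"
 proof -
  have fs: "finite (set_pmf (pmf_of_set ?P))" using fP by simp
  have "(\<integral>\<rho>. (\<Sum>M\<in>?CM. of_int (crossing_sign M) * ?b \<rho> M) \<partial>?R) = (\<Sum>M\<in>?CM. \<integral>\<rho>. of_int (crossing_sign M) * ?b \<rho> M \<partial>?R)"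
   by (rule Bochner_Integration.integral_sum) (rule integrable_measure_pmf_finite[OF fs])
  thus ?thesis by simp
 qed
 also have "... = (- 2) ^ k * (\<Sum>M\<in>?CM. of_int (crossing_sign M) * (\<Prod>e\<in>M. edge_weight y e) / 2 ^ k)"
 proof (rule arg_cong[where f="%s. (- 2) ^ k * s"], rule sum.cong[OF refl])
  fix M assume "M \<in> ?CM"
  hence M: "perfect_on ?V M" using V by simp
  have fM: "finite M" by (rule perfect_on_finite[OF _ M]) simp
  have "card (\<Union>M) = (\<Sum>e\<in>M. card e)"
   using perfect_onD(3,4)[OF M] by (intro card_Union_disjoint) (auto simp: pairwise_def disjnt_def)
  hence "card M = k" using perfect_onD(1,2)[OF M] by simp
  hence "(\<integral>\<rho>. ?b \<rho> M \<partial>?R) = (\<Prod>e\<in>M. edge_weight y e) / 2 ^ k"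
   unfolding tie_breaking_average[OF M finite_atLeastAtMost] by (simp add: prod_dividef)
  thus "of_int (crossing_sign M) * (\<integral>\<rho>. ?b \<rho> M \<partial>?R) = of_int (crossing_sign M) * (\<Prod>e\<in>M. edge_weight y e) / 2 ^ k"
   by simp
 qed
 also have "... = (- 2) ^ k / 2 ^ k * connected_weight k y"
  by (simp add: connected_weight_def sum_divide_distrib[symmetric])
 also have "(- 2) ^ k / 2 ^ k = ((-1) ^ k :: real)" by (simp add: power_divide[symmetric])
 finally show ?thesis .
qed

section \<open>Dropping the non-crossing constraints\<close>

lemma flip_eq_flip_set: "1 \<le> w ==> flip w = flip_set {w}"
 using flip_fixes[of w] by (auto simp: flip_set_def fun_eq_iff)

text \<open>The exchange permutes the connected matchings and reverses their signs.\<close>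

lemma connected_weight_flip:
 assumes k: "2 \<le> k" and w: "w \<in> {1..k}"
 shows "connected_weight k (y \<circ> flip w) = - connected_weight k y"
proof -
 let ?CM = "{M. perfect_on (points {1..k}) M \<and> connected_walls {1..k} M}" and ?s = "flip w"
 have w1: "1 \<le> w" using w by simp
 have inv: "(`) ?s ` (`) ?s ` M = M" for M by (simp add: image_image)
 have W: "{w} \<subseteq> {1..k}" using w by simp
 have fl: "perfect_on (points {1..k}) ((`) ?s ` M)" "connected_walls {1..k} ((`) ?s ` M)" "crossing_sign ((`) ?s ` M) = - crossing_sign M"
  if "perfect_on (points {1..k}) M" "connected_walls {1..k} M" for M
  using matching_flip_set[OF k W that] unfolding flip_eq_flip_set[OF w1] by simp_all
 have ne: "{1..k} \<noteq> {w}"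
 proof
  assume "{1..k} = {w}"
  hence "card {1..k} = 1" by simp
  thus False using k by simp
 qed
 have "connected_weight k (y \<circ> ?s) = (\<Sum>M\<in>?CM. - (of_int (crossing_sign M) * (\<Prod>e\<in>M. edge_weight y e)))"
  unfolding connected_weight_def
 proof (rule sum.reindex_bij_witness[where i="(`) ((`) ?s)" and j="(`) ((`) ?s)"])
  fix M assume "M \<in> ?CM"
  hence M: "perfect_on (points {1..k}) M" "connected_walls {1..k} M" by auto
  have nw: "{2 * w - 1, 2 * w} \<notin> M" by (rule connected_walls_no_wall_edge[OF M w ne w1])
  have "(\<Prod>e\<in>(`) ?s ` M. edge_weight y e) = (\<Prod>e\<in>M. edge_weight y (?s ` e))"
   using inj_flip[of w] by (subst prod.reindex) (auto simp: inj_on_def inj_image_eq_iff)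
  also have "... = (\<Prod>e\<in>M. edge_weight (y \<circ> ?s) e)"
  proof (rule prod.cong[OF refl])
   fix e assume e: "e \<in> M"
   have "e \<noteq> {2 * w - 1, 2 * w}" using e nw by metis
   from flip_edge[OF w1 perfect_onD(2)[OF M(1) e] this]
   show "edge_weight y (?s ` e) = edge_weight (y \<circ> ?s) e" by (simp add: edge_weight_def)
  qed
  finally show "- (of_int (crossing_sign ((`) ?s ` M)) * (\<Prod>e\<in>(`) ?s ` M. edge_weight y e)) = of_int (crossing_sign M) * (\<Prod>e\<in>M. edge_weight (y \<circ> ?s) e)"
   unfolding fl(3)[OF M] by simp
  show "(`) ?s ` M \<in> ?CM" using fl[OF M] by simp
 next
  fix M assume "M \<in> ?CM"
  thus "(`) ?s ` M \<in> ?CM" using fl[of M] by simp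
 qed (rule inv)+
 thus ?thesis by (simp add: connected_weight_def sum_negf)
qed

lemma connected_weight_measurable:
 assumes "\<And>p. p \<in> {1..2 * k} ==> (%z. y z p) \<in> borel_measurable N"
 shows "(%z. connected_weight k (y z)) \<in> borel_measurable N"
 unfolding connected_weight_def
proof (rule borel_measurable_sum)
 fix M assume "M \<in> {M. perfect_on (points {1..k}) M \<and> connected_walls {1..k} M}"
 hence M: "perfect_on (points {1..k}) M" by simp
 have "(%z. edge_weight (y z) e) \<in> borel_measurable N" if "e \<in> M" for e
 proof -
  have "Min e \<in> {1..2 * k}" "Max e \<in> {1..2 * k}"
   using edge_Min_Max[OF perfect_onD(2)[OF M that]] perfect_onD(6)[OF M that] unfolding points_atLeastAtMost by blast+
  thus ?thesis unfolding edge_weight_def by (intro order_weight_measurable assms)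
 qed
 thus "(%z. of_int (crossing_sign M) * (\<Prod>e\<in>M. edge_weight (y z) e)) \<in> borel_measurable N"
  by (intro borel_measurable_times borel_measurable_const borel_measurable_prod)
qed

lemma edge_weight_bounds: "0 \<le> edge_weight y e" "edge_weight y e \<le> 2"
 by (auto simp: edge_weight_def order_weight_def)

lemma prod_edge_weight_bounds: "\<bar>\<Prod>e\<in>M. edge_weight y e\<bar> \<le> 2 ^ card M"
proof -
 have "(\<Prod>e\<in>M. edge_weight y e) \<le> (\<Prod>e\<in>M. 2)" by (rule prod_mono) (use edge_weight_bounds in auto)
 moreover have "0 \<le> (\<Prod>e\<in>M. edge_weight y e)" by (rule prod_nonneg) (use edge_weight_bounds in auto)
 ultimately show ?thesis by simp
qed

lemma connected_weight_bounded: "\<exists>C. \<forall>y. \<bar>connected_weight k y\<bar> \<le> C"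
proof (intro exI allI)
 let ?CM = "{M. perfect_on (points {1..k}) M \<and> connected_walls {1..k} M}"
 fix y
 have "\<bar>connected_weight k y\<bar> \<le> (\<Sum>M\<in>?CM. \<bar>of_int (crossing_sign M) * (\<Prod>e\<in>M. edge_weight y e)\<bar>)"
  unfolding connected_weight_def by (rule sum_abs)
 also have "... \<le> (\<Sum>M\<in>?CM. \<bar>of_int (crossing_sign M)\<bar> * 2 ^ card M)"
  unfolding abs_mult by (intro sum_mono mult_left_mono prod_edge_weight_bounds) auto
 finally show "\<bar>connected_weight k y\<bar> \<le> (\<Sum>M\<in>?CM. \<bar>of_int (crossing_sign M)\<bar> * 2 ^ card M)" .
qed

lemma non_crossing_iff: "non_crossing Tm T f g \<longleftrightarrow> \<not> (\<exists>u\<in>Tm. u \<le> T \<and> max 0 (g u - f u) = 0)"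
 by (auto simp: non_crossing_def max_def not_le)

text \<open>Sorted lists are obtained by finitely many comparisons.\<close>

lemma measurable_sort_key:
 fixes y :: "'a => nat => real"
 assumes y: "\<And>p. (%z. y z p) \<in> borel_measurable N"
 shows "(%z. sort_key (y z) \<rho>) \<in> N \<rightarrow>\<^sub>M count_space UNIV"
proof (induction \<rho>)
 case (Cons p \<rho>)
 have ins: "(%z. insort_key (y z) p l) \<in> N \<rightarrow>\<^sub>M count_space UNIV" for l
 proof (induction l)
  case (Cons r l)
  have [measurable]: "(%z. insort_key (y z) p l) \<in> N \<rightarrow>\<^sub>M count_space UNIV" by (rule Cons)
  have [measurable]: "(%z. y z p) \<in> borel_measurable N" "(%z. y z r) \<in> borel_measurable N" by (rule y)+
  have "(%z. r # insort_key (y z) p l) \<in> N \<rightarrow>\<^sub>M count_space UNIV"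
   by (rule measurable_compose[OF Cons]) simp
  hence "(%z. if y z p \<le> y z r then p # r # l else r # insort_key (y z) p l) \<in> N \<rightarrow>\<^sub>M count_space UNIV"
   by (intro measurable_If) (auto simp: pred_def[symmetric])
  thus ?case by simp
 qed simp
 have "(%z. insort_key (y z) p (sort_key (y z) \<rho>)) \<in> N \<rightarrow>\<^sub>M count_space UNIV"
  by (rule measurable_compose_countable[OF ins Cons])
 thus ?case by simp
qed simp

context skip_free_process begin

text \<open>
  The two paths are viewed as a system of two merging particles, whose merge time is the meeting
  time.
\<close>

lemma meeting_antisymmetric:
 fixes G :: "real \<times> real => real"
 assumes xy: "x \<in> S" "y \<in> S" and T: "T \<in> Tm"
  and G: "G \<in> borel_measurable (borel \<Otimes>\<^sub>M borel)" and anti: "\<And>u v. G (v, u) = - G (u, v)"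
 shows "(\<integral>p. of_bool (\<exists>u\<in>Tm. u \<le> T \<and> fst p u = snd p u) * G (fst p T, snd p T) \<partial>(K 0 x \<Otimes>\<^sub>M K 0 y)) = 0"
proof -
 let ?P = "path_space S Tm" and ?\<Omega> = "skip_free_paths S Tm"
 \<comment> \<open>only the indices 0 and 1 matter\<close>
 define Z :: "(real => real) => (real => real) => nat => real => real"
  where "Z f g i = (if i = 0 then f else if i = 1 then g else undefined)" for f g i
 have Zp: "Z f g i \<in> ?\<Omega>" if "f \<in> ?\<Omega>" "g \<in> ?\<Omega>" "i < 2" for f g i using that by (auto simp: Z_def)
 have ZZ: "Z f g = (%i. if i = 1 then g else undefined)(0 := f)" "Z f g = (%i. if i = 0 then f else undefined)(1 := g)" for f g
  by (auto simp: Z_def fun_eq_iff)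
 have ev: "merge_event Tm T 2 1 {0} (Z f g) \<longleftrightarrow> (\<exists>u\<in>Tm. u \<le> T \<and> f u = g u)" if fg: "f \<in> ?\<Omega>" "g \<in> ?\<Omega>" for f g
 proof -
  have 0: "merge_time Tm T (Z f g) 0 = T + 1" by (simp add: merge_time_def merged_def)
  have "merge_time Tm T (Z f g) 1 \<le> T \<longleftrightarrow> T + 1 \<le> T \<or> merged Tm (Z f g) 1 (min T T)"
   by (rule merge_time(2)[OF setting T]) (use Zp[OF fg] in auto)
  also have "... \<longleftrightarrow> (\<exists>u\<in>Tm. u \<le> T \<and> f u = g u)" by (auto simp: merged_def Z_def)
  finally have m: "merge_time Tm T (Z f g) 1 \<le> T \<longleftrightarrow> (\<exists>u\<in>Tm. u \<le> T \<and> f u = g u)" .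
  have "merge_event Tm T 2 1 {0} (Z f g) \<longleftrightarrow> merge_time Tm T (Z f g) 1 \<le> T"
  proof -
   have "m \<in> {0} \<longleftrightarrow> \<not> merges_before Tm T (Z f g) m 1" if "m < 2" "merge_time Tm T (Z f g) 1 \<le> T" for m
   proof -
    have "m = 0 \<or> m = 1" using that(1) by auto
    thus ?thesis using 0 that(2) by (auto simp: merges_before_def)
   qed
   thus ?thesis unfolding merge_event_def by blast
  qed
  thus ?thesis using m by simp
 qed
 have ev_m: "(%p. Z (fst p) (snd p) i u) \<in> borel_measurable (?P \<Otimes>\<^sub>M ?P)" for i u
  unfolding Z_def
  by (cases "i = 0"; cases "i = 1") (auto intro: measurable_compose[OF measurable_fst path_eval_measurable] measurable_compose[OF measurable_snd path_eval_measurable])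
 have ev_p: "Z (fst p) (snd p) i \<in> ?\<Omega>" if "p \<in> space (?P \<Otimes>\<^sub>M ?P)" "i < 2" for p i
  by (rule Zp) (use that in \<open>auto simp: space_pair_measure\<close>)
 have n: "(1::nat) < 2" by simp
 have "(\<integral>p. of_bool (merge_event Tm T 2 1 {0} (Z (fst p) (snd p))) * G (fst p T, snd p T) \<partial>(K 0 x \<Otimes>\<^sub>M K 0 y)) = 0"
 proof (rule swap_futures[where \<tau>="%f g. merge_time Tm T (Z f g) 1" and A="%f g. merge_event Tm T 2 1 {0} (Z f g)"])
  show "merge_time Tm T (Z f g) 1 \<in> Tm" if "f \<in> ?\<Omega>" "g \<in> ?\<Omega>" for f g
   by (rule merge_time(1)[OF setting T Zp[OF that]]) simp
  show "stopping_time (history S Tm) (%f. merge_time Tm T (Z f g) 1)" if "g \<in> ?\<Omega>" for g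
   unfolding ZZ(1) by (rule merge_time_section[OF T _ n]) (use that in auto)
  show "stopping_time (history S Tm) (%g. merge_time Tm T (Z f g) 1)" if "f \<in> ?\<Omega>" for f
   unfolding ZZ(2) by (rule merge_time_section[OF T _ n]) (use that in auto)
  show "{f \<in> ?\<Omega>. merge_event Tm T 2 1 {0} (Z f g)} \<in> sets (filtration.pre_sigma ?\<Omega> (history S Tm) (%f. merge_time Tm T (Z f g) 1))"
   if "g \<in> ?\<Omega>" for g
   unfolding ZZ(1) by (rule merge_event_section[OF T _ n]) (use that in auto)
  show "{g \<in> ?\<Omega>. merge_event Tm T 2 1 {0} (Z f g)} \<in> sets (filtration.pre_sigma ?\<Omega> (history S Tm) (%g. merge_time Tm T (Z f g) 1))"
   if "f \<in> ?\<Omega>" for f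
   unfolding ZZ(2) by (rule merge_event_section[OF T _ n]) (use that in auto)
  show "(%(f, g). merge_time Tm T (Z f g) 1) \<in> ?P \<Otimes>\<^sub>M ?P \<rightarrow>\<^sub>M borel"
   unfolding case_prod_unfold by (rule merge_event_measurable(1)[OF T n ev_m ev_p n])
  show "Measurable.pred (?P \<Otimes>\<^sub>M ?P) (%(f, g). merge_event Tm T 2 1 {0} (Z f g))"
   unfolding case_prod_unfold by (rule merge_event_measurable(2)[OF T n ev_m ev_p])
  show "merge_time Tm T (Z f g) 1 \<le> T \<and> f (merge_time Tm T (Z f g) 1) = g (merge_time Tm T (Z f g) 1)"
   if "f \<in> ?\<Omega>" "g \<in> ?\<Omega>" "merge_event Tm T 2 1 {0} (Z f g)" for f g
  proof
   show le: "merge_time Tm T (Z f g) 1 \<le> T" using that(3) by (simp add: merge_event_def)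
   have "0 < (1::nat) \<and> Z f g 1 (merge_time Tm T (Z f g) 1) = merging Tm (Z f g) (1 - 1) (merge_time Tm T (Z f g) 1)"
    by (rule merge_time(3)[OF setting T _ le]) (use Zp[OF that(1,2)] in auto)
   thus "f (merge_time Tm T (Z f g) 1) = g (merge_time Tm T (Z f g) 1)" by (simp add: Z_def)
  qed
  show "x \<in> S" "y \<in> S" "T \<in> Tm" "G \<in> borel_measurable (borel \<Otimes>\<^sub>M borel)" by (rule xy T G)+
  show "G (v, u) = - G (u, v)" for u v by (rule anti)
 qed
 also have "(\<integral>p. of_bool (merge_event Tm T 2 1 {0} (Z (fst p) (snd p))) * G (fst p T, snd p T) \<partial>(K 0 x \<Otimes>\<^sub>M K 0 y)) =
   (\<integral>p. of_bool (\<exists>u\<in>Tm. u \<le> T \<and> fst p u = snd p u) * G (fst p T, snd p T) \<partial>(K 0 x \<Otimes>\<^sub>M K 0 y))"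
 proof (rule Bochner_Integration.integral_cong[OF refl])
  fix p assume "p \<in> space (K 0 x \<Otimes>\<^sub>M K 0 y)"
  hence "fst p \<in> ?\<Omega>" "snd p \<in> ?\<Omega>"
   using kernel_at(3)[OF admissible_time(1)[OF setting]] xy by (auto simp: space_pair_measure)
  thus "of_bool (merge_event Tm T 2 1 {0} (Z (fst p) (snd p))) * G (fst p T, snd p T) =
    of_bool (\<exists>u\<in>Tm. u \<le> T \<and> fst p u = snd p u) * G (fst p T, snd p T)" by (simp only: ev)
 qed
 finally show ?thesis .
qed

lemma pred_meeting:
 assumes x: "x \<in> I \<rightarrow> S" and ij: "i \<in> I" "j \<in> I"
 shows "Measurable.pred (PiM I (%i. K 0 (x i))) (%X. \<exists>u\<in>Tm. u \<le> T \<and> X i u = X j u)"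
  and "Measurable.pred (PiM I (%i. K 0 (x i))) (%X. non_crossing Tm T (X i) (X j))"
proof -
 let ?P = "PiM I (%i. K 0 (x i))"
 note PM = PiM_paths[OF x]
 have m: "(%X. X i u - X j u) \<in> borel_measurable ?P" "(%X. max 0 (X j u - X i u)) \<in> borel_measurable ?P" for u
  using PM(4)[OF ij(1), of u] PM(4)[OF ij(2), of u] by measurable
 have "Measurable.pred ?P (%X. \<exists>u\<in>Tm. u \<le> T \<and> X i u - X j u = 0)"
  by (rule pred_hits_zero[where v="%X u. X i u - X j u", OF setting _ m(1)])
   (rule regular_path_diff(1)[OF setting PM(1)[OF _ ij(1)] PM(1)[OF _ ij(2)]])
 thus "Measurable.pred ?P (%X. \<exists>u\<in>Tm. u \<le> T \<and> X i u = X j u)" by simp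
 have "Measurable.pred ?P (%X. \<exists>u\<in>Tm. u \<le> T \<and> max 0 (X j u - X i u) = 0)"
  by (rule pred_hits_zero[where v="%X u. max 0 (X j u - X i u)", OF setting _ m(2)])
   (rule regular_path_diff(2)[OF setting PM(1)[OF _ ij(2)] PM(1)[OF _ ij(1)]])
 thus "Measurable.pred ?P (%X. non_crossing Tm T (X i) (X j))" unfolding non_crossing_iff by (intro pred_intros_logic)
qed

text \<open>
  The constraints are removed one wall at a time. Almost surely a wall is crossed exactly when its
  flanking particles meet, and on that event \<^const>\<open>connected_weight\<close> is
  antisymmetric in their final positions, while the other constraints do not involve them.
\<close>

lemma expectation_noncrossing:
 assumes k: "2 \<le> k" and x: "x \<in> {1..2 * k} \<rightarrow> S" and T: "T \<in> Tm" and le: "\<And>w. w \<in> {1..k} ==> x (2 * w - 1) \<le> x (2 * w)"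
  and W: "W \<subseteq> {1..k}"
 shows "(\<integral>X. (\<Prod>w\<in>W. of_bool (non_crossing Tm T (X (2 * w - 1)) (X (2 * w)))) * connected_weight k (%p. X p T) \<partial>PiM {1..2 * k} (%p. K 0 (x p))) =
  (\<integral>X. connected_weight k (%p. X p T) \<partial>PiM {1..2 * k} (%p. K 0 (x p)))"
proof -
 let ?V = "{1..2 * k}" and ?M = "%p. K 0 (x p)"
 let ?P = "PiM ?V ?M" and ?\<Psi> = "%X :: nat => real => real. connected_weight k (%p. X p T)"
 note PM = PiM_paths[OF x]
 interpret P: prob_space ?P by (rule prob_space_PiM) (use PM(2) in auto)
 obtain C0 where C0: "\<And>y. \<bar>connected_weight k y\<bar> \<le> C0" using connected_weight_bounded by blast
 have C0pos: "0 \<le> C0" using C0[of "%_. 0"] abs_ge_zero order_trans by blast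
 have \<Psi>m: "?\<Psi> \<in> borel_measurable ?P" by (rule connected_weight_measurable) (rule PM(4))
 define J :: "nat set => (nat => real => real) => real" where "J W X = (\<Prod>w\<in>W. of_bool (non_crossing Tm T (X (2 * w - 1)) (X (2 * w))))" for W X
 have wV: "2 * w - 1 \<in> ?V" "2 * w \<in> ?V" "2 * w - 1 \<noteq> 2 * w" if "w \<in> {1..k}" for w using that by auto
 have Jm: "J W \<in> borel_measurable ?P" if "W \<subseteq> {1..k}" for W
  unfolding J_def[abs_def]
 proof (rule borel_measurable_prod)
  fix w assume "w \<in> W"
  hence "w \<in> {1..k}" using that by blast
  from pred_meeting(2)[OF x wV(1,2)[OF this], of T]
  show "(%X. of_bool (non_crossing Tm T (X (2 * w - 1)) (X (2 * w))) :: real) \<in> borel_measurable ?P" by measurable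
 qed
 have J01: "0 \<le> J W X" "J W X \<le> 1" for W X
  unfolding J_def by (auto intro!: prod_nonneg prod_le_1)
 have J\<Psi>: "\<bar>J W X * ?\<Psi> X\<bar> \<le> C0" for W X
  using mult_mono[of "J W X" 1 "\<bar>?\<Psi> X\<bar>" C0] J01[of W X] C0[of "%p. X p T"] by (simp add: abs_mult)
 have "finite W" using W finite_subset by blast
 hence "W \<subseteq> {1..k} \<longrightarrow> (\<integral>X. J W X * ?\<Psi> X \<partial>?P) = (\<integral>X. ?\<Psi> X \<partial>?P)"
 proof (induction W rule: finite_induct)
  case empty show ?case by (simp add: J_def)
 next
  case (insert w W)
  show ?case
  proof
   assume wW: "insert w W \<subseteq> {1..k}"
   hence w: "w \<in> {1..k}" "1 \<le> w" and Wk: "W \<subseteq> {1..k}" by auto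
   let ?r = "2 * w - 1" and ?n = "2 * w"
   note rn = wV[OF w(1)]
   let ?meet = "%X :: nat => real => real. \<exists>u\<in>Tm. u \<le> T \<and> X ?r u = X ?n u"
   have mm: "(%X. of_bool (?meet X) :: real) \<in> borel_measurable ?P"
    using pred_meeting(1)[OF x rn(1,2), of T] by measurable
   have fm: "(%X. of_bool (?meet X) * (J W X * ?\<Psi> X)) \<in> borel_measurable ?P"
    by (intro borel_measurable_times mm Jm[OF Wk] \<Psi>m)
   have fB: "\<bar>of_bool (?meet X) * (J W X * ?\<Psi> X)\<bar> \<le> C0" for X
    using J\<Psi>[of W X] C0pos by (cases "?meet X") auto
   have zero: "(\<integral>X. of_bool (?meet X) * (J W X * ?\<Psi> X) \<partial>?P) = 0"
   proof (rule integral_PiM_zero_pairwise[where r="?r" and n="?n" and B=C0])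
    show "prob_space (?M i)" if "i \<in> ?V" for i using PM(2)[OF that] .
    fix X0 assume X0: "X0 \<in> space (PiM (?V - {?r, ?n}) ?M)"
    define G where "G p = J W X0 * connected_weight k (%i. if i = ?r then fst p else if i = ?n then snd p else X0 i T)" for p :: "real \<times> real"
    have "(\<integral>p. of_bool (\<exists>u\<in>Tm. u \<le> T \<and> fst p u = snd p u) * G (fst p T, snd p T) \<partial>(?M ?r \<Otimes>\<^sub>M ?M ?n)) = 0"
    proof (rule meeting_antisymmetric)
     show "x ?r \<in> S" "x ?n \<in> S" "T \<in> Tm" using x rn T by auto
     have "(%p. connected_weight k (%i. if i = ?r then fst p else if i = ?n then snd p else X0 i T)) \<in> borel_measurable (borel \<Otimes>\<^sub>M borel)"
     proof (rule connected_weight_measurable)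
      fix i
      show "(%p. if i = ?r then fst p else if i = ?n then snd p else X0 i T) \<in> borel_measurable (borel \<Otimes>\<^sub>M borel)"
       by (cases "i = ?r"; cases "i = ?n") simp_all
     qed
     thus "G \<in> borel_measurable (borel \<Otimes>\<^sub>M borel)"
      unfolding G_def[abs_def] by (intro borel_measurable_times borel_measurable_const)
     fix u v
     let ?y = "%i. if i = ?r then u else if i = ?n then v else X0 i T"
     have "(%i. if i = ?r then v else if i = ?n then u else X0 i T) = ?y \<circ> flip w"
      using rn(3) by (auto simp: fun_eq_iff flip_def Transposition.transpose_def)
     thus "G (v, u) = - G (u, v)"
      unfolding G_def fst_conv snd_conv
      by (simp only: connected_weight_flip[OF k w(1)] mult_minus_right)
    qed
    moreover have "J W (X0(?n := g, ?r := f)) = J W X0" for f g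
     unfolding J_def
    proof (rule prod.cong[OF refl])
     fix v assume "v \<in> W"
     hence "v \<noteq> w" "1 \<le> v" using insert(2) Wk by auto
     hence "2 * v - 1 \<noteq> ?r" "2 * v - 1 \<noteq> ?n" "2 * v \<noteq> ?r" "2 * v \<noteq> ?n" using w(2) by presburger+
     thus "of_bool (non_crossing Tm T ((X0(?n := g, ?r := f)) (2 * v - 1)) ((X0(?n := g, ?r := f)) (2 * v))) =
       (of_bool (non_crossing Tm T (X0 (2 * v - 1)) (X0 (2 * v))) :: real)" by (simp only: fun_upd_other not_False_eq_True)
    qed
    moreover have "?\<Psi> (X0(?n := g, ?r := f)) = connected_weight k (%i. if i = ?r then f T else if i = ?n then g T else X0 i T)" for f g
     by (rule arg_cong[where f="connected_weight k"]) auto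
    moreover have "(X0(?n := g, ?r := f)) ?r = f" "(X0(?n := g, ?r := f)) ?n = g" for f g
     using rn(3) by (simp_all only: fun_upd_same fun_upd_other not_False_eq_True)
    ultimately show "(\<integral>p. of_bool (?meet (X0(?n := snd p, ?r := fst p))) * (J W (X0(?n := snd p, ?r := fst p)) * ?\<Psi> (X0(?n := snd p, ?r := fst p))) \<partial>(?M ?r \<Otimes>\<^sub>M ?M ?n)) = 0"
     by (simp only: G_def fst_conv snd_conv)
   qed (use rn fm fB in auto)
   have ins: "J (insert w W) X = of_bool (non_crossing Tm T (X ?r) (X ?n)) * J W X" for X
    unfolding J_def using insert(1,2) by simp
   have "(\<integral>X. J (insert w W) X * ?\<Psi> X \<partial>?P) = (\<integral>X. J W X * ?\<Psi> X - of_bool (?meet X) * (J W X * ?\<Psi> X) \<partial>?P)"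
   proof (rule integral_cong_AE)
    show "(%X. J (insert w W) X * ?\<Psi> X) \<in> borel_measurable ?P"
     by (intro borel_measurable_times Jm[OF wW] \<Psi>m)
    show "(%X. J W X * ?\<Psi> X - of_bool (?meet X) * (J W X * ?\<Psi> X)) \<in> borel_measurable ?P"
     by (intro borel_measurable_diff borel_measurable_times Jm[OF Wk] \<Psi>m mm)
    show "AE X in ?P. J (insert w W) X * ?\<Psi> X = J W X * ?\<Psi> X - of_bool (?meet X) * (J W X * ?\<Psi> X)"
     using AE_no_swap_pair[OF x finite_atLeastAtMost rn le[OF w(1)]]
    proof eventually_elim
     case (elim X)
     have "non_crossing Tm T (X ?r) (X ?n) \<longleftrightarrow> \<not> ?meet X"
     proof
      assume nm: "\<not> ?meet X"
      show "non_crossing Tm T (X ?r) (X ?n)" unfolding non_crossing_def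
      proof (intro ballI impI, rule ccontr)
       fix t assume t: "t \<in> Tm" "t \<le> T" "\<not> X ?r t < X ?n t"
       have "X ?r t \<noteq> X ?n t" using nm t by blast
       hence "X ?n t < X ?r t" using t(3) by simp
       then obtain u where "u \<in> Tm" "u \<le> t" "X ?r u = X ?n u" using elim t(1) by blast
       thus False using nm t(2) order_trans by blast
      qed
     qed (force simp: non_crossing_def)
     thus ?case unfolding ins by simp
    qed
   qed
   also have "... = (\<integral>X. J W X * ?\<Psi> X \<partial>?P) - (\<integral>X. of_bool (?meet X) * (J W X * ?\<Psi> X) \<partial>?P)"
   proof (rule Bochner_Integration.integral_diff)
    show "integrable ?P (%X. J W X * ?\<Psi> X)"
     by (rule P.integrable_const_bound[where B=C0]) (use J\<Psi> Jm[OF Wk] \<Psi>m in auto)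
    show "integrable ?P (%X. of_bool (?meet X) * (J W X * ?\<Psi> X))"
     by (rule P.integrable_const_bound[where B=C0]) (use fB fm in auto)
   qed
   finally show "(\<integral>X. J (insert w W) X * ?\<Psi> X \<partial>?P) = (\<integral>X. ?\<Psi> X \<partial>?P)"
    using insert.IH Wk zero by simp
  qed
 qed
 thus ?thesis using W unfolding J_def by simp
qed

lemma flanking_expectation:
 assumes k: "2 \<le> k" and x: "particle_start a b \<in> {1..2 * k} \<rightarrow> S" and T: "T \<in> Tm"
  and le: "\<And>w. w \<in> {1..k} ==> particle_start a b (2 * w - 1) \<le> particle_start a b (2 * w)"
 shows "(\<integral>(X, \<rho>). real_of_int (coloring_coeff k (color_sequence T X \<rho>)) *
    (\<Prod>w=1..k. of_bool (non_crossing Tm T (X (2 * w - 1)) (X (2 * w)))) \<partial>flanking_space K k a b) =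
  (-1) ^ k * (\<integral>X. connected_weight k (%p. X p T) \<partial>PiM {1..2 * k} (%p. K 0 (particle_start a b p)))"
proof -
 let ?V = "{1..2 * k}" and ?x = "particle_start a b"
 let ?P = "PiM ?V (%p. K 0 (?x p))" and ?R = "measure_pmf (pmf_of_set (permutations_of_set ?V))"
 note PM = PiM_paths[OF x]
 interpret P: prob_space ?P by (rule prob_space_PiM) (use PM(2) in auto)
 interpret R: prob_space ?R by (rule prob_space_measure_pmf)
 interpret PR: pair_prob_space ?P ?R ..
 let ?J = "%X. \<Prod>w=1..k. of_bool (non_crossing Tm T (X (2 * w - 1)) (X (2 * w))) :: real"
 let ?c = "%X \<rho>. real_of_int (coloring_coeff k (color_sequence T X \<rho>))"
 have Jm: "?J \<in> borel_measurable ?P"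
 proof (rule borel_measurable_prod)
  fix w assume w: "w \<in> {1..k}"
  have wV: "2 * w - 1 \<in> ?V" "2 * w \<in> ?V" using w by auto
  from pred_meeting(2)[OF x wV, of T]
  show "(%X. of_bool (non_crossing Tm T (X (2 * w - 1)) (X (2 * w))) :: real) \<in> borel_measurable ?P" by measurable
 qed
 have comp: "(%X. X p T) \<in> borel_measurable ?P" for p
 proof (cases "p \<in> ?V")
  case False
  have "X p T = undefined T" if "X \<in> space ?P" for X
  proof -
   have "X p = undefined" by (rule PiE_arb[OF that[unfolded space_PiM] False])
   thus ?thesis by (simp only:)
  qed
  thus ?thesis by (subst measurable_cong[of ?P _ "%_. undefined T"]) simp_all
 qed (rule PM(4))
 have cm: "(%X. ?c X \<rho>) \<in> borel_measurable ?P" for \<rho>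
  unfolding color_sequence_def by (rule measurable_compose[OF measurable_sort_key[OF comp]]) simp
 have fm: "(%z. ?c (fst z) (snd z) * ?J (fst z)) \<in> borel_measurable (?P \<Otimes>\<^sub>M ?R)"
 proof (rule measurable_compose_countable[where f="%\<rho> z. ?c (fst z) \<rho> * ?J (fst z)" and g=snd])
  show "(%z. ?c (fst z) \<rho> * ?J (fst z)) \<in> borel_measurable (?P \<Otimes>\<^sub>M ?R)" for \<rho>
   by (rule borel_measurable_times[OF measurable_compose[OF measurable_fst cm] measurable_compose[OF measurable_fst Jm]])
  have "snd \<in> ?P \<Otimes>\<^sub>M ?R \<rightarrow>\<^sub>M ?R" by (rule measurable_snd)
  thus "snd \<in> ?P \<Otimes>\<^sub>M ?R \<rightarrow>\<^sub>M count_space UNIV" by simp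
 qed
 have "integrable (?P \<Otimes>\<^sub>M ?R) (%z. ?c (fst z) (snd z) * ?J (fst z))"
 proof -
  let ?A = "{\<rho>. set \<rho> \<subseteq> {1..k} \<and> length \<rho> = 2 * k}"
  \<comment> \<open>only finitely many colorings occur, so the integrand is bounded\<close>
  let ?B = "\<Sum>I\<in>?A. \<bar>real_of_int (coloring_coeff k I)\<bar>"
  have fA: "finite ?A" using finite_lists_length_eq[of "{1..k}" "2 * k"] by simp
  have bnd: "norm (?c X \<rho> * ?J X) \<le> ?B" if "\<rho> \<in> permutations_of_set ?V" for X \<rho>
  proof -
   have r: "set \<rho> = ?V" "distinct \<rho>" using that by (auto simp: permutations_of_set_def)
   have "color_sequence T X \<rho> \<in> ?A"
    using r distinct_card[OF r(2)] by (auto simp: color_sequence_def particle_color_def)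
   hence 1: "\<bar>?c X \<rho>\<bar> \<le> ?B" by (intro member_le_sum[OF _ _ fA]) auto
   have 2: "0 \<le> ?J X" "?J X \<le> 1" by (auto intro!: prod_nonneg prod_le_1)
   have "\<bar>?c X \<rho>\<bar> * ?J X \<le> ?B * 1" using 1 2 by (intro mult_mono) (auto intro: order_trans[OF abs_ge_zero])
   thus ?thesis using 2(1) by (simp add: abs_mult)
  qed
  have "AE z in ?P \<Otimes>\<^sub>M ?R. snd z \<in> permutations_of_set ?V"
  proof -
   have "{z \<in> space (?P \<Otimes>\<^sub>M ?R). snd z \<in> permutations_of_set ?V} = space ?P \<times> permutations_of_set ?V"
    by (auto simp: space_pair_measure)
   hence "{z \<in> space (?P \<Otimes>\<^sub>M ?R). snd z \<in> permutations_of_set ?V} \<in> sets (?P \<Otimes>\<^sub>M ?R)"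
    by (simp add: pair_measureI)
   moreover have "AE \<rho> in ?R. \<rho> \<in> permutations_of_set ?V" by (simp add: AE_measure_pmf_iff)
   ultimately show ?thesis by (intro PR.AE_pair_measure) simp_all
  qed
  hence "AE z in ?P \<Otimes>\<^sub>M ?R. norm (?c (fst z) (snd z) * ?J (fst z)) \<le> ?B"
   by eventually_elim (rule bnd)
  thus ?thesis by (rule PR.P.integrable_const_bound[OF _ fm])
 qed
 from PR.integral_fst'[OF this]
 have "(\<integral>(X, \<rho>). ?c X \<rho> * ?J X \<partial>flanking_space K k a b) = (\<integral>X. \<integral>\<rho>. ?c X \<rho> * ?J X \<partial>?R \<partial>?P)"
  by (simp add: flanking_space_def case_prod_unfold)
 also have "... = (\<integral>X. (-1) ^ k * (?J X * connected_weight k (%p. X p T)) \<partial>?P)"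
 proof (rule Bochner_Integration.integral_cong[OF refl])
  fix X
  show "(\<integral>\<rho>. ?c X \<rho> * ?J X \<partial>?R) = (-1) ^ k * (?J X * connected_weight k (%p. X p T))"
  proof (cases "\<forall>w\<in>{1..k}. non_crossing Tm T (X (2 * w - 1)) (X (2 * w))")
   case True
   hence J1: "?J X = 1" by simp
   have lt: "X (2 * w - 1) T < X (2 * w) T" if "w \<in> {1..k}" for w
    using True that T by (auto simp: non_crossing_def)
   have "(\<integral>\<rho>. ?c X \<rho> \<partial>?R) = (-1) ^ k * connected_weight k (%p. X p T)"
    unfolding color_sequence_def by (rule tie_averaged_coeff[OF k lt])
   thus ?thesis unfolding J1 by simp
  next
   case False
   hence "?J X = 0" by (intro prod_zero) auto
   thus ?thesis by simp
  qed
 qed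
 also have "... = (-1) ^ k * (\<integral>X. ?J X * connected_weight k (%p. X p T) \<partial>?P)" by simp
 also have "(\<integral>X. ?J X * connected_weight k (%p. X p T) \<partial>?P) = (\<integral>X. connected_weight k (%p. X p T) \<partial>?P)"
  by (rule expectation_noncrossing[OF k x T le subset_refl])
 finally show ?thesis .
qed

end

section \<open>Independent edges\<close>

context skip_free_process begin

lemma expectation_prod_edges:
 assumes x: "x \<in> V \<rightarrow> S" and V: "finite V"
  and M: "\<And>e. e \<in> M ==> card e = 2 \<and> e \<subseteq> V" "\<And>e f. e \<in> M ==> f \<in> M ==> e \<noteq> f ==> e \<inter> f = {}"
 shows "(\<integral>X. (\<Prod>e\<in>M. edge_weight (%p. X p T) e) \<partial>PiM V (%p. K 0 (x p))) =
  (\<Prod>e\<in>M. \<integral>X. edge_weight (%p. X p T) e \<partial>PiM V (%p. K 0 (x p)))"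
proof (cases "M = {}")
 case True
 interpret P: prob_space "PiM V (%p. K 0 (x p))" by (rule prob_space_PiM) (use PiM_paths(2)[OF x] in auto)
 show ?thesis using P.prob_space by (simp add: True)
next
 case False
 let ?M = "%p. K 0 (x p)"
 let ?P = "PiM V ?M"
 note PM = PiM_paths[OF x]
 interpret P: prob_space ?P by (rule prob_space_PiM) (use PM(2) in auto)
 have Vne: "V \<noteq> {}" using False M(1) by fastforce
 have fM: "finite M" by (rule finite_subset[of _ "Pow V"]) (use M(1) V in auto)
 have E: "Min e \<in> e" "Max e \<in> e" "e \<subseteq> V" if "e \<in> M" for e using M(1)[OF that] edge_Min_Max(3,4)[of e] by auto
 have proj: "(%X. X p) \<in> ?P \<rightarrow>\<^sub>M ?M p" if "p \<in> V" for p using that by (rule measurable_component_singleton)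
 have ind: "P.indep_vars ?M (%p X. X p) V"
 proof (subst P.indep_vars_iff_distr_eq_PiM'[OF Vne proj])
  have "distr ?P ?P (%X. \<lambda>p\<in>V. X p) = distr ?P ?P (%X. X)"
   by (rule distr_cong) (auto simp: space_PiM restrict_PiE_iff intro!: PiE_restrict)
  also have "... = ?P" by simp
  also have "?P = PiM V (%p. distr ?P (?M p) (%X. X p))"
   by (rule PiM_cong[OF refl]) (rule distr_PiM_component[symmetric], use PM(2) in auto)
  finally show "distr ?P ?P (%X. \<lambda>p\<in>V. X p) = PiM V (%p. distr ?P (?M p) (%X. X p))" .
 qed simp_all
 have "disjoint_family_on (%e. e) M" using M(2) by (simp add: disjoint_family_on_def)
 from P.indep_vars_restrict[OF ind E(3) this]
 have "P.indep_vars (%e. PiM e ?M) (%e X. \<lambda>p\<in>e. X p) M" .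
 hence "P.indep_vars (%_. borel) (%e X. edge_weight (%p. (\<lambda>p\<in>e. X p) p T) e) M"
 proof (rule P.indep_vars_compose2[where Y="%e Z. edge_weight (%p. Z p T) e"])
  fix e assume e: "e \<in> M"
  have "x \<in> e \<rightarrow> S" using x E(3)[OF e] by auto
  from PiM_paths(4)[OF this] show "(%Z. edge_weight (%p. Z p T) e) \<in> PiM e ?M \<rightarrow>\<^sub>M borel"
   unfolding edge_weight_def using E[OF e] by (intro order_weight_measurable) auto
 qed
 hence ind': "P.indep_vars (%_. borel) (%e X. edge_weight (%p. (\<lambda>p\<in>e. X p) p T) e) M" .
 have restr: "edge_weight (%p. (\<lambda>p\<in>e. X p) p T) e = edge_weight (%p. X p T) e" if "e \<in> M" for e X
  using E[OF that] by (simp add: edge_weight_def)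
 have int: "integrable ?P (%X. edge_weight (%p. (\<lambda>p\<in>e. X p) p T) e)" if e: "e \<in> M" for e
  unfolding restr[OF e]
 proof (rule P.integrable_const_bound[where B=2])
  show "AE X in ?P. norm (edge_weight (%p. X p T) e) \<le> 2" using edge_weight_bounds by simp
  show "(%X. edge_weight (%p. X p T) e) \<in> borel_measurable ?P"
   unfolding edge_weight_def using E[OF e] PM(4) by (intro order_weight_measurable) auto
 qed
 have "(\<integral>X. (\<Prod>e\<in>M. edge_weight (%p. (\<lambda>p\<in>e. X p) p T) e) \<partial>?P) = (\<Prod>e\<in>M. \<integral>X. edge_weight (%p. (\<lambda>p\<in>e. X p) p T) e \<partial>?P)"
  by (rule P.indep_vars_lebesgue_integral[OF fM ind' int])
 moreover have "(\<Prod>e\<in>M. edge_weight (%p. (\<lambda>p\<in>e. X p) p T) e) = (\<Prod>e\<in>M. edge_weight (%p. X p T) e)" for X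
  by (rule prod.cong[OF refl restr])
 moreover have "(\<Prod>e\<in>M. \<integral>X. edge_weight (%p. (\<lambda>p\<in>e. X p) p T) e \<partial>?P) = (\<Prod>e\<in>M. \<integral>X. edge_weight (%p. X p T) e \<partial>?P)"
  by (rule prod.cong[OF refl]) (simp only: restr)
 ultimately show ?thesis by (simp only:)
qed

lemma expectation_matching_sum:
 assumes x: "x \<in> V \<rightarrow> S" and V: "finite V" and U: "U \<subseteq> V" and \<M>: "finite \<M>" "\<And>M. M \<in> \<M> ==> perfect_on U M"
 shows "(\<integral>X. (\<Sum>M\<in>\<M>. of_int (crossing_sign M) * (\<Prod>e\<in>M. edge_weight (%p. X p T) e)) \<partial>PiM V (%p. K 0 (x p))) =
  (\<Sum>M\<in>\<M>. of_int (crossing_sign M) * (\<Prod>e\<in>M. \<integral>X. edge_weight (%p. X p T) e \<partial>PiM V (%p. K 0 (x p))))"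
proof -
 let ?P = "PiM V (%p. K 0 (x p))"
 note PM = PiM_paths[OF x]
 interpret P: prob_space ?P by (rule prob_space_PiM) (use PM(2) in auto)
 have E: "card e = 2 \<and> e \<subseteq> V" "Min e \<in> V" "Max e \<in> V" if "M \<in> \<M>" "e \<in> M" for e M
  using perfect_onD(2,6)[OF \<M>(2)[OF that(1)] that(2)] U edge_Min_Max(3,4)[of e] by auto
 have int: "integrable ?P (%X. of_int (crossing_sign M) * (\<Prod>e\<in>M. edge_weight (%p. X p T) e))" if M: "M \<in> \<M>" for M
 proof (rule integrable_mult_right, rule P.integrable_const_bound[where B="2 ^ card M"])
  show "AE X in ?P. norm (\<Prod>e\<in>M. edge_weight (%p. X p T) e) \<le> 2 ^ card M"
   by (rule AE_I2) (simp only: real_norm_def prod_edge_weight_bounds)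
  show "(%X. \<Prod>e\<in>M. edge_weight (%p. X p T) e) \<in> borel_measurable ?P"
   by (rule borel_measurable_prod) (unfold edge_weight_def, intro order_weight_measurable PM(4) E(2,3)[OF M])
 qed
 have "(\<integral>X. (\<Sum>M\<in>\<M>. of_int (crossing_sign M) * (\<Prod>e\<in>M. edge_weight (%p. X p T) e)) \<partial>?P) =
   (\<Sum>M\<in>\<M>. \<integral>X. of_int (crossing_sign M) * (\<Prod>e\<in>M. edge_weight (%p. X p T) e) \<partial>?P)"
  by (rule Bochner_Integration.integral_sum[OF int])
 also have "... = (\<Sum>M\<in>\<M>. of_int (crossing_sign M) * (\<Prod>e\<in>M. \<integral>X. edge_weight (%p. X p T) e \<partial>?P))"
 proof (rule sum.cong[OF refl])
  fix M assume M: "M \<in> \<M>"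
  have "(\<integral>X. (\<Prod>e\<in>M. edge_weight (%p. X p T) e) \<partial>?P) = (\<Prod>e\<in>M. \<integral>X. edge_weight (%p. X p T) e \<partial>?P)"
   by (rule expectation_prod_edges[OF x V E(1)[OF M] perfect_onD(3)[OF \<M>(2)[OF M]]])
  thus "(\<integral>X. of_int (crossing_sign M) * (\<Prod>e\<in>M. edge_weight (%p. X p T) e) \<partial>?P) =
    of_int (crossing_sign M) * (\<Prod>e\<in>M. \<integral>X. edge_weight (%p. X p T) e \<partial>?P)" by simp
 qed
 finally show ?thesis .
qed

text \<open>
  The flanking particles of the walls in \<open>B\<close> are a subfamily of all flanking
  particles, renumbered from 0.
\<close>

lemma expectation_pfaff_reindex:
 fixes vs :: "nat list"
 assumes x: "x \<in> V \<rightarrow> S" and V: "finite V" and vs: "distinct vs" "set vs \<subseteq> V"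
 shows "(\<integral>X. pfaff (map (%i. X i T) [0..<length vs]) \<partial>PiM {..<length vs} (%i. K 0 (x (vs ! i)))) =
  (\<integral>X. pfaff (map (%p. X p T) vs) \<partial>PiM V (%p. K 0 (x p)))"
proof -
 let ?I = "{..<length vs}"
 let ?P = "PiM V (%p. K 0 (x p))" and ?Q = "PiM ?I (%i. K 0 (x (vs ! i)))"
 let ?t = "%X :: nat => real => real. \<lambda>i\<in>?I. X (vs ! i)"
 have inj: "inj_on ((!) vs) ?I" using vs(1) by (simp add: inj_on_def nth_eq_iff_index_eq)
 have into: "(!) vs \<in> ?I \<rightarrow> V" using vs(2) by auto
 have x': "(%i. x (vs ! i)) \<in> ?I \<rightarrow> S" using x into by auto
 have d: "distr ?P ?Q ?t = ?Q" by (rule distr_PiM_reindex[OF PiM_paths(2)[OF x] inj into])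
 have t: "?t \<in> ?P \<rightarrow>\<^sub>M ?Q" by (rule measurable_restrict) (rule measurable_component_singleton, use into in auto)
 have m: "(%X. pfaff (map (%i. X i T) [0..<length vs])) \<in> borel_measurable ?Q"
 proof -
  have "(%X. pfaff (map (%h. h X) (map (%i X. X i T) [0..<length vs]))) \<in> borel_measurable ?Q"
   by (rule pfaff_measurable) (use PiM_paths(4)[OF x'] in auto)
  thus ?thesis by (simp add: comp_def)
 qed
 have "(\<integral>X. pfaff (map (%i. X i T) [0..<length vs]) \<partial>distr ?P ?Q ?t) = (\<integral>X. pfaff (map (%i. ?t X i T) [0..<length vs]) \<partial>?P)"
  by (rule integral_distr[OF t m])
 also have "(%X. pfaff (map (%i. ?t X i T) [0..<length vs])) = (%X. pfaff (map (%p. X p T) vs))"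
 proof
  fix X
  have "map (%i. ?t X i T) [0..<length vs] = map (%p. X p T) vs" by (rule nth_equalityI) auto
  thus "pfaff (map (%i. ?t X i T) [0..<length vs]) = pfaff (map (%p. X p T) vs)" by (simp only:)
 qed
 finally show ?thesis unfolding d .
qed

section \<open>Walls and coalescence of the flanking particles\<close>

lemma prob_flanks_coalesced:
 assumes cs: "coalescing_system S Tm K M Y" and T: "T \<in> Tm"
  and x: "particle_start a b \<in> {1..2 * k} \<rightarrow> S" and mono: "mono_on {1..2 * k} (particle_start a b)" and B: "B \<subseteq> {1..k}"
 shows "measure M {\<omega> \<in> space M. \<forall>w\<in>B. Y (a w) \<omega> T = Y (b w) \<omega> T} =
  (\<Sum>N | perfect_on (points B) N. of_int (crossing_sign N) *
    (\<Prod>e\<in>N. \<integral>X. edge_weight (%p. X p T) e \<partial>PiM {1..2 * k} (%p. K 0 (particle_start a b p))))"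
proof -
 let ?V = "{1..2 * k}" and ?x = "particle_start a b"
 have fB: "finite B" using B finite_subset by blast
 define ws where "ws = sorted_list_of_set B"
 have ws: "set ws = B" "sorted_wrt (<) ws" using fB by (simp_all add: ws_def)
 have wsk: "1 \<le> ws ! j" "ws ! j \<le> k" if "j < length ws" for j using nth_mem[OF that] ws(1) B by auto
 define vs where "vs = map (%i. if even i then 2 * ws ! (i div 2) - 1 else 2 * ws ! (i div 2)) [0..<2 * length ws]"
 have len: "length vs = 2 * length ws" by (simp add: vs_def)
 have nth: "vs ! (2 * j) = 2 * ws ! j - 1" "vs ! (2 * j + 1) = 2 * ws ! j" if "j < length ws" for j
  using that by (simp_all add: vs_def)
 have srt: "sorted_wrt (<) vs"
 proof (unfold sorted_wrt_iff_nth_less, intro allI impI)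
  fix i j assume ij: "i < j" "j < length vs"
  have l: "i div 2 < length ws" "j div 2 < length ws" using ij len by auto
  have vi: "vs ! i = (if even i then 2 * ws ! (i div 2) - 1 else 2 * ws ! (i div 2))"
   "vs ! j = (if even j then 2 * ws ! (j div 2) - 1 else 2 * ws ! (j div 2))" using ij len by (simp_all add: vs_def)
  show "vs ! i < vs ! j"
  proof (cases "i div 2 = j div 2")
   case True
   hence "even i" "odd j" using ij(1) by presburger+
   thus ?thesis using vi True wsk[OF l(1)] by simp
  next
   case False
   hence "i div 2 < j div 2" using ij(1) by (meson div_le_mono le_neq_implies_less less_imp_le)
   hence "ws ! (i div 2) < ws ! (j div 2)" using sorted_wrt_nth_less[OF ws(2)] l by blast
   thus ?thesis using vi by auto
  qed
 qed
 have set: "set vs = points B"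
 proof -
  have 0: "0 \<notin> B" using B by auto
  have "set vs = (\<Union>j<length ws. {2 * ws ! j - 1, 2 * ws ! j})"
  proof (intro equalityI subsetI)
   fix v assume "v \<in> set vs"
   then obtain i where "i < 2 * length ws" "v = (if even i then 2 * ws ! (i div 2) - 1 else 2 * ws ! (i div 2))" by (auto simp: vs_def)
   thus "v \<in> (\<Union>j<length ws. {2 * ws ! j - 1, 2 * ws ! j})" by (intro UN_I[of "i div 2"]) auto
  next
   fix v assume "v \<in> (\<Union>j<length ws. {2 * ws ! j - 1, 2 * ws ! j})"
   then obtain j where j: "j < length ws" "v = 2 * ws ! j - 1 \<or> v = 2 * ws ! j" by auto
   have "vs ! (2 * j) \<in> set vs" "vs ! (2 * j + 1) \<in> set vs" using j(1) len by (auto intro!: nth_mem)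
   thus "v \<in> set vs" using nth[OF j(1)] j(2) by auto
  qed
  also have "... = (\<Union>w\<in>set ws. {2 * w - 1, 2 * w})" by (auto simp: set_conv_nth)
  finally show ?thesis unfolding ws(1) points_eq[OF 0] .
 qed
 have dist: "distinct vs" using srt by (simp add: strict_sorted_iff)
 have pV: "points B \<subseteq> ?V" using B unfolding points_atLeastAtMost[symmetric] by (auto simp: points_def)
 have x': "(%i. ?x (vs ! i)) \<in> {..<length vs} \<rightarrow> S"
 proof
  fix i assume "i \<in> {..<length vs}"
  hence "vs ! i \<in> set vs" by simp
  hence "vs ! i \<in> ?V" unfolding set by (rule subsetD[OF pV])
  thus "?x (vs ! i) \<in> S" by (rule funcset_mem[OF x])
 qed
 have mono': "mono_on {..<length vs} (%i. ?x (vs ! i))"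
 proof (rule mono_onI)
  fix i j assume ij: "i \<in> {..<length vs}" "j \<in> {..<length vs}" "i \<le> j"
  have "vs ! i \<in> set vs" "vs ! j \<in> set vs" using ij by simp_all
  hence "vs ! i \<in> ?V" "vs ! j \<in> ?V" unfolding set by (blast intro: subsetD[OF pV])+
  moreover have "vs ! i \<le> vs ! j"
   using sorted_wrt_nth_less[OF srt, of i j] ij by (cases "i = j") auto
  ultimately show "?x (vs ! i) \<le> ?x (vs ! j)" by (rule mono_onD[OF mono])
 qed
 have ev: "even (length vs)" using len by simp
 have "{\<omega> \<in> space M. \<forall>w\<in>B. Y (a w) \<omega> T = Y (b w) \<omega> T} =
   {\<omega> \<in> space M. \<forall>j<length vs div 2. Y (?x (vs ! (2 * j))) \<omega> T = Y (?x (vs ! (2 * j + 1))) \<omega> T}"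
 proof -
  have s: "?x (vs ! (2 * j)) = a (ws ! j)" "?x (vs ! (2 * j + 1)) = b (ws ! j)" if j: "j < length ws" for j
  proof -
   have "odd (2 * ws ! j - 1)" using wsk[OF j] by simp
   thus "?x (vs ! (2 * j)) = a (ws ! j)" unfolding nth[OF j] particle_start_def
    using particle_color_pair(1)[OF wsk(1)[OF j]] by simp
   show "?x (vs ! (2 * j + 1)) = b (ws ! j)" unfolding nth[OF j] particle_start_def
    using particle_color_pair(2) by simp
  qed
  have l: "length vs div 2 = length ws" using len by simp
  have "(\<forall>j<length vs div 2. Y (?x (vs ! (2 * j))) \<omega> T = Y (?x (vs ! (2 * j + 1))) \<omega> T) \<longleftrightarrow>
    (\<forall>j<length ws. Y (a (ws ! j)) \<omega> T = Y (b (ws ! j)) \<omega> T)" for \<omega>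
   unfolding l by (rule all_cong) (simp only: s)
  moreover have "(\<forall>w\<in>B. Y (a w) \<omega> T = Y (b w) \<omega> T) \<longleftrightarrow> (\<forall>j<length ws. Y (a (ws ! j)) \<omega> T = Y (b (ws ! j)) \<omega> T)" for \<omega>
   unfolding ws(1)[symmetric] by (rule all_set_conv_all_nth)
  ultimately show ?thesis by (simp only:)
 qed
 hence "measure M {\<omega> \<in> space M. \<forall>w\<in>B. Y (a w) \<omega> T = Y (b w) \<omega> T} =
   (\<integral>X. pfaff (map (%i. X i T) [0..<length vs]) \<partial>PiM {..<length vs} (%i. K 0 (?x (vs ! i))))"
  using prob_pairs_coalesced[OF cs x' mono' T ev] by simp
 also have "... = (\<integral>X. pfaff (map (%p. X p T) vs) \<partial>PiM ?V (%p. K 0 (?x p)))"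
  by (rule expectation_pfaff_reindex[OF x finite_atLeastAtMost dist]) (use set pV in simp)
 also have "... = (\<integral>X. (\<Sum>N | perfect_on (points B) N. of_int (crossing_sign N) * (\<Prod>e\<in>N. edge_weight (%p. X p T) e)) \<partial>PiM ?V (%p. K 0 (?x p)))"
  by (simp only: pfaff_eq_matching_sum[OF srt] set)
 also have "... = (\<Sum>N | perfect_on (points B) N. of_int (crossing_sign N) * (\<Prod>e\<in>N. \<integral>X. edge_weight (%p. X p T) e \<partial>PiM ?V (%p. K 0 (?x p))))"
  by (rule expectation_matching_sum[OF x finite_atLeastAtMost pV finite_perfect[OF finite_points[OF fB]]]) simp
 finally show ?thesis .
qed

text \<open>
  For two particles the coalescing paths agree with the merging ones, and those are sorted. It is
  used for integer positions, where the intermediate value theorem is not available.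
\<close>

lemma AE_coalesced_order:
 assumes cs: "coalescing_system S Tm K M Y" and T: "T \<in> Tm" and xy: "x \<in> S" "y \<in> S" "x < y"
 shows "AE \<omega> in M. Y x \<omega> T \<le> Y y \<omega> T"
proof -
 interpret coalescing_system S Tm K M Y by (rule cs)
 define z where "z i = (if i = 0 then x else y)" for i :: nat
 have zS: "z \<in> {..<2} \<rightarrow> S" using xy by (auto simp: z_def)
 have zm: "strict_mono_on {..<2} z" using xy(3) by (auto simp: z_def strict_mono_on_def less_2_cases_iff)
 let ?Q = "PiM {..<2::nat} (%i. K 0 (z i))" and ?PP = "PiM {..<2::nat} (%_. path_space S Tm)"
 let ?f = "%X. \<lambda>i\<in>{..<2}. coalesce Tm X 2 i" and ?y = "%\<omega>. \<lambda>i\<in>{..<2::nat}. Y (z i) \<omega>"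
 interpret Q: prob_space ?Q by (rule prob_space_PiM) (use PiM_paths(2)[OF zS] in auto)
 note lw = law[OF zS zm]
 have ym: "?y \<in> M \<rightarrow>\<^sub>M ?PP" by (rule measurable_restrict) (use path_measurable zS in auto)
 define U where "U = {Z \<in> space ?PP. Z 0 T \<le> Z 1 T}"
 have ev: "(%Z. Z i T) \<in> borel_measurable ?PP" if "i < 2" for i
  by (rule measurable_compose[OF _ path_eval_measurable], rule measurable_component_singleton) (use that in simp)
 have U: "U \<in> sets ?PP"
  unfolding U_def by (rule borel_measurable_le[OF ev ev]) simp_all
 have P: "prob_space (distr ?Q ?PP ?f)" using prob_space_distr[OF ym] unfolding lw .
 have "AE X in ?Q. ?f X \<in> space ?PP \<longrightarrow> (?f X \<in> U) = (X \<in> space ?Q)"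
  using AE_no_swaps[OF zS strict_mono_on_imp_mono_on[OF zm]] AE_space
 proof eventually_elim
  case (elim X)
  have f: "?f X i T = merging Tm X i T" if "i < 2" for i
   using coalesce_eq_merging[OF setting elim(1) PiM_paths(1)[OF zS elim(2)], of 2 i T] that T by simp
  have "merging Tm X 0 T \<le> merging Tm X 1 T" by (rule merging_sorted[OF elim(1)]) (use T in simp_all)
  hence "?f X 0 T \<le> ?f X 1 T" using f[of 0] f[of 1] by simp
  thus ?case using elim(2) by (simp add: U_def)
 qed
 from emeasure_distr_AE[OF P U Q.prob_space_axioms sets.top this]
 have "emeasure (distr ?Q ?PP ?f) U = 1" using Q.emeasure_space_1 by simp
 hence "emeasure M (?y -` U \<inter> space M) = 1" unfolding lw[symmetric] emeasure_distr[OF ym U] .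
 hence "AE \<omega> in M. \<omega> \<in> ?y -` U \<inter> space M"
  using measurable_sets[OF ym U] by (simp add: emeasure_eq_measure prob_eq_1)
 thus ?thesis by eventually_elim (simp add: U_def z_def)
qed

lemma continuous_coalesced_order:
 assumes cs: "coalescing_system S Tm K M Y" and U: "S = UNIV" and T: "T \<in> Tm" and \<omega>: "\<omega> \<in> space M" and xy: "x \<le> y"
 shows "Y x \<omega> T \<le> Y y \<omega> T"
proof (rule ccontr)
 interpret coalescing_system S Tm K M Y by (rule cs)
 assume a: "\<not> Y x \<omega> T \<le> Y y \<omega> T"
 have Tm: "Tm = {0..}" using setting U Ints_neq_UNIV by (auto simp: admissible_setting_def)
 have paths: "Y z \<omega> \<in> skip_free_paths S Tm" for z
  using measurable_space[OF path_measurable \<omega>, of z] U by simp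
 have cont: "continuous_on {0..} (Y z \<omega>)" for z using paths[of z] U Tm by (simp add: skip_free_paths_def)
 have T0: "0 \<le> T" using T Tm by simp
 have "\<exists>s\<ge>0. s \<le> T \<and> Y y \<omega> s - Y x \<omega> s = 0"
 proof (rule IVT2')
  show "Y y \<omega> T - Y x \<omega> T \<le> 0" using a by simp
  show "0 \<le> Y y \<omega> 0 - Y x \<omega> 0" using initial[OF _ \<omega>] U xy by simp
  show "continuous_on {0..T} (%s. Y y \<omega> s - Y x \<omega> s)"
   by (intro continuous_on_diff continuous_on_subset[OF cont]) auto
 qed (rule T0)
 then obtain s where s: "0 \<le> s" "s \<le> T" "Y x \<omega> s = Y y \<omega> s" by auto
 have "Y x \<omega> T = Y y \<omega> T" by (rule merge[OF _ _ \<omega> _ T s(2,3)]) (use U Tm s in auto)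
 thus False using a by simp
qed

end

text \<open>
  If the two end particles have different final positions, an interval that meets both a basin and
  its complement meets the frontier of the basin. If they agree, monotonicity makes the final
  position constant in between.
\<close>

lemma wall_between_real:
 assumes mono: "\<And>x x'. x \<le> x' ==> y x T \<le> (y x' T :: real)" and ab: "a < b"
 shows "wall_between UNIV y T a b \<longleftrightarrow> y a T \<noteq> y b T"
proof
 assume W: "wall_between UNIV y T a b"
 show "y a T \<noteq> y b T"
 proof
  assume eq: "y a T = y b T"
  have const: "y x T = y a T" if "a \<le> x" "x \<le> b" for x using mono[OF that(1)] mono[OF that(2)] eq by simp
  from W consider r where "a < r" "r < b" "is_wall UNIV y T r"
   | "\<exists>\<^sub>F x in at_right a. y x T \<noteq> y a T" | "\<exists>\<^sub>F x in at_left b. y x T \<noteq> y b T"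
   unfolding wall_between_def by blast
  thus False
  proof cases
   case 1
   then obtain z where z: "r \<in> frontier (basin UNIV y T z)" by (auto simp: is_wall_def)
   have "r \<in> interior (basin UNIV y T z) \<or> r \<notin> closure (basin UNIV y T z)"
   proof (cases "y a T = z")
    case True
    have "x \<in> basin UNIV y T z" if "x \<in> {a<..<b}" for x
    proof -
     have "y x T = y a T" by (rule const) (use that in simp_all)
     thus ?thesis unfolding basin_def True by simp
    qed
    hence "{a<..<b} \<subseteq> basin UNIV y T z" by blast
    hence "{a<..<b} \<subseteq> interior (basin UNIV y T z)" by (rule interior_maximal) simp
    thus ?thesis using 1 by auto
   next
    case False
    have "x \<notin> basin UNIV y T z" if "x \<in> {a<..<b}" for x
    proof -
     have "y x T = y a T" by (rule const) (use that in simp_all)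
     thus ?thesis using False unfolding basin_def by simp
    qed
    hence "{a<..<b} \<inter> basin UNIV y T z = {}" by blast
    hence "{a<..<b} \<inter> closure (basin UNIV y T z) = {}" by (simp add: open_Int_closure_eq_empty)
    thus ?thesis using 1 by auto
   qed
   thus False using z by (auto simp: frontier_def)
  next
   case 2
   have "\<forall>\<^sub>F x in at_right a. y x T = y a T"
    by (rule eventually_at_rightI[OF _ ab]) (rule const, simp_all)
   thus False using 2 by (simp add: frequently_def)
  next
   case 3
   have "\<forall>\<^sub>F x in at_left b. y x T = y b T"
    unfolding eq[symmetric] by (rule eventually_at_leftI[OF _ ab]) (rule const, simp_all)
   thus False using 3 by (simp add: frequently_def)
  qed
 qed
next
 assume ne: "y a T \<noteq> y b T"
 show "wall_between UNIV y T a b"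
 proof (rule ccontr)
  assume W: "\<not> wall_between UNIV y T a b"
  hence "\<forall>\<^sub>F x in at_right a. y x T = y a T" "\<forall>\<^sub>F x in at_left b. y x T = y b T"
   unfolding wall_between_def by (auto simp: frequently_def)
  then obtain c d where c: "a < c" "\<And>x. a < x ==> x < c ==> y x T = y a T" and d: "d < b" "\<And>x. d < x ==> x < b ==> y x T = y b T"
   using ab by (auto simp: eventually_at_right_field eventually_at_left_field)
  obtain x0 where x0: "a < x0" "x0 < min b c" using dense[of a "min b c"] ab c(1) by auto
  obtain x1 where x1: "max a d < x1" "x1 < b" using dense[of "max a d" b] ab d(1) by auto
  have "{a<..<b} \<inter> frontier (basin UNIV y T (y a T)) \<noteq> {}"
  proof (rule connected_Int_frontier)
   have "x0 \<in> {a<..<b} \<inter> basin UNIV y T (y a T)" using x0 c(2) by (auto simp: basin_def)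
   thus "{a<..<b} \<inter> basin UNIV y T (y a T) \<noteq> {}" by blast
   have "x1 \<in> {a<..<b} - basin UNIV y T (y a T)" using x1 d(2)[of x1] ne by (auto simp: basin_def)
   thus "{a<..<b} - basin UNIV y T (y a T) \<noteq> {}" by blast
  qed simp
  hence "\<exists>r. a < r \<and> r < b \<and> is_wall UNIV y T r" by (auto simp: is_wall_def)
  thus False using W by (simp add: wall_between_def)
 qed
qed

lemma wall_between_Ints_iff:
 "wall_between \<int> y T a b \<longleftrightarrow> (\<exists>n\<in>\<int>. a < n + 1 / 2 \<and> n + 1 / 2 < b \<and> y n T \<noteq> y (n + 1) T)"
proof -
 have "n + 1 \<in> \<int>" if "n \<in> \<int>" for n :: real using that by simp
 thus ?thesis unfolding wall_between_def is_wall_def basin_def using Ints_neq_UNIV by auto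
qed

lemma wall_between_Ints:
 assumes mono: "\<And>n. n \<in> \<int> ==> y n T \<le> (y (n + 1) T :: real)" and ab: "a \<in> \<int>" "b \<in> \<int>" "a < b"
 shows "wall_between \<int> y T a b \<longleftrightarrow> y a T \<noteq> y b T"
proof -
 obtain i j where ij: "a = of_int i" "b = of_int j" using ab by (auto elim!: Ints_cases)
 have "i < j" using ab ij by simp
 let ?g = "%n::int. y (of_int n) T"
 have step: "?g n \<le> ?g (n + 1)" for n using mono[of "of_int n"] by simp
 have step': "y (of_int n) T \<le> y (of_int n + 1) T" for n using step[of n] by simp
 have up: "?g m \<le> ?g n" if "m \<le> n" for m n
  using that by (induction n rule: int_ge_induct) (auto intro: order_trans[OF _ step'])
 have W: "wall_between \<int> y T a b \<longleftrightarrow> (\<exists>n. i \<le> n \<and> n < j \<and> ?g n \<noteq> ?g (n + 1))"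
 proof -
  have r: "(real_of_int i < real_of_int n + 1 / 2) = (i \<le> n)" "(real_of_int n + 1 / 2 < real_of_int j) = (n < j)" for n by linarith+
  show ?thesis unfolding wall_between_Ints_iff ij by (auto simp: Ints_def r)
 qed
 show ?thesis
 proof
  assume "wall_between \<int> y T a b"
  then obtain n where n: "i \<le> n" "n < j" "?g n \<noteq> ?g (n + 1)" using W by blast
  hence "?g n < ?g (n + 1)" using step[of n] by simp
  moreover have "?g i \<le> ?g n" by (rule up[OF n(1)])
  moreover have "?g (n + 1) \<le> ?g j" by (rule up) (use n(2) in simp)
  ultimately show "y a T \<noteq> y b T" unfolding ij by linarith
 next
  assume ne: "y a T \<noteq> y b T"
  show "wall_between \<int> y T a b"
  proof (rule ccontr)
   assume "\<not> wall_between \<int> y T a b"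
   hence eq: "?g n = ?g (n + 1)" if "i \<le> n" "n < j" for n using W that by blast
   have "n \<le> j \<longrightarrow> ?g i = ?g n" if "i \<le> n" for n
    using that by (induction n rule: int_ge_induct) (auto simp: eq)
   from this[of j] \<open>i < j\<close> ne show False unfolding ij by simp
  qed
 qed
qed

context skip_free_process begin

text \<open>
  Measurability is shown separately, because an almost sure equality with a measurable event does
  not imply it.
\<close>

lemma wall_iff_not_coalesced:
 assumes cs: "coalescing_system S Tm K M Y" and T: "T \<in> Tm" and ab: "a \<in> S" "b \<in> S" "a < b"
 shows "AE \<omega> in M. wall_between S (%x. Y x \<omega>) T a b \<longleftrightarrow> Y a \<omega> T \<noteq> Y b \<omega> T"
  and "Measurable.pred M (%\<omega>. wall_between S (%x. Y x \<omega>) T a b)"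
proof -
 interpret coalescing_system S Tm K M Y by (rule cs)
 have ev: "(%\<omega>. Y x \<omega> T) \<in> borel_measurable M" if "x \<in> S" for x
  by (rule measurable_compose[OF path_measurable[OF that] path_eval_measurable])
 have "(AE \<omega> in M. wall_between S (%x. Y x \<omega>) T a b \<longleftrightarrow> Y a \<omega> T \<noteq> Y b \<omega> T) \<and> Measurable.pred M (%\<omega>. wall_between S (%x. Y x \<omega>) T a b)"
 proof (cases "S = UNIV")
  case True
  have w: "wall_between S (%x. Y x \<omega>) T a b \<longleftrightarrow> Y a \<omega> T \<noteq> Y b \<omega> T" if "\<omega> \<in> space M" for \<omega>
   unfolding True by (rule wall_between_real[where y="%x. Y x \<omega>", OF continuous_coalesced_order[OF cs True T that] ab(3)])
  have "Measurable.pred M (%\<omega>. Y a \<omega> T \<noteq> Y b \<omega> T)"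
   by (rule pred_intros_logic(2)[OF pred_eq_borel[OF ev[OF ab(1)] ev[OF ab(2)]]])
  hence "Measurable.pred M (%\<omega>. wall_between S (%x. Y x \<omega>) T a b)" by (subst measurable_cong[OF w])
  thus ?thesis using w by (auto intro!: AE_I2)
 next
  case False
  hence S: "S = \<int>" using setting by (auto simp: admissible_setting_def)
  have c: "countable (\<int> :: real set)" by (simp add: Ints_def)
  have "AE \<omega> in M. \<forall>n\<in>\<int>. Y n \<omega> T \<le> Y (n + 1) \<omega> T"
   unfolding AE_ball_countable[OF c] by (intro ballI AE_coalesced_order[OF cs T]) (auto simp: S)
  hence "AE \<omega> in M. wall_between S (%x. Y x \<omega>) T a b \<longleftrightarrow> Y a \<omega> T \<noteq> Y b \<omega> T"
  proof eventually_elim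
   case (elim \<omega>)
   thus ?case unfolding S by (intro wall_between_Ints) (use ab S in auto)
  qed
  moreover have "Measurable.pred M (%\<omega>. wall_between S (%x. Y x \<omega>) T a b)"
  proof -
   let ?W = "%n. {\<omega> \<in> space M. a < n + 1 / 2 \<and> n + 1 / 2 < b \<and> Y n \<omega> T \<noteq> Y (n + 1) \<omega> T}"
   have W: "?W n \<in> sets M" if "n \<in> \<int>" for n
   proof -
    have [measurable]: "(%\<omega>. Y n \<omega> T) \<in> borel_measurable M" "(%\<omega>. Y (n + 1) \<omega> T) \<in> borel_measurable M"
     by (rule ev, use that S in simp)+
    show ?thesis by measurable
   qed
   have "(\<Union>n\<in>\<int>. ?W n) \<in> sets M" by (rule sets.countable_UN'[OF c], rule image_subsetI, rule W)
   also have "(\<Union>n\<in>\<int>. ?W n) = {\<omega> \<in> space M. wall_between \<int> (%x. Y x \<omega>) T a b}"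
    unfolding wall_between_Ints_iff by blast
   finally show ?thesis unfolding S pred_def .
  qed
  ultimately show ?thesis by blast
 qed
 thus "AE \<omega> in M. wall_between S (%x. Y x \<omega>) T a b \<longleftrightarrow> Y a \<omega> T \<noteq> Y b \<omega> T"
  "Measurable.pred M (%\<omega>. wall_between S (%x. Y x \<omega>) T a b)" by blast+
qed

text \<open>Inclusion and exclusion over the walls whose flanking particles have coalesced.\<close>

lemma expectation_walls:
 assumes cs: "coalescing_system S Tm K M Y" and T: "T \<in> Tm" and B: "finite B"
  and ab: "\<And>w. w \<in> B ==> a w \<in> S \<and> b w \<in> S \<and> a w < b w"
 shows "(\<integral>\<omega>. (\<Prod>w\<in>B. of_bool (wall_between S (%x. Y x \<omega>) T (a w) (b w))) \<partial>M) =
  (\<Sum>D\<in>Pow B. (-1) ^ card D * measure M {\<omega> \<in> space M. \<forall>w\<in>D. Y (a w) \<omega> T = Y (b w) \<omega> T})"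
proof -
 interpret coalescing_system S Tm K M Y by (rule cs)
 have ev: "(%\<omega>. Y x \<omega> T) \<in> borel_measurable M" if "x \<in> S" for x
  by (rule measurable_compose[OF path_measurable[OF that] path_eval_measurable])
 let ?E = "%D. {\<omega> \<in> space M. \<forall>w\<in>D. Y (a w) \<omega> T = Y (b w) \<omega> T}"
 have E: "?E D \<in> sets M" if "D \<subseteq> B" for D
 proof -
  have "Measurable.pred M (%\<omega>. \<forall>w\<in>D. Y (a w) \<omega> T = Y (b w) \<omega> T)"
  proof (rule pred_intros_finite(3))
   fix w assume "w \<in> D"
   hence "a w \<in> S" "b w \<in> S" using that ab by blast+
   thus "Measurable.pred M (%\<omega>. Y (a w) \<omega> T = Y (b w) \<omega> T)" by (intro pred_eq_borel ev)
  qed (rule finite_subset[OF that B])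
  thus ?thesis by (simp add: pred_def)
 qed
 have "(\<integral>\<omega>. (\<Prod>w\<in>B. of_bool (wall_between S (%x. Y x \<omega>) T (a w) (b w))) \<partial>M) =
   (\<integral>\<omega>. (\<Sum>D\<in>Pow B. (-1) ^ card D * indicator (?E D) \<omega> :: real) \<partial>M)"
 proof (rule integral_cong_AE)
  show "(%\<omega>. \<Prod>w\<in>B. of_bool (wall_between S (%x. Y x \<omega>) T (a w) (b w)) :: real) \<in> borel_measurable M"
  proof (rule borel_measurable_prod)
   fix w assume "w \<in> B"
   from wall_iff_not_coalesced(2)[OF cs T, of "a w" "b w"] ab[OF this]
   have "Measurable.pred M (%\<omega>. wall_between S (%x. Y x \<omega>) T (a w) (b w))" by blast
   thus "(%\<omega>. of_bool (wall_between S (%x. Y x \<omega>) T (a w) (b w)) :: real) \<in> borel_measurable M" by measurable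
  qed
  show "(%\<omega>. \<Sum>D\<in>Pow B. (-1) ^ card D * indicator (?E D) \<omega> :: real) \<in> borel_measurable M"
   by (intro borel_measurable_sum borel_measurable_times borel_measurable_const borel_measurable_indicator E) auto
  have "AE \<omega> in M. \<forall>w\<in>B. wall_between S (%x. Y x \<omega>) T (a w) (b w) \<longleftrightarrow> Y (a w) \<omega> T \<noteq> Y (b w) \<omega> T"
   using B ab wall_iff_not_coalesced(1)[OF cs T] by (intro AE_finite_allI) blast+
  thus "AE \<omega> in M. (\<Prod>w\<in>B. of_bool (wall_between S (%x. Y x \<omega>) T (a w) (b w))) = (\<Sum>D\<in>Pow B. (-1) ^ card D * indicator (?E D) \<omega> :: real)"
   using AE_space
  proof eventually_elim
   case (elim \<omega>)
   let ?e = "%w. of_bool (Y (a w) \<omega> T = Y (b w) \<omega> T) :: real"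
   have "(\<Prod>w\<in>B. of_bool (wall_between S (%x. Y x \<omega>) T (a w) (b w))) = (\<Prod>w\<in>B. - ?e w + 1)"
    by (rule prod.cong[OF refl]) (use elim(1) in simp)
   also have "... = (\<Sum>D\<in>Pow B. (\<Prod>w\<in>D. - ?e w) * (\<Prod>w\<in>B - D. 1))" by (rule prod_add[OF B])
   also have "... = (\<Sum>D\<in>Pow B. (-1) ^ card D * indicator (?E D) \<omega>)"
   proof (rule sum.cong[OF refl])
    fix D assume D: "D \<in> Pow B"
    have fD: "finite D" by (rule finite_subset[OF PowD[OF D] B])
    have "(\<Prod>w\<in>D. - ?e w) = (-1) ^ card D * (\<Prod>w\<in>D. ?e w)" by (rule prod_uminus)
    also have "(\<Prod>w\<in>D. ?e w) = indicator (?E D) \<omega>"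
    proof -
     have "(\<Prod>w\<in>D. ?e w) = of_bool (\<forall>w\<in>D. Y (a w) \<omega> T = Y (b w) \<omega> T)"
      using fD by (induction D rule: finite_induct) simp_all
     thus ?thesis using elim(2) by (simp add: indicator_def)
    qed
    finally show "(\<Prod>w\<in>D. - ?e w) * (\<Prod>w\<in>B - D. 1) = (-1) ^ card D * indicator (?E D) \<omega>" by simp
   qed
   finally show ?case .
  qed
 qed
 also have "... = (\<Sum>D\<in>Pow B. \<integral>\<omega>. (-1) ^ card D * indicator (?E D) \<omega> \<partial>M)"
 proof (rule Bochner_Integration.integral_sum, rule integrable_mult_right)
  fix D assume "D \<in> Pow B"
  hence "?E D \<in> sets M" by (intro E) simp
  thus "integrable M (indicator (?E D) :: _ => real)"
   by (rule integrable_real_indicator) (simp add: emeasure_eq_measure)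
 qed
 also have "... = (\<Sum>D\<in>Pow B. (-1) ^ card D * measure M (?E D))"
 proof (rule sum.cong[OF refl])
  fix D
  have "?E D \<inter> space M = ?E D" by blast
  thus "(\<integral>\<omega>. (-1) ^ card D * indicator (?E D) \<omega> \<partial>M) = (-1) ^ card D * measure M (?E D)"
   by (simp only: integral_mult_right_zero Bochner_Integration.integral_indicator)
 qed
 finally show ?thesis .
qed

lemma cumulant_walls:
 assumes cs: "coalescing_system S Tm K M Y" and T: "T \<in> Tm" and k: "2 \<le> k"
  and ab: "\<And>w. w \<in> {1..k} ==> a w \<in> S \<and> b w \<in> S \<and> a w < b w"
  and x: "particle_start a b \<in> {1..2 * k} \<rightarrow> S" and mono: "mono_on {1..2 * k} (particle_start a b)"
 shows "joint_cumulant M k (%w \<omega>. of_bool (wall_between S (%x. Y x \<omega>) T (a w) (b w))) =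
  (-1) ^ k * (\<integral>X. connected_weight k (%p. X p T) \<partial>PiM {1..2 * k} (%p. K 0 (particle_start a b p)))"
proof -
 let ?P = "PiM {1..2 * k} (%p. K 0 (particle_start a b p))"
 interpret coalescing_system S Tm K M Y by (rule cs)
 define m where "m D = measure M {\<omega> \<in> space M. \<forall>w\<in>D. Y (a w) \<omega> T = Y (b w) \<omega> T}" for D
 define f where "f N = real_of_int (crossing_sign N) * (\<Prod>e\<in>N. \<integral>X. edge_weight (%p. X p T) e \<partial>?P)" for N
 have m: "m D = (\<Sum>N | perfect_on (points D) N. f N)" if "D \<subseteq> {1..k}" for D
  unfolding m_def f_def by (rule prob_flanks_coalesced[OF cs T x mono that])
 have m0: "m {} = 1" unfolding m_def using prob_space by simp
 have f0: "f {} = 1" by (simp add: f_def crossing_sign_def edge_pairs_def)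
 have fU: "f (M1 \<union> M2) = f M1 * f M2"
  if M: "perfect_on (points A) M1" "perfect_on (points B) M2" "A \<inter> B = {}" "0 \<notin> A" "0 \<notin> B" "finite A" "finite B" for A B M1 M2
 proof -
  have "finite M1" "finite M2" using perfect_on_finite[OF finite_points] M by blast+
  moreover have "M1 \<inter> M2 = {}"
  proof -
   have "points A \<inter> points B = {}" using M(3) by (auto simp: points_def)
   thus ?thesis using perfect_onD(5,6)[OF M(1)] perfect_onD(6)[OF M(2)] by blast
  qed
  ultimately show ?thesis unfolding f_def crossing_sign_Un[OF M] by (simp add: prod.union_disjoint)
 qed
 have "joint_cumulant M k (%w \<omega>. of_bool (wall_between S (%x. Y x \<omega>) T (a w) (b w))) =
   (\<Sum>\<pi> | partition_on {1..k} \<pi>. cumulant_coeff \<pi> * (\<Prod>B\<in>\<pi>. \<Sum>D\<in>Pow B. (-1) ^ card D * m D))"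
  unfolding joint_cumulant_def
 proof (rule sum.cong[OF refl])
  fix \<pi> assume "\<pi> \<in> {\<pi>. partition_on {1..k} \<pi>}"
  hence B: "B \<subseteq> {1..k}" if "B \<in> \<pi>" for B using that by (auto simp: partition_on_def)
  have "(\<Prod>B\<in>\<pi>. \<integral>\<omega>. (\<Prod>w\<in>B. of_bool (wall_between S (%x. Y x \<omega>) T (a w) (b w))) \<partial>M) = (\<Prod>B\<in>\<pi>. \<Sum>D\<in>Pow B. (-1) ^ card D * m D)"
   unfolding m_def by (intro prod.cong refl expectation_walls[OF cs T] ab) (use B finite_subset in blast)+
  thus "(-1) ^ (card \<pi> - 1) * fact (card \<pi> - 1) * (\<Prod>B\<in>\<pi>. \<integral>\<omega>. (\<Prod>w\<in>B. of_bool (wall_between S (%x. Y x \<omega>) T (a w) (b w))) \<partial>M) =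
    cumulant_coeff \<pi> * (\<Prod>B\<in>\<pi>. \<Sum>D\<in>Pow B. (-1) ^ card D * m D)"
   by (simp only: cumulant_coeff_def)
 qed
 also have "... = (-1) ^ card {1..k} * (\<Sum>\<pi> | partition_on {1..k} \<pi>. cumulant_coeff \<pi> * (\<Prod>B\<in>\<pi>. m B))"
  by (rule partition_sum_complement[where m=m, OF _ _ m0]) (use k in simp_all)
 also have "(\<Sum>\<pi> | partition_on {1..k} \<pi>. cumulant_coeff \<pi> * (\<Prod>B\<in>\<pi>. m B)) =
   (\<Sum>\<pi> | partition_on {1..k} \<pi>. cumulant_coeff \<pi> * (\<Prod>B\<in>\<pi>. \<Sum>N | perfect_on (points B) N. f N))"
  by (intro sum.cong refl arg_cong2[where f="(*)"] prod.cong m) (auto simp: partition_on_def)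
 also have "... = (\<Sum>N | perfect_on (points {1..k}) N \<and> connected_walls {1..k} N. f N)"
 proof (rule partition_sum_connected[where f=f, OF _ _ _ f0])
  show "f (M1 \<union> M2) = f M1 * f M2"
   if "perfect_on (points A) M1" "perfect_on (points B) M2" "A \<inter> B = {}" "0 \<notin> A" "0 \<notin> B" "finite A" "finite B" for A B M1 M2
   by (rule fU[OF that])
 qed (use k in auto)
 also have "... = (\<integral>X. connected_weight k (%p. X p T) \<partial>?P)"
  unfolding connected_weight_def f_def
  by (rule expectation_matching_sum[OF x finite_atLeastAtMost _ finite_connected, where U="points {1..k}", symmetric])
   (simp_all only: points_atLeastAtMost subset_refl mem_Collect_eq)
 finally show ?thesis by simp
qed

end

lemma particle_start_mono:
 assumes ab: "\<And>w. w \<in> {1..k} ==> a w < b w" and ba: "\<And>w. w \<in> {1..<k} ==> b w \<le> (a (Suc w) :: real)"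
 shows "mono_on {1..2 * k} (particle_start a b)"
proof (rule mono_onI)
 fix p q assume pq: "p \<in> {1..2 * k}" "q \<in> {1..2 * k}" "p \<le> q"
 have step: "particle_start a b r \<le> particle_start a b (Suc r)" if "1 \<le> r" "Suc r \<le> 2 * k" for r
 proof (cases "odd r")
  case True
  then obtain w where w: "r = 2 * w + 1" by (auto elim: oddE)
  hence "Suc w \<in> {1..k}" using that by auto
  from ab[OF this] show ?thesis by (simp add: w particle_start_def particle_color_def)
 next
  case False
  then obtain w where w: "r = 2 * w" by (auto elim: evenE)
  hence "w \<in> {1..<k}" using that by auto
  from ba[OF this] show ?thesis by (simp add: w particle_start_def particle_color_def)
 qed
 from pq(3,2) show "particle_start a b p \<le> particle_start a b q"
 proof (induction q rule: dec_induct)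
  case (step r)
  have "particle_start a b p \<le> particle_start a b r" using step pq(1) by auto
  also have "... \<le> particle_start a b (Suc r)" using step pq(1) by (intro \<open>\<And>r. 1 \<le> r ==> Suc r \<le> 2 * k ==> particle_start a b r \<le> particle_start a b (Suc r)\<close>) auto
  finally show ?case .
 qed simp
qed

theorem theorem3p1:
  fixes S Tm :: "real set"
    and K :: "real \<Rightarrow> real \<Rightarrow> (real \<Rightarrow> real) measure"
    and M :: "'w measure"
    and Y :: "real \<Rightarrow> 'w \<Rightarrow> real \<Rightarrow> real"
    and T :: real and k :: nat and a b :: "nat \<Rightarrow> real"
  assumes "skip_free_process S Tm K"
    and "coalescing_system S Tm K M Y"
    and "T \<in> Tm" and "T > 0" and "k \<ge> 2"
    and "\<And>w. w \<in> {1..k} \<Longrightarrow> a w \<in> S \<and> b w \<in> S \<and> a w < b w"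
    and "\<And>w. w \<in> {1..<k} \<Longrightarrow> b w \<le> a (Suc w)"
  shows "joint_cumulant M k
           (\<lambda>w \<omega>. of_bool (wall_between S (\<lambda>x. Y x \<omega>) T (a w) (b w))) =
         (\<integral>(X, \<rho>). real_of_int (coloring_coeff k (color_sequence T X \<rho>)) *
              (\<Prod>w=1..k. of_bool (non_crossing Tm T (X (2 * w - 1)) (X (2 * w))))
            \<partial>flanking_space K k a b)"
proof -
  interpret skip_free_process S Tm K by (rule assms(1))
  have mono: "mono_on {1..2 * k} (particle_start a b)"
    by (rule particle_start_mono) (use assms(6,7) in auto)
  have x: "particle_start a b \<in> {1..2 * k} \<rightarrow> S"
  proof
    fix p assume p: "p \<in> {1..2 * k}"
    have "particle_color p \<in> {1..k}" using p by (auto simp: particle_color_def)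
    from assms(6)[OF this] show "particle_start a b p \<in> S" by (simp add: particle_start_def)
  qed
  have le: "particle_start a b (2 * w - 1) \<le> particle_start a b (2 * w)" if "w \<in> {1..k}" for w
    by (rule mono_onD[OF mono]) (use that in auto)
  have "joint_cumulant M k (\<lambda>w \<omega>. of_bool (wall_between S (\<lambda>x. Y x \<omega>) T (a w) (b w))) =
      (- 1) ^ k * (\<integral>X. connected_weight k (\<lambda>p. X p T) \<partial>Pi\<^sub>M {1..2 * k} (\<lambda>p. K 0 (particle_start a b p)))"
    by (rule cumulant_walls[OF assms(2,3,5) assms(6) x mono])
  also have "\<dots> = (\<integral>(X, \<rho>). real_of_int (coloring_coeff k (color_sequence T X \<rho>)) *
      (\<Prod>w=1..k. of_bool (non_crossing Tm T (X (2 * w - 1)) (X (2 * w)))) \<partial>flanking_space K k a b)"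
    by (rule flanking_expectation[OF assms(5) x assms(3) le, symmetric])
  finally show ?thesis .
qed

end
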